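(* Let $H$ be a quasitriangular quasi-Hopf algebra and $A$ any braided commutative algebra in ${}^H\mathscr{M}$. Let $U,V,W,X,Y,Z$ be any six objects in ${}^H{}_A\mathscr{M}^{\mathrm{sym}}_A$. (i) The tensor product morphisms $\boxtimes^A$ satisfy the braided composition property: writing $P=\hom_A(V,Y)$, $Q=\hom_A(X,Z)$, $K=\hom_A(U,V)$, $T=\hom_A(W,X)$, the ${}^H{}_A\mathscr{M}_A$-morphisms $(P\otimes_AQ)\otimes_A(K\otimes_AT)\to\hom_A(U\otimes_AW,Y\otimes_AZ)$ $$\bullet^A_{U\otimes_AW,V\otimes_AX,Y\otimes_AZ}\circ\big(\boxtimes^A_{V,Y,X,Z}\otimes_A\boxtimes^A_{U,V,W,X}\big)$$ and $$\boxtimes^A_{U,Y,W,Z}\circ(\bullet^A_{U,V,Y}\otimes_A\bullet^A_{W,X,Z})\circ(\Phi^A_{P,K,Q\otimes_AT})^{-1}\circ(\mathrm{id}_P\otimes_A\Phi^A_{K,Q,T})\circ\big(\mathrm{id}_P\otimes_A(\tau^A_{Q,K}\otimes_A\mathrm{id}_T)\big)\circ\big(\mathrm{id}_P\otimes_A(\Phi^A_{Q,K,T})^{-1}\big)\circ\Phi^A_{P,Q,K\otimes_AT}$$ coincide. (ii) The tensor product morphisms $\boxtimes^A$ are weakly associative: the ${}^H{}_A\mathscr{M}_A$-morphisms $(\hom_A(U,V)\otimes_A\hom_A(W,X))\otimes_A\hom_A(Y,Z)\to\hom_A(U\otimes_A(W\otimes_AY),V\otimes_A(X\otimes_AZ))$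 $$\big(\Phi^A_{V,X,Z}\circ(\,\cdot\,)\circ(\Phi^A_{U,W,Y})^{-1}\big)\circ\boxtimes^A_{U\otimes_AW,V\otimes_AX,Y,Z}\circ\big(\boxtimes^A_{U,V,W,X}\otimes_A\mathrm{id}_{\hom_A(Y,Z)}\big)$$ and $$\boxtimes^A_{U,V,W\otimes_AY,X\otimes_AZ}\circ\big(\mathrm{id}_{\hom_A(U,V)}\otimes_A\boxtimes^A_{W,X,Y,Z}\big)\circ\Phi^A_{\hom_A(U,V),\hom_A(W,X),\hom_A(Y,Z)}$$ coincide.
   Context: Fix a commutative ring $k$ with unit; $\otimes=\otimes_k$. A quasi-bialgebra is an associative unital $k$-algebra $H$ with algebra homomorphisms $\Delta:H\to H\otimes H$, $\epsilon:H\to k$ and an invertible $\phi\in H^{\otimes 3}$ such that for all $h\in H$: $(\epsilon\otimes\mathrm{id})\Delta(h)=h=(\mathrm{id}\otimes\epsilon)\Delta(h)$; $(\mathrm{id}\otimes\Delta)\Delta(h)\cdot\phi=\phi\cdot(\Delta\otimes\mathrm{id})\Delta(h)$; $(\mathrm{id}\otimes\mathrm{id}\otimes\Delta)(\phi)\cdot(\Delta\otimes\mathrm{id}\otimes\mathrm{id})(\phi)=(1\otimes\phi)\cdot(\mathrm{id}\otimes\Delta\otimes\mathrm{id})(\phi)\cdot(\phi\otimes1)$; $(\mathrm{id}\otimes\epsilon\otimes\mathrm{id})(\phi)=1\otimes1$. Notation (summation understood): $\Delta(h)=h_{(1)}\otimes h_{(2)}$, $\phi=\phi^{(1)}\otimes\phi^{(2)}\otimes\phi^{(3)}$,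 $\phi^{-1}=\phi^{(-1)}\otimes\phi^{(-2)}\otimes\phi^{(-3)}$. A quasi-Hopf algebra is a quasi-bialgebra with a quasi-antipode $(S,\alpha,\beta)$: an algebra anti-automorphism $S:H\to H$ and $\alpha,\beta\in H$ with $S(h_{(1)})\alpha h_{(2)}=\epsilon(h)\alpha$, $h_{(1)}\beta S(h_{(2)})=\epsilon(h)\beta$ for all $h$, $\phi^{(1)}\beta S(\phi^{(2)})\alpha\phi^{(3)}=1$, $S(\phi^{(-1)})\alpha\phi^{(-2)}\beta S(\phi^{(-3)})=1$. It is quasitriangular if equipped with an invertible $R=R^{(1)}\otimes R^{(2)}\in H\otimes H$ with $\Delta^{\mathrm{op}}(h)=R\Delta(h)R^{-1}$, $(\mathrm{id}\otimes\Delta)(R)=\phi_{231}^{-1}R_{13}\phi_{213}R_{12}\phi_{123}^{-1}$ and $(\Delta\otimes\mathrm{id})(R)=\phi_{312}R_{13}\phi_{132}^{-1}R_{23}\phi_{123}$, where $\Delta^{\mathrm{op}}(h)=h_{(2)}\otimes h_{(1)}$ and $X_{i_1\dots i_p}$ denotes the element with $j$-th leg of $X$ placed in tensor position $i_j$ and $1$ elsewhere. ${}^H\mathscr{M}$ is the category of left $H$-modules (action $\triangleright$) and $H$-equivariant $k$-linear maps, monoidal with $h\triangleright(v\otimes w)=(h_{(1)}\triangleright v)\otimes(h_{(2)}\triangleright w)$, unit $I=k$ (action via $\epsilon$), associator $\Phi_{V,W,X}((v\otimes w)\otimes x)=(\phi^{(1)}\triangleright v)\otimes((\phi^{(2)}\triangleright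 w)\otimes(\phi^{(3)}\triangleright x))$ and braiding $\tau_{V,W}(v\otimes w)=(R^{(2)}\triangleright w)\otimes(R^{(1)}\triangleright v)$. It is closed with internal hom $\hom(V,W)=\mathrm{Hom}_k(V,W)$, $h\triangleright L=(h_{(1)}\triangleright\cdot)\circ L\circ(S(h_{(2)})\triangleright\cdot)$, evaluation $\mathrm{ev}_{V,W}(L\otimes v)=\phi^{(1)}\triangleright L\big((S(\phi^{(2)})\alpha\phi^{(3)})\triangleright v\big)$ and composition $\bullet_{V,W,X}:\hom(W,X)\otimes\hom(V,W)\to\hom(V,X)$, the unique ${}^H\mathscr{M}$-morphism with $\mathrm{ev}_{V,X}\circ(\bullet_{V,W,X}\otimes\mathrm{id}_V)=\mathrm{ev}_{W,X}\circ(\mathrm{id}\otimes\mathrm{ev}_{V,W})\circ\Phi_{\hom(W,X),\hom(V,W),V}$. An algebra in ${}^H\mathscr{M}$ is an object $A$ with ${}^H\mathscr{M}$-morphisms $\mu_A:A\otimes A\to A$ (written $aa'$) and $\eta_A:I\to A$ ($1_A=\eta_A(1)$) such that $(aa')a''=(\phi^{(1)}\triangleright a)\big((\phi^{(2)}\triangleright a')(\phi^{(3)}\triangleright a'')\big)$ and $1_Aa=a=a1_A$. An $A$-bimodule in ${}^H\mathscr{M}$ is an object $V$ with ${}^H\mathscr{M}$-morphisms $l_V:A\otimes V\to V$ (written $av$) and $r_V:V\otimes A\to V$ (written $va$) such that $(va)a'=(\phi^{(1)}\triangleright v)\big((\phi^{(2)}\triangleright a)(\phi^{(3)}\triangleright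 a')\big)$, $a(a'v)=\big((\phi^{(-1)}\triangleright a)(\phi^{(-2)}\triangleright a')\big)(\phi^{(-3)}\triangleright v)$, $a(va')=\big((\phi^{(-1)}\triangleright a)(\phi^{(-2)}\triangleright v)\big)(\phi^{(-3)}\triangleright a')$, $1_Av=v=v1_A$. ${}^H{}_A\mathscr{M}_A$ is the category of these with $H$-equivariant, left and right $A$-linear maps. ${}^H{}_A\mathscr{M}_A$ is monoidal: $V\otimes_A W=(V\otimes W)/\mathrm{Im}\big(r_V\otimes\mathrm{id}-(\mathrm{id}\otimes l_W)\circ\Phi_{V,A,W}\big)$, $v\otimes_A w$ the class of $v\otimes w$, with $a(v\otimes_A w)=\big((\phi^{(-1)}\triangleright a)(\phi^{(-2)}\triangleright v)\big)\otimes_A(\phi^{(-3)}\triangleright w)$, $(v\otimes_A w)a=(\phi^{(1)}\triangleright v)\otimes_A\big((\phi^{(2)}\triangleright w)(\phi^{(3)}\triangleright a)\big)$; associator $\Phi^A$ induced by $\Phi$; unit object $A$; unitors induced by $l_V$, $r_V$. It is closed with internal hom $\hom_A$: $\hom(V,W)$ is an $A$-bimodule via $aL=\widehat{l}_W(a)\bullet_{V,W,W}L$, $La=L\bullet_{V,V,W}\widehat{l}_V(a)$ with $\widehat{l}_V(a)=(\phi^{(-1)}\triangleright a)\big((\phi^{(-2)}\beta S(\phi^{(-3)}))\triangleright(\,\cdot\,)\big)$; $\mathrm{ev}_{V,W}$ descends to $\mathrm{ev}^A_{V,W}:\hom(V,W)\otimes_A V\to W$; with $f_1(L\otimes_A(v\otimes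 a))=\mathrm{ev}^A_{V,W}(L\otimes_A(va))$, $f_2(L\otimes_A(v\otimes a))=\mathrm{ev}^A_{V,W}\big((\phi^{(-1)}\triangleright L)\otimes_A(\phi^{(-2)}\triangleright v)\big)(\phi^{(-3)}\triangleright a)$ and $D_i:\hom(V,W)\to\hom(V\otimes A,W)$, $D_i(L)=f_i\big((\phi^{(-1)}\triangleright L)\otimes_A((\phi^{(-2)}\beta S(\phi^{(-3)}))\triangleright_{V\otimes A}(\,\cdot\,))\big)$, one sets $\hom_A(V,W)=\mathrm{Ker}(D_1-D_2)$ with induced structures. The restrictions $\mathrm{ev}^A_{V,W}:\hom_A(V,W)\otimes_AV\to W$ and $\bullet^A_{V,W,X}:\hom_A(W,X)\otimes_A\hom_A(V,W)\to\hom_A(V,X)$ (induced by $\mathrm{ev}$ and $\bullet$) are the evaluation and composition morphisms of this closed monoidal category. $A$ is braided commutative if $\mu_A\circ\tau_{A,A}=\mu_A$. For such $A$, an $A$-bimodule $V$ is symmetric if $r_V\circ\tau_{A,V}=l_V$ and $l_V\circ\tau_{V,A}=r_V$. The full subcategory ${}^H{}_A\mathscr{M}^{\mathrm{sym}}_A$ of symmetric $A$-bimodules is a braided closed monoidal category with $\otimes_A$, $\hom_A$ and braiding $\tau^A_{V,W}(v\otimes_Aw)=(R^{(2)}\triangleright w)\otimes_A(R^{(1)}\triangleright v)$. The tensor product morphism $\boxtimes^A_{V,W,X,Y}:\hom_A(V,W)\otimes_A\hom_A(X,Y)\to\hom_A(V\otimes_AX,W\otimes_AY)$ is the unique ${}^H{}_A\mathscr{M}_A$-morphism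 with, writing $M=\hom_A(V,W)$, $N=\hom_A(X,Y)$, $$\mathrm{ev}^A_{V\otimes_AX,W\otimes_AY}\circ(\boxtimes^A_{V,W,X,Y}\otimes_A\mathrm{id})=(\mathrm{ev}^A_{V,W}\otimes_A\mathrm{ev}^A_{X,Y})\circ(\Phi^A_{M,V,N\otimes_AX})^{-1}\circ(\mathrm{id}_M\otimes_A\Phi^A_{V,N,X})\circ(\mathrm{id}_M\otimes_A(\tau^A_{N,V}\otimes_A\mathrm{id}_X))\circ(\mathrm{id}_M\otimes_A(\Phi^A_{N,V,X})^{-1})\circ\Phi^A_{M,N,V\otimes_AX}.$$ The notation $g\circ(\,\cdot\,)\circ f$ stands for the map $L\mapsto g\circ L\circ f$. *)

theory Defs
  imports "HOL-Algebra.Module" "HOL-Algebra.AbelCoset" "HOL-Library.FuncSet"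
begin

section \<open>Modules and tensor products over a commutative ring\<close>

text \<open>
  Modules are the records of HOL-Algebra; their inherited ring fields \<^const>\<open>mult\<close> and
  \<^const>\<open>one\<close> carry information only for algebras and are left undefined otherwise.
  Elements of a tensor product over \<open>k\<close> are cosets in a free module, elements of a tensor
  product over an algebra \<open>A\<close> are cosets of such cosets.
\<close>

type_synonym ('k, 'v, 'w) tens = "('v \<times> 'w \<Rightarrow> 'k) set"
type_synonym ('k, 'v, 'w) tensA = "('k, 'v, 'w) tens set"

definition is_lin ::
  "'k ring \<Rightarrow> ('k, 'v, 'm) module_scheme \<Rightarrow> ('k, 'w, 'n) module_scheme \<Rightarrow> ('v \<Rightarrow> 'w) \<Rightarrow> bool" where
  "is_lin k V W f \<longleftrightarrow> f \<in> carrier V \<rightarrow> carrier W \<and>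
     (\<forall>x\<in>carrier V. \<forall>y\<in>carrier V. f (x \<oplus>\<^bsub>V\<^esub> y) = f x \<oplus>\<^bsub>W\<^esub> f y) \<and>
     (\<forall>c\<in>carrier k. \<forall>x\<in>carrier V. f (c \<odot>\<^bsub>V\<^esub> x) = c \<odot>\<^bsub>W\<^esub> f x)"

text \<open>Extensionality makes a map determined by its values on the carrier.\<close>

definition lin ::
  "'k ring \<Rightarrow> ('k, 'v, 'm) module_scheme \<Rightarrow> ('k, 'w, 'n) module_scheme \<Rightarrow> ('v \<Rightarrow> 'w) set" where
  "lin k V W = {f \<in> extensional (carrier V). is_lin k V W f}"

definition quot_module ::
  "'k ring \<Rightarrow> ('k, 'v, 'm) module_scheme \<Rightarrow> 'v set \<Rightarrow> ('k, 'v set) module" where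
  "quot_module k M N =
     \<lparr> carrier = a_rcosets\<^bsub>M\<^esub> N, mult = undefined, one = undefined,
       zero = N, add = (\<lambda>X Y. X <+>\<^bsub>M\<^esub> Y),
       smult = (\<lambda>c X. \<Union>x\<in>X. N +>\<^bsub>M\<^esub> (c \<odot>\<^bsub>M\<^esub> x)) \<rparr>"

definition free_module :: "'k ring \<Rightarrow> 'i set \<Rightarrow> ('k, 'i \<Rightarrow> 'k) module" where
  "free_module k I =
     \<lparr> carrier = {f. (\<forall>i\<in>I. f i \<in> carrier k) \<and> (\<forall>i. i \<notin> I \<longrightarrow> f i = \<zero>\<^bsub>k\<^esub>) \<and> finite {i. f i \<noteq> \<zero>\<^bsub>k\<^esub>}},
       mult = undefined, one = undefined,
       zero = (\<lambda>i. \<zero>\<^bsub>k\<^esub>), add = (\<lambda>f g i. f i \<oplus>\<^bsub>k\<^esub> g i), smult = (\<lambda>c f i. c \<otimes>\<^bsub>k\<^esub> f i) \<rparr>"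

definition free_gen :: "'k ring \<Rightarrow> 'i \<Rightarrow> 'i \<Rightarrow> 'k" where
  "free_gen k i = (\<lambda>j. if j = i then \<one>\<^bsub>k\<^esub> else \<zero>\<^bsub>k\<^esub>)"

definition span_of :: "'k ring \<Rightarrow> ('k, 'v, 'm) module_scheme \<Rightarrow> 'v set \<Rightarrow> 'v set" where
  "span_of k M S = \<Inter> {N. submodule N k M \<and> S \<subseteq> N}"

definition tens_rels ::
  "'k ring \<Rightarrow> ('k, 'v, 'm) module_scheme \<Rightarrow> ('k, 'w, 'n) module_scheme \<Rightarrow> ('v \<times> 'w \<Rightarrow> 'k) set" where
  "tens_rels k V W =
    (let F = free_module k (carrier V \<times> carrier W); e = (\<lambda>v w. free_gen k (v, w)) in
      {e (v \<oplus>\<^bsub>V\<^esub> v') w \<ominus>\<^bsub>F\<^esub> (e v w \<oplus>\<^bsub>F\<^esub> e v' w) | v v' w.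
         v \<in> carrier V \<and> v' \<in> carrier V \<and> w \<in> carrier W} \<union>
      {e v (w \<oplus>\<^bsub>W\<^esub> w') \<ominus>\<^bsub>F\<^esub> (e v w \<oplus>\<^bsub>F\<^esub> e v w') | v w w'.
         v \<in> carrier V \<and> w \<in> carrier W \<and> w' \<in> carrier W} \<union>
      {e (c \<odot>\<^bsub>V\<^esub> v) w \<ominus>\<^bsub>F\<^esub> c \<odot>\<^bsub>F\<^esub> e v w | c v w.
         c \<in> carrier k \<and> v \<in> carrier V \<and> w \<in> carrier W} \<union>
      {e v (c \<odot>\<^bsub>W\<^esub> w) \<ominus>\<^bsub>F\<^esub> c \<odot>\<^bsub>F\<^esub> e v w | c v w.
         c \<in> carrier k \<and> v \<in> carrier V \<and> w \<in> carrier W})"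

definition tens_null ::
  "'k ring \<Rightarrow> ('k, 'v, 'm) module_scheme \<Rightarrow> ('k, 'w, 'n) module_scheme \<Rightarrow> ('v \<times> 'w \<Rightarrow> 'k) set" where
  "tens_null k V W = span_of k (free_module k (carrier V \<times> carrier W)) (tens_rels k V W)"

definition tmod ::
  "'k ring \<Rightarrow> ('k, 'v, 'm) module_scheme \<Rightarrow> ('k, 'w, 'n) module_scheme
    \<Rightarrow> ('k, ('k, 'v, 'w) tens) module" where
  "tmod k V W = quot_module k (free_module k (carrier V \<times> carrier W)) (tens_null k V W)"

definition pure ::
  "'k ring \<Rightarrow> ('k, 'v, 'm) module_scheme \<Rightarrow> ('k, 'w, 'n) module_scheme
    \<Rightarrow> 'v \<Rightarrow> 'w \<Rightarrow> ('k, 'v, 'w) tens" where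
  "pure k V W v w =
     tens_null k V W +>\<^bsub>free_module k (carrier V \<times> carrier W)\<^esub> free_gen k (v, w)"

text \<open>The linear map with values \<open>f v w\<close> on pure tensors (for bilinear \<open>f\<close>).\<close>

definition tlift ::
  "'k ring \<Rightarrow> ('k, 'v, 'm) module_scheme \<Rightarrow> ('k, 'w, 'n) module_scheme \<Rightarrow> ('k, 'x, 'p) module_scheme
    \<Rightarrow> ('v \<Rightarrow> 'w \<Rightarrow> 'x) \<Rightarrow> ('k, 'v, 'w) tens \<Rightarrow> 'x" where
  "tlift k V W X f = (THE g. g \<in> lin k (tmod k V W) X \<and>
     (\<forall>v\<in>carrier V. \<forall>w\<in>carrier W. g (pure k V W v w) = f v w))"

definition tmap ::
  "'k ring \<Rightarrow> ('k, 'v, 'm) module_scheme \<Rightarrow> ('k, 'w, 'n) module_scheme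
    \<Rightarrow> ('k, 'v1, 'm1) module_scheme \<Rightarrow> ('k, 'w1, 'n1) module_scheme
    \<Rightarrow> ('v \<Rightarrow> 'v1) \<Rightarrow> ('w \<Rightarrow> 'w1) \<Rightarrow> ('k, 'v, 'w) tens \<Rightarrow> ('k, 'v1, 'w1) tens" where
  "tmap k V W V' W' f g = tlift k V W (tmod k V' W') (\<lambda>v w. pure k V' W' (f v) (g w))"

text \<open>The tensor product of two algebras, with \<open>(b \<otimes> c) (b' \<otimes> c') = b b' \<otimes> c c'\<close>.\<close>

definition talg ::
  "'k ring \<Rightarrow> ('k, 'v, 'm) module_scheme \<Rightarrow> ('k, 'w, 'n) module_scheme
    \<Rightarrow> ('k, ('k, 'v, 'w) tens) module" where
  "talg k B C = (tmod k B C)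
     \<lparr> mult := (\<lambda>s t. tlift k B C (tmod k B C) (\<lambda>b c.
                 tlift k B C (tmod k B C) (\<lambda>b' c'. pure k B C (b \<otimes>\<^bsub>B\<^esub> b') (c \<otimes>\<^bsub>C\<^esub> c')) t) s),
       one := pure k B C \<one>\<^bsub>B\<^esub> \<one>\<^bsub>C\<^esub> \<rparr>"

definition base_module :: "'k ring \<Rightarrow> ('k, 'k) module" where
  "base_module k = \<lparr> carrier = carrier k, mult = mult k, one = one k, zero = zero k, add = add k,
     smult = mult k \<rparr>"

locale assoc_algebra = module R M + ring M for R (structure) and M (structure) +
  assumes smult_mult_left:
    "\<lbrakk> c \<in> carrier R; x \<in> carrier M; y \<in> carrier M \<rbrakk>
      \<Longrightarrow> (c \<odot>\<^bsub>M\<^esub> x) \<otimes>\<^bsub>M\<^esub> y = c \<odot>\<^bsub>M\<^esub> (x \<otimes>\<^bsub>M\<^esub> y)"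
    and smult_mult_right:
    "\<lbrakk> c \<in> carrier R; x \<in> carrier M; y \<in> carrier M \<rbrakk>
      \<Longrightarrow> x \<otimes>\<^bsub>M\<^esub> (c \<odot>\<^bsub>M\<^esub> y) = c \<odot>\<^bsub>M\<^esub> (x \<otimes>\<^bsub>M\<^esub> y)"

definition is_alg_hom ::
  "'k ring \<Rightarrow> ('k, 'v, 'm) module_scheme \<Rightarrow> ('k, 'w, 'n) module_scheme \<Rightarrow> ('v \<Rightarrow> 'w) \<Rightarrow> bool" where
  "is_alg_hom k B C f \<longleftrightarrow> is_lin k B C f \<and>
     (\<forall>x\<in>carrier B. \<forall>y\<in>carrier B. f (x \<otimes>\<^bsub>B\<^esub> y) = f x \<otimes>\<^bsub>C\<^esub> f y) \<and> f \<one>\<^bsub>B\<^esub> = \<one>\<^bsub>C\<^esub>"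

section \<open>Quasitriangular quasi-Hopf algebras\<close>

text \<open>
  \<open>H \<otimes> H \<otimes> H\<close> and \<open>H \<otimes> H \<otimes> H \<otimes> H\<close> are bracketed to the right, so that \<open>\<phi>\<close> lies in
  \<open>H \<otimes> (H \<otimes> H)\<close>.
\<close>

record ('k, 'h) qqH = "('k, 'h) module" +
  comult :: "'h \<Rightarrow> ('k, 'h, 'h) tens"
  counit :: "'h \<Rightarrow> 'k"
  phi :: "('k, 'h, ('k, 'h, 'h) tens) tens"
  antip :: "'h \<Rightarrow> 'h"
  alpha :: "'h"
  beta :: "'h"
  Rmat :: "('k, 'h, 'h) tens"

context
  fixes k :: "'k ring" and H :: "('k, 'h) qqH"
begin

definition H2 :: "('k, ('k, 'h, 'h) tens) module" where
  "H2 = talg k H H"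

definition H3 :: "('k, ('k, 'h, ('k, 'h, 'h) tens) tens) module" where
  "H3 = talg k H H2"

definition H4 :: "('k, ('k, 'h, ('k, 'h, ('k, 'h, 'h) tens) tens) tens) module" where
  "H4 = talg k H H3"

definition p2 :: "'h \<Rightarrow> 'h \<Rightarrow> ('k, 'h, 'h) tens" where
  "p2 x y = pure k H H x y"

definition p3 :: "'h \<Rightarrow> 'h \<Rightarrow> 'h \<Rightarrow> ('k, 'h, ('k, 'h, 'h) tens) tens" where
  "p3 x y z = pure k H H2 x (p2 y z)"

definition p4 :: "'h \<Rightarrow> 'h \<Rightarrow> 'h \<Rightarrow> 'h \<Rightarrow> ('k, 'h, ('k, 'h, ('k, 'h, 'h) tens) tens) tens" where
  "p4 w x y z = pure k H H3 w (p3 x y z)"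

text \<open>
  Sweedler-type summation: \<open>sw2 X t f\<close> stands for the sum of the \<open>f t\<^sub>1 t\<^sub>2\<close> in the module \<open>X\<close>,
  where \<open>t = t\<^sub>1 \<otimes> t\<^sub>2\<close> (summation understood); \<open>sw3\<close> is the analogue for three tensor factors.
\<close>

definition sw2 :: "('k, 'x, 'p) module_scheme \<Rightarrow> ('k, 'h, 'h) tens \<Rightarrow> ('h \<Rightarrow> 'h \<Rightarrow> 'x) \<Rightarrow> 'x" where
  "sw2 X t f = tlift k H H X f t"

definition sw3 ::
  "('k, 'x, 'p) module_scheme \<Rightarrow> ('k, 'h, ('k, 'h, 'h) tens) tens \<Rightarrow> ('h \<Rightarrow> 'h \<Rightarrow> 'h \<Rightarrow> 'x) \<Rightarrow> 'x" where
  "sw3 X t f = tlift k H H2 X (\<lambda>x s. sw2 X s (\<lambda>y z. f x y z)) t"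

definition phi_inv :: "('k, 'h, ('k, 'h, 'h) tens) tens" where
  "phi_inv = inv\<^bsub>H3\<^esub> (phi H)"

end

locale quasi_bialgebra = assoc_algebra k H for k :: "'k ring" and H :: "('k, 'h) qqH" +
  assumes comult_hom: "is_alg_hom k H (H2 k H) (comult H)"
    and counit_hom: "is_alg_hom k H (base_module k) (counit H)"
    and phi_unit: "phi H \<in> Units (H3 k H)"
    and counit_left: "h \<in> carrier H \<Longrightarrow>
      sw2 k H H (comult H h) (\<lambda>h1 h2. counit H h1 \<odot>\<^bsub>H\<^esub> h2) = h"
    and counit_right: "h \<in> carrier H \<Longrightarrow>
      sw2 k H H (comult H h) (\<lambda>h1 h2. counit H h2 \<odot>\<^bsub>H\<^esub> h1) = h"
    and quasi_coassoc: "h \<in> carrier H \<Longrightarrow>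
      sw2 k H (H3 k H) (comult H h) (\<lambda>h1 h2. pure k H (H2 k H) h1 (comult H h2))
        \<otimes>\<^bsub>H3 k H\<^esub> phi H
      = phi H \<otimes>\<^bsub>H3 k H\<^esub>
        sw2 k H (H3 k H) (comult H h) (\<lambda>h1 h2.
          sw2 k H (H3 k H) (comult H h1) (\<lambda>x y. p3 k H x y h2))"
    and pentagon:
      "sw3 k H (H4 k H) (phi H) (\<lambda>x y z.
          pure k H (H3 k H) x (pure k H (H2 k H) y (comult H z)))
        \<otimes>\<^bsub>H4 k H\<^esub>
        sw3 k H (H4 k H) (phi H) (\<lambda>x y z.
          sw2 k H (H4 k H) (comult H x) (\<lambda>x1 x2. p4 k H x1 x2 y z))
      = pure k H (H3 k H) \<one>\<^bsub>H\<^esub> (phi H)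
        \<otimes>\<^bsub>H4 k H\<^esub>
        sw3 k H (H4 k H) (phi H) (\<lambda>x y z.
          sw2 k H (H4 k H) (comult H y) (\<lambda>y1 y2. p4 k H x y1 y2 z))
        \<otimes>\<^bsub>H4 k H\<^esub>
        sw3 k H (H4 k H) (phi H) (\<lambda>x y z. p4 k H x y z \<one>\<^bsub>H\<^esub>)"
    and phi_counit:
      "sw3 k H (H2 k H) (phi H) (\<lambda>x y z. p2 k H x (counit H y \<odot>\<^bsub>H\<^esub> z)) = \<one>\<^bsub>H2 k H\<^esub>"

locale quasi_Hopf_algebra = quasi_bialgebra +
  assumes antip_lin: "is_lin k H H (antip H)"
    and antip_bij: "bij_betw (antip H) (carrier H) (carrier H)"
    and antip_mult: "\<lbrakk> x \<in> carrier H; y \<in> carrier H \<rbrakk>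
      \<Longrightarrow> antip H (x \<otimes>\<^bsub>H\<^esub> y) = antip H y \<otimes>\<^bsub>H\<^esub> antip H x"
    and antip_one: "antip H \<one>\<^bsub>H\<^esub> = \<one>\<^bsub>H\<^esub>"
    and alpha_closed: "alpha H \<in> carrier H"
    and beta_closed: "beta H \<in> carrier H"
    and antip_alpha: "h \<in> carrier H \<Longrightarrow>
      sw2 k H H (comult H h) (\<lambda>h1 h2. antip H h1 \<otimes>\<^bsub>H\<^esub> alpha H \<otimes>\<^bsub>H\<^esub> h2)
        = counit H h \<odot>\<^bsub>H\<^esub> alpha H"
    and antip_beta: "h \<in> carrier H \<Longrightarrow>
      sw2 k H H (comult H h) (\<lambda>h1 h2. h1 \<otimes>\<^bsub>H\<^esub> beta H \<otimes>\<^bsub>H\<^esub> antip H h2)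
        = counit H h \<odot>\<^bsub>H\<^esub> beta H"
    and antip_phi:
      "sw3 k H H (phi H) (\<lambda>x y z.
         x \<otimes>\<^bsub>H\<^esub> beta H \<otimes>\<^bsub>H\<^esub> antip H y \<otimes>\<^bsub>H\<^esub> alpha H \<otimes>\<^bsub>H\<^esub> z) = \<one>\<^bsub>H\<^esub>"
    and antip_phi_inv:
      "sw3 k H H (phi_inv k H) (\<lambda>x y z.
         antip H x \<otimes>\<^bsub>H\<^esub> alpha H \<otimes>\<^bsub>H\<^esub> y \<otimes>\<^bsub>H\<^esub> beta H \<otimes>\<^bsub>H\<^esub> antip H z) = \<one>\<^bsub>H\<^esub>"

text \<open>
  Leg notation puts the \<open>j\<close>-th leg into position \<open>i\<^sub>j\<close>: the legs of \<open>\<phi>\<^sub>2\<^sub>3\<^sub>1\<close> occur in the order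
  \<open>z, x, y\<close> and those of \<open>\<phi>\<^sub>3\<^sub>1\<^sub>2\<close> in the order \<open>y, z, x\<close>.
\<close>

locale quasitriangular_quasi_Hopf_algebra = quasi_Hopf_algebra +
  assumes Rmat_unit: "Rmat H \<in> Units (H2 k H)"
    and Rmat_comult: "h \<in> carrier H \<Longrightarrow>
      sw2 k H (H2 k H) (comult H h) (\<lambda>h1 h2. p2 k H h2 h1)
      = Rmat H \<otimes>\<^bsub>H2 k H\<^esub> comult H h \<otimes>\<^bsub>H2 k H\<^esub> inv\<^bsub>H2 k H\<^esub> (Rmat H)"
    and Rmat_right:
      "sw2 k H (H3 k H) (Rmat H) (\<lambda>r1 r2. pure k H (H2 k H) r1 (comult H r2))
      = inv\<^bsub>H3 k H\<^esub> (sw3 k H (H3 k H) (phi H) (\<lambda>x y z. p3 k H z x y))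
        \<otimes>\<^bsub>H3 k H\<^esub> sw2 k H (H3 k H) (Rmat H) (\<lambda>r1 r2. p3 k H r1 \<one>\<^bsub>H\<^esub> r2)
        \<otimes>\<^bsub>H3 k H\<^esub> sw3 k H (H3 k H) (phi H) (\<lambda>x y z. p3 k H y x z)
        \<otimes>\<^bsub>H3 k H\<^esub> sw2 k H (H3 k H) (Rmat H) (\<lambda>r1 r2. p3 k H r1 r2 \<one>\<^bsub>H\<^esub>)
        \<otimes>\<^bsub>H3 k H\<^esub> phi_inv k H"
    and Rmat_left:
      "sw2 k H (H3 k H) (Rmat H) (\<lambda>r1 r2.
          sw2 k H (H3 k H) (comult H r1) (\<lambda>x y. p3 k H x y r2))
      = sw3 k H (H3 k H) (phi H) (\<lambda>x y z. p3 k H y z x)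
        \<otimes>\<^bsub>H3 k H\<^esub> sw2 k H (H3 k H) (Rmat H) (\<lambda>r1 r2. p3 k H r1 \<one>\<^bsub>H\<^esub> r2)
        \<otimes>\<^bsub>H3 k H\<^esub> inv\<^bsub>H3 k H\<^esub> (sw3 k H (H3 k H) (phi H) (\<lambda>x y z. p3 k H x z y))
        \<otimes>\<^bsub>H3 k H\<^esub> sw2 k H (H3 k H) (Rmat H) (\<lambda>r1 r2. p3 k H \<one>\<^bsub>H\<^esub> r1 r2)
        \<otimes>\<^bsub>H3 k H\<^esub> phi H"

section \<open>The category of left \<open>H\<close>-modules\<close>

record ('k, 'h, 'v) hmod = "('k, 'v) module" +
  act :: "'h \<Rightarrow> 'v \<Rightarrow> 'v"

definition mk_hmod ::
  "('k, 'v, 'm) module_scheme \<Rightarrow> ('h \<Rightarrow> 'v \<Rightarrow> 'v) \<Rightarrow> ('k, 'h, 'v) hmod" where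
  "mk_hmod M a = \<lparr> carrier = carrier M, mult = mult M, one = one M, zero = zero M, add = add M,
     smult = smult M, act = a \<rparr>"

context
  fixes k :: "'k ring" and H :: "('k, 'h) qqH"
begin

definition is_hmod :: "('k, 'h, 'v, 'm) hmod_scheme \<Rightarrow> bool" where
  "is_hmod V \<longleftrightarrow> module k V \<and>
     (\<forall>h\<in>carrier H. is_lin k V V (act V h)) \<and>
     (\<forall>v\<in>carrier V. is_lin k H V (\<lambda>h. act V h v)) \<and>
     (\<forall>g\<in>carrier H. \<forall>h\<in>carrier H. \<forall>v\<in>carrier V. act V (g \<otimes>\<^bsub>H\<^esub> h) v = act V g (act V h v)) \<and>
     (\<forall>v\<in>carrier V. act V \<one>\<^bsub>H\<^esub> v = v)"

definition is_hmor ::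
  "('k, 'h, 'v, 'm) hmod_scheme \<Rightarrow> ('k, 'h, 'w, 'n) hmod_scheme \<Rightarrow> ('v \<Rightarrow> 'w) \<Rightarrow> bool" where
  "is_hmor V W f \<longleftrightarrow> is_lin k V W f \<and>
     (\<forall>h\<in>carrier H. \<forall>v\<in>carrier V. f (act V h v) = act W h (f v))"

definition hunit :: "('k, 'h, 'k) hmod" where
  "hunit = mk_hmod (base_module k) (\<lambda>h c. counit H h \<otimes>\<^bsub>k\<^esub> c)"

definition hten ::
  "('k, 'h, 'v, 'm) hmod_scheme \<Rightarrow> ('k, 'h, 'w, 'n) hmod_scheme
    \<Rightarrow> ('k, 'h, ('k, 'v, 'w) tens) hmod" where
  "hten V W = mk_hmod (tmod k V W) (\<lambda>h. tlift k V W (tmod k V W) (\<lambda>v w.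
     sw2 k H (tmod k V W) (comult H h) (\<lambda>h1 h2. pure k V W (act V h1 v) (act W h2 w))))"

definition Phi ::
  "('k, 'h, 'v, 'm) hmod_scheme \<Rightarrow> ('k, 'h, 'w, 'n) hmod_scheme \<Rightarrow> ('k, 'h, 'x, 'p) hmod_scheme
    \<Rightarrow> ('k, ('k, 'v, 'w) tens, 'x) tens \<Rightarrow> ('k, 'v, ('k, 'w, 'x) tens) tens" where
  "Phi V W X = tlift k (hten V W) X (hten V (hten W X)) (\<lambda>t x.
     tlift k V W (hten V (hten W X)) (\<lambda>v w.
       sw3 k H (hten V (hten W X)) (phi H) (\<lambda>p1 p2 p3.
         pure k V (hten W X) (act V p1 v) (pure k W X (act W p2 w) (act X p3 x)))) t)"

definition tau ::
  "('k, 'h, 'v, 'm) hmod_scheme \<Rightarrow> ('k, 'h, 'w, 'n) hmod_scheme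
    \<Rightarrow> ('k, 'v, 'w) tens \<Rightarrow> ('k, 'w, 'v) tens" where
  "tau V W = tlift k V W (hten W V) (\<lambda>v w.
     sw2 k H (hten W V) (Rmat H) (\<lambda>r1 r2. pure k W V (act W r2 w) (act V r1 v)))"

text \<open>The internal hom consists of all \<open>k\<close>-linear maps, not only the \<open>H\<close>-equivariant ones.\<close>

definition lin_module ::
  "('k, 'v, 'm) module_scheme \<Rightarrow> ('k, 'w, 'n) module_scheme \<Rightarrow> ('k, 'v \<Rightarrow> 'w) module" where
  "lin_module V W =
     \<lparr> carrier = lin k V W, mult = undefined, one = undefined,
       zero = (\<lambda>v\<in>carrier V. \<zero>\<^bsub>W\<^esub>),
       add = (\<lambda>L L'. \<lambda>v\<in>carrier V. L v \<oplus>\<^bsub>W\<^esub> L' v),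
       smult = (\<lambda>c L. \<lambda>v\<in>carrier V. c \<odot>\<^bsub>W\<^esub> L v) \<rparr>"

definition hhom ::
  "('k, 'h, 'v, 'm) hmod_scheme \<Rightarrow> ('k, 'h, 'w, 'n) hmod_scheme \<Rightarrow> ('k, 'h, 'v \<Rightarrow> 'w) hmod" where
  "hhom V W = mk_hmod (lin_module V W) (\<lambda>h L.
     sw2 k H (lin_module V W) (comult H h) (\<lambda>h1 h2.
       \<lambda>v\<in>carrier V. act W h1 (L (act V (antip H h2) v))))"

definition ev ::
  "('k, 'h, 'v, 'm) hmod_scheme \<Rightarrow> ('k, 'h, 'w, 'n) hmod_scheme
    \<Rightarrow> ('k, 'v \<Rightarrow> 'w, 'v) tens \<Rightarrow> 'w" where
  "ev V W = tlift k (hhom V W) V W (\<lambda>L v.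
     sw3 k H W (phi H) (\<lambda>p1 p2 p3.
       act W p1 (L (act V (antip H p2 \<otimes>\<^bsub>H\<^esub> alpha H \<otimes>\<^bsub>H\<^esub> p3) v))))"

definition hcomp ::
  "('k, 'h, 'v, 'm) hmod_scheme \<Rightarrow> ('k, 'h, 'w, 'n) hmod_scheme \<Rightarrow> ('k, 'h, 'x, 'p) hmod_scheme
    \<Rightarrow> ('k, 'w \<Rightarrow> 'x, 'v \<Rightarrow> 'w) tens \<Rightarrow> ('v \<Rightarrow> 'x)" where
  "hcomp V W X = (THE f.
     f \<in> extensional (carrier (hten (hhom W X) (hhom V W))) \<and>
     is_hmor (hten (hhom W X) (hhom V W)) (hhom V X) f \<and>
     (\<forall>t\<in>carrier (hten (hten (hhom W X) (hhom V W)) V).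
        (ev V X \<circ> tmap k (hten (hhom W X) (hhom V W)) V (hhom V X) V f id) t =
        (ev W X \<circ> tmap k (hhom W X) (hten (hhom V W) V) (hhom W X) W id (ev V W)
          \<circ> Phi (hhom W X) (hhom V W) V) t))"

end

section \<open>Algebras and bimodules\<close>

record ('k, 'h, 'a) halg = "('k, 'h, 'a) hmod" +
  mu :: "('k, 'a, 'a) tens \<Rightarrow> 'a"
  eta :: "'k \<Rightarrow> 'a"

record ('k, 'h, 'a, 'v) bimod = "('k, 'h, 'v) hmod" +
  lact :: "('k, 'a, 'v) tens \<Rightarrow> 'v"
  ract :: "('k, 'v, 'a) tens \<Rightarrow> 'v"

definition mk_bimod ::
  "('k, 'h, 'v, 'm) hmod_scheme \<Rightarrow> (('k, 'a, 'v) tens \<Rightarrow> 'v) \<Rightarrow> (('k, 'v, 'a) tens \<Rightarrow> 'v)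
    \<Rightarrow> ('k, 'h, 'a, 'v) bimod" where
  "mk_bimod M l r = \<lparr> carrier = carrier M, mult = mult M, one = one M, zero = zero M, add = add M,
     smult = smult M, act = act M, lact = l, ract = r \<rparr>"

definition self_bimod :: "('k, 'h, 'a) halg \<Rightarrow> ('k, 'h, 'a, 'a) bimod" where
  "self_bimod A = mk_bimod A (mu A) (mu A)"

context
  fixes k :: "'k ring" and H :: "('k, 'h) qqH" and A :: "('k, 'h, 'a) halg"
begin

definition mm :: "'a \<Rightarrow> 'a \<Rightarrow> 'a" where
  "mm a b = mu A (pure k A A a b)"

definition lm :: "('k, 'h, 'a, 'v) bimod \<Rightarrow> 'a \<Rightarrow> 'v \<Rightarrow> 'v" where
  "lm V a v = lact V (pure k A V a v)"

definition rm :: "('k, 'h, 'a, 'v) bimod \<Rightarrow> 'v \<Rightarrow> 'a \<Rightarrow> 'v" where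
  "rm V v a = ract V (pure k V A v a)"

definition is_halg :: bool where
  "is_halg \<longleftrightarrow> is_hmod k H A \<and>
     is_hmor k H (hten k H A A) A (mu A) \<and> is_hmor k H (hunit k H) A (eta A) \<and>
     (\<forall>a\<in>carrier A. \<forall>b\<in>carrier A. \<forall>c\<in>carrier A. mm (mm a b) c =
        sw3 k H A (phi H) (\<lambda>p1 p2 p3. mm (act A p1 a) (mm (act A p2 b) (act A p3 c)))) \<and>
     (\<forall>a\<in>carrier A. mm (eta A \<one>\<^bsub>k\<^esub>) a = a \<and> mm a (eta A \<one>\<^bsub>k\<^esub>) = a)"

definition braided_commutative :: bool where
  "braided_commutative \<longleftrightarrow> (\<forall>t\<in>carrier (hten k H A A). mu A (tau k H A A t) = mu A t)"

definition is_bimod :: "('k, 'h, 'a, 'v) bimod \<Rightarrow> bool" where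
  "is_bimod V \<longleftrightarrow> is_hmod k H V \<and>
     is_hmor k H (hten k H A V) V (lact V) \<and> is_hmor k H (hten k H V A) V (ract V) \<and>
     (\<forall>v\<in>carrier V. \<forall>a\<in>carrier A. \<forall>b\<in>carrier A.
        rm V (rm V v a) b = sw3 k H V (phi H) (\<lambda>p1 p2 p3.
          rm V (act V p1 v) (mm (act A p2 a) (act A p3 b))) \<and>
        lm V a (lm V b v) = sw3 k H V (phi_inv k H) (\<lambda>p1 p2 p3.
          lm V (mm (act A p1 a) (act A p2 b)) (act V p3 v)) \<and>
        lm V a (rm V v b) = sw3 k H V (phi_inv k H) (\<lambda>p1 p2 p3.
          rm V (lm V (act A p1 a) (act V p2 v)) (act A p3 b))) \<and>
     (\<forall>v\<in>carrier V. lm V (eta A \<one>\<^bsub>k\<^esub>) v = v \<and> rm V v (eta A \<one>\<^bsub>k\<^esub>) = v)"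

definition is_sym_bimod :: "('k, 'h, 'a, 'v) bimod \<Rightarrow> bool" where
  "is_sym_bimod V \<longleftrightarrow> is_bimod V \<and>
     (\<forall>t\<in>carrier (hten k H A V). ract V (tau k H A V t) = lact V t) \<and>
     (\<forall>t\<in>carrier (hten k H V A). lact V (tau k H V A t) = ract V t)"

definition is_bimor ::
  "('k, 'h, 'a, 'v) bimod \<Rightarrow> ('k, 'h, 'a, 'w) bimod \<Rightarrow> ('v \<Rightarrow> 'w) \<Rightarrow> bool" where
  "is_bimor V W f \<longleftrightarrow> is_hmor k H V W f \<and>
     (\<forall>a\<in>carrier A. \<forall>v\<in>carrier V. f (lm V a v) = lm W a (f v) \<and> f (rm V v a) = rm W (f v) a)"

text \<open>The tensor product over \<open>k\<close> of two bimodules, again a bimodule.\<close>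

definition bten ::
  "('k, 'h, 'a, 'v) bimod \<Rightarrow> ('k, 'h, 'a, 'w) bimod
    \<Rightarrow> ('k, 'h, 'a, ('k, 'v, 'w) tens) bimod" where
  "bten V W = mk_bimod (hten k H V W)
     (tlift k A (hten k H V W) (hten k H V W) (\<lambda>a. tlift k V W (hten k H V W) (\<lambda>v w.
        sw3 k H (hten k H V W) (phi_inv k H) (\<lambda>p1 p2 p3.
          pure k V W (lm V (act A p1 a) (act V p2 v)) (act W p3 w)))))
     (tlift k (hten k H V W) A (hten k H V W) (\<lambda>t a. tlift k V W (hten k H V W) (\<lambda>v w.
        sw3 k H (hten k H V W) (phi H) (\<lambda>p1 p2 p3.
          pure k V W (act V p1 v) (rm W (act W p2 w) (act A p3 a)))) t))"

subsection \<open>The tensor product over \<open>A\<close>\<close>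

definition tensA_null ::
  "('k, 'h, 'a, 'v) bimod \<Rightarrow> ('k, 'h, 'a, 'w) bimod \<Rightarrow> ('k, 'v, 'w) tens set" where
  "tensA_null V W = (\<lambda>t.
       tmap k (hten k H V A) W V W (ract V) id t
       \<ominus>\<^bsub>hten k H V W\<^esub> (tmap k V (hten k H A W) V W id (lact W) \<circ> Phi k H V A W) t)
     ` carrier (hten k H (hten k H V A) W)"

definition tmodA ::
  "('k, 'h, 'a, 'v) bimod \<Rightarrow> ('k, 'h, 'a, 'w) bimod \<Rightarrow> ('k, ('k, 'v, 'w) tensA) module" where
  "tmodA V W = quot_module k (hten k H V W) (tensA_null V W)"

definition pureA ::
  "('k, 'h, 'a, 'v) bimod \<Rightarrow> ('k, 'h, 'a, 'w) bimod \<Rightarrow> 'v \<Rightarrow> 'w \<Rightarrow> ('k, 'v, 'w) tensA" where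
  "pureA V W v w = tensA_null V W +>\<^bsub>hten k H V W\<^esub> pure k V W v w"

text \<open>The linear map with values \<open>f v w\<close> on the classes of pure tensors (for \<open>A\<close>-balanced \<open>f\<close>).\<close>

definition tliftA ::
  "('k, 'h, 'a, 'v) bimod \<Rightarrow> ('k, 'h, 'a, 'w) bimod \<Rightarrow> ('k, 'x, 'p) module_scheme
    \<Rightarrow> ('v \<Rightarrow> 'w \<Rightarrow> 'x) \<Rightarrow> ('k, 'v, 'w) tensA \<Rightarrow> 'x" where
  "tliftA V W X f = (THE g. g \<in> lin k (tmodA V W) X \<and>
     (\<forall>v\<in>carrier V. \<forall>w\<in>carrier W. g (pureA V W v w) = f v w))"

definition tensA ::
  "('k, 'h, 'a, 'v) bimod \<Rightarrow> ('k, 'h, 'a, 'w) bimod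
    \<Rightarrow> ('k, 'h, 'a, ('k, 'v, 'w) tensA) bimod" where
  "tensA V W = mk_bimod
     (mk_hmod (tmodA V W) (\<lambda>h. tliftA V W (tmodA V W) (\<lambda>v w.
        sw2 k H (tmodA V W) (comult H h) (\<lambda>h1 h2. pureA V W (act V h1 v) (act W h2 w)))))
     (tlift k A (tmodA V W) (tmodA V W) (\<lambda>a. tliftA V W (tmodA V W) (\<lambda>v w.
        sw3 k H (tmodA V W) (phi_inv k H) (\<lambda>p1 p2 p3.
          pureA V W (lm V (act A p1 a) (act V p2 v)) (act W p3 w)))))
     (tlift k (tmodA V W) A (tmodA V W) (\<lambda>t a. tliftA V W (tmodA V W) (\<lambda>v w.
        sw3 k H (tmodA V W) (phi H) (\<lambda>p1 p2 p3.
          pureA V W (act V p1 v) (rm W (act W p2 w) (act A p3 a)))) t))"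

definition tmapA ::
  "('k, 'h, 'a, 'v) bimod \<Rightarrow> ('k, 'h, 'a, 'w) bimod
    \<Rightarrow> ('k, 'h, 'a, 'v1) bimod \<Rightarrow> ('k, 'h, 'a, 'w1) bimod
    \<Rightarrow> ('v \<Rightarrow> 'v1) \<Rightarrow> ('w \<Rightarrow> 'w1) \<Rightarrow> ('k, 'v, 'w) tensA \<Rightarrow> ('k, 'v1, 'w1) tensA" where
  "tmapA V W V' W' f g = tliftA V W (tensA V' W') (\<lambda>v w. pureA V' W' (f v) (g w))"

definition PhiA ::
  "('k, 'h, 'a, 'v) bimod \<Rightarrow> ('k, 'h, 'a, 'w) bimod \<Rightarrow> ('k, 'h, 'a, 'x) bimod
    \<Rightarrow> ('k, ('k, 'v, 'w) tensA, 'x) tensA \<Rightarrow> ('k, 'v, ('k, 'w, 'x) tensA) tensA" where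
  "PhiA V W X = tliftA (tensA V W) X (tensA V (tensA W X)) (\<lambda>t x.
     tliftA V W (tensA V (tensA W X)) (\<lambda>v w.
       sw3 k H (tensA V (tensA W X)) (phi H) (\<lambda>p1 p2 p3.
         pureA V (tensA W X) (act V p1 v) (pureA W X (act W p2 w) (act X p3 x)))) t)"

definition PhiA_inv ::
  "('k, 'h, 'a, 'v) bimod \<Rightarrow> ('k, 'h, 'a, 'w) bimod \<Rightarrow> ('k, 'h, 'a, 'x) bimod
    \<Rightarrow> ('k, 'v, ('k, 'w, 'x) tensA) tensA \<Rightarrow> ('k, ('k, 'v, 'w) tensA, 'x) tensA" where
  "PhiA_inv V W X = inv_into (carrier (tensA (tensA V W) X)) (PhiA V W X)"

definition tauA ::
  "('k, 'h, 'a, 'v) bimod \<Rightarrow> ('k, 'h, 'a, 'w) bimod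
    \<Rightarrow> ('k, 'v, 'w) tensA \<Rightarrow> ('k, 'w, 'v) tensA" where
  "tauA V W = tliftA V W (tensA W V) (\<lambda>v w.
     sw2 k H (tensA W V) (Rmat H) (\<lambda>r1 r2. pureA W V (act W r2 w) (act V r1 v)))"

subsection \<open>The internal hom over \<open>A\<close>\<close>

definition lhat :: "('k, 'h, 'a, 'v) bimod \<Rightarrow> 'a \<Rightarrow> ('v \<Rightarrow> 'v)" where
  "lhat V a = (\<lambda>v\<in>carrier V. sw3 k H V (phi_inv k H) (\<lambda>p1 p2 p3.
     lm V (act A p1 a) (act V (p2 \<otimes>\<^bsub>H\<^esub> beta H \<otimes>\<^bsub>H\<^esub> antip H p3) v)))"

definition bhom ::
  "('k, 'h, 'a, 'v) bimod \<Rightarrow> ('k, 'h, 'a, 'w) bimod \<Rightarrow> ('k, 'h, 'a, 'v \<Rightarrow> 'w) bimod" where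
  "bhom V W = mk_bimod (hhom k H V W)
     (tlift k A (hhom k H V W) (hhom k H V W) (\<lambda>a L.
        hcomp k H V W W (pure k (hhom k H W W) (hhom k H V W) (lhat W a) L)))
     (tlift k (hhom k H V W) A (hhom k H V W) (\<lambda>L a.
        hcomp k H V V W (pure k (hhom k H V W) (hhom k H V V) L (lhat V a))))"

definition ev_desc ::
  "('k, 'h, 'a, 'v) bimod \<Rightarrow> ('k, 'h, 'a, 'w) bimod \<Rightarrow> ('k, 'v \<Rightarrow> 'w, 'v) tensA \<Rightarrow> 'w" where
  "ev_desc V W = tliftA (bhom V W) V W (\<lambda>L v. ev k H V W (pure k (hhom k H V W) V L v))"

definition f1 ::
  "('k, 'h, 'a, 'v) bimod \<Rightarrow> ('k, 'h, 'a, 'w) bimod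
    \<Rightarrow> ('k, 'v \<Rightarrow> 'w, ('k, 'v, 'a) tens) tensA \<Rightarrow> 'w" where
  "f1 V W = tliftA (bhom V W) (bten V (self_bimod A)) W (\<lambda>L. tlift k V A W (\<lambda>v a.
     ev_desc V W (pureA (bhom V W) V L (rm V v a))))"

definition f2 ::
  "('k, 'h, 'a, 'v) bimod \<Rightarrow> ('k, 'h, 'a, 'w) bimod
    \<Rightarrow> ('k, 'v \<Rightarrow> 'w, ('k, 'v, 'a) tens) tensA \<Rightarrow> 'w" where
  "f2 V W = tliftA (bhom V W) (bten V (self_bimod A)) W (\<lambda>L. tlift k V A W (\<lambda>v a.
     sw3 k H W (phi_inv k H) (\<lambda>p1 p2 p3.
       rm W (ev_desc V W (pureA (bhom V W) V (act (bhom V W) p1 L) (act V p2 v))) (act A p3 a))))"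

text \<open>\<open>D V W f\<^sub>i\<close> is the map \<open>D\<^sub>i\<close> from \<open>hom(V, W)\<close> to \<open>hom(V \<otimes> A, W)\<close>.\<close>

definition D ::
  "('k, 'h, 'a, 'v) bimod \<Rightarrow> ('k, 'h, 'a, 'w) bimod
    \<Rightarrow> (('k, 'v \<Rightarrow> 'w, ('k, 'v, 'a) tens) tensA \<Rightarrow> 'w)
    \<Rightarrow> ('v \<Rightarrow> 'w) \<Rightarrow> (('k, 'v, 'a) tens \<Rightarrow> 'w)" where
  "D V W f L = (let VA = bten V (self_bimod A) in
     (\<lambda>t\<in>carrier VA. sw3 k H W (phi_inv k H) (\<lambda>p1 p2 p3.
       f (pureA (bhom V W) VA (act (bhom V W) p1 L)
            (act VA (p2 \<otimes>\<^bsub>H\<^esub> beta H \<otimes>\<^bsub>H\<^esub> antip H p3) t)))))"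

definition homA_hmod ::
  "('k, 'h, 'a, 'v) bimod \<Rightarrow> ('k, 'h, 'a, 'w) bimod \<Rightarrow> ('k, 'h, 'v \<Rightarrow> 'w) hmod" where
  "homA_hmod V W = (hhom k H V W)
     \<lparr> carrier := {L \<in> carrier (hhom k H V W). D V W (f1 V W) L = D V W (f2 V W) L} \<rparr>"

definition homA ::
  "('k, 'h, 'a, 'v) bimod \<Rightarrow> ('k, 'h, 'a, 'w) bimod \<Rightarrow> ('k, 'h, 'a, 'v \<Rightarrow> 'w) bimod" where
  "homA V W = mk_bimod (homA_hmod V W)
     (tlift k A (homA_hmod V W) (homA_hmod V W) (\<lambda>a L. lm (bhom V W) a L))
     (tlift k (homA_hmod V W) A (homA_hmod V W) (\<lambda>L a. rm (bhom V W) L a))"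

definition evA ::
  "('k, 'h, 'a, 'v) bimod \<Rightarrow> ('k, 'h, 'a, 'w) bimod \<Rightarrow> ('k, 'v \<Rightarrow> 'w, 'v) tensA \<Rightarrow> 'w" where
  "evA V W = tliftA (homA V W) V W (\<lambda>L v. ev_desc V W (pureA (bhom V W) V L v))"

definition compA ::
  "('k, 'h, 'a, 'v) bimod \<Rightarrow> ('k, 'h, 'a, 'w) bimod \<Rightarrow> ('k, 'h, 'a, 'x) bimod
    \<Rightarrow> ('k, 'w \<Rightarrow> 'x, 'v \<Rightarrow> 'w) tensA \<Rightarrow> ('v \<Rightarrow> 'x)" where
  "compA V W X = tliftA (homA W X) (homA V W) (homA V X) (\<lambda>L L'.
     hcomp k H V W X (pure k (hhom k H W X) (hhom k H V W) L L'))"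

subsection \<open>The tensor product morphisms\<close>

text \<open>
  The rebracketed braiding \<open>(M \<otimes>\<^sub>A N) \<otimes>\<^sub>A (V \<otimes>\<^sub>A X) \<rightarrow> (M \<otimes>\<^sub>A V) \<otimes>\<^sub>A (N \<otimes>\<^sub>A X)\<close> of the two
  middle factors.
\<close>

definition exchA ::
  "('k, 'h, 'a, 'm) bimod \<Rightarrow> ('k, 'h, 'a, 'n) bimod
    \<Rightarrow> ('k, 'h, 'a, 'v) bimod \<Rightarrow> ('k, 'h, 'a, 'x) bimod
    \<Rightarrow> ('k, ('k, 'm, 'n) tensA, ('k, 'v, 'x) tensA) tensA
    \<Rightarrow> ('k, ('k, 'm, 'v) tensA, ('k, 'n, 'x) tensA) tensA" where
  "exchA M N V X =
     PhiA_inv M V (tensA N X)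
     \<circ> tmapA M (tensA (tensA V N) X) M (tensA V (tensA N X)) id (PhiA V N X)
     \<circ> tmapA M (tensA (tensA N V) X) M (tensA (tensA V N) X) id
         (tmapA (tensA N V) X (tensA V N) X (tauA N V) id)
     \<circ> tmapA M (tensA N (tensA V X)) M (tensA (tensA N V) X) id (PhiA_inv N V X)
     \<circ> PhiA M N (tensA V X)"

definition boxA ::
  "('k, 'h, 'a, 'v) bimod \<Rightarrow> ('k, 'h, 'a, 'w) bimod
    \<Rightarrow> ('k, 'h, 'a, 'x) bimod \<Rightarrow> ('k, 'h, 'a, 'y) bimod
    \<Rightarrow> ('k, 'v \<Rightarrow> 'w, 'x \<Rightarrow> 'y) tensA \<Rightarrow> (('k, 'v, 'x) tensA \<Rightarrow> ('k, 'w, 'y) tensA)" where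
  "boxA V W X Y =
    (let M = homA V W; N = homA X Y; VX = tensA V X; WY = tensA W Y in
     THE f. f \<in> extensional (carrier (tensA M N)) \<and>
       is_bimor (tensA M N) (homA VX WY) f \<and>
       (\<forall>t\<in>carrier (tensA (tensA M N) VX).
          (evA VX WY \<circ> tmapA (tensA M N) VX (homA VX WY) VX f id) t =
          (tmapA (tensA M V) (tensA N X) W Y (evA V W) (evA X Y) \<circ> exchA M N V X) t))"

definition conjA ::
  "('k, 'h, 'a, 'u) bimod \<Rightarrow> ('k, 'h, 'a, 'v) bimod \<Rightarrow> ('k, 'h, 'a, 'w) bimod
    \<Rightarrow> ('k, 'h, 'a, 'x) bimod \<Rightarrow> ('k, 'h, 'a, 'y) bimod \<Rightarrow> ('k, 'h, 'a, 'z) bimod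
    \<Rightarrow> (('k, ('k, 'u, 'w) tensA, 'y) tensA \<Rightarrow> ('k, ('k, 'v, 'x) tensA, 'z) tensA)
    \<Rightarrow> (('k, 'u, ('k, 'w, 'y) tensA) tensA \<Rightarrow> ('k, 'v, ('k, 'x, 'z) tensA) tensA)" where
  "conjA U V W X Y Z L =
     restrict (PhiA V X Z \<circ> L \<circ> PhiA_inv U W Y) (carrier (tensA U (tensA W Y)))"

end

end

theory Submission
  imports Defs
begin

text \<open>Both identities are equations between morphisms into an internal hom, so they may be checked after
evaluation (\<open>Hom_ext\<close>). Evaluating turns \<open>\<boxtimes>\<^sub>A\<close> into the exchange of the two middle tensor factors followed
by \<open>ev \<otimes> ev\<close> (\<open>box_evp\<close>), composition into iterated evaluation (\<open>compA_evp\<close>) and conjugation into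
composition with associators (\<open>conj_evp\<close>). Naturality of the exchange moves the evaluations to the end,
and what remains concerns exchange morphisms alone: \<open>ex_comp\<close> says that the two ways to turn
\<open>((P \<otimes> Q) \<otimes> (K \<otimes> T)) \<otimes> (U \<otimes> W)\<close> into \<open>(P \<otimes> (K \<otimes> U)) \<otimes> (Q \<otimes> (T \<otimes> W))\<close> agree, and \<open>ex_assoc\<close> that exchanges
are compatible with reassociation. These hold in every braided monoidal category. They follow from
pentagon, hexagons and naturality once the exchange is written as the conjugate, under associators, of
a morphism \<open>ss\<close> that braids the first two of three factors.

Most of the work is to establish the braided closed monoidal structure. Tensor products over \<open>A\<close> are
cosets of cosets; to compute with elements, a morphism out of a tensor product is replaced by an
equivariant bilinear map (\<open>eqb\<close>, \<open>bimap\<close>), and an equation between iterated products by a relation: \<open>F\<close> is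
related to \<open>G\<close> by an element \<open>t\<close> of a tensor power of \<open>H\<close> if \<open>F\<close> is \<open>G\<close> with the legs of \<open>t\<close> applied to its
arguments. Composing relations multiplies the elements. The associativity of \<open>A\<close>, the laws of a bimodule,
balancing over \<open>A\<close>, and the laws for evaluation and composition all become one law \<open>asc\<close>, a relation by
\<open>\<phi>\<close>; the braiding and the symmetry of a bimodule become relations by \<open>R\<close>. The pentagon axiom then says
that among the five instances of \<open>asc\<close> for four factors any four imply the fifth, and the two axioms for
the coproducts of \<open>R\<close> say that five sides of a hexagon of relations imply the sixth. Each structural fact
(the actions on \<open>V \<otimes>\<^sub>A W\<close> and on \<open>hom\<^sub>A\<close>, the associator, the braiding, the symmetry of tensor products and
internal homs) rests on pentagons or hexagons in which \<open>A\<close> is one of the factors.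

The axioms for the antipode enter through the internal hom of \<open>H\<close>-modules: evaluation and an explicit
currying formula are inverse to each other (\<open>evp_cur\<close>, \<open>cur_evp\<close>). Hence a linear map is determined by the
evaluations of its translates (\<open>evp_nondegenerate\<close>), laws in the internal hom can be verified after
evaluation, and \<open>hom\<^sub>A\<close> consists of the maps all of whose translates have right linear evaluation
(\<open>Hom_iff\<close>).\<close>

text \<open>The ASCII notations \<open>:\<close> for set membership and \<open>*\<close> for the product of a type class are freed, for
membership in the carrier of a structure and for the multiplication of \<open>H\<close>.\<close>

unbundle no member_ASCII_syntax
no_notation times (infixl "*" 70)
notation (input) iff (infixr "<->" 25)

abbreviation mem_carrier (infix ":" 50) where "x : M \<equiv> x \<in> carrier M"

section \<open>Linear maps, quotient modules and tensor products over the base ring\<close>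

lemma is_linI:
 assumes "!!x. x : V ==> f x : W"
  and "!!x y. x : V ==> y : V ==> f (x \<oplus>\<^bsub>V\<^esub> y) = f x \<oplus>\<^bsub>W\<^esub> f y"
  and "!!c x. c : k ==> x : V ==> f (c \<odot>\<^bsub>V\<^esub> x) = c \<odot>\<^bsub>W\<^esub> f x"
 shows "is_lin k V W f"
 using assms by (auto simp: is_lin_def)

lemma lin_closed: "is_lin k V W f ==> x : V ==> f x : W"
 by (auto simp: is_lin_def)

lemma lin_add:
 "is_lin k V W f ==> x : V ==> y : V ==> f (x \<oplus>\<^bsub>V\<^esub> y) = f x \<oplus>\<^bsub>W\<^esub> f y"
 by (auto simp: is_lin_def)

lemma lin_smult:
 "is_lin k V W f ==> c : k ==> x : V ==> f (c \<odot>\<^bsub>V\<^esub> x) = c \<odot>\<^bsub>W\<^esub> f x"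
 by (auto simp: is_lin_def)

lemma lin_comp:
 "is_lin k V W f ==> is_lin k W X g ==> is_lin k V X (%v. g (f v))"
 by (auto simp: is_lin_def Pi_iff)

lemma lin_id: "is_lin k V V (%v. v)"
 by (auto simp: is_lin_def)

lemma module_abelian_group: "module k V ==> abelian_group V"
 by (simp add: module_def)

lemma module_add_closed:
 "module k V ==> x : V ==> y : V ==> x \<oplus>\<^bsub>V\<^esub> y : V"
 by (simp add: module_def abelian_group_def abelian_monoid.a_closed)

lemma module_smult_closed:
 "module k V ==> c : k ==> x : V ==> c \<odot>\<^bsub>V\<^esub> x : V"
 by (rule module.smult_closed)

lemma module_zero_closed: "module k V ==> \<zero>\<^bsub>V\<^esub> : V"
 by (simp add: module_def abelian_group_def abelian_monoid.zero_closed)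

lemma module_inv_closed: "module k V ==> x : V ==> \<ominus>\<^bsub>V\<^esub> x : V"
 by (simp add: module_def abelian_group.a_inv_closed)

lemma module_cring: "module k V ==> cring k"
 by (simp add: module_def)

lemma module_add_comm4:
 assumes "module k V" "a : V" "b : V" "c : V" "d : V"
 shows "(a \<oplus>\<^bsub>V\<^esub> b) \<oplus>\<^bsub>V\<^esub> (c \<oplus>\<^bsub>V\<^esub> d) = (a \<oplus>\<^bsub>V\<^esub> c) \<oplus>\<^bsub>V\<^esub> (b \<oplus>\<^bsub>V\<^esub> d)"
proof -
 interpret V: module k V by fact
 show ?thesis using assms by (simp add: V.a_ac)
qed

lemma module_smult_comm:
 assumes "module k V" "c : k" "d : k" "x : V"
 shows "c \<odot>\<^bsub>V\<^esub> (d \<odot>\<^bsub>V\<^esub> x) = d \<odot>\<^bsub>V\<^esub> (c \<odot>\<^bsub>V\<^esub> x)"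
proof -
 interpret V: module k V by fact
 show ?thesis using assms by (metis V.R.m_comm V.smult_assoc1)
qed

lemma module_minus_eq_zero_iff:
 assumes "module k V" "x : V" "y : V"
 shows "x \<ominus>\<^bsub>V\<^esub> y = \<zero>\<^bsub>V\<^esub> <-> x = y"
proof -
 interpret V: module k V by fact
 show ?thesis using assms
  by (auto simp: a_minus_def V.r_neg) (metis V.minus_equality V.minus_minus V.a_inv_closed)
qed

lemma lin_zero:
 assumes "module k V" "module k W" "is_lin k V W f"
 shows "f \<zero>\<^bsub>V\<^esub> = \<zero>\<^bsub>W\<^esub>"
proof -
 interpret V: module k V by fact
 interpret W: module k W by fact
 have "f (\<zero>\<^bsub>V\<^esub> \<oplus>\<^bsub>V\<^esub> \<zero>\<^bsub>V\<^esub>) = f \<zero>\<^bsub>V\<^esub> \<oplus>\<^bsub>W\<^esub> f \<zero>\<^bsub>V\<^esub>"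
  by (rule lin_add[OF assms(3) V.zero_closed V.zero_closed])
 moreover have "f \<zero>\<^bsub>V\<^esub> : W" by (rule lin_closed[OF assms(3) V.zero_closed])
 ultimately show ?thesis using V.l_zero[OF V.zero_closed] W.add.r_cancel_one'[of "f \<zero>\<^bsub>V\<^esub>" "f \<zero>\<^bsub>V\<^esub>"]
  by simp
qed

lemma lin_inv:
 assumes "module k V" "module k W" "is_lin k V W f" "x : V"
 shows "f (\<ominus>\<^bsub>V\<^esub> x) = \<ominus>\<^bsub>W\<^esub> f x"
proof -
 interpret V: module k V by fact
 interpret W: module k W by fact
 have "f (\<ominus>\<^bsub>V\<^esub> x) \<oplus>\<^bsub>W\<^esub> f x = \<zero>\<^bsub>W\<^esub>"
  using lin_add[OF assms(3), of "\<ominus>\<^bsub>V\<^esub> x" x] lin_zero[OF assms(1-3)] assms(4)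
  by (simp add: V.l_neg)
 thus ?thesis using lin_closed[OF assms(3)] assms(4)
  by (simp add: W.minus_equality)
qed

lemma lin_minus:
 assumes "module k V" "module k W" "is_lin k V W f" "x : V" "y : V"
 shows "f (x \<ominus>\<^bsub>V\<^esub> y) = f x \<ominus>\<^bsub>W\<^esub> f y"
 using lin_inv[OF assms(1-3)] lin_add[OF assms(3)] assms
 by (simp add: a_minus_def module_inv_closed)

lemma lin_cong:
 assumes "module k V" "is_lin k V W f" "!!v. v : V ==> g v = f v"
 shows "is_lin k V W g"
 using assms
 by (auto intro!: is_linI simp: lin_closed lin_add lin_smult module_add_closed module_smult_closed)

lemma lin_addf:
 assumes "module k W" "is_lin k V W f" "is_lin k V W g"
 shows "is_lin k V W (%v. f v \<oplus>\<^bsub>W\<^esub> g v)"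
proof -
 interpret W: module k W by fact
 show ?thesis using assms
  by (intro is_linI)
    (simp_all add: lin_closed lin_add lin_smult W.smult_r_distr module_add_comm4[OF assms(1)])
qed

lemma lin_zerof: "module k W ==> is_lin k V W (%v. \<zero>\<^bsub>W\<^esub>)"
proof -
 assume "module k W" then interpret W: module k W .
 show ?thesis by (intro is_linI) auto
qed

lemma lin_smultf:
 assumes "module k W" "is_lin k V W f" "c : k"
 shows "is_lin k V W (%v. c \<odot>\<^bsub>W\<^esub> f v)"
proof -
 interpret W: module k W by fact
 show ?thesis using assms
  by (intro is_linI)
    (simp_all add: lin_closed lin_add lin_smult W.smult_r_distr module_smult_comm[OF assms(1)])
qed

lemma lin_minusf:
 assumes "module k W" "is_lin k V W f" "is_lin k V W g"
 shows "is_lin k V W (%v. f v \<ominus>\<^bsub>W\<^esub> g v)"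
proof -
 interpret W: module k W by fact
 show ?thesis using assms
  apply (intro is_linI)
   apply (simp_all add: lin_closed lin_add lin_smult W.smult_r_distr a_minus_def
    module_add_comm4[OF assms(1)] W.minus_add W.smult_r_minus)
  done
qed

lemma kernel_submodule:
 assumes "module k V" "module k W" "is_lin k V W f"
 shows "submodule {v \<in> carrier V. f v = \<zero>\<^bsub>W\<^esub>} k V"
proof -
 interpret V: module k V by fact
 interpret W: module k W by fact
 show ?thesis
  by (intro V.submoduleI)
    (use lin_zero[OF assms] lin_inv[OF assms] lin_add[OF assms(3)] lin_smult[OF assms(3)] in auto)
qed

lemma image_submodule:
 assumes "module k V" "module k W" "is_lin k V W f"
 shows "submodule (f ` carrier V) k W"
proof -
 interpret V: module k V by fact
 interpret W: module k W by fact
 show ?thesis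
 proof (intro W.submoduleI)
  show "f ` carrier V \<subseteq> carrier W" using lin_closed[OF assms(3)] by auto
  show "\<zero>\<^bsub>W\<^esub> \<in> f ` carrier V" using lin_zero[OF assms] by (metis V.zero_closed image_eqI)
  show "!!a. a \<in> f ` carrier V ==> \<ominus>\<^bsub>W\<^esub> a \<in> f ` carrier V"
   using lin_inv[OF assms] by (metis (no_types, lifting) V.a_inv_closed image_iff)
  show "!!a b. a \<in> f ` carrier V ==> b \<in> f ` carrier V ==> a \<oplus>\<^bsub>W\<^esub> b \<in> f ` carrier V"
   using lin_add[OF assms(3)] by (metis (no_types, lifting) V.a_closed image_iff)
  show "!!a x. a : k ==> x \<in> f ` carrier V ==> a \<odot>\<^bsub>W\<^esub> x \<in> f ` carrier V"
   using lin_smult[OF assms(3)] by (metis (no_types, lifting) V.smult_closed image_iff)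
 qed
qed

lemma lin_eqI:
 assumes "f \<in> lin k V W" "g \<in> lin k V W" "!!v. v : V ==> f v = g v"
 shows "f = g"
 using assms by (auto simp: lin_def intro: extensionalityI)

subsection \<open>Quotients\<close>

lemma quot_simps:
 "carrier (quot_module k M N) = a_rcosets\<^bsub>M\<^esub> N"
 "zero (quot_module k M N) = N"
 "add (quot_module k M N) = (%X Y. X <+>\<^bsub>M\<^esub> Y)"
 "smult (quot_module k M N) = (%c X. \<Union>x\<in>X. N +>\<^bsub>M\<^esub> (c \<odot>\<^bsub>M\<^esub> x))"
 by (simp_all add: quot_module_def)

context
 fixes k :: "'k ring" and M N
 assumes M: "module k M" and N: "submodule N k M"
begin

interpretation M: module k M by (rule M)

lemma submodule_abelian_subgroup: "abelian_subgroup N M"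
 using submodule.axioms(1)[OF N] M.abelian_group_axioms
 by (intro abelian_subgroupI3 additive_subgroupI)

interpretation N: abelian_subgroup N M by (rule submodule_abelian_subgroup)

lemma quot_eq_iff:
 assumes "x : M" "y : M"
 shows "N +>\<^bsub>M\<^esub> x = N +>\<^bsub>M\<^esub> y <-> x \<ominus>\<^bsub>M\<^esub> y \<in> N"
proof -
 have "x \<in> N +>\<^bsub>M\<^esub> y <-> x \<ominus>\<^bsub>M\<^esub> y \<in> N"
  using N.a_rcos_module[of y x] assms by (simp add: a_minus_def)
 thus ?thesis using N.a_repr_independence'[of x y] N.a_rcos_self[of x] assms by auto
qed

lemma quot_smult_rep:
 assumes "c : k" "x : M"
 shows "(\<Union>y\<in>N +>\<^bsub>M\<^esub> x. N +>\<^bsub>M\<^esub> (c \<odot>\<^bsub>M\<^esub> y)) = N +>\<^bsub>M\<^esub> (c \<odot>\<^bsub>M\<^esub> x)"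
proof -
 have "N +>\<^bsub>M\<^esub> (c \<odot>\<^bsub>M\<^esub> y) = N +>\<^bsub>M\<^esub> (c \<odot>\<^bsub>M\<^esub> x)" if y: "y \<in> N +>\<^bsub>M\<^esub> x" for y
 proof -
  have yc: "y : M" using N.a_elemrcos_carrier[OF assms(2) y] .
  have "y \<ominus>\<^bsub>M\<^esub> x \<in> N" using N.a_rcos_module_imp[OF assms(2) y] by (simp add: a_minus_def)
  hence "c \<odot>\<^bsub>M\<^esub> (y \<ominus>\<^bsub>M\<^esub> x) \<in> N" by (rule submodule.smult_closed[OF N assms(1)])
  hence "c \<odot>\<^bsub>M\<^esub> y \<ominus>\<^bsub>M\<^esub> c \<odot>\<^bsub>M\<^esub> x \<in> N"
   using assms yc by (simp add: a_minus_def M.smult_r_distr M.smult_r_minus)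
  thus ?thesis using quot_eq_iff assms yc by simp
 qed
 thus ?thesis using N.a_rcos_self[OF assms(2)] by blast
qed

lemma quot_carrierE:
 assumes "X : quot_module k M N"
 obtains x where "x : M" "X = N +>\<^bsub>M\<^esub> x"
 using assms by (auto simp: quot_simps A_RCOSETS_def')

lemma quot_carrierI: "x : M ==> N +>\<^bsub>M\<^esub> x : quot_module k M N"
 by (simp add: quot_simps M.a_rcosetsI[OF N.a_subset])

lemma quot_add_rep:
 assumes "x : M" "y : M"
 shows "(N +>\<^bsub>M\<^esub> x) \<oplus>\<^bsub>quot_module k M N\<^esub> (N +>\<^bsub>M\<^esub> y) = N +>\<^bsub>M\<^esub> (x \<oplus>\<^bsub>M\<^esub> y)"
 using assms by (simp add: quot_simps N.a_rcos_sum)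

lemma quot_smult_rep':
 assumes "c : k" "x : M"
 shows "c \<odot>\<^bsub>quot_module k M N\<^esub> (N +>\<^bsub>M\<^esub> x) = N +>\<^bsub>M\<^esub> (c \<odot>\<^bsub>M\<^esub> x)"
 using assms by (simp add: quot_simps quot_smult_rep)

lemma quot_zero_rep: "\<zero>\<^bsub>quot_module k M N\<^esub> = N +>\<^bsub>M\<^esub> \<zero>\<^bsub>M\<^esub>"
 by (simp add: quot_simps M.a_coset_add_zero N.a_subset)

lemma quot_module_module: "module k (quot_module k M N)" (is "module k ?Q")
proof (rule moduleI)
 show "cring k" by (rule module_cring[OF M])
 show "abelian_group ?Q"
 proof (rule abelian_groupI)
  fix X assume X: "X : ?Q"
  show "\<exists>y\<in>carrier ?Q. y \<oplus>\<^bsub>?Q\<^esub> X = \<zero>\<^bsub>?Q\<^esub>"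
   by (rule quot_carrierE[OF X])
    (use quot_carrierI M.l_neg in \<open>auto simp: quot_add_rep quot_zero_rep
      intro!: bexI[where x = "N +>\<^bsub>M\<^esub> \<ominus>\<^bsub>M\<^esub> _"]\<close>)
 qed (auto elim!: quot_carrierE simp: quot_add_rep quot_zero_rep quot_carrierI M.a_ac)
qed (auto elim!: quot_carrierE
   simp: quot_add_rep quot_smult_rep' quot_carrierI M.smult_l_distr M.smult_r_distr M.smult_assoc1)

lemma quot_proj_lin: "is_lin k M (quot_module k M N) (%x. N +>\<^bsub>M\<^esub> x)"
 by (intro is_linI) (simp_all add: quot_carrierI quot_add_rep quot_smult_rep')

text \<open>The lift exists because \<open>f\<close> vanishes on differences of representatives; it is made extensional to fit the
unique existence in the definition of lifts.\<close>

lemma quot_lift: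
 assumes X: "module k X" and f: "is_lin k M X f" and null: "!!n. n \<in> N ==> f n = \<zero>\<^bsub>X\<^esub>"
 shows "\<exists>g. g \<in> lin k (quot_module k M N) X \<and> (\<forall>x\<in>carrier M. g (N +>\<^bsub>M\<^esub> x) = f x)"
proof -
 define g where "g = (\<lambda>Y\<in>carrier (quot_module k M N). f (SOME x. x : M \<and> Y = N +>\<^bsub>M\<^esub> x))"
 have g: "g (N +>\<^bsub>M\<^esub> x) = f x" if x: "x : M" for x
 proof -
  define y where "y = (SOME y. y : M \<and> N +>\<^bsub>M\<^esub> x = N +>\<^bsub>M\<^esub> y)"
  have y: "y : M" "N +>\<^bsub>M\<^esub> x = N +>\<^bsub>M\<^esub> y"
   using someI[where P = "%y. y : M \<and> N +>\<^bsub>M\<^esub> x = N +>\<^bsub>M\<^esub> y", of x] x by (auto simp: y_def)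
  have "f (x \<ominus>\<^bsub>M\<^esub> y) = \<zero>\<^bsub>X\<^esub>" using null y x quot_eq_iff by auto
  hence "f x = f y"
   using lin_minus[OF M X f x y(1)] module_minus_eq_zero_iff[OF X] lin_closed[OF f] x y by auto
  thus ?thesis using quot_carrierI[OF x] by (simp add: g_def y_def)
 qed
 have "is_lin k (quot_module k M N) X g"
  by (rule is_linI)
   (auto elim!: quot_carrierE simp: g quot_add_rep quot_smult_rep' lin_closed[OF f]
     lin_add[OF f] lin_smult[OF f])
 moreover have "g \<in> extensional (carrier (quot_module k M N))" by (simp add: g_def)
 ultimately show ?thesis using g by (auto simp: lin_def)
qed

end

lemma span_of_submodule:
 assumes "module k M" "S \<subseteq> carrier M"
 shows "submodule (span_of k M S) k M" "S \<subseteq> span_of k M S"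
proof -
 interpret M: module k M by fact
 have sub: "submodule (carrier M) k M" by (rule M.carrier_is_submodule)
 show "submodule (span_of k M S) k M"
 proof (rule M.submoduleI)
  show "span_of k M S \<subseteq> carrier M" using sub assms(2) by (auto simp: span_of_def)
  show "\<zero>\<^bsub>M\<^esub> \<in> span_of k M S"
   by (auto simp: span_of_def dest: submodule_abelian_subgroup[OF assms(1)]
     intro: additive_subgroup.zero_closed[OF abelian_subgroup.axioms(1)])
 qed (auto simp: span_of_def dest: M.submoduleE)
 show "S \<subseteq> span_of k M S" by (auto simp: span_of_def)
qed

lemma span_of_least: "submodule N k M ==> S \<subseteq> N ==> span_of k M S \<subseteq> N"
 by (auto simp: span_of_def)

subsection \<open>Free modules\<close>

context
 fixes k :: "'k ring"
 assumes k: "cring k"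
begin

interpretation k: cring k by (rule k)

private abbreviation "FM \<equiv> free_module k"
private abbreviation "supp f \<equiv> {i. f i \<noteq> \<zero>\<^bsub>k\<^esub>}"

lemma free_simps:
 "carrier (FM I) = {f. (\<forall>i\<in>I. f i : k) \<and> (\<forall>i. i \<notin> I --> f i = \<zero>\<^bsub>k\<^esub>) \<and> finite {i. f i \<noteq> \<zero>\<^bsub>k\<^esub>}}"
 "zero (FM I) = (%i. \<zero>\<^bsub>k\<^esub>)"
 "add (FM I) = (%f g i. f i \<oplus>\<^bsub>k\<^esub> g i)"
 "smult (FM I) = (%c f i. c \<otimes>\<^bsub>k\<^esub> f i)"
 by (simp_all add: free_module_def)

lemma free_val: "f : FM I ==> f i : k"
 by (cases "i \<in> I") (auto simp: free_simps)

lemma free_module_module: "module k (FM I)"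
proof (rule moduleI)
 show "cring k" by (rule k)
 show "abelian_group (FM I)"
 proof (rule abelian_groupI)
  fix f g assume f: "f : FM I" and g: "g : FM I"
  have "finite (supp f \<union> supp g)" using f g by (simp add: free_simps)
  moreover have "{i. f i \<oplus>\<^bsub>k\<^esub> g i \<noteq> \<zero>\<^bsub>k\<^esub>} \<subseteq> supp f \<union> supp g" by auto
  ultimately have "finite {i. f i \<oplus>\<^bsub>k\<^esub> g i \<noteq> \<zero>\<^bsub>k\<^esub>}" by (rule finite_subset[rotated])
  thus "f \<oplus>\<^bsub>FM I\<^esub> g : FM I"
   using f g by (auto simp: free_simps)
  show "f \<oplus>\<^bsub>FM I\<^esub> g = g \<oplus>\<^bsub>FM I\<^esub> f"
   using free_val[OF f] free_val[OF g] by (auto simp: free_simps(3) k.a_comm)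
 next
  fix f assume f: "f : FM I"
  have "{i. \<ominus>\<^bsub>k\<^esub> f i \<noteq> \<zero>\<^bsub>k\<^esub>} \<subseteq> supp f" by auto
  hence "(%i. \<ominus>\<^bsub>k\<^esub> f i) : FM I"
   using f finite_subset by (auto simp: free_simps)
  thus "\<exists>g\<in>carrier (FM I). g \<oplus>\<^bsub>FM I\<^esub> f = \<zero>\<^bsub>FM I\<^esub>"
   using free_val[OF f] by (intro bexI[where x = "%i. \<ominus>\<^bsub>k\<^esub> f i"]) (auto simp: free_simps(2,3) k.l_neg)
 next
  fix f g h assume *: "f : FM I" "g : FM I" "h : FM I"
  show "f \<oplus>\<^bsub>FM I\<^esub> g \<oplus>\<^bsub>FM I\<^esub> h = f \<oplus>\<^bsub>FM I\<^esub> (g \<oplus>\<^bsub>FM I\<^esub> h)"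
   using free_val[OF *(1)] free_val[OF *(2)] free_val[OF *(3)] by (auto simp: free_simps(3) k.a_assoc)
 next
  show "\<zero>\<^bsub>FM I\<^esub> : FM I" by (simp add: free_simps)
 next
  fix f assume f: "f : FM I"
  show "\<zero>\<^bsub>FM I\<^esub> \<oplus>\<^bsub>FM I\<^esub> f = f"
   using free_val[OF f] by (auto simp: free_simps(2,3))
 qed
next
 fix c f assume c: "c : k" and f: "f : FM I"
 have "{i. c \<otimes>\<^bsub>k\<^esub> f i \<noteq> \<zero>\<^bsub>k\<^esub>} \<subseteq> supp f" using c by auto
 thus "c \<odot>\<^bsub>FM I\<^esub> f : FM I"
  using f c finite_subset by (auto simp: free_simps)
qed (auto simp: free_simps(3,4) free_val k.l_distr k.r_distr k.m_assoc)

lemma free_gen_closed: "i \<in> I ==> free_gen k i : FM I"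
 using k.zero_closed by (auto simp: free_simps free_gen_def)

text \<open>Induction on the support: removing one point splits off a multiple of a generator.\<close>

lemma free_induct:
 assumes f: "f : FM I"
  and zero: "P \<zero>\<^bsub>FM I\<^esub>"
  and gen: "!!c i. c : k ==> i \<in> I ==> P (c \<odot>\<^bsub>FM I\<^esub> free_gen k i)"
  and add: "!!f g. f : FM I ==> g : FM I ==> P f ==> P g
        ==> P (f \<oplus>\<^bsub>FM I\<^esub> g)"
 shows "P f"
proof -
 define S where "S = supp f"
 have "finite S" "supp f \<subseteq> S" using f by (auto simp: free_simps S_def)
 thus ?thesis using f
 proof (induction S arbitrary: f rule: finite_induct)
  case empty
  hence "f = \<zero>\<^bsub>FM I\<^esub>" by (auto simp: free_simps(2) fun_eq_iff)
  thus ?case using zero by simp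
 next
  case (insert j S)
  let ?g = "(f j) \<odot>\<^bsub>FM I\<^esub> free_gen k j" and ?h = "f(j := \<zero>\<^bsub>k\<^esub>)"
  have h: "?h : FM I"
  proof -
   have "supp ?h \<subseteq> supp f" by auto
   hence "finite (supp ?h)"
    by (rule finite_subset) (use insert.prems(2) in \<open>simp add: free_simps\<close>)
   thus ?thesis using insert.prems(2) k.zero_closed by (auto simp: free_simps)
  qed
  have Ph: "P ?h" using insert.prems insert.hyps by (intro insert.IH h) auto
  show ?case
  proof (cases "j \<in> I")
   case True
   have eq: "f = ?g \<oplus>\<^bsub>FM I\<^esub> ?h"
    using free_val[OF insert.prems(2)] by (auto simp: free_simps(3,4) free_gen_def)
   have "?g : FM I"
    using module_smult_closed[OF free_module_module free_val[OF insert.prems(2)] free_gen_closed[OF True]] .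
   with Ph h show ?thesis by (subst eq) (intro add gen free_val[OF insert.prems(2)] True)
  next
   case False
   hence "?h = f" using insert.prems(2) by (auto simp: free_simps)
   thus ?thesis using Ph by simp
  qed
 qed
qed

lemma free_lift:
 assumes X: "module k X" and g: "!!i. i \<in> I ==> g i : X"
 shows "\<exists>h. is_lin k (FM I) X h \<and> (\<forall>i\<in>I. h (free_gen k i) = g i)"
proof -
 interpret X: module k X by (rule X)
 define h where "h = (%f. \<Oplus>\<^bsub>X\<^esub>i\<in>supp f. f i \<odot>\<^bsub>X\<^esub> g i)"
 have supp: "supp f \<subseteq> I" "finite (supp f)" if "f : FM I" for f
  using that by (auto simp: free_simps)
 have h_eq: "h f = (\<Oplus>\<^bsub>X\<^esub>i\<in>S. f i \<odot>\<^bsub>X\<^esub> g i)"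
  if f: "f : FM I" and S: "finite S" "supp f \<subseteq> S" "S \<subseteq> I" for f S
  unfolding h_def
  using that free_val[OF f] g
  by (intro X.add.finprod_mono_neutral_cong_left) auto
 have cl: "(%i. f i \<odot>\<^bsub>X\<^esub> g i) \<in> S \<rightarrow> carrier X" if "f : FM I" "S \<subseteq> I" for f S
  using that free_val[OF that(1)] g by auto
 have "is_lin k (FM I) X h"
 proof (rule is_linI)
  fix f assume f: "f : FM I"
  show "h f : X" unfolding h_def using supp[OF f] cl[OF f] by (intro X.finsum_closed) auto
  fix c assume c: "c : k"
  have cf: "c \<odot>\<^bsub>FM I\<^esub> f : FM I"
   by (rule module_smult_closed[OF free_module_module c f])
  have "h (c \<odot>\<^bsub>FM I\<^esub> f) = (\<Oplus>\<^bsub>X\<^esub>i\<in>supp f. (c \<odot>\<^bsub>FM I\<^esub> f) i \<odot>\<^bsub>X\<^esub> g i)"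
   using supp[OF f] c by (intro h_eq[OF cf]) (auto simp: free_simps)
  also have "... = (\<Oplus>\<^bsub>X\<^esub>i\<in>supp f. c \<odot>\<^bsub>X\<^esub> (f i \<odot>\<^bsub>X\<^esub> g i))"
   using supp[OF f] c g free_val[OF f]
   by (intro X.finsum_cong') (auto simp: free_simps X.smult_assoc1 subset_iff)
  also have "... = c \<odot>\<^bsub>X\<^esub> h f"
   unfolding h_def using supp[OF f] c cl[OF f] by (intro X.finsum_smult_ldistr[symmetric]) auto
  finally show "h (c \<odot>\<^bsub>FM I\<^esub> f) = c \<odot>\<^bsub>X\<^esub> h f" .
 next
  fix f f' assume f: "f : FM I" and f': "f' : FM I"
  have ff: "f \<oplus>\<^bsub>FM I\<^esub> f' : FM I"
   by (rule module_add_closed[OF free_module_module f f'])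
  let ?S = "supp f \<union> supp f'"
  have S: "finite ?S" "?S \<subseteq> I" using supp[OF f] supp[OF f'] by auto
  have "h (f \<oplus>\<^bsub>FM I\<^esub> f') = (\<Oplus>\<^bsub>X\<^esub>i\<in>?S. (f \<oplus>\<^bsub>FM I\<^esub> f') i \<odot>\<^bsub>X\<^esub> g i)"
   using S by (intro h_eq[OF ff]) (auto simp: free_simps)
  also have "... = (\<Oplus>\<^bsub>X\<^esub>i\<in>?S. f i \<odot>\<^bsub>X\<^esub> g i \<oplus>\<^bsub>X\<^esub> f' i \<odot>\<^bsub>X\<^esub> g i)"
   using S g free_val[OF f] free_val[OF f']
   by (intro X.finsum_cong') (auto simp: free_simps(3) X.smult_l_distr subset_iff)
  also have "... = h f \<oplus>\<^bsub>X\<^esub> h f'"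
   using S cl[OF f S(2)] cl[OF f' S(2)]
   by (simp add: h_eq[OF f S(1) _ S(2)] h_eq[OF f' S(1) _ S(2)] X.finsum_addf)
  finally show "h (f \<oplus>\<^bsub>FM I\<^esub> f') = h f \<oplus>\<^bsub>X\<^esub> h f'" .
 qed
 moreover have "h (free_gen k i) = g i" if i: "i \<in> I" for i
 proof -
  have "h (free_gen k i) = (\<Oplus>\<^bsub>X\<^esub>j\<in>{i}. free_gen k i j \<odot>\<^bsub>X\<^esub> g j)"
   using i by (intro h_eq free_gen_closed) (auto simp: free_gen_def)
  also have "... = g i" using i g by (simp add: free_gen_def)
  finally show ?thesis .
 qed
 ultimately show ?thesis by blast
qed

end

subsection \<open>Tensor products\<close>

definition bil where
 "bil k V W X f <-> (\<forall>v\<in>carrier V. is_lin k W X (f v)) \<and> (\<forall>w\<in>carrier W. is_lin k V X (%v. f v w))"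

lemma bilI:
 assumes "!!v. v : V ==> is_lin k W X (%w. f v w)"
  and "!!w. w : W ==> is_lin k V X (%v. f v w)"
 shows "bil k V W X f"
 using assms by (auto simp: bil_def)

lemma bil_r: "bil k V W X f ==> v : V ==> is_lin k W X (%w. f v w)"
 and bil_l: "bil k V W X f ==> w : W ==> is_lin k V X (%v. f v w)"
 by (auto simp: bil_def)

lemma bil_flip: "bil k V W X f ==> bil k W V X (%w v. f v w)"
 by (simp add: bil_def)

lemma bil_closed: "bil k V W X f ==> v : V ==> w : W ==> f v w : X"
 using lin_closed[OF bil_r] .

context
 fixes k :: "'k ring" and V W
 assumes V: "module k V" and W: "module k W"
begin

interpretation V: module k V by (rule V)
interpretation W: module k W by (rule W)

lemma tens_free_module: "module k (free_module k (carrier V \<times> carrier W))"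
 by (rule free_module_module) (rule module_cring[OF V])

private abbreviation F where "F \<equiv> free_module k (carrier V \<times> carrier W)"
private abbreviation N where "N \<equiv> tens_null k V W"

interpretation F: module k F by (rule tens_free_module)

lemma tens_gen_closed:
 "v : V ==> w : W ==> free_gen k (v, w) : F"
 by (rule free_gen_closed[OF module_cring[OF V]]) simp

lemma tens_rels_subset: "tens_rels k V W \<subseteq> carrier F"
 by (auto simp: tens_rels_def Let_def tens_gen_closed)

lemma tens_null_submodule: "submodule N k F"
 and tens_rels_null: "tens_rels k V W \<subseteq> N"
 unfolding tens_null_def using span_of_submodule[OF tens_free_module tens_rels_subset] by auto

private lemmas FN = tens_free_module tens_null_submodule

lemma tmod_module: "module k (tmod k V W)"
 unfolding tmod_def by (rule quot_module_module[OF FN])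

lemma pure_closed: "v : V ==> w : W ==> pure k V W v w : tmod k V W"
 unfolding tmod_def pure_def
 by (rule quot_carrierI[OF FN tens_gen_closed])

lemma pure_bil: "bil k V W (tmod k V W) (pure k V W)"
proof -
 note qa = quot_add_rep[OF FN]
 note qs = quot_smult_rep'[OF FN]
 note qe = quot_eq_iff[OF FN]
 show ?thesis
 proof (intro bilI is_linI)
  fix v w w' assume *: "v : V" "w : W" "w' : W"
  have "free_gen k (v, w \<oplus>\<^bsub>W\<^esub> w') \<ominus>\<^bsub>F\<^esub> (free_gen k (v, w) \<oplus>\<^bsub>F\<^esub> free_gen k (v, w')) \<in> tens_rels k V W"
   unfolding tens_rels_def Let_def using * by blast
  thus "pure k V W v (w \<oplus>\<^bsub>W\<^esub> w') = pure k V W v w \<oplus>\<^bsub>tmod k V W\<^esub> pure k V W v w'"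
   unfolding pure_def tmod_def using * tens_rels_null
   by (auto simp: qa qe tens_gen_closed)
 next
  fix v c w assume *: "v : V" "w : W" "c : k"
  have "free_gen k (v, c \<odot>\<^bsub>W\<^esub> w) \<ominus>\<^bsub>F\<^esub> (c \<odot>\<^bsub>F\<^esub> free_gen k (v, w)) \<in> tens_rels k V W"
   unfolding tens_rels_def Let_def using * by blast
  thus "pure k V W v (c \<odot>\<^bsub>W\<^esub> w) = c \<odot>\<^bsub>tmod k V W\<^esub> pure k V W v w"
   unfolding pure_def tmod_def using * tens_rels_null
   by (auto simp: qs qe tens_gen_closed)
 next
  fix v w v' assume *: "w : W" "v : V" "v' : V"
  have "free_gen k (v \<oplus>\<^bsub>V\<^esub> v', w) \<ominus>\<^bsub>F\<^esub> (free_gen k (v, w) \<oplus>\<^bsub>F\<^esub> free_gen k (v', w)) \<in> tens_rels k V W"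
   unfolding tens_rels_def Let_def using * by blast
  thus "pure k V W (v \<oplus>\<^bsub>V\<^esub> v') w = pure k V W v w \<oplus>\<^bsub>tmod k V W\<^esub> pure k V W v' w"
   unfolding pure_def tmod_def using * tens_rels_null
   by (auto simp: qa qe tens_gen_closed)
 next
  fix v c w assume *: "w : W" "c : k" "v : V"
  have "free_gen k (c \<odot>\<^bsub>V\<^esub> v, w) \<ominus>\<^bsub>F\<^esub> (c \<odot>\<^bsub>F\<^esub> free_gen k (v, w)) \<in> tens_rels k V W"
   unfolding tens_rels_def Let_def using * by blast
  thus "pure k V W (c \<odot>\<^bsub>V\<^esub> v) w = c \<odot>\<^bsub>tmod k V W\<^esub> pure k V W v w"
   unfolding pure_def tmod_def using * tens_rels_null
   by (auto simp: qs qe tens_gen_closed)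
 qed (simp_all add: pure_closed)
qed

text \<open>There is no case for scalar multiples, since a scalar can be absorbed into the first factor.\<close>

lemma tmod_induct [consumes 1, case_names pure add]:
 assumes t: "t : tmod k V W"
  and pure: "!!v w. v : V ==> w : W ==> P (pure k V W v w)"
  and add: "!!s t. s : tmod k V W ==> t : tmod k V W ==> P s ==> P t
        ==> P (s \<oplus>\<^bsub>tmod k V W\<^esub> t)"
 shows "P t"
proof -
 note qp = quot_proj_lin[OF FN, folded tmod_def]
 obtain f where f: "f : F" "t = N +>\<^bsub>F\<^esub> f"
  using quot_carrierE[OF FN, of t] t unfolding tmod_def by blast
 have gen: "P (N +>\<^bsub>F\<^esub> (c \<odot>\<^bsub>F\<^esub> free_gen k (v, w)))"
  if *: "c : k" "v : V" "w : W" for c v w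
 proof -
  have "N +>\<^bsub>F\<^esub> (c \<odot>\<^bsub>F\<^esub> free_gen k (v, w)) = c \<odot>\<^bsub>tmod k V W\<^esub> pure k V W v w"
   using lin_smult[OF qp *(1) tens_gen_closed[OF *(2,3)]] by (simp add: pure_def)
  also have "... = pure k V W (c \<odot>\<^bsub>V\<^esub> v) w"
   using lin_smult[OF bil_l[OF pure_bil *(3)] *(1,2)] by simp
  finally show ?thesis using * by (simp add: pure)
 qed
 have z: "\<zero>\<^bsub>F\<^esub> = \<zero>\<^bsub>k\<^esub> \<odot>\<^bsub>F\<^esub> free_gen k (\<zero>\<^bsub>V\<^esub>, \<zero>\<^bsub>W\<^esub>)"
  by (simp add: tens_gen_closed)
 have "P (N +>\<^bsub>F\<^esub> f)"
  using f(1)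
 proof (induction f rule: free_induct[OF module_cring[OF V], consumes 1])
  case 1 show ?case unfolding z by (rule gen) auto
 next
  case (2 c i) thus ?case by (cases i) (auto intro: gen)
 next
  case (3 f g) thus ?case using lin_add[OF qp] add lin_closed[OF qp] by simp
 qed
 thus ?thesis using f(2) by simp
qed

text \<open>The linear extension of \<open>f\<close> to the free module kills the relations because \<open>f\<close> is bilinear.\<close>

lemma tmod_lift:
 assumes X: "module k X" and f: "bil k V W X f"
 shows "\<exists>g. g \<in> lin k (tmod k V W) X \<and> (\<forall>v\<in>carrier V. \<forall>w\<in>carrier W. g (pure k V W v w) = f v w)"
proof -
 interpret X: module k X by (rule X)
 obtain h where h: "is_lin k F X h" "!!v w. v : V ==> w : W ==> h (free_gen k (v, w)) = f v w"
  using free_lift[OF module_cring[OF V] X, of "carrier V \<times> carrier W" "%(v, w). f v w"] bil_closed[OF f] by auto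
 let ?K = "{x \<in> carrier F. h x = \<zero>\<^bsub>X\<^esub>}"
 have "submodule ?K k F" by (rule kernel_submodule[OF tens_free_module X h(1)])
 moreover have "tens_rels k V W \<subseteq> ?K"
 proof -
  note hm = lin_minus[OF tens_free_module X h(1)] and ha = lin_add[OF h(1)] and hs = lin_smult[OF h(1)]
  note fa = lin_add[OF bil_r[OF f]] lin_add[OF bil_l[OF f]]
   lin_smult[OF bil_r[OF f]] lin_smult[OF bil_l[OF f]]
  show ?thesis
   unfolding tens_rels_def Let_def
   by (auto simp: hm ha hs h(2) tens_gen_closed fa bil_closed[OF f] module_minus_eq_zero_iff[OF X])
 qed
 ultimately have "N \<subseteq> ?K" unfolding tens_null_def by (rule span_of_least)
 then obtain g where "g \<in> lin k (quot_module k F N) X" "\<forall>x\<in>carrier F. g (N +>\<^bsub>F\<^esub> x) = h x"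
  using quot_lift[OF FN X h(1)] by auto
 thus ?thesis unfolding tmod_def pure_def using h(2) tens_gen_closed by metis
qed

lemma tmod_lin_eqI:
 assumes "is_lin k (tmod k V W) X f" "is_lin k (tmod k V W) X g"
  and "!!v w. v : V ==> w : W ==> f (pure k V W v w) = g (pure k V W v w)"
  and "t : tmod k V W"
 shows "f t = g t"
 using assms(4) by (induction t rule: tmod_induct) (auto simp: assms(3) lin_add[OF assms(1)] lin_add[OF assms(2)])

lemma tlift_lin_pure:
 assumes X: "module k X" and f: "bil k V W X f"
 shows "tlift k V W X f \<in> lin k (tmod k V W) X \<and>
  (\<forall>v\<in>carrier V. \<forall>w\<in>carrier W. tlift k V W X f (pure k V W v w) = f v w)"
proof -
 have "\<exists>!g. g \<in> lin k (tmod k V W) X \<and> (\<forall>v\<in>carrier V. \<forall>w\<in>carrier W. g (pure k V W v w) = f v w)"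
 proof (rule ex_ex1I[OF tmod_lift[OF X f]])
  fix g h
  assume g: "g \<in> lin k (tmod k V W) X \<and> (\<forall>v\<in>carrier V. \<forall>w\<in>carrier W. g (pure k V W v w) = f v w)"
   and h: "h \<in> lin k (tmod k V W) X \<and> (\<forall>v\<in>carrier V. \<forall>w\<in>carrier W. h (pure k V W v w) = f v w)"
  show "g = h"
   by (rule lin_eqI[where V = "tmod k V W" and W = X and k = k])
     (use g h tmod_lin_eqI[of X g h] in \<open>auto simp: lin_def\<close>)
 qed
 from theI'[OF this] show ?thesis unfolding tlift_def by simp
qed

lemma tlift_lin: "module k X ==> bil k V W X f ==> is_lin k (tmod k V W) X (tlift k V W X f)"
 using tlift_lin_pure by (auto simp: lin_def)

lemma tlift_pure:
 "module k X ==> bil k V W X f ==> v : V ==> w : W ==> tlift k V W X f (pure k V W v w) = f v w"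
 using tlift_lin_pure by auto

end

lemma tlift_cong:
 assumes "!!v w. v : V ==> w : W ==> f v w = g v w"
 shows "tlift k V W X f = tlift k V W X g"
proof -
 have "(\<forall>v\<in>carrier V. \<forall>w\<in>carrier W. h (pure k V W v w) = f v w) <->
    (\<forall>v\<in>carrier V. \<forall>w\<in>carrier W. h (pure k V W v w) = g v w)" for h
  using assms by auto
 thus ?thesis by (simp add: tlift_def)
qed

section \<open>Multilinear maps and tensor products of algebras\<close>

definition tri where
 "tri k V W X R f <-> (\<forall>v\<in>carrier V. bil k W X R (f v)) \<and>
   (\<forall>w\<in>carrier W. \<forall>x\<in>carrier X. is_lin k V R (%v. f v w x))"

definition quad where
 "quad k V W X Y R f <-> (\<forall>v\<in>carrier V. tri k W X Y R (f v)) \<and>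
   (\<forall>w\<in>carrier W. \<forall>x\<in>carrier X. \<forall>y\<in>carrier Y. is_lin k V R (%v. f v w x y))"

lemma triI:
 assumes "!!w x. w : W ==> x : X ==> is_lin k V R (%v. f v w x)"
  and "!!v x. v : V ==> x : X ==> is_lin k W R (%w. f v w x)"
  and "!!v w. v : V ==> w : W ==> is_lin k X R (%x. f v w x)"
 shows "tri k V W X R f"
 using assms by (auto simp: tri_def bil_def)

lemma tri_bil: "tri k V W X R f ==> v : V ==> bil k W X R (%w x. f v w x)"
 and tri_1: "tri k V W X R f ==> w : W ==> x : X ==> is_lin k V R (%v. f v w x)"
 and tri_2: "tri k V W X R f ==> v : V ==> x : X ==> is_lin k W R (%w. f v w x)"
 and tri_3: "tri k V W X R f ==> v : V ==> w : W ==> is_lin k X R (%x. f v w x)"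
 by (auto simp: tri_def bil_def)

lemma tri_closed:
 "tri k V W X R f ==> v : V ==> w : W ==> x : X ==> f v w x : R"
 using lin_closed[OF tri_3] .

lemma quadI:
 assumes "!!w x y. w : W ==> x : X ==> y : Y ==> is_lin k V R (%v. f v w x y)"
  and "!!v x y. v : V ==> x : X ==> y : Y ==> is_lin k W R (%w. f v w x y)"
  and "!!v w y. v : V ==> w : W ==> y : Y ==> is_lin k X R (%x. f v w x y)"
  and "!!v w x. v : V ==> w : W ==> x : X ==> is_lin k Y R (%y. f v w x y)"
 shows "quad k V W X Y R f"
 using assms by (auto simp: quad_def tri_def bil_def)

lemma quad_tri: "quad k V W X Y R f ==> v : V ==> tri k W X Y R (%w x y. f v w x y)"
 and quad_1: "quad k V W X Y R f ==> w : W ==> x : X ==> y : Y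
  ==> is_lin k V R (%v. f v w x y)"
 and quad_2: "quad k V W X Y R f ==> v : V ==> x : X ==> y : Y
  ==> is_lin k W R (%w. f v w x y)"
 and quad_3: "quad k V W X Y R f ==> v : V ==> w : W ==> y : Y
  ==> is_lin k X R (%x. f v w x y)"
 and quad_4: "quad k V W X Y R f ==> v : V ==> w : W ==> x : X
  ==> is_lin k Y R (%y. f v w x y)"
 by (auto simp: quad_def tri_def bil_def)

lemma quad_closed:
 "quad k V W X Y R f ==> v : V ==> w : W ==> x : X ==> y : Y
  ==> f v w x y : R"
 using lin_closed[OF quad_4] .

lemma bil_comp:
 assumes "bil k V' W' R f" "is_lin k V V' g" "is_lin k W W' h"
 shows "bil k V W R (%v w. f (g v) (h w))"
 using assms
 by (auto intro!: bilI lin_comp[OF assms(2) bil_l[OF assms(1)]] lin_comp[OF assms(3) bil_r[OF assms(1)]]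
   intro: lin_closed)

lemma bil_lin:
 assumes "is_lin k X R g" "bil k V W X f"
 shows "bil k V W R (%v w. g (f v w))"
 using assms(2)
 by (auto intro!: bilI lin_comp[OF bil_l[OF assms(2)] assms(1)] lin_comp[OF bil_r[OF assms(2)] assms(1)])

lemma tri_lin:
 assumes "is_lin k X' R g" "tri k V W X X' f"
 shows "tri k V W X R (%v w x. g (f v w x))"
 using assms(2)
 by (auto intro!: triI lin_comp[OF tri_1[OF assms(2)] assms(1)] lin_comp[OF tri_2[OF assms(2)] assms(1)]
   lin_comp[OF tri_3[OF assms(2)] assms(1)])

lemma quad_lin:
 assumes "is_lin k X' R g" "quad k V W X Y X' f"
 shows "quad k V W X Y R (%v w x y. g (f v w x y))"
 using assms(2)
 by (auto intro!: quadI lin_comp[OF quad_1[OF assms(2)] assms(1)] lin_comp[OF quad_2[OF assms(2)] assms(1)]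
   lin_comp[OF quad_3[OF assms(2)] assms(1)] lin_comp[OF quad_4[OF assms(2)] assms(1)])

lemma tri_left:
 assumes "bil k V W VW f" "bil k VW X R g"
 shows "tri k V W X R (%v w x. g (f v w) x)"
 using assms
 by (auto intro!: triI intro: lin_comp[OF bil_r[OF assms(1)] bil_l[OF assms(2)]]
   lin_comp[OF bil_l[OF assms(1)] bil_l[OF assms(2)]] bil_r bil_closed)

lemma tri_right:
 assumes "bil k W X WX f" "bil k V WX R g"
 shows "tri k V W X R (%v w x. g v (f w x))"
 using assms
 by (auto intro!: triI intro: lin_comp[OF bil_r[OF assms(1)] bil_r[OF assms(2)]]
   lin_comp[OF bil_l[OF assms(1)] bil_r[OF assms(2)]] bil_l bil_closed)

lemma quad_12:
 assumes "bil k V W VW f" "tri k VW X Y R g"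
 shows "quad k V W X Y R (%v w x y. g (f v w) x y)"
 using assms
 by (auto intro!: quadI intro: lin_comp[OF bil_r[OF assms(1)] tri_1[OF assms(2)]]
   lin_comp[OF bil_l[OF assms(1)] tri_1[OF assms(2)]] tri_2 tri_3 bil_closed)

lemma quad_23:
 assumes "bil k W X WX f" "tri k V WX Y R g"
 shows "quad k V W X Y R (%v w x y. g v (f w x) y)"
 using assms
 by (auto intro!: quadI intro: lin_comp[OF bil_r[OF assms(1)] tri_2[OF assms(2)]]
   lin_comp[OF bil_l[OF assms(1)] tri_2[OF assms(2)]] tri_1 tri_3 bil_closed)

lemma quad_34:
 assumes "bil k X Y XY f" "tri k V W XY R g"
 shows "quad k V W X Y R (%v w x y. g v w (f x y))"
 using assms
 by (auto intro!: quadI intro: lin_comp[OF bil_r[OF assms(1)] tri_3[OF assms(2)]]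
   lin_comp[OF bil_l[OF assms(1)] tri_3[OF assms(2)]] tri_1 tri_2 bil_closed)

lemma quad_123:
 assumes "tri k V W X VWX f" "bil k VWX Y R g"
 shows "quad k V W X Y R (%v w x y. g (f v w x) y)"
 using assms
 by (auto intro!: quadI intro: lin_comp[OF tri_1[OF assms(1)] bil_l[OF assms(2)]]
   lin_comp[OF tri_2[OF assms(1)] bil_l[OF assms(2)]]
   lin_comp[OF tri_3[OF assms(1)] bil_l[OF assms(2)]] bil_r tri_closed)

lemma quad_234:
 assumes "tri k W X Y WXY f" "bil k V WXY R g"
 shows "quad k V W X Y R (%v w x y. g v (f w x y))"
 using assms
 by (auto intro!: quadI intro: lin_comp[OF tri_1[OF assms(1)] bil_r[OF assms(2)]]
   lin_comp[OF tri_2[OF assms(1)] bil_r[OF assms(2)]]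
   lin_comp[OF tri_3[OF assms(1)] bil_r[OF assms(2)]] bil_l tri_closed)

text \<open>A sum over one tensor is linear in every parameter of its summand. This is what makes sums over several
tensors, nested in any order, well defined.\<close>

lemma tlift_param_lin:
 assumes V: "module k V" and W: "module k W" and X: "module k X" and U: "module k U"
  and f: "!!u. u : U ==> bil k V W X (f u)"
  and lin: "!!v w. v : V ==> w : W ==> is_lin k U X (%u. f u v w)"
  and t: "t : tmod k V W"
 shows "is_lin k U X (%u. tlift k V W X (f u) t)"
 using t
proof (induction t rule: tmod_induct[OF V W, consumes 1])
 case (1 v w)
 show ?case by (rule lin_cong[OF U lin[OF 1]]) (simp add: tlift_pure[OF V W X f] 1)
next
 case (2 s t)
 show ?case
  by (rule lin_cong[OF U lin_addf[OF X 2(3,4)]]) (simp add: lin_add[OF tlift_lin[OF V W X f]] 2)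
qed

subsection \<open>Algebras\<close>

lemma alg_mod: "assoc_algebra k B ==> module k B"
 and alg_ring: "assoc_algebra k B ==> ring B"
 by (simp_all add: assoc_algebra_def)

lemma alg_mult_bil:
 assumes "assoc_algebra k B"
 shows "bil k B B B (%x y. x \<otimes>\<^bsub>B\<^esub> y)"
proof -
 interpret B: assoc_algebra k B by fact
 show ?thesis
  by (intro bilI is_linI) (simp_all add: B.l_distr B.r_distr B.smult_mult_left B.smult_mult_right)
qed

lemma talg_simps:
 "carrier (talg k B C) = carrier (tmod k B C)"
 "add (talg k B C) = add (tmod k B C)"
 "zero (talg k B C) = zero (tmod k B C)"
 "smult (talg k B C) = smult (tmod k B C)"
 "one (talg k B C) = pure k B C \<one>\<^bsub>B\<^esub> \<one>\<^bsub>C\<^esub>"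
 by (simp_all add: talg_def)

text \<open>The tensor product of algebras, of modules and of \<open>H\<close>-modules are different records with the same
operations; this moves the module axioms between them.\<close>

lemma module_cong:
 assumes "module k V" "carrier W = carrier V" "add W = add V" "zero W = zero V" "smult W = smult V"
 shows "module k W"
proof -
 interpret V: module k V by fact
 show ?thesis
 proof (rule moduleI)
  show "abelian_group W"
   by (rule abelian_groupI) (use V.l_neg in \<open>auto simp: assms(2-) V.a_ac\<close>)
 qed (simp_all add: assms(2-) module_cring[OF assms(1)] V.smult_l_distr V.smult_r_distr V.smult_assoc1)
qed

context
 fixes k :: "'k ring" and B C
 assumes B: "assoc_algebra k B" and C: "assoc_algebra k C"
begin

interpretation B: assoc_algebra k B by (rule B)
interpretation C: assoc_algebra k C by (rule C)

private abbreviation "T \<equiv> tmod k B C"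
private abbreviation "pp b c b' c' \<equiv> pure k B C (b \<otimes>\<^bsub>B\<^esub> b') (c \<otimes>\<^bsub>C\<^esub> c')"
private abbreviation "inner t b c \<equiv> tlift k B C T (pp b c) t"

lemma talg_module: "module k (talg k B C)"
 by (rule module_cong[OF tmod_module[OF B.module_axioms C.module_axioms]]) (simp_all add: talg_simps)

lemma talg_mult_inner:
 assumes "b : B" "c : C"
 shows "bil k B C T (pp b c)"
 by (rule bil_comp[OF pure_bil[OF B.module_axioms C.module_axioms]
    bil_r[OF alg_mult_bil[OF B] assms(1)] bil_r[OF alg_mult_bil[OF C] assms(2)]])

lemma talg_mult_outer:
 assumes t: "t : T"
 shows "bil k B C T (inner t)"
proof -
 note mB = B.module_axioms and mC = C.module_axioms
 note mT = tmod_module[OF mB mC] and pb = pure_bil[OF mB mC]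
 note mult = alg_mult_bil[OF B] alg_mult_bil[OF C]
 show ?thesis
 proof (intro bilI)
  fix b assume b: "b : B"
  show "is_lin k C T (%c. inner t b c)"
   by (rule tlift_param_lin[OF mB mC mT mC talg_mult_inner[OF b] _ t])
    (auto intro!: lin_comp[OF bil_l[OF mult(2)] bil_r[OF pb]] simp: b)
 next
  fix c assume c: "c : C"
  show "is_lin k B T (%b. inner t b c)"
   by (rule tlift_param_lin[OF mB mC mT mB talg_mult_inner[OF _ c] _ t])
    (auto intro!: lin_comp[OF bil_l[OF mult(1)] bil_l[OF pb]] simp: c)
 qed
qed

lemma talg_mult_eq:
 "s \<otimes>\<^bsub>talg k B C\<^esub> t = tlift k B C T (inner t) s"
 by (simp add: talg_def)

lemma talg_mult_bil': "bil k T T T (%s t. s \<otimes>\<^bsub>talg k B C\<^esub> t)"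
proof -
 note mB = B.module_axioms and mC = C.module_axioms
 note mT = tmod_module[OF mB mC]
 show ?thesis unfolding talg_mult_eq
 proof (rule bilI)
  fix s assume s: "s : T"
  show "is_lin k T T (%t. tlift k B C T (inner t) s)"
   by (rule tlift_param_lin[OF mB mC mT mT talg_mult_outer tlift_lin[OF mB mC mT talg_mult_inner] s])
 next
  fix t assume t: "t : T"
  show "is_lin k T T (%s. tlift k B C T (inner t) s)"
   by (rule tlift_lin[OF mB mC mT talg_mult_outer[OF t]])
 qed
qed

lemma talg_mult_pure:
 assumes "b : B" "c : C" "b' : B" "c' : C"
 shows "pure k B C b c \<otimes>\<^bsub>talg k B C\<^esub> pure k B C b' c' = pp b c b' c'"
proof -
 note mB = B.module_axioms and mC = C.module_axioms
 note mT = tmod_module[OF mB mC]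
 show ?thesis unfolding talg_mult_eq using assms
  by (simp add: tlift_pure[OF mB mC mT] talg_mult_inner talg_mult_outer pure_closed[OF mB mC])
qed

lemma talg_assoc_algebra: "assoc_algebra k (talg k B C)" (is "assoc_algebra k ?T")
proof -
 note mB = B.module_axioms and mC = C.module_axioms
 note mT = tmod_module[OF mB mC] and pc = pure_closed[OF mB mC]
 note ind = tmod_induct[OF mB mC, consumes 1, case_names pure add]
 note mb = talg_mult_bil'
 note cl = bil_closed[OF mb]
 note ad = lin_add[OF bil_l[OF mb]] lin_add[OF bil_r[OF mb]]
 note sm = lin_smult[OF bil_l[OF mb]] lin_smult[OF bil_r[OF mb]]
 have assoc: "x \<otimes>\<^bsub>?T\<^esub> y \<otimes>\<^bsub>?T\<^esub> z = x \<otimes>\<^bsub>?T\<^esub> (y \<otimes>\<^bsub>?T\<^esub> z)"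
  if x: "x : T" and y: "y : T" and z: "z : T" for x y z
  using x
 proof (induction x rule: ind)
  case (pure b c)
  note p1 = pure
  show ?case using y
  proof (induction y rule: ind)
   case (pure b' c')
   note p2 = pure
   show ?case using z
    by (induction z rule: ind)
     (simp_all add: p1 p2 talg_mult_pure pc cl ad B.m_assoc C.m_assoc)
  qed (simp add: p1 pc cl ad z)
 qed (simp add: cl ad y z)
 have one: "\<one>\<^bsub>?T\<^esub> : T" by (simp add: talg_simps pc)
 have l1: "\<one>\<^bsub>?T\<^esub> \<otimes>\<^bsub>?T\<^esub> x = x" if x: "x : T" for x
  using x by (induction x rule: ind) (simp_all add: talg_simps(5) talg_mult_pure ad pc)
 have r1: "x \<otimes>\<^bsub>?T\<^esub> \<one>\<^bsub>?T\<^esub> = x" if x: "x : T" for x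
  using x by (induction x rule: ind) (simp_all add: talg_simps(5) talg_mult_pure ad pc)
 have "ring ?T"
 proof (rule ringI)
  show "abelian_group ?T" by (rule module_abelian_group[OF talg_module])
  show "monoid ?T"
   by (rule monoidI) (simp_all add: talg_simps(1-4) cl assoc one l1 r1)
 qed (simp_all add: talg_simps(1-4) ad)
 with talg_module show ?thesis
  by (auto intro!: assoc_algebra.intro assoc_algebra_axioms.intro simp: talg_simps(1-4) sm)
qed

end

section \<open>Sweedler sums\<close>

context quasi_bialgebra
begin

abbreviation "kmod \<equiv> module k"
abbreviation "klin \<equiv> is_lin k"
abbreviation "hmod \<equiv> is_hmod k H"
abbreviation "hmor \<equiv> is_hmor k H"
abbreviation "ht \<equiv> hten k H"
abbreviation "hh \<equiv> hhom k H"
abbreviation "sm2 \<equiv> sw2 k H"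
abbreviation "sm3 \<equiv> sw3 k H"
abbreviation "phiI \<equiv> phi_inv k H"
abbreviation "ph \<equiv> phi H"
abbreviation "cop \<equiv> comult H"
abbreviation "eps \<equiv> counit H"
abbreviation "HH \<equiv> H2 k H"
abbreviation "HHH \<equiv> H3 k H"
abbreviation "HHHH \<equiv> H4 k H"
abbreviation "oneH \<equiv> \<one>\<^bsub>H\<^esub>"
abbreviation mult1 (infixl "*" 70) where "x * y \<equiv> x \<otimes>\<^bsub>H\<^esub> y"
abbreviation mult2 (infixl "*\<^sub>2" 70) where "x *\<^sub>2 y \<equiv> x \<otimes>\<^bsub>HH\<^esub> y"
abbreviation mult3 (infixl "*\<^sub>3" 70) where "x *\<^sub>3 y \<equiv> x \<otimes>\<^bsub>HHH\<^esub> y"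
abbreviation mult4 (infixl "*\<^sub>4" 70) where "x *\<^sub>4 y \<equiv> x \<otimes>\<^bsub>HHHH\<^esub> y"

definition sw4 where
 "sw4 X t f = tlift k H HHH X (%a s. sm3 X s (%b c d. f a b c d)) t"

lemma alg_H: "assoc_algebra k H"
 and alg_H2: "assoc_algebra k HH"
 and alg_H3: "assoc_algebra k HHH"
 and alg_H4: "assoc_algebra k HHHH"
proof -
 show 1: "assoc_algebra k H" by (rule assoc_algebra_axioms)
 show 2: "assoc_algebra k HH" unfolding H2_def by (rule talg_assoc_algebra[OF 1 1])
 show 3: "assoc_algebra k HHH" unfolding H3_def by (rule talg_assoc_algebra[OF 1 2])
 show 4: "assoc_algebra k HHHH" unfolding H4_def by (rule talg_assoc_algebra[OF 1 3])
qed

lemmas mod_H = alg_mod[OF alg_H]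
 and mod_H2 = alg_mod[OF alg_H2]
 and mod_H3 = alg_mod[OF alg_H3]
 and mod_H4 = alg_mod[OF alg_H4]

lemmas ring_H2 = alg_ring[OF alg_H2] and ring_H3 = alg_ring[OF alg_H3] and ring_H4 = alg_ring[OF alg_H4]

lemmas alg_mult_closed = bil_closed[OF alg_mult_bil]

lemma alg_one_closed: "assoc_algebra k B ==> \<one>\<^bsub>B\<^esub> : B"
 by (simp add: alg_ring ring.ring_simprules)

lemma H2_tmod: "carrier HH = carrier (tmod k H H)" "add HH = add (tmod k H H)"
 "zero HH = zero (tmod k H H)" "smult HH = smult (tmod k H H)"
 and H3_tmod: "carrier HHH = carrier (tmod k H HH)" "add HHH = add (tmod k H HH)"
 "zero HHH = zero (tmod k H HH)" "smult HHH = smult (tmod k H HH)"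
 and H4_tmod: "carrier HHHH = carrier (tmod k H HHH)" "add HHHH = add (tmod k H HHH)"
 "zero HHHH = zero (tmod k H HHH)" "smult HHHH = smult (tmod k H HHH)"
 by (simp_all add: H2_def H3_def H4_def talg_simps)

lemma lin_H_dom:
 "klin HH X f <-> klin (tmod k H H) X f"
 "klin HHH X f3 <-> klin (tmod k H HH) X f3"
 "klin HHHH X f4 <-> klin (tmod k H HHH) X f4"
 by (simp_all add: is_lin_def H2_tmod H3_tmod H4_tmod)

lemma lin_H_cod:
 "klin X HH f <-> klin X (tmod k H H) f"
 "klin X HHH f3 <-> klin X (tmod k H HH) f3"
 "klin X HHHH f4 <-> klin X (tmod k H HHH) f4"
 by (simp_all add: is_lin_def H2_tmod H3_tmod H4_tmod)

lemma p2_bil: "bil k H H HH (p2 k H)"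
proof -
 have "p2 k H = pure k H H" by (intro ext) (simp add: p2_def)
 thus ?thesis using pure_bil[OF mod_H mod_H] by (simp add: bil_def lin_H_cod)
qed

lemma pure3_bil: "bil k H HH HHH (pure k H HH)"
 using pure_bil[OF mod_H mod_H2] by (simp add: bil_def lin_H_cod)

lemma pure4_bil: "bil k H HHH HHHH (pure k H HHH)"
 using pure_bil[OF mod_H mod_H3] by (simp add: bil_def lin_H_cod)

lemma p3_tri: "tri k H H H HHH (p3 k H)"
proof -
 have "p3 k H = (%x y z. pure k H HH x (p2 k H y z))" by (intro ext) (simp add: p3_def)
 thus ?thesis using tri_right[OF p2_bil pure3_bil] by simp
qed

lemma p4_quad: "quad k H H H H HHHH (p4 k H)"
proof -
 have "p4 k H = (%w x y z. pure k H HHH w (p3 k H x y z))" by (intro ext) (simp add: p4_def)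
 thus ?thesis using quad_234[OF p3_tri pure4_bil] by simp
qed

lemmas p2_closed = bil_closed[OF p2_bil]
 and p3_closed = tri_closed[OF p3_tri]
 and p4_closed = quad_closed[OF p4_quad]

lemma H2_induct [consumes 1, case_names pure add]:
 assumes "t : HH"
  and "!!x y. x : H ==> y : H ==> P (p2 k H x y)"
  and "!!s t. s : HH ==> t : HH ==> P s ==> P t ==> P (s \<oplus>\<^bsub>HH\<^esub> t)"
 shows "P t"
 using assms(1) unfolding H2_tmod
 by (induction t rule: tmod_induct[OF mod_H mod_H, consumes 1])
  (use assms(2,3) in \<open>simp_all add: H2_tmod p2_def\<close>)

lemma H3_induct [consumes 1, case_names pure add]:
 assumes "t : HHH"
  and "!!x y z. x : H ==> y : H ==> z : H ==> P (p3 k H x y z)"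
  and "!!s t. s : HHH ==> t : HHH ==> P s ==> P t ==> P (s \<oplus>\<^bsub>HHH\<^esub> t)"
 shows "P t"
 using assms(1) unfolding H3_tmod
proof (induction t rule: tmod_induct[OF mod_H mod_H2, consumes 1, case_names pure add])
 case (pure x s)
 show ?case using pure(2)
 proof (induction s rule: H2_induct)
  case (add s t)
  thus ?case using lin_add[OF bil_r[OF pure3_bil pure(1)]] assms(3) pure(1)
   by (simp add: bil_closed[OF pure3_bil])
 qed (use assms(2) pure(1) in \<open>simp add: p3_def\<close>)
qed (use assms(3) in \<open>simp add: H3_tmod\<close>)

lemma H4_induct [consumes 1, case_names pure add]:
 assumes "t : HHHH"
  and "!!w x y z. w : H ==> x : H ==> y : H ==> z : H ==> P (p4 k H w x y z)"
  and "!!s t. s : HHHH ==> t : HHHH ==> P s ==> P t ==> P (s \<oplus>\<^bsub>HHHH\<^esub> t)"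
 shows "P t"
 using assms(1) unfolding H4_tmod
proof (induction t rule: tmod_induct[OF mod_H mod_H3, consumes 1, case_names pure add])
 case (pure x s)
 show ?case using pure(2)
 proof (induction s rule: H3_induct)
  case (add s t)
  thus ?case using lin_add[OF bil_r[OF pure4_bil pure(1)]] assms(3) pure(1)
   by (simp add: bil_closed[OF pure4_bil])
 qed (use assms(2) pure(1) in \<open>simp add: p4_def\<close>)
qed (use assms(3) in \<open>simp add: H4_tmod\<close>)

lemma H2_ext:
 assumes "klin HH X f" "klin HH X g" "!!a b. a : H ==> b : H ==> f (p2 k H a b) = g (p2 k H a b)" "t : HH"
 shows "f t = g t"
 using assms(4) by (induction t rule: H2_induct) (simp_all add: assms(3) lin_add[OF assms(1)] lin_add[OF assms(2)])

lemma H3_ext: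
 assumes "klin HHH X f" "klin HHH X g" "!!a b c. a : H ==> b : H ==> c : H ==> f (p3 k H a b c) = g (p3 k H a b c)" "t : HHH"
 shows "f t = g t"
 using assms(4) by (induction t rule: H3_induct) (simp_all add: assms(3) lin_add[OF assms(1)] lin_add[OF assms(2)])

lemma H4_ext:
 assumes "klin HHHH X f" "klin HHHH X g" "!!a b c d. a : H ==> b : H ==> c : H ==> d : H ==> f (p4 k H a b c d) = g (p4 k H a b c d)" "t : HHHH"
 shows "f t = g t"
 using assms(4) by (induction t rule: H4_induct) (simp_all add: assms(3) lin_add[OF assms(1)] lin_add[OF assms(2)])

lemma sw2_cong:
 "(!!a b. a : H ==> b : H ==> f a b = g a b) ==> sm2 X t f = sm2 X t g"
 by (simp add: sw2_def cong: tlift_cong)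

lemma sw3_cong:
 "(!!a b c. a : H ==> b : H ==> c : H ==> f a b c = g a b c)
  ==> sm3 X t f = sm3 X t g"
 unfolding sw3_def by (rule tlift_cong[THEN fun_cong]) (auto intro!: sw2_cong)

lemma sw4_cong:
 "(!!a b c d. a : H ==> b : H ==> c : H ==> d : H ==> f a b c d = g a b c d)
  ==> sw4 X t f = sw4 X t g"
 unfolding sw4_def by (rule tlift_cong[THEN fun_cong]) (auto intro!: sw3_cong)

lemma sw2_lin: "kmod X ==> bil k H H X f ==> klin HH X (%t. sm2 X t f)"
 unfolding sw2_def lin_H_dom by (rule tlift_lin[OF mod_H mod_H])

lemma sw2_pure:
 "kmod X ==> bil k H H X f ==> a : H ==> b : H ==> sm2 X (p2 k H a b) f = f a b"
 unfolding sw2_def p2_def by (rule tlift_pure[OF mod_H mod_H])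

lemma sw2_param_lin:
 assumes "kmod X" "kmod U" "t : HH"
  and "!!u. u : U ==> bil k H H X (f u)"
  and "!!a b. a : H ==> b : H ==> klin U X (%u. f u a b)"
 shows "klin U X (%u. sm2 X t (f u))"
 unfolding sw2_def using assms
 by (intro tlift_param_lin[OF mod_H mod_H]) (auto simp: H2_tmod)

lemma sw3_inner_bil:
 assumes "kmod X" "tri k H H H X f"
 shows "bil k H HH X (%a s. sm2 X s (%b c. f a b c))"
 by (rule bilI; (rule sw2_lin | rule sw2_param_lin))
  (auto simp: assms(1) mod_H intro: tri_bil[OF assms(2)] tri_1[OF assms(2)])

lemma sw3_lin: "kmod X ==> tri k H H H X f ==> klin HHH X (%t. sm3 X t f)"
 unfolding sw3_def lin_H_dom by (intro tlift_lin[OF mod_H mod_H2] sw3_inner_bil)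

lemma sw3_pure2:
 "kmod X ==> tri k H H H X f ==> a : H ==> s : HH ==>
  sm3 X (pure k H HH a s) f = sm2 X s (%b c. f a b c)"
 unfolding sw3_def by (simp add: tlift_pure[OF mod_H mod_H2] sw3_inner_bil)

lemma sw3_pure:
 "kmod X ==> tri k H H H X f ==> a : H ==> b : H ==> c : H ==>
  sm3 X (p3 k H a b c) f = f a b c"
 unfolding p3_def by (simp add: sw3_pure2 p2_closed sw2_pure tri_bil)

lemma sw3_param_lin:
 assumes "kmod X" "kmod U" "t : HHH"
  and "!!u. u : U ==> tri k H H H X (f u)"
  and "!!a b c. a : H ==> b : H ==> c : H ==> klin U X (%u. f u a b c)"
 shows "klin U X (%u. sm3 X t (f u))"
 unfolding sw3_def
 by (intro tlift_param_lin[OF mod_H mod_H2] sw3_inner_bil sw2_param_lin)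
  (use assms in \<open>auto simp: H3_tmod[symmetric] intro: tri_bil\<close>)

lemma sw4_inner_bil:
 assumes "kmod X" "quad k H H H H X f"
 shows "bil k H HHH X (%a s. sm3 X s (%b c d. f a b c d))"
 by (rule bilI; (rule sw3_lin | rule sw3_param_lin))
  (auto simp: assms(1) mod_H intro: quad_tri[OF assms(2)] quad_1[OF assms(2)])

lemma sw4_lin: "kmod X ==> quad k H H H H X f ==> klin HHHH X (%t. sw4 X t f)"
 unfolding sw4_def lin_H_dom by (intro tlift_lin[OF mod_H mod_H3] sw4_inner_bil)

lemma sw4_pure3:
 "kmod X ==> quad k H H H H X f ==> a : H ==> s : HHH ==>
  sw4 X (pure k H HHH a s) f = sm3 X s (%b c d. f a b c d)"
 unfolding sw4_def by (simp add: tlift_pure[OF mod_H mod_H3] sw4_inner_bil)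

lemma sw4_pure:
 "kmod X ==> quad k H H H H X f ==> a : H ==> b : H ==> c : H ==> d : H ==>
  sw4 X (p4 k H a b c d) f = f a b c d"
 unfolding p4_def by (simp add: sw4_pure3 p3_closed sw3_pure quad_tri)

lemma sw4_param_lin:
 assumes "kmod X" "kmod U" "t : HHHH"
  and "!!u. u : U ==> quad k H H H H X (f u)"
  and "!!a b c d. a : H ==> b : H ==> c : H ==> d : H
   ==> klin U X (%u. f u a b c d)"
 shows "klin U X (%u. sw4 X t (f u))"
 unfolding sw4_def
 by (intro tlift_param_lin[OF mod_H mod_H3] sw4_inner_bil sw3_param_lin)
  (use assms in \<open>auto simp: H4_tmod[symmetric] intro: quad_tri\<close>)

lemmas sw2_closed = lin_closed[OF sw2_lin]
 and sw3_closed = lin_closed[OF sw3_lin]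
 and sw4_closed = lin_closed[OF sw4_lin]

text \<open>Linear maps move into a Sweedler sum. With the expansion of sums over products below, this is the main
rewriting step of all computations.\<close>

lemma sw2_push:
 assumes "kmod X" "kmod Y" "bil k H H X f" "klin X Y g" "t : HH"
 shows "g (sm2 X t f) = sm2 Y t (%a b. g (f a b))"
 using assms(5)
 by (induction t rule: H2_induct)
  (simp_all add: sw2_pure assms bil_lin[OF assms(4,3)] lin_add[OF sw2_lin] sw2_closed lin_add[OF assms(4)])

lemma sw3_push:
 assumes "kmod X" "kmod Y" "tri k H H H X f" "klin X Y g" "t : HHH"
 shows "g (sm3 X t f) = sm3 Y t (%a b c. g (f a b c))"
 using assms(5)
 by (induction t rule: H3_induct)
  (simp_all add: sw3_pure assms tri_lin[OF assms(4,3)] lin_add[OF sw3_lin] sw3_closed lin_add[OF assms(4)])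

lemma sw4_push:
 assumes "kmod X" "kmod Y" "quad k H H H H X f" "klin X Y g" "t : HHHH"
 shows "g (sw4 X t f) = sw4 Y t (%a b c d. g (f a b c d))"
 using assms(5)
 by (induction t rule: H4_induct)
  (simp_all add: sw4_pure assms quad_lin[OF assms(4,3)] lin_add[OF sw4_lin] sw4_closed lin_add[OF assms(4)])

subsection \<open>Multiplication\<close>

lemma p2_mult:
 "a : H ==> b : H ==> a' : H ==> b' : H ==>
  p2 k H a b *\<^sub>2 p2 k H a' b' = p2 k H (a * a') (b * b')"
 unfolding p2_def H2_def by (rule talg_mult_pure[OF alg_H alg_H])

lemma pure3_mult:
 "a : H ==> s : HH ==> a' : H ==> s' : HH ==>
  pure k H HH a s *\<^sub>3 pure k H HH a' s' = pure k H HH (a * a') (s *\<^sub>2 s')"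
 unfolding H3_def by (rule talg_mult_pure[OF alg_H alg_H2])

lemma pure4_mult:
 "a : H ==> s : HHH ==> a' : H ==> s' : HHH ==>
  pure k H HHH a s *\<^sub>4 pure k H HHH a' s' = pure k H HHH (a * a') (s *\<^sub>3 s')"
 unfolding H4_def by (rule talg_mult_pure[OF alg_H alg_H3])

lemma p3_mult:
 "a : H ==> b : H ==> c : H ==> a' : H ==> b' : H ==> c' : H ==>
  p3 k H a b c *\<^sub>3 p3 k H a' b' c' = p3 k H (a * a') (b * b') (c * c')"
 by (simp add: p3_def pure3_mult p2_closed p2_mult)

lemma p4_mult:
 "a : H ==> b : H ==> c : H ==> d : H ==>
  a' : H ==> b' : H ==> c' : H ==> d' : H ==>
  p4 k H a b c d *\<^sub>4 p4 k H a' b' c' d'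
   = p4 k H (a * a') (b * b') (c * c') (d * d')"
 by (simp add: p4_def pure4_mult p3_closed p3_mult)

lemma p2_one: "p2 k H oneH oneH = \<one>\<^bsub>HH\<^esub>"
 and p3_one: "p3 k H oneH oneH oneH = \<one>\<^bsub>HHH\<^esub>"
 and p4_one: "p4 k H oneH oneH oneH oneH = \<one>\<^bsub>HHHH\<^esub>"
 by (simp_all add: p2_def p3_def p4_def H2_def H3_def H4_def talg_simps)

lemma mult_lin:
 "assoc_algebra k B ==> a : B ==> klin B B (%x. a \<otimes>\<^bsub>B\<^esub> x)"
 "assoc_algebra k B ==> a : B ==> klin B B (%x. x \<otimes>\<^bsub>B\<^esub> a)"
 by (rule bil_r[OF alg_mult_bil], assumption+, rule bil_l[OF alg_mult_bil])

lemma tri_comp: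
 assumes "tri k V' W' X' R f" "klin V V' g1" "klin W W' g2" "klin X X' g3"
 shows "tri k V W X R (%v w x. f (g1 v) (g2 w) (g3 x))"
 using assms(2-)
 by (auto intro!: triI lin_comp[OF assms(2) tri_1[OF assms(1)]] lin_comp[OF assms(3) tri_2[OF assms(1)]]
   lin_comp[OF assms(4) tri_3[OF assms(1)]] intro: lin_closed)

lemma quad_comp:
 assumes "quad k V' W' X' Y' R f" "klin V V' g1" "klin W W' g2" "klin X X' g3" "klin Y Y' g4"
 shows "quad k V W X Y R (%v w x y. f (g1 v) (g2 w) (g3 x) (g4 y))"
 using assms(2-)
 by (auto intro!: quadI lin_comp[OF assms(2) quad_1[OF assms(1)]] lin_comp[OF assms(3) quad_2[OF assms(1)]]
   lin_comp[OF assms(4) quad_3[OF assms(1)]] lin_comp[OF assms(5) quad_4[OF assms(1)]] intro: lin_closed)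

lemma tri_shift:
 assumes "tri k H H H X f" "a : H" "b : H" "c : H"
 shows "tri k H H H X (%a' b' c'. f (a * a') (b * b') (c * c'))"
 by (rule tri_comp[OF assms(1)]) (auto intro: mult_lin alg_H assms)

lemma quad_shift:
 assumes "quad k H H H H X f" "a : H" "b : H" "c : H" "d : H"
 shows "quad k H H H H X (%a' b' c' d'. f (a * a') (b * b') (c * c') (d * d'))"
 by (rule quad_comp[OF assms(1)]) (auto intro: mult_lin alg_H assms)

text \<open>The multiplication \<open>m\<close> of legs is a parameter, so that one proof yields both orders of nesting: \<open>m\<close> is the
multiplication of \<open>H\<close> or the opposite one.\<close>

lemma sw2_inner:
 assumes X: "kmod X" and f: "bil k H H X f" and m: "bil k H H H m" and t: "t : HH"
 shows "bil k H H X (%a b. sm2 X t (%a' b'. f (m a a') (m b b')))"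
 by (rule bilI; rule sw2_param_lin[OF X mod_H t]) (auto simp: bil_closed[OF m] intro: bil_comp[OF f bil_r[OF m] bil_r[OF m]] lin_comp[OF bil_l[OF m] bil_l[OF f]] lin_comp[OF bil_l[OF m] bil_r[OF f]])

lemma sw2_product:
 assumes X: "kmod X" and f: "bil k H H X f" and m: "bil k H H H m" and M: "bil k HH HH HH M"
  and mM: "!!a b a' b'. a : H ==> b : H ==> a' : H ==> b' : H ==> M (p2 k H a b) (p2 k H a' b') = p2 k H (m a a') (m b b')"
  and s: "s : HH" and t: "t : HH"
 shows "sm2 X (M s t) f = sm2 X s (%a b. sm2 X t (%a' b'. f (m a a') (m b b')))"
proof (rule H2_ext[OF lin_comp[OF bil_l[OF M t] sw2_lin[OF X f]] sw2_lin[OF X sw2_inner[OF X f m t]] _ s])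
 fix a b assume p: "a : H" "b : H"
 show "sm2 X (M (p2 k H a b) t) f = sm2 X (p2 k H a b) (%a b. sm2 X t (%a' b'. f (m a a') (m b b')))"
  unfolding sw2_pure[OF X sw2_inner[OF X f m t] p]
  by (rule H2_ext[OF lin_comp[OF bil_r[OF M p2_closed[OF p]] sw2_lin[OF X f]]
     sw2_lin[OF X bil_comp[OF f bil_r[OF m p(1)] bil_r[OF m p(2)]]] _ t])
   (simp add: mM p sw2_pure[OF X f] sw2_pure[OF X bil_comp[OF f bil_r[OF m p(1)] bil_r[OF m p(2)]]] bil_closed[OF m])
qed

lemma
 assumes "kmod X" "bil k H H X f" "s : HH" "t : HH"
 shows sw2_mult: "sm2 X (s *\<^sub>2 t) f = sm2 X s (%a b. sm2 X t (%a' b'. f (a * a') (b * b')))"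
  and sw2_mult': "sm2 X (t *\<^sub>2 s) f = sm2 X s (%a b. sm2 X t (%a' b'. f (a' * a) (b' * b)))"
 by (rule sw2_product[OF assms(1,2) alg_mult_bil[OF alg_H] alg_mult_bil[OF alg_H2] _ assms(3,4)]
   sw2_product[OF assms(1,2) bil_flip[OF alg_mult_bil[OF alg_H]] bil_flip[OF alg_mult_bil[OF alg_H2]] _ assms(3,4)]; simp add: p2_mult)+

lemma sw3_inner:
 assumes X: "kmod X" and f: "tri k H H H X f" and m: "bil k H H H m" and t: "t : HHH"
 shows "tri k H H H X (%a b c. sm3 X t (%a' b' c'. f (m a a') (m b b') (m c c')))"
 by (rule triI; rule sw3_param_lin[OF X mod_H t]) (auto simp: bil_closed[OF m] intro: tri_comp[OF f bil_r[OF m] bil_r[OF m] bil_r[OF m]] lin_comp[OF bil_l[OF m] tri_1[OF f]] lin_comp[OF bil_l[OF m] tri_2[OF f]] lin_comp[OF bil_l[OF m] tri_3[OF f]])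

lemma sw3_product:
 assumes X: "kmod X" and f: "tri k H H H X f" and m: "bil k H H H m" and M: "bil k HHH HHH HHH M"
  and mM: "!!a b c a' b' c'. a : H ==> b : H ==> c : H ==> a' : H ==> b' : H ==> c' : H ==> M (p3 k H a b c) (p3 k H a' b' c') = p3 k H (m a a') (m b b') (m c c')"
  and s: "s : HHH" and t: "t : HHH"
 shows "sm3 X (M s t) f = sm3 X s (%a b c. sm3 X t (%a' b' c'. f (m a a') (m b b') (m c c')))"
proof (rule H3_ext[OF lin_comp[OF bil_l[OF M t] sw3_lin[OF X f]] sw3_lin[OF X sw3_inner[OF X f m t]] _ s])
 fix a b c assume p: "a : H" "b : H" "c : H"
 show "sm3 X (M (p3 k H a b c) t) f = sm3 X (p3 k H a b c) (%a b c. sm3 X t (%a' b' c'. f (m a a') (m b b') (m c c')))"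
  unfolding sw3_pure[OF X sw3_inner[OF X f m t] p]
  by (rule H3_ext[OF lin_comp[OF bil_r[OF M p3_closed[OF p]] sw3_lin[OF X f]]
     sw3_lin[OF X tri_comp[OF f bil_r[OF m p(1)] bil_r[OF m p(2)] bil_r[OF m p(3)]]] _ t])
   (simp add: mM p sw3_pure[OF X f] sw3_pure[OF X tri_comp[OF f bil_r[OF m p(1)] bil_r[OF m p(2)] bil_r[OF m p(3)]]] bil_closed[OF m])
qed

lemmas sw3_mult_inner = sw3_inner[OF _ _ alg_mult_bil[OF alg_H]]
 and sw3_mult'_inner = sw3_inner[OF _ _ bil_flip[OF alg_mult_bil[OF alg_H]]]

lemma
 assumes "kmod X" "tri k H H H X f" "s : HHH" "t : HHH"
 shows sw3_mult: "sm3 X (s *\<^sub>3 t) f = sm3 X s (%a b c. sm3 X t (%a' b' c'. f (a * a') (b * b') (c * c')))"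
  and sw3_mult': "sm3 X (t *\<^sub>3 s) f = sm3 X s (%a b c. sm3 X t (%a' b' c'. f (a' * a) (b' * b) (c' * c)))"
 by (rule sw3_product[OF assms(1,2) alg_mult_bil[OF alg_H] alg_mult_bil[OF alg_H3] _ assms(3,4)]
   sw3_product[OF assms(1,2) bil_flip[OF alg_mult_bil[OF alg_H]] bil_flip[OF alg_mult_bil[OF alg_H3]] _ assms(3,4)]; simp add: p3_mult)+

lemma sw4_inner:
 assumes X: "kmod X" and f: "quad k H H H H X f" and m: "bil k H H H m" and t: "t : HHHH"
 shows "quad k H H H H X (%a b c d. sw4 X t (%a' b' c' d'. f (m a a') (m b b') (m c c') (m d d')))"
 by (rule quadI; rule sw4_param_lin[OF X mod_H t]) (auto simp: bil_closed[OF m] intro: quad_comp[OF f bil_r[OF m] bil_r[OF m] bil_r[OF m] bil_r[OF m]] lin_comp[OF bil_l[OF m] quad_1[OF f]] lin_comp[OF bil_l[OF m] quad_2[OF f]] lin_comp[OF bil_l[OF m] quad_3[OF f]] lin_comp[OF bil_l[OF m] quad_4[OF f]])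

lemma sw4_product:
 assumes X: "kmod X" and f: "quad k H H H H X f" and m: "bil k H H H m" and M: "bil k HHHH HHHH HHHH M"
  and mM: "!!a b c d a' b' c' d'. a : H ==> b : H ==> c : H ==> d : H ==> a' : H ==> b' : H ==> c' : H ==> d' : H ==> M (p4 k H a b c d) (p4 k H a' b' c' d') = p4 k H (m a a') (m b b') (m c c') (m d d')"
  and s: "s : HHHH" and t: "t : HHHH"
 shows "sw4 X (M s t) f = sw4 X s (%a b c d. sw4 X t (%a' b' c' d'. f (m a a') (m b b') (m c c') (m d d')))"
proof (rule H4_ext[OF lin_comp[OF bil_l[OF M t] sw4_lin[OF X f]] sw4_lin[OF X sw4_inner[OF X f m t]] _ s])
 fix a b c d assume p: "a : H" "b : H" "c : H" "d : H"
 show "sw4 X (M (p4 k H a b c d) t) f = sw4 X (p4 k H a b c d) (%a b c d. sw4 X t (%a' b' c' d'. f (m a a') (m b b') (m c c') (m d d')))"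
  unfolding sw4_pure[OF X sw4_inner[OF X f m t] p]
  by (rule H4_ext[OF lin_comp[OF bil_r[OF M p4_closed[OF p]] sw4_lin[OF X f]]
     sw4_lin[OF X quad_comp[OF f bil_r[OF m p(1)] bil_r[OF m p(2)] bil_r[OF m p(3)] bil_r[OF m p(4)]]] _ t])
   (simp add: mM p sw4_pure[OF X f] sw4_pure[OF X quad_comp[OF f bil_r[OF m p(1)] bil_r[OF m p(2)] bil_r[OF m p(3)] bil_r[OF m p(4)]]] bil_closed[OF m])
qed

lemmas sw4_mult_inner = sw4_inner[OF _ _ alg_mult_bil[OF alg_H]]
 and sw4_mult'_inner = sw4_inner[OF _ _ bil_flip[OF alg_mult_bil[OF alg_H]]]

lemma
 assumes "kmod X" "quad k H H H H X f" "s : HHHH" "t : HHHH"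
 shows sw4_mult: "sw4 X (s *\<^sub>4 t) f = sw4 X s (%a b c d. sw4 X t (%a' b' c' d'. f (a * a') (b * b') (c * c') (d * d')))"
  and sw4_mult': "sw4 X (t *\<^sub>4 s) f = sw4 X s (%a b c d. sw4 X t (%a' b' c' d'. f (a' * a) (b' * b) (c' * c) (d' * d)))"
 by (rule sw4_product[OF assms(1,2) alg_mult_bil[OF alg_H] alg_mult_bil[OF alg_H4] _ assms(3,4)]
   sw4_product[OF assms(1,2) bil_flip[OF alg_mult_bil[OF alg_H]] bil_flip[OF alg_mult_bil[OF alg_H4]] _ assms(3,4)]; simp add: p4_mult)+

end

section \<open>Coproducts and legs as algebra homomorphisms\<close>

context quasi_bialgebra
begin

lemma comult_lin: "klin H HH cop"
 and comult_mult: "x : H ==> y : H ==> cop (x * y) = cop x *\<^sub>2 cop y"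
 and comult_one: "cop oneH = p2 k H oneH oneH"
 using comult_hom by (auto simp: is_alg_hom_def p2_one)

lemmas cop_cl = lin_closed[OF comult_lin]

lemma sw2_comult_lin: "kmod X ==> bil k H H X f ==> klin H X (%h. sm2 X (cop h) f)"
 by (rule lin_comp[OF comult_lin sw2_lin])

lemma bil_cop:
 assumes "kmod X" "tri k H H H X f"
 shows bil_cop_l: "bil k H H X (%x y. sm2 X (cop x) (%a b. f a b y))"
  and bil_cop_r: "bil k H H X (%x y. sm2 X (cop y) (%a b. f x a b))"
 by ((rule bilI; (rule sw2_comult_lin | rule sw2_param_lin));
  auto simp: assms(1) mod_H cop_cl intro!: bilI tri_1[OF assms(2)] tri_2[OF assms(2)] tri_3[OF assms(2)])+

lemma tri_cop:
 assumes "kmod X" "quad k H H H H X f"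
 shows "tri k H H H X (%x y z. sm2 X (cop x) (%a b. f a b y z))"
  and "tri k H H H X (%x y z. sm2 X (cop y) (%a b. f x a b z))"
  and "tri k H H H X (%x y z. sm2 X (cop z) (%a b. f x y a b))"
 by ((rule triI; (rule sw2_comult_lin | rule sw2_param_lin));
  auto simp: assms(1) mod_H cop_cl intro!: bilI quad_1[OF assms(2)] quad_2[OF assms(2)]
   quad_3[OF assms(2)] quad_4[OF assms(2)])+

lemma one_H_closed: "oneH : H"
 by simp

text \<open>Invertibility is recorded as an explicit pair because algebra homomorphisms transport pairs: the image of
\<open>\<phi>\<close> under a coproduct or a placement of legs is inverted by the same image of \<open>phi_inv\<close>.\<close>

definition ipair where
 "ipair B u v <-> u : B \<and> v : B \<and> u \<otimes>\<^bsub>B\<^esub> v = \<one>\<^bsub>B\<^esub> \<and> v \<otimes>\<^bsub>B\<^esub> u = \<one>\<^bsub>B\<^esub>"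

lemma ipair_sym: "ipair B u v ==> ipair B v u"
 by (simp add: ipair_def)

lemma ipair_unit:
 assumes "assoc_algebra k B" "u \<in> Units B" shows "ipair B u (inv\<^bsub>B\<^esub> u)"
proof -
 interpret B: ring B by (rule alg_ring[OF assms(1)])
 show ?thesis using assms(2) by (simp add: ipair_def B.Units_closed B.Units_r_inv B.Units_l_inv)
qed

lemma ipair_inv:
 assumes "assoc_algebra k B" "ipair B u v" shows "inv\<^bsub>B\<^esub> u = v"
proof -
 interpret B: ring B by (rule alg_ring[OF assms(1)])
 show ?thesis using assms(2) by (auto simp: ipair_def intro!: B.inv_char)
qed

lemma ipair_hom:
 assumes "is_alg_hom k B C f" "ipair B s t"
 shows "ipair C (f s) (f t)"
 using assms by (auto simp: is_alg_hom_def ipair_def lin_closed) metis+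

text \<open>Maps between tensor powers of \<open>H\<close> are sums of pure tensors, and multiplicativity can be read off from the
summand.\<close>

lemma sw2_hom:
 assumes B: "assoc_algebra k B" and P: "bil k H H B P" and one: "P oneH oneH = \<one>\<^bsub>B\<^esub>"
  and mult: "!!a b a' b'. a : H ==> b : H ==> a' : H ==> b' : H ==> P (a * a') (b * b') = P a b \<otimes>\<^bsub>B\<^esub> P a' b'"
 shows "is_alg_hom k HH B (%t. sm2 B t P)"
proof -
 note mB = alg_mod[OF B]
 have "sm2 B (s *\<^sub>2 t) P = sm2 B s P \<otimes>\<^bsub>B\<^esub> sm2 B t P" if s: "s : HH" and t: "t : HH" for s t
  unfolding sw2_mult[OF mB P s t] sw2_push[OF mB mB P mult_lin(2)[OF B sw2_closed[OF mB P t]] s]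
  by (rule sw2_cong) (simp add: sw2_push[OF mB mB P mult_lin(1)[OF B bil_closed[OF P]] t] mult cong: sw2_cong)
 thus ?thesis using sw2_lin[OF mB P] by (simp add: is_alg_hom_def one sw2_pure[OF mB P] flip: p2_one)
qed

lemma sw3_hom:
 assumes B: "assoc_algebra k B" and P: "tri k H H H B P" and one: "P oneH oneH oneH = \<one>\<^bsub>B\<^esub>"
  and mult: "!!a b c a' b' c'. a : H ==> b : H ==> c : H ==> a' : H ==> b' : H ==> c' : H
   ==> P (a * a') (b * b') (c * c') = P a b c \<otimes>\<^bsub>B\<^esub> P a' b' c'"
 shows "is_alg_hom k HHH B (%t. sm3 B t P)"
proof -
 note mB = alg_mod[OF B]
 have "sm3 B (s *\<^sub>3 t) P = sm3 B s P \<otimes>\<^bsub>B\<^esub> sm3 B t P" if s: "s : HHH" and t: "t : HHH" for s t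
  unfolding sw3_mult[OF mB P s t] sw3_push[OF mB mB P mult_lin(2)[OF B sw3_closed[OF mB P t]] s]
  by (rule sw3_cong) (simp add: sw3_push[OF mB mB P mult_lin(1)[OF B tri_closed[OF P]] t] mult cong: sw3_cong)
 thus ?thesis using sw3_lin[OF mB P] by (simp add: is_alg_hom_def one sw3_pure[OF mB P] flip: p3_one)
qed

lemma sw2_comult_prod:
 assumes B: "assoc_algebra k B" and F: "bil k H H B F" and F': "bil k H H B F'" and G: "bil k H H B G"
  and x: "x : H" "x' : H"
  and mult: "!!a b c d. a : H ==> b : H ==> c : H ==> d : H ==> G (a * c) (b * d) = F a b \<otimes>\<^bsub>B\<^esub> F' c d"
 shows "sm2 B (cop (x * x')) G = sm2 B (cop x) F \<otimes>\<^bsub>B\<^esub> sm2 B (cop x') F'"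
proof -
 note mB = alg_mod[OF B] and c = x[THEN cop_cl]
 show ?thesis
  unfolding comult_mult[OF x] sw2_mult[OF mB G c] sw2_push[OF mB mB F mult_lin(2)[OF B sw2_closed[OF mB F' c(2)]] c(1)]
  by (rule sw2_cong) (simp add: sw2_push[OF mB mB F' mult_lin(1)[OF B bil_closed[OF F]] c(2)] mult cong: sw2_cong)
qed

text \<open>The maps between tensor powers of \<open>H\<close> that occur in the axioms: \<open>cop1\<close>, \<open>cop2\<close>, \<open>cop3\<close>, \<open>copl\<close>, \<open>copr\<close> apply
the coproduct to one factor, \<open>leg\<close> with an index inserts a unit, and \<open>perm231 \<phi>\<close> is \<open>\<phi>\<^sub>2\<^sub>3\<^sub>1\<close>.\<close>

definition leg123 where "leg123 t = sm3 HHHH t (%x y z. p4 k H x y z oneH)"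
definition leg234 where "leg234 t = pure k H HHH oneH t"
definition cop1 where "cop1 t = sm3 HHHH t (%x y z. sm2 HHHH (cop x) (%a b. p4 k H a b y z))"
definition cop2 where "cop2 t = sm3 HHHH t (%x y z. sm2 HHHH (cop y) (%a b. p4 k H x a b z))"
definition cop3 where "cop3 t = sm3 HHHH t (%x y z. pure k H HHH x (pure k H HH y (cop z)))"

definition leg12 where "leg12 t = sm2 HHH t (%a b. p3 k H a b oneH)"
definition leg13 where "leg13 t = sm2 HHH t (%a b. p3 k H a oneH b)"
definition leg23 where "leg23 t = sm2 HHH t (%a b. p3 k H oneH a b)"
definition copl where "copl t = sm2 HHH t (%a b. sm2 HHH (cop a) (%x y. p3 k H x y b))"
definition copr where "copr t = sm2 HHH t (%a b. pure k H HH a (cop b))"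

definition perm213 where "perm213 t = sm3 HHH t (%x y z. p3 k H y x z)"
definition perm231 where "perm231 t = sm3 HHH t (%x y z. p3 k H z x y)"
definition perm312 where "perm312 t = sm3 HHH t (%x y z. p3 k H y z x)"
definition perm132 where "perm132 t = sm3 HHH t (%x y z. p3 k H x z y)"

lemma pure3_sw:
 assumes "x : H" "s : HH"
 shows "pure k H HH x s = sm2 HHH s (%a b. p3 k H x a b)"
 using assms(2)
proof (induction s rule: H2_induct)
 case (pure a b)
 thus ?case using assms(1) sw2_pure[OF mod_H3 tri_bil[OF p3_tri assms(1)] pure] by (simp add: p3_def)
next
 case (add s t)
 thus ?case using assms(1)
  by (simp add: lin_add[OF bil_r[OF pure3_bil assms(1)]] lin_add[OF sw2_lin[OF mod_H3 tri_bil[OF p3_tri assms(1)]]])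
qed

lemma pure4_sw:
 assumes "x : H" "s : HHH"
 shows "pure k H HHH x s = sm3 HHHH s (%a b c. p4 k H x a b c)"
 using assms(2)
proof (induction s rule: H3_induct)
 case (pure a b c)
 thus ?case using assms(1) sw3_pure[OF mod_H4 quad_tri[OF p4_quad assms(1)] pure] by (simp add: p4_def)
next
 case (add s t)
 thus ?case using assms(1)
  by (simp add: lin_add[OF bil_r[OF pure4_bil assms(1)]] lin_add[OF sw3_lin[OF mod_H4 quad_tri[OF p4_quad assms(1)]]])
qed

lemma leg234_sw: "t : HHH ==> leg234 t = sm3 HHHH t (%x y z. p4 k H oneH x y z)"
 by (simp add: leg234_def pure4_sw)

lemma cop3_sw: "cop3 t = sm3 HHHH t (%x y z. sm2 HHHH (cop z) (%a b. p4 k H x y a b))"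
 unfolding cop3_def
proof (rule sw3_cong)
 fix x y z assume *: "x : H" "y : H" "z : H"
 have "pure k H HHH x (pure k H HH y (cop z))
   = pure k H HHH x (sm2 HHH (cop z) (%a b. p3 k H y a b))"
  using * by (simp add: pure3_sw cop_cl)
 also have "... = sm2 HHHH (cop z) (%a b. pure k H HHH x (p3 k H y a b))"
  by (rule sw2_push[OF mod_H3 mod_H4 tri_bil[OF p3_tri] bil_r[OF pure4_bil] cop_cl]) (use * in auto)
 finally show "pure k H HHH x (pure k H HH y (cop z))
   = sm2 HHHH (cop z) (%a b. p4 k H x y a b)"
  by (simp add: p4_def)
qed

lemma copr_sw: "copr t = sm2 HHH t (%a b. sm2 HHH (cop b) (%x y. p3 k H a x y))"
 unfolding copr_def by (rule sw2_cong) (simp add: pure3_sw cop_cl)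

lemma tri_leg123: "quad k H H H H X f ==> tri k H H H X (%x y z. f x y z oneH)"
 and tri_leg234: "quad k H H H H X f ==> tri k H H H X (%x y z. f oneH x y z)"
 by (auto intro!: triI intro: quad_1 quad_2 quad_3 quad_4)

lemma bil_leg12: "tri k H H H X f ==> bil k H H X (%x y. f x y oneH)"
 and bil_leg13: "tri k H H H X f ==> bil k H H X (%x y. f x oneH y)"
 and bil_leg23: "tri k H H H X f ==> bil k H H X (%x y. f oneH x y)"
 by (auto intro!: bilI intro: tri_1 tri_2 tri_3)

lemma tri_perm213: "tri k V W X R f ==> tri k W V X R (%x y z. f y x z)"
 and tri_perm231: "tri k V W X R f ==> tri k W X V R (%x y z. f z x y)"
 and tri_perm312: "tri k V W X R f ==> tri k X V W R (%x y z. f y z x)"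
 and tri_perm132: "tri k V W X R f ==> tri k V X W R (%x y z. f x z y)"
 by (auto intro!: triI intro: tri_1 tri_2 tri_3)

lemma quad_bil:
 assumes "quad k H H H H X f" "x : H" "y : H"
 shows "bil k H H X (%a b. f a b x y)" and "bil k H H X (%a b. f x a b y)" and "bil k H H X (%a b. f x y a b)"
 using assms by (auto intro!: bilI intro: quad_1 quad_2 quad_3 quad_4)

lemma cop_hom:
 shows "is_alg_hom k HHH HHHH leg123" and "is_alg_hom k HHH HHHH leg234" and "is_alg_hom k HHH HHHH cop1"
  and "is_alg_hom k HHH HHHH cop2" and "is_alg_hom k HHH HHHH cop3"
proof -
 note h = sw3_hom[OF alg_H4] and c = sw2_comult_prod[OF alg_H4 _ _ quad_bil(1)[OF p4_quad]]
  sw2_comult_prod[OF alg_H4 _ _ quad_bil(2)[OF p4_quad]] sw2_comult_prod[OF alg_H4 _ _ quad_bil(3)[OF p4_quad]]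
 note q = quad_bil[OF p4_quad] and s = p4_mult p4_one comult_one sw2_pure[OF mod_H4]
 have "is_alg_hom k HHH HHHH f" if "is_alg_hom k HHH HHHH g" "!!t. t : HHH ==> f t = g t" for f g
  using that by (auto simp: is_alg_hom_def is_lin_def module_add_closed[OF mod_H3] module_smult_closed[OF mod_H3]
   alg_mult_closed[OF alg_H3] alg_one_closed[OF alg_H3])
 note e = this[OF _ leg234_sw]
 show "is_alg_hom k HHH HHHH leg123" unfolding leg123_def[abs_def] by (rule h[OF tri_leg123[OF p4_quad]]) (simp_all add: s)
 show "is_alg_hom k HHH HHHH leg234" by (rule e[OF h[OF tri_leg234[OF p4_quad]]]) (simp_all add: s)
 show "is_alg_hom k HHH HHHH cop1" unfolding cop1_def[abs_def]
  by (rule h[OF tri_cop(1)[OF mod_H4 p4_quad]], simp add: s q, rule c(1)) (simp_all add: s q)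
 show "is_alg_hom k HHH HHHH cop2" unfolding cop2_def[abs_def]
  by (rule h[OF tri_cop(2)[OF mod_H4 p4_quad]], simp add: s q, rule c(2)) (simp_all add: s q)
 show "is_alg_hom k HHH HHHH cop3" unfolding cop3_sw[abs_def]
  by (rule h[OF tri_cop(3)[OF mod_H4 p4_quad]], simp add: s q, rule c(3)) (simp_all add: s q)
qed

lemma leg_hom:
 shows "is_alg_hom k HH HHH leg12" and "is_alg_hom k HH HHH leg13" and "is_alg_hom k HH HHH leg23"
 unfolding leg12_def[abs_def] leg13_def[abs_def] leg23_def[abs_def]
 by (rule sw2_hom[OF alg_H3 bil_leg12[OF p3_tri]] sw2_hom[OF alg_H3 bil_leg13[OF p3_tri]] sw2_hom[OF alg_H3 bil_leg23[OF p3_tri]];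
  simp add: p3_mult p3_one)+

lemma perm_hom:
 shows "is_alg_hom k HHH HHH perm213" and "is_alg_hom k HHH HHH perm231"
  and "is_alg_hom k HHH HHH perm312" and "is_alg_hom k HHH HHH perm132"
 unfolding perm213_def[abs_def] perm231_def[abs_def] perm312_def[abs_def] perm132_def[abs_def]
 by (rule sw3_hom[OF alg_H3 tri_perm213[OF p3_tri]] sw3_hom[OF alg_H3 tri_perm231[OF p3_tri]]
   sw3_hom[OF alg_H3 tri_perm312[OF p3_tri]] sw3_hom[OF alg_H3 tri_perm132[OF p3_tri]]; simp add: p3_mult p3_one)+

lemma is_alg_hom_lin: "is_alg_hom k B C f ==> is_lin k B C f" and is_alg_hom_one: "is_alg_hom k B C f ==> f \<one>\<^bsub>B\<^esub> = \<one>\<^bsub>C\<^esub>"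
 by (simp_all add: is_alg_hom_def)

lemmas leg_lin = leg_hom[THEN is_alg_hom_lin]
lemmas leg_closed = leg_lin[THEN lin_closed]
 and cop_closed = cop_hom[THEN is_alg_hom_lin, THEN lin_closed]
 and perm_closed = perm_hom[THEN is_alg_hom_lin, THEN lin_closed]
 and leg_one = leg_hom[THEN is_alg_hom_one]

lemma copl_lin: "klin HH HHH copl" and copr_lin: "klin HH HHH copr"
 using sw2_lin[OF mod_H3 bil_cop_l[OF mod_H3 p3_tri]] sw2_lin[OF mod_H3 bil_cop_r[OF mod_H3 p3_tri]]
 by (simp_all add: copl_def[abs_def] copr_sw[abs_def])

lemmas copl_closed = lin_closed[OF copl_lin] and copr_closed = lin_closed[OF copr_lin]

text \<open>A sum over the image of \<open>t\<close> is a sum over \<open>t\<close>. In this form the axioms of \<open>H\<close> act on summands.\<close>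

lemma sw4_cop:
 assumes X: "kmod X" and f: "quad k H H H H X f" and t: "t : HHH"
 shows sw4_leg123: "sw4 X (leg123 t) f = sm3 X t (%x y z. f x y z oneH)"
  and sw4_leg234: "sw4 X (leg234 t) f = sm3 X t (%x y z. f oneH x y z)"
  and sw4_cop1: "sw4 X (cop1 t) f = sm3 X t (%x y z. sm2 X (cop x) (%a b. f a b y z))"
  and sw4_cop2: "sw4 X (cop2 t) f = sm3 X t (%x y z. sm2 X (cop y) (%a b. f x a b z))"
  and sw4_cop3: "sw4 X (cop3 t) f = sm3 X t (%x y z. sm2 X (cop z) (%a b. f x y a b))"
 unfolding leg123_def leg234_sw[OF t] cop1_def cop2_def cop3_sw
 using sw3_push[OF mod_H4 X tri_leg123[OF p4_quad] sw4_lin[OF X f] t] sw3_push[OF mod_H4 X tri_leg234[OF p4_quad] sw4_lin[OF X f] t]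
  tri_cop[OF mod_H4 p4_quad, THEN sw3_push[OF mod_H4 X _ sw4_lin[OF X f] t]]
 by (simp_all add: sw4_pure[OF X f] cop_cl sw2_push[OF mod_H4 X quad_bil(1)[OF p4_quad] sw4_lin[OF X f]]
  sw2_push[OF mod_H4 X quad_bil(2)[OF p4_quad] sw4_lin[OF X f]]
  sw2_push[OF mod_H4 X quad_bil(3)[OF p4_quad] sw4_lin[OF X f]] cong: sw2_cong sw3_cong)

lemma sw3_cop:
 assumes X: "kmod X" and f: "tri k H H H X f" and t: "t : HH"
 shows sw3_leg12: "sm3 X (leg12 t) f = sm2 X t (%x y. f x y oneH)"
  and sw3_leg13: "sm3 X (leg13 t) f = sm2 X t (%x y. f x oneH y)"
  and sw3_leg23: "sm3 X (leg23 t) f = sm2 X t (%x y. f oneH x y)"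
  and sw3_copl: "sm3 X (copl t) f = sm2 X t (%x y. sm2 X (cop x) (%a b. f a b y))"
  and sw3_copr: "sm3 X (copr t) f = sm2 X t (%x y. sm2 X (cop y) (%a b. f x a b))"
proof -
 note p = sw2_push[OF mod_H3 X _ sw3_lin[OF X f]]
 have b: "bil k H H HHH (%a b. p3 k H a b y)" "bil k H H HHH (%a b. p3 k H y a b)" if "y : H" for y
  using that by (auto intro!: bilI intro: tri_1[OF p3_tri] tri_2[OF p3_tri] tri_3[OF p3_tri])
 show "sm3 X (leg12 t) f = sm2 X t (%x y. f x y oneH)" "sm3 X (leg13 t) f = sm2 X t (%x y. f x oneH y)"
  "sm3 X (leg23 t) f = sm2 X t (%x y. f oneH x y)"
  "sm3 X (copl t) f = sm2 X t (%x y. sm2 X (cop x) (%a b. f a b y))"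
  "sm3 X (copr t) f = sm2 X t (%x y. sm2 X (cop y) (%a b. f x a b))"
  unfolding leg12_def leg13_def leg23_def copl_def copr_sw
  using p[OF bil_leg12[OF p3_tri] t] p[OF bil_leg13[OF p3_tri] t] p[OF bil_leg23[OF p3_tri] t] bil_cop[OF mod_H3 p3_tri, THEN p, OF t]
  by (simp_all add: sw3_pure[OF X f] cop_cl p[OF b(1)] p[OF b(2)] cong: sw2_cong)
qed

lemma sw3_perm:
 assumes X: "kmod X" and f: "tri k H H H X f" and t: "t : HHH"
 shows sw3_perm213: "sm3 X (perm213 t) f = sm3 X t (%x y z. f y x z)"
  and sw3_perm231: "sm3 X (perm231 t) f = sm3 X t (%x y z. f z x y)"
  and sw3_perm312: "sm3 X (perm312 t) f = sm3 X t (%x y z. f y z x)"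
  and sw3_perm132: "sm3 X (perm132 t) f = sm3 X t (%x y z. f x z y)"
 unfolding perm213_def perm231_def perm312_def perm132_def
 using sw3_push[OF mod_H3 X tri_perm213[OF p3_tri] sw3_lin[OF X f] t] sw3_push[OF mod_H3 X tri_perm231[OF p3_tri] sw3_lin[OF X f] t]
  sw3_push[OF mod_H3 X tri_perm312[OF p3_tri] sw3_lin[OF X f] t] sw3_push[OF mod_H3 X tri_perm132[OF p3_tri] sw3_lin[OF X f] t]
 by (simp_all add: sw3_pure[OF X f] cong: sw3_cong)

lemma phi_ipair: "ipair HHH ph phiI"
 unfolding phi_inv_def by (rule ipair_unit[OF alg_H3 phi_unit])

lemma phi_closed: "ph : HHH" and phiI_closed: "phiI : HHH"
 using phi_ipair by (auto simp: ipair_def)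

lemma coassoc: "h : H ==>
  copr (cop h) *\<^sub>3 ph = ph *\<^sub>3 copl (cop h)"
 using quasi_coassoc by (simp add: copr_def copl_def)

lemma pentagon': "cop3 ph *\<^sub>4 cop1 ph
  = leg234 ph *\<^sub>4 cop2 ph *\<^sub>4 leg123 ph"
 using pentagon by (simp add: cop1_def cop2_def cop3_def leg123_def leg234_def)

end

section \<open>Modules over the quasi-bialgebra and change of bracketing\<close>

context quasi_bialgebra
begin

lemma hmod_mod: "hmod V ==> kmod V"
 by (simp add: is_hmod_def)

lemma act_bil: "hmod V ==> bil k H V V (act V)"
 by (auto simp: is_hmod_def intro!: bilI)

lemma act_lin1: "hmod V ==> v : V ==> klin H V (%h. act V h v)"
 and act_lin2: "hmod V ==> h : H ==> klin V V (act V h)"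
 by (auto simp: is_hmod_def)

lemma act_closed: "hmod V ==> h : H ==> v : V ==> act V h v : V"
 using lin_closed[OF act_lin2] .

lemma act_mult: "hmod V ==> g : H ==> h : H ==> v : V
  ==> act V (g * h) v = act V g (act V h v)"
 and act_one: "hmod V ==> v : V ==> act V oneH v = v"
 by (auto simp: is_hmod_def)

text \<open>These are the equivariant maps \<open>V \<otimes> W \<rightarrow> X\<close>, as products of elements.\<close>

definition eqb where
 "eqb V W X f <-> bil k V W X f \<and> (\<forall>h\<in>carrier H. \<forall>v\<in>carrier V. \<forall>w\<in>carrier W.
   act X h (f v w) = sm2 X (cop h) (%a b. f (act V a v) (act W b w)))"

lemma eqb_bil: "eqb V W X f ==> bil k V W X f"
 and eqb_act: "eqb V W X f ==> h : H ==> v : V ==> w : W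
  ==> act X h (f v w) = sm2 X (cop h) (%a b. f (act V a v) (act W b w))"
 by (simp_all add: eqb_def)

lemmas eqb_closed = bil_closed[OF eqb_bil]

text \<open>The relations \<open>rel2\<close>, \<open>rel3\<close>, \<open>rel4\<close> between multilinear functions \<open>F\<close> and \<open>G\<close> of two, three, four
 arguments by an element of a tensor power of \<open>H\<close>: \<open>F\<close> is \<open>G\<close> with the legs of that element applied to the
 arguments. Changing the bracketing of a product is such a relation, and composing relations multiplies the
 elements. All coherence computations below take place in the tensor powers of \<open>H\<close>.\<close>

definition rel2 where
 "rel2 V W R F G t <-> (\<forall>v\<in>carrier V. \<forall>w\<in>carrier W.
   F v w = sm2 R t (%a b. G (act V a v) (act W b w)))"

lemma bil_act:
 assumes "hmod V" "hmod W" "bil k V W R G" "v : V" "w : W"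
 shows "bil k H H R (%a b. G (act V a v) (act W b w))"
 by (rule bil_comp[OF assms(3)]) (auto intro: act_lin1 assms)

lemma bil_rel:
 assumes "hmod V" "hmod W" "kmod R" "bil k V W R G" "t : HH"
 shows "bil k V W R (%v w. sm2 R t (%a b. G (act V a v) (act W b w)))"
 by (rule bilI; rule sw2_param_lin[OF assms(3) hmod_mod assms(5)])
  (auto intro!: bil_act assms(1-4) lin_comp[OF act_lin2]
   intro: bil_l[OF assms(4)] bil_r[OF assms(4)] act_closed assms)

definition rel3 where
 "rel3 V W X R F G t <-> (\<forall>v\<in>carrier V. \<forall>w\<in>carrier W. \<forall>x\<in>carrier X.
   F v w x = sm3 R t (%a b c. G (act V a v) (act W b w) (act X c x)))"

lemma rel3D: "rel3 V W X R F G t ==> v : V ==> w : W ==> x : X ==>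
  F v w x = sm3 R t (%a b c. G (act V a v) (act W b w) (act X c x))"
 by (simp add: rel3_def)

lemma tri_act:
 assumes "hmod V" "hmod W" "hmod X" "tri k V W X R G" "v : V" "w : W" "x : X"
 shows "tri k H H H R (%a b c. G (act V a v) (act W b w) (act X c x))"
 by (rule tri_comp[OF assms(4)]) (auto intro: act_lin1 assms)

text \<open>The element of the first relation acts on the arguments first, hence is the right factor of the product.\<close>

lemma rel3_trans:
 assumes "hmod V" "hmod W" "hmod X" "kmod R" "tri k V W X R K"
  and "rel3 V W X R F G s" "rel3 V W X R G K t" "s : HHH" "t : HHH"
 shows "rel3 V W X R F K (t *\<^sub>3 s)"
 unfolding rel3_def
proof (intro ballI)
 fix v w x assume *: "v : V" "w : W" "x : X"
 have "F v w x = sm3 R s (%a b c. G (act V a v) (act W b w) (act X c x))"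
  by (rule rel3D[OF assms(6) *])
 also have "... = sm3 R s (%a b c. sm3 R t (%a' b' c'. K (act V (a' * a) v) (act W (b' * b) w) (act X (c' * c) x)))"
  by (intro sw3_cong) (simp add: act_mult assms(1-3) * act_closed rel3D[OF assms(7)] cong: sw3_cong)
 also have "... = sm3 R (t *\<^sub>3 s) (%a b c. K (act V a v) (act W b w) (act X c x))"
  by (rule sw3_mult'[OF assms(4) tri_act[OF assms(1-3,5) *] assms(8,9), symmetric])
 finally show "F v w x = sm3 R (t *\<^sub>3 s) (%a b c. K (act V a v) (act W b w) (act X c x))" .
qed

lemma rel3_inv:
 assumes "hmod V" "hmod W" "hmod X" "kmod R" "tri k V W X R G"
  and "rel3 V W X R F G s" "ipair HHH s t"
 shows "rel3 V W X R G F t"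
 unfolding rel3_def
proof (intro ballI)
 fix v w x assume *: "v : V" "w : W" "x : X"
 note ml = tri_act[OF assms(1-3,5) *]
 have st: "s : HHH" "t : HHH" "s *\<^sub>3 t = p3 k H oneH oneH oneH"
  using assms(7) by (auto simp: ipair_def p3_one)
 have "sm3 R t (%a b c. F (act V a v) (act W b w) (act X c x))
   = sm3 R t (%a b c. sm3 R s (%a' b' c'. G (act V (a' * a) v) (act W (b' * b) w) (act X (c' * c) x)))"
  by (intro sw3_cong) (simp add: act_mult assms(1-3) * act_closed rel3D[OF assms(6)] cong: sw3_cong)
 also have "... = sm3 R (s *\<^sub>3 t) (%a b c. G (act V a v) (act W b w) (act X c x))"
  by (rule sw3_mult'[OF assms(4) ml st(2,1), symmetric])
 also have "... = G v w x"
  unfolding st(3) by (simp add: sw3_pure[OF assms(4) ml] act_one assms(1-3) *)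
 finally show "G v w x = sm3 R t (%a b c. F (act V a v) (act W b w) (act X c x))" by simp
qed

lemma tri_rel:
 assumes "hmod V" "hmod W" "hmod X" "kmod R" "tri k V W X R G" "t : HHH"
 shows "tri k V W X R (%v w x. sm3 R t (%a b c. G (act V a v) (act W b w) (act X c x)))"
 by (rule triI; rule sw3_param_lin[OF assms(4) hmod_mod assms(6)])
  (auto intro!: tri_act assms(1-5) lin_comp[OF act_lin2]
   intro: tri_1[OF assms(5)] tri_2[OF assms(5)] tri_3[OF assms(5)] act_closed assms)

lemma rel3_cong:
 assumes "rel3 V W X R F G t"
  and "!!v w x. v : V ==> w : W ==> x : X ==> F' v w x = F v w x"
  and "!!v w x. v : V ==> w : W ==> x : X ==> G' v w x = G v w x"
  and "hmod V" "hmod W" "hmod X"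
 shows "rel3 V W X R F' G' t"
 using assms unfolding rel3_def by (simp add: act_closed cong: sw3_cong)

lemma quad_shift':
 assumes "quad k H H H H X f" "a : H" "b : H" "c : H" "d : H"
 shows "quad k H H H H X (%a' b' c' d'. f (a' * a) (b' * b) (c' * c) (d' * d))"
 by (rule quad_comp[OF assms(1)]) (auto intro: mult_lin alg_H assms)

definition rel4 where
 "rel4 V W X Y R F G t <-> (\<forall>v\<in>carrier V. \<forall>w\<in>carrier W. \<forall>x\<in>carrier X. \<forall>y\<in>carrier Y.
   F v w x y = sw4 R t (%a b c d. G (act V a v) (act W b w) (act X c x) (act Y d y)))"

lemma rel4D: "rel4 V W X Y R F G t ==> v : V ==> w : W ==> x : X ==> y : Y ==>
  F v w x y = sw4 R t (%a b c d. G (act V a v) (act W b w) (act X c x) (act Y d y))"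
 by (simp add: rel4_def)

lemma quad_act:
 assumes "hmod V" "hmod W" "hmod X" "hmod Y" "quad k V W X Y R G" "v : V" "w : W" "x : X" "y : Y"
 shows "quad k H H H H R (%a b c d. G (act V a v) (act W b w) (act X c x) (act Y d y))"
 by (rule quad_comp[OF assms(5)]) (auto intro: act_lin1 assms)

lemma rel4_trans:
 assumes "hmod V" "hmod W" "hmod X" "hmod Y" "kmod R" "quad k V W X Y R K"
  and "rel4 V W X Y R F G s" "rel4 V W X Y R G K t" "s : HHHH" "t : HHHH"
 shows "rel4 V W X Y R F K (t *\<^sub>4 s)"
 unfolding rel4_def
proof (intro ballI)
 fix v w x y assume *: "v : V" "w : W" "x : X" "y : Y"
 have "F v w x y = sw4 R s (%a b c d. G (act V a v) (act W b w) (act X c x) (act Y d y))"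
  by (rule rel4D[OF assms(7) *])
 also have "... = sw4 R s (%a b c d. sw4 R t (%a' b' c' d'. K (act V (a' * a) v) (act W (b' * b) w) (act X (c' * c) x) (act Y (d' * d) y)))"
  by (intro sw4_cong) (simp add: act_mult assms(1-4) * act_closed rel4D[OF assms(8)] cong: sw4_cong)
 also have "... = sw4 R (t *\<^sub>4 s) (%a b c d. K (act V a v) (act W b w) (act X c x) (act Y d y))"
  by (rule sw4_mult'[OF assms(5) quad_act[OF assms(1-4,6) *] assms(9,10), symmetric])
 finally show "F v w x y = sw4 R (t *\<^sub>4 s) (%a b c d. K (act V a v) (act W b w) (act X c x) (act Y d y))" .
qed

lemma rel4_inv:
 assumes "hmod V" "hmod W" "hmod X" "hmod Y" "kmod R" "quad k V W X Y R G"
  and "rel4 V W X Y R F G s" "ipair HHHH s t"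
 shows "rel4 V W X Y R G F t"
 unfolding rel4_def
proof (intro ballI)
 fix v w x y assume *: "v : V" "w : W" "x : X" "y : Y"
 note ml = quad_act[OF assms(1-4,6) *]
 have st: "s : HHHH" "t : HHHH" "s *\<^sub>4 t = p4 k H oneH oneH oneH oneH"
  using assms(8) by (auto simp: ipair_def p4_one)
 have "sw4 R t (%a b c d. F (act V a v) (act W b w) (act X c x) (act Y d y))
   = sw4 R t (%a b c d. sw4 R s (%a' b' c' d'. G (act V (a' * a) v) (act W (b' * b) w) (act X (c' * c) x) (act Y (d' * d) y)))"
  by (intro sw4_cong) (simp add: act_mult assms(1-4) * act_closed rel4D[OF assms(7)] cong: sw4_cong)
 also have "... = sw4 R (s *\<^sub>4 t) (%a b c d. G (act V a v) (act W b w) (act X c x) (act Y d y))"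
  by (rule sw4_mult'[OF assms(5) ml st(2,1), symmetric])
 also have "... = G v w x y"
  unfolding st(3) by (simp add: sw4_pure[OF assms(5) ml] act_one assms(1-4) *)
 finally show "G v w x y = sw4 R t (%a b c d. F (act V a v) (act W b w) (act X c x) (act Y d y))" by simp
qed

end

context quasi_bialgebra
begin

subsection \<open>Relations between subexpressions\<close>

text \<open>Let two products be related by \<open>t\<close>. If both are multiplied by a further factor, they are related by \<open>t\<close> with
a unit inserted at the place of that factor. If the same argument of both is itself an equivariant product,
they are related, as functions of more arguments, by \<open>t\<close> with the coproduct applied at that place. First
for values, then for relations; with \<open>leg13\<close> the additional factor may stand on either side. Permuting arguments permutes legs.\<close>

lemma sw4_leg123_apply:
 assumes hm: "hmod W" "hmod X" "hmod Y" "hmod Z" and P: "kmod P" and R: "kmod R"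
  and K: "tri k W X Y P K" and m: "bil k P Z R m" and t: "t : HHH"
  and el: "w : W" "x : X" "y : Y" "z : Z"
 shows "sw4 R (leg123 t) (%a b c d. m (K (act W a w) (act X b x) (act Y c y)) (act Z d z))
  = m (sm3 P t (%a b c. K (act W a w) (act X b x) (act Y c y))) z"
 unfolding sw4_leg123[OF R quad_act[OF hm quad_123[OF K m] el] t]
  sw3_push[OF P R tri_act[OF hm(1-3) K el(1-3)] bil_l[OF m el(4)] t]
 by (simp add: act_one[OF hm(4) el(4)])

lemma sw4_leg234_apply:
 assumes hm: "hmod W" "hmod X" "hmod Y" "hmod Z" and P: "kmod P" and R: "kmod R"
  and K: "tri k X Y Z P K" and m: "bil k W P R m" and t: "t : HHH"
  and el: "w : W" "x : X" "y : Y" "z : Z"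
 shows "sw4 R (leg234 t) (%a b c d. m (act W a w) (K (act X b x) (act Y c y) (act Z d z)))
  = m w (sm3 P t (%a b c. K (act X a x) (act Y b y) (act Z c z)))"
 unfolding sw4_leg234[OF R quad_act[OF hm quad_234[OF K m] el] t]
  sw3_push[OF P R tri_act[OF hm(2-4) K el(2-4)] bil_r[OF m el(1)] t]
 by (simp add: act_one[OF hm(1) el(1)])

lemma sw4_cop1_apply:
 assumes hm: "hmod W" "hmod X" "hmod Y" "hmod Z" and P: "hmod P" and R: "kmod R"
  and K: "tri k P Y Z R K" and f: "eqb W X P f" and t: "t : HHH"
  and el: "w : W" "x : X" "y : Y" "z : Z"
 shows "sw4 R (cop1 t) (%a b c d. K (f (act W a w) (act X b x)) (act Y c y) (act Z d z))
  = sm3 R t (%a b c. K (act P a (f w x)) (act Y b y) (act Z c z))"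
 unfolding sw4_cop1[OF R quad_act[OF hm quad_12[OF eqb_bil[OF f] K] el] t]
proof (rule sw3_cong, goal_cases)
 case (1 a b c)
 have "bil k H H P (%a b. f (act W a w) (act X b x))" by (rule bil_act[OF hm(1,2) eqb_bil[OF f] el(1,2)])
 from sw2_push[OF hmod_mod[OF P] R this tri_1[OF K] cop_cl[OF 1(1)]]
 show ?case using 1 by (simp add: eqb_act[OF f _ el(1,2)] act_closed hm el)
qed

lemma sw4_cop2_apply:
 assumes hm: "hmod W" "hmod X" "hmod Y" "hmod Z" and P: "hmod P" and R: "kmod R"
  and K: "tri k W P Z R K" and f: "eqb X Y P f" and t: "t : HHH"
  and el: "w : W" "x : X" "y : Y" "z : Z"
 shows "sw4 R (cop2 t) (%a b c d. K (act W a w) (f (act X b x) (act Y c y)) (act Z d z))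
  = sm3 R t (%a b c. K (act W a w) (act P b (f x y)) (act Z c z))"
 unfolding sw4_cop2[OF R quad_act[OF hm quad_23[OF eqb_bil[OF f] K] el] t]
proof (rule sw3_cong, goal_cases)
 case (1 a b c)
 have "bil k H H P (%a b. f (act X a x) (act Y b y))" by (rule bil_act[OF hm(2,3) eqb_bil[OF f] el(2,3)])
 from sw2_push[OF hmod_mod[OF P] R this tri_2[OF K] cop_cl[OF 1(2)]]
 show ?case using 1 by (simp add: eqb_act[OF f _ el(2,3)] act_closed hm el)
qed

lemma sw4_cop3_apply:
 assumes hm: "hmod W" "hmod X" "hmod Y" "hmod Z" and P: "hmod P" and R: "kmod R"
  and K: "tri k W X P R K" and f: "eqb Y Z P f" and t: "t : HHH"
  and el: "w : W" "x : X" "y : Y" "z : Z"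
 shows "sw4 R (cop3 t) (%a b c d. K (act W a w) (act X b x) (f (act Y c y) (act Z d z)))
  = sm3 R t (%a b c. K (act W a w) (act X b x) (act P c (f y z)))"
 unfolding sw4_cop3[OF R quad_act[OF hm quad_34[OF eqb_bil[OF f] K] el] t]
proof (rule sw3_cong, goal_cases)
 case (1 a b c)
 have "bil k H H P (%a b. f (act Y a y) (act Z b z))" by (rule bil_act[OF hm(3,4) eqb_bil[OF f] el(3,4)])
 from sw2_push[OF hmod_mod[OF P] R this tri_3[OF K] cop_cl[OF 1(3)]]
 show ?case using 1 by (simp add: eqb_act[OF f _ el(3,4)] act_closed hm el)
qed

lemma sw3_leg12_apply:
 assumes hm: "hmod X" "hmod Y" "hmod Z" and P: "kmod P" and R: "kmod R"
  and K: "bil k X Y P K" and m: "bil k P Z R m" and t: "t : HH"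
  and el: "x : X" "y : Y" "z : Z"
 shows "sm3 R (leg12 t) (%a b c. m (K (act X a x) (act Y b y)) (act Z c z))
  = m (sm2 P t (%a b. K (act X a x) (act Y b y))) z"
 unfolding sw3_leg12[OF R tri_act[OF hm tri_left[OF K m] el] t]
  sw2_push[OF P R bil_act[OF hm(1,2) K el(1,2)] bil_l[OF m el(3)] t]
 by (simp add: act_one[OF hm(3) el(3)])

lemma sw3_leg23_apply:
 assumes hm: "hmod X" "hmod Y" "hmod Z" and P: "kmod P" and R: "kmod R"
  and K: "bil k Y Z P K" and m: "bil k X P R m" and t: "t : HH"
  and el: "x : X" "y : Y" "z : Z"
 shows "sm3 R (leg23 t) (%a b c. m (act X a x) (K (act Y b y) (act Z c z)))
  = m x (sm2 P t (%a b. K (act Y a y) (act Z b z)))"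
 unfolding sw3_leg23[OF R tri_act[OF hm tri_right[OF K m] el] t]
  sw2_push[OF P R bil_act[OF hm(2,3) K el(2,3)] bil_r[OF m el(1)] t]
 by (simp add: act_one[OF hm(1) el(1)])

lemma sw3_leg13_apply_l:
 assumes hm: "hmod X" "hmod Y" "hmod Z" and P: "kmod P" and R: "kmod R"
  and K: "bil k X Z P K" and m: "bil k P Y R m" and t: "t : HH"
  and el: "x : X" "y : Y" "z : Z"
 shows "sm3 R (leg13 t) (%a b c. m (K (act X a x) (act Z c z)) (act Y b y))
  = m (sm2 P t (%a b. K (act X a x) (act Z b z))) y"
 unfolding sw3_leg13[OF R tri_act[OF hm tri_perm132[OF tri_left[OF K m]] el] t]
  sw2_push[OF P R bil_act[OF hm(1,3) K el(1,3)] bil_l[OF m el(2)] t]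
 by (simp add: act_one[OF hm(2) el(2)])

lemma sw3_leg13_apply_r:
 assumes hm: "hmod X" "hmod Y" "hmod Z" and P: "kmod P" and R: "kmod R"
  and K: "bil k X Z P K" and m: "bil k Y P R m" and t: "t : HH"
  and el: "x : X" "y : Y" "z : Z"
 shows "sm3 R (leg13 t) (%a b c. m (act Y b y) (K (act X a x) (act Z c z)))
  = m y (sm2 P t (%a b. K (act X a x) (act Z b z)))"
 unfolding sw3_leg13[OF R tri_act[OF hm tri_perm213[OF tri_right[OF K m]] el] t]
  sw2_push[OF P R bil_act[OF hm(1,3) K el(1,3)] bil_r[OF m el(2)] t]
 by (simp add: act_one[OF hm(2) el(2)])

lemma sw3_copl_apply:
 assumes hm: "hmod X" "hmod Y" "hmod Z" and P: "hmod P" and R: "kmod R"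
  and K: "bil k P Z R K" and f: "eqb X Y P f" and t: "t : HH"
  and el: "x : X" "y : Y" "z : Z"
 shows "sm3 R (copl t) (%a b c. K (f (act X a x) (act Y b y)) (act Z c z))
  = sm2 R t (%a b. K (act P a (f x y)) (act Z b z))"
 unfolding sw3_copl[OF R tri_act[OF hm tri_left[OF eqb_bil[OF f] K] el] t]
proof (rule sw2_cong, goal_cases)
 case (1 a b)
 have "bil k H H P (%a b. f (act X a x) (act Y b y))" by (rule bil_act[OF hm(1,2) eqb_bil[OF f] el(1,2)])
 from sw2_push[OF hmod_mod[OF P] R this bil_l[OF K] cop_cl[OF 1(1)]]
 show ?case using 1 by (simp add: eqb_act[OF f _ el(1,2)] act_closed hm el)
qed

lemma sw3_copr_apply:
 assumes hm: "hmod X" "hmod Y" "hmod Z" and P: "hmod P" and R: "kmod R"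
  and K: "bil k X P R K" and f: "eqb Y Z P f" and t: "t : HH"
  and el: "x : X" "y : Y" "z : Z"
 shows "sm3 R (copr t) (%a b c. K (act X a x) (f (act Y b y) (act Z c z)))
  = sm2 R t (%a b. K (act X a x) (act P b (f y z)))"
 unfolding sw3_copr[OF R tri_act[OF hm tri_right[OF eqb_bil[OF f] K] el] t]
proof (rule sw2_cong, goal_cases)
 case (1 a b)
 have "bil k H H P (%a b. f (act Y a y) (act Z b z))" by (rule bil_act[OF hm(2,3) eqb_bil[OF f] el(2,3)])
 from sw2_push[OF hmod_mod[OF P] R this bil_r[OF K] cop_cl[OF 1(2)]]
 show ?case using 1 by (simp add: eqb_act[OF f _ el(2,3)] act_closed hm el)
qed

lemma rel4_leg123:
 assumes "rel3 W X Y P G K t" "bil k P Z R m" "tri k W X Y P K" "t : HHH"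
  and "hmod W" "hmod X" "hmod Y" "hmod Z" "kmod P" "kmod R"
 shows "rel4 W X Y Z R (%w x y z. m (G w x y) z) (%w x y z. m (K w x y) z) (leg123 t)"
 using assms(1) unfolding rel4_def rel3_def
 by (simp add: sw4_leg123_apply[OF assms(5-10,3,2,4)])

lemma rel4_leg234:
 assumes "rel3 X Y Z P G K t" "bil k W P R m" "tri k X Y Z P K" "t : HHH"
  and "hmod W" "hmod X" "hmod Y" "hmod Z" "kmod P" "kmod R"
 shows "rel4 W X Y Z R (%w x y z. m w (G x y z)) (%w x y z. m w (K x y z)) (leg234 t)"
 using assms(1) unfolding rel4_def rel3_def
 by (simp add: sw4_leg234_apply[OF assms(5-10,3,2,4)])

lemma rel4_cop1:
 assumes "rel3 P Y Z R G K t" "eqb W X P f" "tri k P Y Z R K" "t : HHH"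
  and "hmod W" "hmod X" "hmod Y" "hmod Z" "hmod P" "kmod R"
 shows "rel4 W X Y Z R (%w x y z. G (f w x) y z) (%w x y z. K (f w x) y z) (cop1 t)"
 using assms(1) unfolding rel4_def rel3_def
 by (simp add: sw4_cop1_apply[OF assms(5-10,3,2,4)] eqb_closed[OF assms(2)])

lemma rel4_cop2:
 assumes "rel3 W P Z R G K t" "eqb X Y P f" "tri k W P Z R K" "t : HHH"
  and "hmod W" "hmod X" "hmod Y" "hmod Z" "hmod P" "kmod R"
 shows "rel4 W X Y Z R (%w x y z. G w (f x y) z) (%w x y z. K w (f x y) z) (cop2 t)"
 using assms(1) unfolding rel4_def rel3_def
 by (simp add: sw4_cop2_apply[OF assms(5-10,3,2,4)] eqb_closed[OF assms(2)])

lemma rel4_cop3: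
 assumes "rel3 W X P R G K t" "eqb Y Z P f" "tri k W X P R K" "t : HHH"
  and "hmod W" "hmod X" "hmod Y" "hmod Z" "hmod P" "kmod R"
 shows "rel4 W X Y Z R (%w x y z. G w x (f y z)) (%w x y z. K w x (f y z)) (cop3 t)"
 using assms(1) unfolding rel4_def rel3_def
 by (simp add: sw4_cop3_apply[OF assms(5-10,3,2,4)] eqb_closed[OF assms(2)])

lemma rel3_leg12:
 assumes "rel2 X Y P G K t" "bil k P Z R m" "bil k X Y P K" "t : HH"
  and "hmod X" "hmod Y" "hmod Z" "kmod P" "kmod R"
 shows "rel3 X Y Z R (%x y z. m (G x y) z) (%x y z. m (K x y) z) (leg12 t)"
 using assms(1) unfolding rel2_def rel3_def
 by (simp add: sw3_leg12_apply[OF assms(5-9,3,2,4)])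

lemma rel3_leg23:
 assumes "rel2 Y Z P G K t" "bil k X P R m" "bil k Y Z P K" "t : HH"
  and "hmod X" "hmod Y" "hmod Z" "kmod P" "kmod R"
 shows "rel3 X Y Z R (%x y z. m x (G y z)) (%x y z. m x (K y z)) (leg23 t)"
 using assms(1) unfolding rel2_def rel3_def
 by (simp add: sw3_leg23_apply[OF assms(5-9,3,2,4)])

lemma rel3_leg13_l:
 assumes "rel2 X Z P G K t" "bil k P Y R m" "bil k X Z P K" "t : HH"
  and "hmod X" "hmod Y" "hmod Z" "kmod P" "kmod R"
 shows "rel3 X Y Z R (%x y z. m (G x z) y) (%x y z. m (K x z) y) (leg13 t)"
 using assms(1) unfolding rel2_def rel3_def
 by (simp add: sw3_leg13_apply_l[OF assms(5-9,3,2,4)])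

lemma rel3_leg13_r:
 assumes "rel2 X Z P G K t" "bil k Y P R m" "bil k X Z P K" "t : HH"
  and "hmod X" "hmod Y" "hmod Z" "kmod P" "kmod R"
 shows "rel3 X Y Z R (%x y z. m y (G x z)) (%x y z. m y (K x z)) (leg13 t)"
 using assms(1) unfolding rel2_def rel3_def
 by (simp add: sw3_leg13_apply_r[OF assms(5-9,3,2,4)])

lemma rel3_copl:
 assumes "rel2 P Z R G K t" "eqb X Y P f" "bil k P Z R K" "t : HH"
  and "hmod X" "hmod Y" "hmod Z" "hmod P" "kmod R"
 shows "rel3 X Y Z R (%x y z. G (f x y) z) (%x y z. K (f x y) z) (copl t)"
 using assms(1) unfolding rel2_def rel3_def
 by (simp add: sw3_copl_apply[OF assms(5-9,3,2,4)] eqb_closed[OF assms(2)])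

lemma rel3_copr:
 assumes "rel2 X P R G K t" "eqb Y Z P f" "bil k X P R K" "t : HH"
  and "hmod X" "hmod Y" "hmod Z" "hmod P" "kmod R"
 shows "rel3 X Y Z R (%x y z. G x (f y z)) (%x y z. K x (f y z)) (copr t)"
 using assms(1) unfolding rel2_def rel3_def
 by (simp add: sw3_copr_apply[OF assms(5-9,3,2,4)] eqb_closed[OF assms(2)])

lemma rel3_perm213:
 assumes "rel3 Y X Z R G K t" "tri k Y X Z R K" "t : HHH" "kmod R"
  and "hmod X" "hmod Y" "hmod Z"
 shows "rel3 X Y Z R (%x y z. G y x z) (%x y z. K y x z) (perm213 t)"
 using assms(1) unfolding rel3_def
 by (simp add: sw3_perm213[OF assms(4) tri_act[OF assms(5-7) tri_perm213[OF assms(2)]] assms(3)])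

lemma rel3_perm132:
 assumes "rel3 X Z Y R G K t" "tri k X Z Y R K" "t : HHH" "kmod R"
  and "hmod X" "hmod Y" "hmod Z"
 shows "rel3 X Y Z R (%x y z. G x z y) (%x y z. K x z y) (perm132 t)"
 using assms(1) unfolding rel3_def
 by (simp add: sw3_perm132[OF assms(4) tri_act[OF assms(5-7) tri_perm132[OF assms(2)]] assms(3)])

lemma rel3_perm231:
 assumes "rel3 Y Z X R G K t" "tri k Y Z X R K" "t : HHH" "kmod R"
  and "hmod X" "hmod Y" "hmod Z"
 shows "rel3 X Y Z R (%x y z. G y z x) (%x y z. K y z x) (perm231 t)"
 using assms(1) unfolding rel3_def
 by (simp add: sw3_perm231[OF assms(4) tri_act[OF assms(5-7) tri_perm312[OF assms(2)]] assms(3)])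

lemma rel3_perm312:
 assumes "rel3 Z X Y R G K t" "tri k Z X Y R K" "t : HHH" "kmod R"
  and "hmod X" "hmod Y" "hmod Z"
 shows "rel3 X Y Z R (%x y z. G z x y) (%x y z. K z x y) (perm312 t)"
 using assms(1) unfolding rel3_def
 by (simp add: sw3_perm312[OF assms(4) tri_act[OF assms(5-7) tri_perm231[OF assms(2)]] assms(3)])

subsection \<open>The pentagon\<close>

lemma alg_cancel_l:
 assumes "assoc_algebra k B" "ipair B u u'" "x : B" "y : B" "u \<otimes>\<^bsub>B\<^esub> x = u \<otimes>\<^bsub>B\<^esub> y"
 shows "x = y"
proof -
 interpret B: ring B by (rule alg_ring[OF assms(1)])
 have "u' \<otimes>\<^bsub>B\<^esub> (u \<otimes>\<^bsub>B\<^esub> z) = z" if "z : B" for z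
  using assms(2) that by (simp add: ipair_def flip: B.m_assoc)
 thus ?thesis using assms(3-5) by metis
qed

text \<open>The functions \<open>F1\<close>, \<open>F2\<close>, \<open>F3\<close>, \<open>F4\<close>, \<open>F5\<close> stand for the bracketings \<open>((wx)y)z\<close>, \<open>(w(xy))z\<close>, \<open>w((xy)z)\<close>,
\<open>w(x(yz))\<close>, \<open>(wx)(yz)\<close> of a product of four factors, and the abbreviations for the elements that relate
them. The two paths from \<open>F1\<close> to \<open>F4\<close> are related by the same element, and since all elements involved are
invertible, four sides of the pentagon imply the fifth.\<close>

abbreviation (input) "pLR \<equiv> leg123 ph"
abbreviation (input) "pM \<equiv> cop2 ph"
abbreviation (input) "pRR \<equiv> leg234 ph"
abbreviation (input) "pA \<equiv> cop1 ph"
abbreviation (input) "pB \<equiv> cop3 ph"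

lemmas pent_ipairs = cop_hom[THEN ipair_hom, OF phi_ipair]

lemmas pent_closed = cop_closed[OF phi_closed] cop_closed[OF phiI_closed]

lemma rel4_cancel:
 assumes hm: "hmod W" "hmod X" "hmod Y" "hmod Z" "kmod R"
  and q: "quad k W X Y Z R G" "quad k W X Y Z R K"
  and FK: "rel4 W X Y Z R F K s" and GK: "rel4 W X Y Z R G K t" and tt: "ipair HHHH t t'"
  and s: "s = t *\<^sub>4 u" and u: "u : HHHH"
 shows "rel4 W X Y Z R F G u"
proof -
 interpret H4: ring HHHH by (rule ring_H4)
 have tc: "t : HHHH" "t' : HHHH" using tt by (auto simp: ipair_def)
 have sc: "s : HHHH" using s tc u by simp
 have "rel4 W X Y Z R F G (t' *\<^sub>4 s)"
  by (rule rel4_trans[OF hm q(1) FK rel4_inv[OF hm q(2) GK tt] sc tc(2)])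
 moreover have "t' *\<^sub>4 s = u" using s tt u tc by (simp add: ipair_def flip: H4.m_assoc)
 ultimately show ?thesis by simp
qed

context
 fixes W X Y Z R F2 F3 F4 F5
 assumes hm: "hmod W" "hmod X" "hmod Y" "hmod Z" "kmod R"
  and q: "quad k W X Y Z R F2" "quad k W X Y Z R F3" "quad k W X Y Z R F4" "quad k W X Y Z R F5"
begin

private abbreviation "rl \<equiv> rel4 W X Y Z R"

interpretation H4: ring HHHH by (rule ring_H4)

lemma pent_path3:
 assumes "rl F1 F2 pLR" "rl F2 F3 pM" "rl F3 F4 pRR"
 shows "rl F1 F4 (pB *\<^sub>4 pA)"
proof -
 have "rl F1 F4 (pRR *\<^sub>4 (pM *\<^sub>4 pLR))"
  by (rule rel4_trans[OF hm q(3) rel4_trans[OF hm q(2) assms(1,2)] assms(3)]) (simp_all add: pent_closed)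
 thus ?thesis by (simp add: pentagon' H4.m_assoc pent_closed)
qed

lemma pent_path2:
 assumes "rl F1 F5 pA" "rl F5 F4 pB"
 shows "rl F1 F4 (pRR *\<^sub>4 (pM *\<^sub>4 pLR))"
 using rel4_trans[OF hm q(3) assms] by (simp add: pentagon' H4.m_assoc pent_closed)

lemma pent_15:
 assumes "rl F1 F2 pLR" "rl F2 F3 pM" "rl F3 F4 pRR"
  "rl F5 F4 pB"
 shows "rl F1 F5 pA"
 by (rule rel4_cancel[OF hm q(4,3) pent_path3[OF assms(1-3)] assms(4) pent_ipairs(5) refl pent_closed(3)])

lemma pent_12:
 assumes "rl F2 F3 pM" "rl F3 F4 pRR"
  "rl F1 F5 pA" "rl F5 F4 pB"
 shows "rl F1 F2 pLR"
proof -
 have 1: "rl F1 F3 (pM *\<^sub>4 pLR)"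
  by (rule rel4_cancel[OF hm q(2,3) pent_path2[OF assms(3,4)] assms(2) pent_ipairs(2) refl])
    (simp add: pent_closed)
 show ?thesis by (rule rel4_cancel[OF hm q(1,2) 1 assms(1) pent_ipairs(4) refl pent_closed(1)])
qed

lemma pent_34:
 assumes "rl F1 F2 pLR" "rl F2 F3 pM"
  "rl F1 F5 pA" "rl F5 F4 pB" and F1: "quad k W X Y Z R F1"
 shows "rl F3 F4 pRR"
proof -
 note i21 = rel4_inv[OF hm q(1) assms(1) pent_ipairs(1)] and i32 = rel4_inv[OF hm q(2) assms(2) pent_ipairs(4)]
 have 31: "rl F3 F1 (leg123 phiI *\<^sub>4 cop2 phiI)"
  by (rule rel4_trans[OF hm F1 i32 i21]) (simp_all add: pent_closed)
 have "rl F3 F4 (pRR *\<^sub>4 (pM *\<^sub>4 pLR)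
   *\<^sub>4 (leg123 phiI *\<^sub>4 cop2 phiI))"
  by (rule rel4_trans[OF hm q(3) 31 pent_path2[OF assms(3,4)]]) (simp_all add: pent_closed)
 moreover have "pRR *\<^sub>4 (pM *\<^sub>4 pLR) *\<^sub>4
   (leg123 phiI *\<^sub>4 cop2 phiI) = pRR"
 proof -
  have "pRR *\<^sub>4 (pM *\<^sub>4 pLR) *\<^sub>4 (leg123 phiI *\<^sub>4 cop2 phiI)
   = pRR *\<^sub>4 (pM *\<^sub>4 ((pLR *\<^sub>4 leg123 phiI) *\<^sub>4 cop2 phiI))"
   by (simp add: H4.m_assoc pent_closed)
  thus ?thesis using pent_ipairs(1,4) by (simp add: ipair_def pent_closed)
 qed
 ultimately show ?thesis by simp
qed

lemma pent_54:
 assumes "rl F1 F2 pLR" "rl F2 F3 pM" "rl F3 F4 pRR"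
  "rl F1 F5 pA" and F1: "quad k W X Y Z R F1"
 shows "rl F5 F4 pB"
proof -
 have "rl F5 F4 (pB *\<^sub>4 pA *\<^sub>4 cop1 phiI)"
  by (rule rel4_trans[OF hm q(3) rel4_inv[OF hm q(4) assms(4) pent_ipairs(3)] pent_path3[OF assms(1-3)]])
   (simp_all add: pent_closed)
 thus ?thesis using pent_ipairs(3,5) by (simp add: ipair_def H4.m_assoc)
qed

lemma pent_23:
 assumes "rl F1 F2 pLR" "rl F3 F4 pRR"
  "rl F1 F5 pA" "rl F5 F4 pB" and F1: "quad k W X Y Z R F1"
 shows "rl F2 F3 pM"
proof -
 have 1: "rl F1 F3 (pM *\<^sub>4 pLR)"
  by (rule rel4_cancel[OF hm q(2,3) pent_path2[OF assms(3,4)] assms(2) pent_ipairs(2) refl])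
    (simp add: pent_closed)
 have "rl F2 F3 (pM *\<^sub>4 pLR *\<^sub>4 leg123 phiI)"
  by (rule rel4_trans[OF hm q(2) rel4_inv[OF hm q(1) assms(1) pent_ipairs(1)] 1]) (simp_all add: pent_closed)
 thus ?thesis using pent_ipairs(1,4) by (simp add: ipair_def H4.m_assoc)
qed

end

subsection \<open>Equivariance of trilinear maps\<close>

text \<open>A trilinear map is equivariant for one of the two bracketings of its arguments if \<open>h\<close> acts
 through \<open>c (cop h)\<close> for the corresponding iterated coproduct \<open>c\<close>.\<close>

definition eqt where
 "eqt c V W X R G <-> tri k V W X R G \<and> (\<forall>h\<in>carrier H. \<forall>v\<in>carrier V. \<forall>w\<in>carrier W. \<forall>x\<in>carrier X.
   act R h (G v w x) = sm3 R (c (cop h)) (%a b c. G (act V a v) (act W b w) (act X c x)))"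

abbreviation "eql \<equiv> eqt copl"
abbreviation "eqr \<equiv> eqt copr"

lemma eqt_tri: "eqt c V W X R G ==> tri k V W X R G"
 by (simp add: eqt_def)

lemma eql_left:
 assumes "eqb V W P f" "eqb P X R g" "hmod V" "hmod W" "hmod X" "hmod P" "kmod R"
 shows "eql V W X R (%v w x. g (f v w) x)"
 unfolding eqt_def using tri_left[OF eqb_bil[OF assms(1)] eqb_bil[OF assms(2)]]
 by (simp add: sw3_copl_apply[OF assms(3-7) eqb_bil[OF assms(2)] assms(1)] cop_cl eqb_closed[OF assms(1)]
   eqb_act[OF assms(2)])

lemma eqr_right:
 assumes "eqb W X P f" "eqb V P R g" "hmod V" "hmod W" "hmod X" "hmod P" "kmod R"
 shows "eqr V W X R (%v w x. g v (f w x))"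
 unfolding eqt_def using tri_right[OF eqb_bil[OF assms(1)] eqb_bil[OF assms(2)]]
 by (simp add: sw3_copr_apply[OF assms(3-7) eqb_bil[OF assms(2)] assms(1)] cop_cl eqb_closed[OF assms(1)]
   eqb_act[OF assms(2)])

lemma sw3_act_mult:
 assumes hm: "hmod V" "hmod W" "hmod X" and R: "kmod R" and G: "tri k V W X R G"
  and el: "v : V" "w : W" "x : X" and st: "s : HHH" "t : HHH"
 shows "sm3 R (s *\<^sub>3 t) (%a b c. G (act V a v) (act W b w) (act X c x))
  = sm3 R t (%a b c. sm3 R s (%a' b' c'.
    G (act V a' (act V a v)) (act W b' (act W b w)) (act X c' (act X c x))))"
 unfolding sw3_mult'[OF R tri_act[OF hm G el] st(2,1)]
 by (intro sw3_cong) (simp add: act_mult hm el)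

text \<open>Both sides are obtained from \<open>G\<close> by applying \<open>c (cop h) t = t c' (cop h)\<close>.\<close>

lemma eqt_rel:
 assumes hm: "hmod V" "hmod W" "hmod X" and R: "hmod R" and G: "eqt c V W X R G" and F: "rel3 V W X R F G t" and t: "t : HHH"
  and c: "!!h. h : H ==> c (cop h) : HHH" "!!h. h : H ==> c' (cop h) : HHH"
  and ct: "!!h. h : H ==> c (cop h) *\<^sub>3 t = t *\<^sub>3 c' (cop h)"
 shows "eqt c' V W X R F"
proof -
 note mR = hmod_mod[OF R] and tG = eqt_tri[OF G]
 note r = tri_rel[OF hm mR tG t]
 have tF: "tri k V W X R F"
  by (intro triI lin_cong[OF hmod_mod[OF hm(1)] tri_1[OF r]] lin_cong[OF hmod_mod[OF hm(2)] tri_2[OF r]]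
    lin_cong[OF hmod_mod[OF hm(3)] tri_3[OF r]]) (auto simp: rel3D[OF F])
 show ?thesis unfolding eqt_def
 proof (intro conjI tF ballI)
  fix h v w x assume *: "h : H" "v : V" "w : W" "x : X"
  have "act R h (F v w x) = sm3 R t (%a b c. act R h (G (act V a v) (act W b w) (act X c x)))"
   unfolding rel3D[OF F *(2-4)] by (rule sw3_push[OF mR mR tri_act[OF hm tG *(2-4)] act_lin2[OF R *(1)] t])
  also have "... = sm3 R (t *\<^sub>3 c' (cop h)) (%a b c. G (act V a v) (act W b w) (act X c x))"
   unfolding ct[OF *(1), symmetric] sw3_act_mult[OF hm mR tG *(2-4) c(1)[OF *(1)] t]
   using G by (intro sw3_cong) (simp add: eqt_def * act_closed hm)
  also have "... = sm3 R (c' (cop h)) (%a b c. F (act V a v) (act W b w) (act X c x))"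
   unfolding sw3_act_mult[OF hm mR tG *(2-4) t c(2)[OF *(1)]]
   by (intro sw3_cong) (simp add: rel3D[OF F] * act_closed hm)
  finally show "act R h (F v w x) = sm3 R (c' (cop h)) (%a b c. F (act V a v) (act W b w) (act X c x))" .
 qed
qed

lemma coassoc_inv:
 assumes "h : H"
 shows "copl (cop h) *\<^sub>3 phiI = phiI *\<^sub>3 copr (cop h)"
proof -
 interpret H3: ring HHH by (rule ring_H3)
 note cl = copl_closed[OF cop_cl[OF assms]] copr_closed[OF cop_cl[OF assms]] phi_closed phiI_closed
 have "phiI *\<^sub>3 (copr (cop h) *\<^sub>3 ph) *\<^sub>3 phiI
  = phiI *\<^sub>3 (ph *\<^sub>3 copl (cop h)) *\<^sub>3 phiI"
  by (simp add: coassoc assms)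
 moreover have "phiI *\<^sub>3 (copr (cop h) *\<^sub>3 ph) *\<^sub>3 phiI
  = phiI *\<^sub>3 copr (cop h)"
  using phi_ipair cl by (simp add: ipair_def H3.m_assoc)
 moreover have "phiI *\<^sub>3 (ph *\<^sub>3 copl (cop h)) *\<^sub>3 phiI
  = copl (cop h) *\<^sub>3 phiI"
  using phi_ipair cl by (simp add: ipair_def flip: H3.m_assoc)
 ultimately show ?thesis by simp
qed

text \<open>Rebracketing by \<open>\<phi>\<close> turns one kind of equivariance into the other; this is quasi-coassociativity.\<close>

lemma eql_rel: "hmod V ==> hmod W ==> hmod X ==> hmod R ==> eqr V W X R G ==> rel3 V W X R F G ph ==> eql V W X R F"
 and eqr_rel: "hmod V ==> hmod W ==> hmod X ==> hmod R ==> eql V W X R G ==> rel3 V W X R F G phiI ==> eqr V W X R F"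
 by (rule eqt_rel[where t = "ph" and c = copr] eqt_rel[where t = phiI and c = copl];
  simp add: phi_closed phiI_closed copl_closed copr_closed cop_cl coassoc coassoc_inv)+

end

section \<open>The counit and the antipode\<close>

context quasi_bialgebra
begin

lemma counit_closed: "h : H ==> eps h : k"
 and counit_add: "x : H ==> y : H ==> eps (x \<oplus>\<^bsub>H\<^esub> y) = eps x \<oplus>\<^bsub>k\<^esub> eps y"
 and counit_smult: "c : k ==> x : H ==> eps (c \<odot>\<^bsub>H\<^esub> x) = c \<otimes>\<^bsub>k\<^esub> eps x"
 and counit_mult: "x : H ==> y : H ==> eps (x * y) = eps x \<otimes>\<^bsub>k\<^esub> eps y"
 and counit_one: "eps oneH = \<one>\<^bsub>k\<^esub>"
 using counit_hom by (auto simp: is_alg_hom_def is_lin_def base_module_def)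

lemma counit_scale_bil: "kmod X ==> bil k H X X (%h x. eps h \<odot>\<^bsub>X\<^esub> x)"
proof -
 assume "kmod X" then interpret X: module k X .
 show ?thesis
  by (intro bilI is_linI)
   (simp_all add: counit_closed counit_add counit_smult X.smult_l_distr X.smult_r_distr X.smult_assoc1
     module_smult_comm[OF X.module_axioms])
qed

lemma counit_left_apply:
 assumes X: "kmod X" and g: "klin H X g" and h: "h : H"
 shows "sm2 X (cop h) (%a b. eps a \<odot>\<^bsub>X\<^esub> g b) = g h"
proof -
 have "g (sm2 H (cop h) (%a b. eps a \<odot>\<^bsub>H\<^esub> b))
   = sm2 X (cop h) (%a b. g (eps a \<odot>\<^bsub>H\<^esub> b))"
  by (rule sw2_push[OF mod_H X counit_scale_bil[OF mod_H] g cop_cl[OF h]])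
 also have "... = sm2 X (cop h) (%a b. eps a \<odot>\<^bsub>X\<^esub> g b)"
  by (rule sw2_cong) (simp add: lin_smult[OF g] counit_closed)
 finally show ?thesis using counit_left[OF h] by simp
qed

lemma counit_right_apply:
 assumes X: "kmod X" and g: "klin H X g" and h: "h : H"
 shows "sm2 X (cop h) (%a b. eps b \<odot>\<^bsub>X\<^esub> g a) = g h"
proof -
 have "g (sm2 H (cop h) (%a b. eps b \<odot>\<^bsub>H\<^esub> a))
   = sm2 X (cop h) (%a b. g (eps b \<odot>\<^bsub>H\<^esub> a))"
  by (rule sw2_push[OF mod_H X bil_flip[OF counit_scale_bil[OF mod_H]] g cop_cl[OF h]])
 also have "... = sm2 X (cop h) (%a b. eps b \<odot>\<^bsub>X\<^esub> g a)"
  by (rule sw2_cong) (simp add: lin_smult[OF g] counit_closed)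
 finally show ?thesis using counit_right[OF h] by simp
qed

definition eps2 where "eps2 t = sm3 HH t (%x y z. p2 k H x (eps y \<odot>\<^bsub>H\<^esub> z))"
definition eps3 where "eps3 t = sm3 HH t (%x y z. p2 k H x (eps z \<odot>\<^bsub>H\<^esub> y))"

lemma eps_tri:
 assumes "bil k H H X f"
 shows "tri k H H H X (%x y z. f x (eps y \<odot>\<^bsub>H\<^esub> z))"
  and "tri k H H H X (%x y z. f x (eps z \<odot>\<^bsub>H\<^esub> y))"
 using tri_right[OF counit_scale_bil[OF mod_H] assms] tri_right[OF bil_flip[OF counit_scale_bil[OF mod_H]] assms] .

lemma smult_closed_H: "c : k ==> x : H ==> c \<odot>\<^bsub>H\<^esub> x : H"
 by (rule module_smult_closed[OF mod_H])

lemma smult_mult_smult: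
 assumes "c : k" "d : k" "x : H" "y : H"
 shows "(c \<odot>\<^bsub>H\<^esub> x) * (d \<odot>\<^bsub>H\<^esub> y) = (c \<otimes>\<^bsub>k\<^esub> d) \<odot>\<^bsub>H\<^esub> (x * y)"
 using assms by (simp add: smult_mult_left smult_mult_right smult_closed_H module.smult_assoc1[OF mod_H]
   module_smult_comm[OF mod_H, of d c])

lemma eps_hom: "is_alg_hom k HHH HH eps2" "is_alg_hom k HHH HH eps3"
 unfolding eps2_def[abs_def] eps3_def[abs_def]
 by (rule sw3_hom[OF alg_H2 eps_tri(1)[OF p2_bil]] sw3_hom[OF alg_H2 eps_tri(2)[OF p2_bil]];
  simp add: p2_one counit_one module.smult_one[OF mod_H] p2_mult counit_closed smult_closed_H smult_mult_smult counit_mult)+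

lemma sw2_id: "t : HH ==> sm2 HH t (p2 k H) = t"
 by (induction t rule: H2_induct) (simp_all add: sw2_pure[OF mod_H2 p2_bil] lin_add[OF sw2_lin[OF mod_H2 p2_bil]])

lemma sw3_id: "t : HHH ==> sm3 HHH t (p3 k H) = t"
 by (induction t rule: H3_induct) (simp_all add: sw3_pure[OF mod_H3 p3_tri] lin_add[OF sw3_lin[OF mod_H3 p3_tri]])

lemma eps3_leg12:
 assumes "s : HH"
 shows "eps3 (leg12 s) = s"
 unfolding eps3_def sw3_leg12[OF mod_H2 eps_tri(2)[OF p2_bil] assms]
 using sw2_id[OF assms] sw2_cong[of "%x y. p2 k H x (eps oneH \<odot>\<^bsub>H\<^esub> y)" "p2 k H" "HH" s]
 by (simp add: counit_one module.smult_one[OF mod_H])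

lemma copl_p2: "x : H ==> y : H
  ==> copl (p2 k H x y) = sm2 HHH (cop x) (%a b. p3 k H a b y)"
 unfolding copl_def by (rule sw2_pure[OF mod_H3 bil_cop_l[OF mod_H3 p3_tri]])

lemma copl_one: "copl \<one>\<^bsub>HH\<^esub> = \<one>\<^bsub>HHH\<^esub>"
 unfolding p2_one[symmetric]
 using sw2_pure[OF mod_H3 bil_leg12[OF p3_tri] one_H_closed one_H_closed] by (simp add: copl_p2 comult_one p3_one)

lemma eps_push:
 assumes X: "kmod X" and E: "klin HH X E" and t: "t : HHH"
 shows "E (eps2 t) = sm3 X t (%x y z. E (p2 k H x (eps y \<odot>\<^bsub>H\<^esub> z)))"
  and "E (eps3 t) = sm3 X t (%x y z. E (p2 k H x (eps z \<odot>\<^bsub>H\<^esub> y)))"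
 unfolding eps2_def eps3_def
 by (rule sw3_push[OF mod_H2 X eps_tri(1)[OF p2_bil] E t] sw3_push[OF mod_H2 X eps_tri(2)[OF p2_bil] E t])+

lemma p3_scale:
 assumes "c : k" "x : H" "y : H" "z : H"
 shows "p3 k H x (c \<odot>\<^bsub>H\<^esub> y) z = c \<odot>\<^bsub>HHH\<^esub> p3 k H x y z"
  and "p3 k H x y (c \<odot>\<^bsub>H\<^esub> z) = c \<odot>\<^bsub>HHH\<^esub> p3 k H x y z"
 using assms lin_smult[OF tri_2[OF p3_tri]] lin_smult[OF tri_3[OF p3_tri]] by auto

lemma eps2_phi: "eps2 ph = \<one>\<^bsub>HH\<^esub>"
 using phi_counit by (simp add: eps2_def)

text \<open>The counit axiom for the middle leg of \<open>\<phi>\<close> implies the one for the last leg: apply the counit to the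
 third leg of the pentagon. All factors but one become \<open>\<phi>\<close> or \<open>1\<close>, and \<open>\<phi>\<close> cancels.\<close>

lemma eps3_phi: "eps3 ph = \<one>\<^bsub>HH\<^esub>"
proof -
 let ?f = "%a b c d. p3 k H a b (eps c \<odot>\<^bsub>H\<^esub> d)"
 define E where "E t = sw4 HHH t ?f" for t
 interpret H3: ring HHH by (rule ring_H3)
 have q: "quad k H H H H HHH ?f" by (rule quad_34[OF counit_scale_bil[OF mod_H] p3_tri])
 have em: "E (s *\<^sub>4 t) = E s *\<^sub>3 E t" if s: "s : HHHH" and t: "t : HHHH" for s t
  unfolding E_def sw4_mult[OF mod_H3 q s t] sw4_push[OF mod_H3 mod_H3 q mult_lin(2)[OF alg_H3 sw4_closed[OF mod_H3 q t]] s]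
  by (rule sw4_cong) (simp add: sw4_push[OF mod_H3 mod_H3 q mult_lin(1)[OF alg_H3 quad_closed[OF q]] t] p3_mult counit_closed
   smult_closed_H smult_mult_smult counit_mult cong: sw4_cong)
 note c3 = lin_closed[OF is_alg_hom_lin[OF eps_hom(2)] phi_closed]
 note simps = sw3_id[OF phi_closed] p3_scale counit_closed smult_closed_H
 have E: "E (cop3 ph) = ph" "E (cop1 ph) = copl (eps2 ph)" "E (leg234 ph) = leg23 (eps2 ph)"
  "E (cop2 ph) = ph" "E (leg123 ph) = leg12 (eps3 ph)"
  unfolding E_def sw4_cop[OF mod_H3 q phi_closed] eps_push(1)[OF mod_H3 copl_lin phi_closed]
   eps_push(1)[OF mod_H3 leg_lin(3) phi_closed] eps_push(2)[OF mod_H3 leg_lin(1) phi_closed]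
  by (simp_all add: simps copl_p2 leg12_def leg23_def sw2_pure[OF mod_H3 bil_leg23[OF p3_tri]] sw2_pure[OF mod_H3 bil_leg12[OF p3_tri]]
   counit_left_apply[OF mod_H3 tri_3[OF p3_tri]] counit_right_apply[OF mod_H3 tri_2[OF p3_tri]] cong: sw2_cong sw3_cong)
 have "ph *\<^sub>3 \<one>\<^bsub>HHH\<^esub> = \<one>\<^bsub>HHH\<^esub> *\<^sub>3 ph *\<^sub>3 leg12 (eps3 ph)"
  using arg_cong[OF pentagon', of E]
  by (simp only: em[OF pent_closed(5,3)] em[OF alg_mult_closed[OF alg_H4 pent_closed(2,4)] pent_closed(1)]
   em[OF pent_closed(2,4)] E eps2_phi copl_one leg_one)
 hence "ph *\<^sub>3 leg12 (eps3 ph) = ph *\<^sub>3 \<one>\<^bsub>HHH\<^esub>"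
  by (simp add: phi_closed)
 hence "leg12 (eps3 ph) = \<one>\<^bsub>HHH\<^esub>"
  by (rule alg_cancel_l[OF alg_H3 phi_ipair leg_closed(1)[OF c3] alg_one_closed[OF alg_H3]])
 thus ?thesis using eps3_leg12[OF c3] is_alg_hom_one[OF eps_hom(2)] by simp
qed

text \<open>The counit on the second or third leg turns \<open>\<phi>\<close> and its inverse into \<open>1 \<otimes> 1\<close>.\<close>

lemma eps_apply:
 assumes X: "kmod X" and f: "bil k H H X f" and t: "t = ph \<or> t = phiI"
 shows "sm3 X t (%x y z. eps y \<odot>\<^bsub>X\<^esub> f x z) = f oneH oneH"
  and "sm3 X t (%x y z. eps z \<odot>\<^bsub>X\<^esub> f x y) = f oneH oneH"
proof -
 interpret H2: ring HH by (rule ring_H2)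
 have tc: "t : HHH" using t phi_closed phiI_closed by auto
 have e: "eps2 t = \<one>\<^bsub>HH\<^esub>" "eps3 t = \<one>\<^bsub>HH\<^esub>"
  using t eps_hom[THEN ipair_hom, OF phi_ipair] by (auto simp: ipair_def eps2_phi eps3_phi)
 have 1: "sm2 X \<one>\<^bsub>HH\<^esub> f = f oneH oneH" unfolding p2_one[symmetric] by (simp add: sw2_pure[OF X f])
 show "sm3 X t (%x y z. eps y \<odot>\<^bsub>X\<^esub> f x z) = f oneH oneH"
  "sm3 X t (%x y z. eps z \<odot>\<^bsub>X\<^esub> f x y) = f oneH oneH"
  using eps_push[OF X sw2_lin[OF X f] tc, unfolded e 1]
  by (simp_all add: sw2_pure[OF X f] smult_closed_H counit_closed lin_smult[OF bil_r[OF f]] cong: sw3_cong)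
qed

text \<open>The way in which the axioms for \<open>\<alpha>\<close> and \<open>\<beta>\<close> remove a factor of the pentagon: if the coproduct of a leg
meets \<open>S(h\<^sub>1) \<alpha> h\<^sub>2\<close> or \<open>h\<^sub>1 \<beta> S(h\<^sub>2)\<close> in the summand, only the counit of that leg remains.\<close>

lemma cop_collapse:
 assumes X: "kmod X" and f: "quad k H H H H X f" and t: "t = ph \<or> t = phiI"
 shows "(!!x y z. x : H ==> y : H ==> z : H ==> sm2 X (cop y) (%a b. f x a b z) = eps y \<odot>\<^bsub>X\<^esub> f x oneH oneH z)
   ==> sw4 X (cop2 t) f = f oneH oneH oneH oneH"
  and "(!!x y z. x : H ==> y : H ==> z : H ==> sm2 X (cop z) (%a b. f x y a b) = eps z \<odot>\<^bsub>X\<^esub> f x y oneH oneH)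
   ==> sw4 X (cop3 t) f = f oneH oneH oneH oneH"
proof -
 have tc: "t : HHH" using t phi_closed phiI_closed by auto
 have "bil k H H X (%x z. f x oneH oneH z)" "bil k H H X (%x y. f x y oneH oneH)"
  by (auto intro!: bilI intro: quad_1[OF f] quad_2[OF f] quad_4[OF f])
 note e = this[THEN eps_apply(1)[OF X _ t]] this[THEN eps_apply(2)[OF X _ t]]
 show "(!!x y z. x : H ==> y : H ==> z : H ==> sm2 X (cop y) (%a b. f x a b z) = eps y \<odot>\<^bsub>X\<^esub> f x oneH oneH z)
   ==> sw4 X (cop2 t) f = f oneH oneH oneH oneH"
  unfolding sw4_cop2[OF X f tc] e(1)[symmetric] by (rule sw3_cong)
 show "(!!x y z. x : H ==> y : H ==> z : H ==> sm2 X (cop z) (%a b. f x y a b) = eps z \<odot>\<^bsub>X\<^esub> f x y oneH oneH)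
   ==> sw4 X (cop3 t) f = f oneH oneH oneH oneH"
  unfolding sw4_cop3[OF X f tc] e(4)[symmetric] by (rule sw3_cong)
qed

lemma sw2_sw3_swap:
 assumes X: "kmod X" and s: "s : HH" and t: "t : HHH"
  and F2: "!!a b c. a : H ==> b : H ==> c : H ==> bil k H H X (%x y. F x y a b c)"
  and F3: "!!x y. x : H ==> y : H ==> tri k H H H X (%a b c. F x y a b c)"
 shows "sm2 X s (%x y. sm3 X t (%a b c. F x y a b c))
  = sm3 X t (%a b c. sm2 X s (%x y. F x y a b c))"
proof -
 have in2: "bil k H H X (%x y. sm3 X t (%a b c. F x y a b c))" if "t : HHH" for t
  by (rule bilI; rule sw3_param_lin[OF X mod_H that]) (auto intro: F3 bil_l[OF F2] bil_r[OF F2])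
 have in3: "tri k H H H X (%a b c. sm2 X s (%x y. F x y a b c))"
  by (rule triI; rule sw2_param_lin[OF X mod_H s]) (auto intro: F2 tri_1[OF F3] tri_2[OF F3] tri_3[OF F3])
 show ?thesis using t
 proof (induction t rule: H3_induct)
  case (pure a b c)
  thus ?case using F3 by (simp add: sw3_pure[OF X in3] sw3_pure[OF X] cong: sw2_cong)
 next
  case (add t t')
  have "klin HHH X (%t. sm2 X s (%x y. sm3 X t (%a b c. F x y a b c)))"
   by (rule sw2_param_lin[OF X mod_H3 s in2]) (auto intro: sw3_lin[OF X F3])
  from lin_add[OF this add(1,2)] add(3,4) show ?case
   by (simp add: lin_add[OF sw3_lin[OF X in3] add(1,2)])
 qed
qed

end

context quasi_Hopf_algebra
begin

abbreviation "aS \<equiv> antip H"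

lemma antip_closed: "x : H ==> aS x : H"
 by (rule lin_closed[OF antip_lin])

lemma alpha_bil: "bil k H H H (%a b. aS a * alpha H * b)"
 by (rule bilI)
  (auto intro!: mult_lin(1)[OF alg_H] lin_comp[OF lin_comp[OF antip_lin mult_lin(2)[OF alg_H]] mult_lin(2)[OF alg_H]]
   simp: antip_closed alpha_closed)

lemma beta_bil: "bil k H H H (%a b. a * beta H * aS b)"
 by (rule bilI)
  (auto intro!: lin_comp[OF antip_lin mult_lin(1)[OF alg_H]] lin_comp[OF mult_lin(2)[OF alg_H] mult_lin(2)[OF alg_H]]
   simp: antip_closed beta_closed)

lemma alpha_collapse:
 assumes X: "kmod X" and g: "klin H X g" and h: "h : H"
 shows "sm2 X (cop h) (%a b. g (aS a * alpha H * b)) = eps h \<odot>\<^bsub>X\<^esub> g (alpha H)"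
 using sw2_push[OF mod_H X alpha_bil g cop_cl[OF h]] antip_alpha[OF h]
 by (simp add: lin_smult[OF g] counit_closed h alpha_closed)

lemma beta_collapse:
 assumes X: "kmod X" and g: "klin H X g" and h: "h : H"
 shows "sm2 X (cop h) (%a b. g (a * beta H * aS b)) = eps h \<odot>\<^bsub>X\<^esub> g (beta H)"
 using sw2_push[OF mod_H X beta_bil g cop_cl[OF h]] antip_beta[OF h]
 by (simp add: lin_smult[OF g] counit_closed h beta_closed)

end

section \<open>The internal hom of modules\<close>

context quasi_bialgebra
begin

lemma mk_hmod_simps:
 "carrier (mk_hmod M a) = carrier M" "add (mk_hmod M a) = add M" "zero (mk_hmod M a) = zero M"
 "smult (mk_hmod M a) = smult M" "act (mk_hmod M a) = a"
 by (simp_all add: mk_hmod_def)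

lemma module_mk_hmod: "kmod M ==> kmod (mk_hmod M a)"
 by (rule module_cong) (simp_all add: mk_hmod_simps)

lemma lm_simps:
 "carrier (lin_module k V W) = lin k V W" "zero (lin_module k V W) = (\<lambda>v\<in>carrier V. \<zero>\<^bsub>W\<^esub>)"
 "add (lin_module k V W) = (%L L'. \<lambda>v\<in>carrier V. L v \<oplus>\<^bsub>W\<^esub> L' v)"
 "smult (lin_module k V W) = (%c L. \<lambda>v\<in>carrier V. c \<odot>\<^bsub>W\<^esub> L v)"
 by (simp_all add: lin_module_def)

lemma lin_is_lin: "L \<in> lin k V W ==> klin V W L"
 by (simp add: lin_def)

lemma lin_restrictI: "kmod V ==> klin V W f ==> (\<lambda>v\<in>carrier V. f v) \<in> lin k V W"
 by (auto simp: lin_def intro: lin_cong)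

lemma lin_module_module:
 assumes V: "kmod V" and W: "kmod W"
 shows "kmod (lin_module k V W)"
proof -
 interpret W: module k W by fact
 have cl: "L v : W" if "L \<in> lin k V W" "v : V" for L v
  using lin_closed[OF lin_is_lin[OF that(1)] that(2)] .
 show ?thesis
 proof (rule moduleI)
  show "cring k" by (rule module_cring[OF V])
  show "abelian_group (lin_module k V W)"
  proof (rule abelian_groupI, unfold lm_simps)
   fix L assume L: "L \<in> lin k V W"
   have "(\<lambda>v\<in>carrier V. \<ominus>\<^bsub>W\<^esub> L v) \<in> lin k V W"
    by (rule lin_restrictI[OF V], rule lin_cong[OF V lin_minusf[OF W lin_zerof[OF W] lin_is_lin[OF L]]])
     (simp add: a_minus_def cl[OF L])
   moreover have "(\<lambda>v\<in>carrier V. (\<lambda>v\<in>carrier V. \<ominus>\<^bsub>W\<^esub> L v) v \<oplus>\<^bsub>W\<^esub> L v) = (\<lambda>v\<in>carrier V. \<zero>\<^bsub>W\<^esub>)"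
    by (rule restrict_ext) (simp add: W.l_neg cl[OF L])
   ultimately show "\<exists>L'\<in>lin k V W. (\<lambda>v\<in>carrier V. L' v \<oplus>\<^bsub>W\<^esub> L v) = (\<lambda>v\<in>carrier V. \<zero>\<^bsub>W\<^esub>)" by blast
  next
   fix L assume L: "L \<in> lin k V W"
   show "(\<lambda>v\<in>carrier V. (\<lambda>v\<in>carrier V. \<zero>\<^bsub>W\<^esub>) v \<oplus>\<^bsub>W\<^esub> L v) = L"
   proof (rule extensionalityI[where A = "carrier V"])
    show "L \<in> extensional (carrier V)" using L by (simp add: lin_def)
   qed (simp_all add: cl[OF L])
  qed (auto intro!: lin_restrictI[OF V] lin_addf lin_zerof restrict_ext simp: lin_is_lin W cl W.a_ac)
 next
  fix L assume "L : lin_module k V W"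
  hence L: "L \<in> lin k V W" by (simp add: lm_simps)
  show "\<one>\<^bsub>k\<^esub> \<odot>\<^bsub>lin_module k V W\<^esub> L = L" unfolding lm_simps
  proof (rule extensionalityI[where A = "carrier V"])
   show "L \<in> extensional (carrier V)" using L by (simp add: lin_def)
  qed (simp_all add: cl[OF L])
 qed (auto intro!: lin_restrictI[OF V] lin_smultf restrict_ext
    simp: lm_simps lin_is_lin W cl W.smult_l_distr W.smult_r_distr W.smult_assoc1)
qed

lemma lin_into_lin_module:
 assumes "!!u. u : U ==> f u \<in> lin k V W" "!!v. v : V ==> klin U W (%u. f u v)" "kmod U"
 shows "klin U (lin_module k V W) f"
proof (rule is_linI)
 fix x y assume *: "x : U" "y : U"
 have "f (x \<oplus>\<^bsub>U\<^esub> y) \<in> extensional (carrier V)" using assms(1) * module_add_closed[OF assms(3)] by (auto simp: lin_def)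
 thus "f (x \<oplus>\<^bsub>U\<^esub> y) = f x \<oplus>\<^bsub>lin_module k V W\<^esub> f y"
  unfolding lm_simps by (rule extensionalityI) (auto simp: lin_add[OF assms(2)] *)
next
 fix c x assume *: "c : k" "x : U"
 have "f (c \<odot>\<^bsub>U\<^esub> x) \<in> extensional (carrier V)" using assms(1) * module_smult_closed[OF assms(3)] by (auto simp: lin_def)
 thus "f (c \<odot>\<^bsub>U\<^esub> x) = c \<odot>\<^bsub>lin_module k V W\<^esub> f x"
  unfolding lm_simps by (rule extensionalityI) (auto simp: lin_smult[OF assms(2)] *)
qed (simp add: lm_simps assms)

lemma lin_module_eval_lin: "v : V ==> klin (lin_module k V W) W (%L. L v)"
 by (auto intro!: is_linI simp: lm_simps lin_def is_lin_def)

end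

context quasi_Hopf_algebra
begin

text \<open>The summands of the action of \<open>H\<close> on the internal hom.\<close>

definition cj where "cj V W a b L = (\<lambda>v\<in>carrier V. act W a (L (act V (aS b) v)))"

lemma cj_lin:
 assumes "hmod V" "hmod W" "a : H" "b : H" "L \<in> lin k V W"
 shows "cj V W a b L \<in> lin k V W"
 unfolding cj_def
 by (rule lin_restrictI[OF hmod_mod[OF assms(1)]
   lin_comp[OF lin_comp[OF act_lin2[OF assms(1)] lin_is_lin[OF assms(5)]] act_lin2[OF assms(2,3)]]])
  (simp add: antip_closed assms)

lemma eval_bil:
 assumes V: "hmod V" and W: "hmod W" and L: "klin V W L" and v: "v : V"
 shows "bil k H H W (%a b. act W a (L (act V (aS b) v)))"
 by (rule bil_comp[OF act_bil[OF W] lin_id lin_comp[OF lin_comp[OF antip_lin act_lin1[OF V v]] L]])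

lemma cj_bil:
 assumes V: "hmod V" and W: "hmod W" and L: "L \<in> lin k V W"
 shows "bil k H H (lin_module k V W) (%a b. cj V W a b L)"
proof -
 have *: "klin H W (%a. cj V W a b L v)" "klin H W (%b. cj V W a b L v)"
  if "v : V" "a : H" "b : H" for v a b
  using bil_l[OF eval_bil[OF V W lin_is_lin[OF L] that(1)] that(3)]
   bil_r[OF eval_bil[OF V W lin_is_lin[OF L] that(1)] that(2)] that(1)
  by (simp_all add: cj_def)
 show ?thesis
  by (rule bilI; rule lin_into_lin_module[OF _ _ mod_H]) (auto intro: cj_lin[OF V W] L *)
qed

lemma hhom_simps:
 "carrier (hh V W) = lin k V W" "add (hh V W) = add (lin_module k V W)"
 "zero (hh V W) = zero (lin_module k V W)" "smult (hh V W) = smult (lin_module k V W)"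
 by (simp_all add: hhom_def mk_hmod_simps lm_simps)

lemma lin_hhom:
 "klin (hh V W) X f <-> klin (lin_module k V W) X f"
 "klin X (hh V W) g <-> klin X (lin_module k V W) g"
 by (simp_all add: is_lin_def hhom_simps lm_simps)

lemma hhom_act: "act (hh V W) h L = sm2 (lin_module k V W) (cop h) (%a b. cj V W a b L)"
 by (simp add: hhom_def mk_hmod_simps cj_def)

lemma hhom_act_eval:
 assumes V: "hmod V" and W: "hmod W" and L: "L \<in> lin k V W" and h: "h : H" and v: "v : V"
 shows "act (hh V W) h L v = sm2 W (cop h) (%a b. act W a (L (act V (aS b) v)))"
 unfolding hhom_act
  sw2_push[OF lin_module_module[OF hmod_mod[OF V] hmod_mod[OF W]] hmod_mod[OF W] cj_bil[OF V W L]
   lin_module_eval_lin[OF v] cop_cl[OF h]]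
 by (rule sw2_cong) (simp add: cj_def v)

lemma hhom_hmod:
 assumes V: "hmod V" and W: "hmod W"
 shows "hmod (hh V W)"
proof -
 note mV = hmod_mod[OF V] and mW = hmod_mod[OF W]
 note mL = lin_module_module[OF mV mW]
 have mh: "kmod (hh V W)" unfolding hhom_def by (rule module_mk_hmod[OF mL])
 have cl: "act (hh V W) h L \<in> lin k V W" if "h : H" "L \<in> lin k V W" for h L
  unfolding hhom_act using sw2_closed[OF mL cj_bil[OF V W that(2)] cop_cl[OF that(1)]]
  by (simp add: lm_simps)
 have lin2: "klin (hh V W) (hh V W) (act (hh V W) h)" if h: "h : H" for h
  unfolding lin_hhom
 proof (rule lin_into_lin_module)
  fix v assume v: "v : V"
  have *: "klin (lin_module k V W) W (%L. act W a (L (act V (aS b) v)))"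
   if "a : H" "b : H" for a b
   using that by (intro lin_comp[OF lin_module_eval_lin act_lin2[OF W]])
    (simp_all add: act_closed[OF V] antip_closed v)
  have "klin (lin_module k V W) W (%L. sm2 W (cop h) (%a b. act W a (L (act V (aS b) v))))"
   by (rule sw2_param_lin[OF mW mL cop_cl[OF h]])
    (auto intro: * eval_bil[OF V W] simp: lm_simps lin_is_lin v)
  thus "klin (lin_module k V W) W (%L. act (hh V W) h L v)"
   by (rule lin_cong[OF mL]) (simp add: hhom_act_eval[OF V W _ h v] lm_simps)
 qed (simp_all add: lm_simps cl h mL)
 have lin1: "klin H (hh V W) (%h. act (hh V W) h L)" if L: "L \<in> lin k V W" for L
  unfolding lin_hhom hhom_act by (rule sw2_comult_lin[OF mL cj_bil[OF V W L]])
 have mult: "act (hh V W) (g * h) L = act (hh V W) g (act (hh V W) h L)"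
  if g: "g : H" and h: "h : H" and L: "L \<in> lin k V W" for g h L
 proof (rule lin_eqI[OF cl[OF _ L] cl[OF g cl[OF h L]]])
  show "g * h : H" using g h by simp
  fix v assume v: "v : V"
  have "act (hh V W) (g * h) L v
   = sm2 W (cop g) (%a b. sm2 W (cop h) (%c d.
     act W (a * c) (L (act V (aS (b * d)) v))))"
   using g h by (simp add: hhom_act_eval[OF V W L _ v] comult_mult
     sw2_mult[OF mW eval_bil[OF V W lin_is_lin[OF L] v]] cop_cl)
  also have "... = sm2 W (cop g) (%a b. act W a (act (hh V W) h L (act V (aS b) v)))"
  proof (rule sw2_cong, goal_cases)
   case (1 a b)
   have v': "act V (aS b) v : V" using 1 v by (simp add: act_closed[OF V] antip_closed)
   have "act W a (act (hh V W) h L (act V (aS b) v))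
     = sm2 W (cop h) (%c d. act W a (act W c (L (act V (aS d) (act V (aS b) v)))))"
    unfolding hhom_act_eval[OF V W L h v']
    by (rule sw2_push[OF mW mW eval_bil[OF V W lin_is_lin[OF L] v'] act_lin2[OF W 1(1)] cop_cl[OF h]])
   also have "... = sm2 W (cop h) (%c d. act W (a * c) (L (act V (aS (b * d)) v)))"
    using 1 v by (intro sw2_cong)
     (simp add: act_mult[OF W] antip_mult act_mult[OF V] antip_closed act_closed[OF V] lin_closed[OF lin_is_lin[OF L]])
   finally show ?case by simp
  qed
  also have "... = act (hh V W) g (act (hh V W) h L) v"
   by (simp add: hhom_act_eval[OF V W cl[OF h L] g v])
  finally show "act (hh V W) (g * h) L v = act (hh V W) g (act (hh V W) h L) v" .
 qed
 have one: "act (hh V W) oneH L = L" if L: "L \<in> lin k V W" for L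
  by (rule lin_eqI[OF cl[OF one_H_closed L] L])
   (simp add: hhom_act_eval[OF V W L] comult_one sw2_pure[OF mW eval_bil[OF V W lin_is_lin[OF L]]]
    antip_one act_one[OF V] act_one[OF W] lin_closed[OF lin_is_lin[OF L]])
 show ?thesis unfolding is_hmod_def using mh lin2 lin1 mult one by (auto simp: hhom_simps)
qed

text \<open>Evaluation on elements, and the map \<open>M \<rightarrow> hom(V, W)\<close> whose evaluation is to be a given product
\<open>p : M \<times> V \<rightarrow> W\<close>. Applied to evaluation itself, the second formula recovers a linear map from the
evaluations of its translates.\<close>

definition evp where
 "evp V W L v = sm3 W ph (%a b c. act W a (L (act V (aS b * alpha H * c) v)))"

definition cur where
 "cur M V W p m = (\<lambda>v\<in>carrier V. sm3 W phiI (%a b c.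
   p (act M a m) (act V (b * beta H * aS c) v)))"

lemma evp_tri:
 assumes V: "hmod V" and W: "hmod W" and L: "klin V W L" and v: "v : V"
 shows "tri k H H H W (%a b c. act W a (L (act V (aS b * alpha H * c) v)))"
 by (rule tri_right[OF bil_lin[OF lin_comp[OF act_lin1[OF V v] L] alpha_bil] act_bil[OF W]])

lemma cur_tri:
 assumes M: "hmod M" and V: "hmod V" and p: "bil k M V W p" and m: "m : M" and v: "v : V"
 shows "tri k H H H W (%a b c. p (act M a m) (act V (b * beta H * aS c) v))"
 by (rule tri_right[OF bil_lin[OF act_lin1[OF V v] beta_bil] bil_comp[OF p act_lin1[OF M m] lin_id]])

lemma closed_abS: "b : H ==> c : H ==> aS b * alpha H * c : H"
 "b : H ==> c : H ==> b * beta H * aS c : H"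
 by (simp_all add: antip_closed alpha_closed beta_closed)

lemma evp_bil:
 assumes V: "hmod V" and W: "hmod W"
 shows "bil k (hh V W) V W (evp V W)"
proof (rule bilI)
 note mV = hmod_mod[OF V] and mW = hmod_mod[OF W]
 fix L assume "L : hh V W"
 hence L: "klin V W L" by (simp add: hhom_simps lin_is_lin)
 show "klin V W (%v. evp V W L v)" unfolding evp_def
  by (rule sw3_param_lin[OF mW mV phi_closed])
   (auto intro!: evp_tri[OF V W L] lin_comp[OF lin_comp[OF act_lin2[OF V] L] act_lin2[OF W]] closed_abS)
next
 note mV = hmod_mod[OF V] and mW = hmod_mod[OF W]
 fix v assume v: "v : V"
 show "klin (hh V W) W (%L. evp V W L v)" unfolding evp_def lin_hhom
  by (rule sw3_param_lin[OF mW lin_module_module[OF mV mW] phi_closed])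
   (auto intro!: evp_tri[OF V W lin_is_lin v] lin_comp[OF lin_module_eval_lin act_lin2[OF W]] closed_abS
    act_closed[OF V] v simp: lm_simps)
qed

lemma evp_cj:
 assumes V: "hmod V" and W: "hmod W" and L: "L \<in> lin k V W" and v: "v : V"
  and h: "a : H" "b : H" "c : H"
 shows "evp V W (cj V W a b L) (act V c v)
  = sm3 W ph (%x y z. act W (x * a) (L (act V (aS (y * b) * alpha H * (z * c)) v)))"
 unfolding evp_def
proof (rule sw3_cong, goal_cases)
 case (1 x y z)
 have "act V (aS b) (act V (aS y * alpha H * z) (act V c v))
   = act V (aS b * (aS y * alpha H * z * c)) v"
  using 1 h v by (simp add: act_mult[OF V] antip_closed alpha_closed act_closed[OF V])
 also have "aS b * (aS y * alpha H * z * c)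
   = aS (y * b) * alpha H * (z * c)"
  using 1 h by (simp add: antip_mult antip_closed alpha_closed m_assoc)
 finally show ?case using 1 h v
  by (simp add: cj_def act_mult[OF W] act_closed[OF V] antip_closed alpha_closed lin_closed[OF lin_is_lin[OF L]])
qed

lemma evp_act:
 assumes V: "hmod V" and W: "hmod W" and L: "L \<in> lin k V W" and v: "v : V"
  and h: "h : H" and c: "c : H"
 shows "evp V W (act (hh V W) h L) (act V c v)
  = sm2 W (cop h) (%a b. sm3 W ph (%x y z. act W (x * a)
    (L (act V (aS (y * b) * alpha H * (z * c)) v))))"
proof -
 note mV = hmod_mod[OF V] and mW = hmod_mod[OF W]
 have "klin (lin_module k V W) W (%L. evp V W L (act V c v))"
  using bil_l[OF evp_bil[OF V W] act_closed[OF V c v]] by (simp add: lin_hhom)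
 from sw2_push[OF lin_module_module[OF mV mW] mW cj_bil[OF V W L] this cop_cl[OF h]]
 show ?thesis unfolding hhom_act using evp_cj[OF V W L v _ _ c] by (simp cong: sw2_cong)
qed

text \<open>Quasi-coassociativity moves the two coproducts of \<open>h\<close> to the left of \<open>\<phi>\<close>, where two legs meet in
\<open>S(h\<^sub>1) \<alpha> h\<^sub>2 = \<epsilon>(h) \<alpha>\<close>.\<close>

lemma evp_eqb:
 assumes V: "hmod V" and W: "hmod W"
 shows "eqb (hh V W) V W (evp V W)"
 unfolding eqb_def
proof (intro conjI evp_bil[OF V W] ballI)
 fix h L v assume h: "h : H" and "L : hh V W" and v: "v : V"
 hence L: "L \<in> lin k V W" by (simp add: hhom_simps)
 note l = lin_is_lin[OF L] and mV = hmod_mod[OF V] and mW = hmod_mod[OF W]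
 let ?T = "%a b c. act W a (L (act V (aS b * alpha H * c) v))"
 note T = evp_tri[OF V W l v]
 note cl = copl_closed[OF cop_cl[OF h]] copr_closed[OF cop_cl[OF h]]
 have "sm2 W (cop h) (%a b. evp V W (act (hh V W) a L) (act V b v))
  = sm2 W (cop h) (%a c. sm2 W (cop a) (%a b. sm3 W ph (%x y z.
    ?T (x * a) (y * b) (z * c))))"
  by (rule sw2_cong) (rule evp_act[OF V W L v])
 also have "... = sm3 W (ph *\<^sub>3 copl (cop h)) ?T"
  unfolding sw3_mult'[OF mW T cl(1) phi_closed]
  using sw3_copl[OF mW sw3_mult'_inner[OF mW T phi_closed] cop_cl[OF h]] by simp
 also have "... = sm3 W (copr (cop h) *\<^sub>3 ph) ?T" by (simp add: coassoc h)
 also have "... = sm3 W ph (%x y z. sm3 W (copr (cop h)) (%a b c.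
    ?T (a * x) (b * y) (c * z)))"
  by (rule sw3_mult'[OF mW T phi_closed cl(2)])
 also have "... = sm3 W ph (%x y z. act W h (?T x y z))"
 proof (rule sw3_cong, goal_cases)
  case (1 x y z)
  have "sm3 W (copr (cop h)) (%a b c. ?T (a * x) (b * y) (c * z))
   = sm2 W (cop h) (%a b. sm2 W (cop b) (%c d. ?T (a * x) (c * y) (d * z)))"
   by (rule sw3_copr[OF mW _ cop_cl[OF h]])
    (rule tri_comp[OF T mult_lin(2)[OF alg_H 1(1)] mult_lin(2)[OF alg_H 1(2)] mult_lin(2)[OF alg_H 1(3)]])
  also have "... = sm2 W (cop h) (%a b. eps b \<odot>\<^bsub>W\<^esub> ?T (a * x) y z)"
  proof (rule sw2_cong, goal_cases)
   case (1 a b)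
   let ?g = "%u. act W (a * x) (L (act V (aS y * u * z) v))"
   have g: "klin H W ?g"
    using 1 \<open>x : H\<close> \<open>y : H\<close> \<open>z : H\<close>
    by (intro lin_comp[OF lin_comp[OF mult_lin(1)[OF alg_H] mult_lin(2)[OF alg_H]]
      lin_comp[OF lin_comp[OF act_lin1[OF V v] l] act_lin2[OF W]]]) (simp_all add: antip_closed)
   have "sm2 W (cop b) (%c d. ?T (a * x) (c * y) (d * z))
     = sm2 W (cop b) (%c d. ?g (aS c * alpha H * d))"
    using \<open>y : H\<close> \<open>z : H\<close>
    by (intro sw2_cong) (simp add: antip_mult antip_closed alpha_closed m_assoc)
   thus ?case using alpha_collapse[OF mW g 1(2)] by simp
  qed
  also have "... = ?T (h * x) y z"
   by (rule counit_right_apply[OF mW lin_comp[OF mult_lin(2)[OF alg_H 1(1)] tri_1[OF T 1(2,3)]] h])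
  also have "... = act W h (?T x y z)"
   using h 1 v by (simp add: act_mult[OF W] antip_closed alpha_closed act_closed[OF V] lin_closed[OF l])
  finally show ?case .
 qed
 also have "... = act W h (evp V W L v)"
  unfolding evp_def by (rule sw3_push[OF mW mW T act_lin2[OF W h] phi_closed, symmetric])
 finally show "act W h (evp V W L v)
   = sm2 W (cop h) (%a b. evp V W (act (hh V W) a L) (act V b v))" by simp
qed

text \<open>The pentagon solved for the two products of \<open>\<phi>\<close> and its inverse that occur when an evaluation follows a
currying, and when a currying follows an evaluation.\<close>

lemma pent_inv1:
 "cop1 ph *\<^sub>4 leg123 phiI
  = cop3 phiI *\<^sub>4 (leg234 ph *\<^sub>4 cop2 ph)"
proof -
 interpret H4: ring HHHH by (rule ring_H4)
 have "cop3 phiI *\<^sub>4 (cop3 ph *\<^sub>4 cop1 ph) *\<^sub>4 leg123 phiI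
  = cop1 ph *\<^sub>4 leg123 phiI"
  using pent_ipairs(5) by (simp add: ipair_def pent_closed flip: H4.m_assoc)
 moreover have "cop3 phiI *\<^sub>4 (leg234 ph *\<^sub>4 cop2 ph *\<^sub>4 leg123 ph)
   *\<^sub>4 leg123 phiI
  = cop3 phiI *\<^sub>4 (leg234 ph *\<^sub>4 cop2 ph)"
  using pent_ipairs(1) by (simp add: ipair_def pent_closed H4.m_assoc)
 ultimately show ?thesis by (simp add: pentagon')
qed

lemma pent_inv2:
 "leg123 ph *\<^sub>4 cop1 phiI
  = cop2 phiI *\<^sub>4 (leg234 phiI *\<^sub>4 cop3 ph)"
proof -
 interpret H4: ring HHHH by (rule ring_H4)
 let ?l = "cop2 phiI *\<^sub>4 leg234 phiI"
 have l: "?l *\<^sub>4 (leg234 ph *\<^sub>4 cop2 ph *\<^sub>4 leg123 ph) = leg123 ph"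
 proof -
  have "?l *\<^sub>4 (leg234 ph *\<^sub>4 cop2 ph *\<^sub>4 leg123 ph)
   = cop2 phiI *\<^sub>4 ((leg234 phiI *\<^sub>4 leg234 ph) *\<^sub>4 cop2 ph)
     *\<^sub>4 leg123 ph"
   by (simp add: pent_closed H4.m_assoc)
  thus ?thesis using pent_ipairs(2,4) by (simp add: ipair_def pent_closed)
 qed
 have "?l *\<^sub>4 (cop3 ph *\<^sub>4 cop1 ph) *\<^sub>4 cop1 phiI
  = leg123 ph *\<^sub>4 cop1 phiI"
  by (simp only: pentagon' l)
 moreover have "?l *\<^sub>4 (cop3 ph *\<^sub>4 cop1 ph) *\<^sub>4 cop1 phiI
  = ?l *\<^sub>4 cop3 ph"
  using pent_ipairs(3) by (simp add: ipair_def pent_closed H4.m_assoc)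
 ultimately show ?thesis by (simp add: pent_closed H4.m_assoc)
qed

lemma phi_disj: "ph = ph \<or> ph = phiI" "phiI = ph \<or> phiI = phiI"
 by simp_all

lemma cur_closed:
 assumes M: "hmod M" and V: "hmod V" and W: "kmod W" and p: "bil k M V W p" and m: "m : M"
 shows "cur M V W p m \<in> lin k V W"
 unfolding cur_def
 by (rule lin_restrictI[OF hmod_mod[OF V] sw3_param_lin[OF W hmod_mod[OF V] phiI_closed]])
  (auto intro!: cur_tri[OF M V p m] lin_comp[OF act_lin2[OF V] bil_r[OF p]] closed_abS act_closed[OF M] m)

lemma cur_lin:
 assumes M: "hmod M" and V: "hmod V" and W: "kmod W" and p: "bil k M V W p"
 shows "klin M (hh V W) (cur M V W p)"
 unfolding lin_hhom
proof (rule lin_into_lin_module[OF cur_closed[OF M V W p] _ hmod_mod[OF M]])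
 fix v assume v: "v : V"
 have "klin M W (%m. sm3 W phiI (%a b c.
   p (act M a m) (act V (b * beta H * aS c) v)))"
  by (rule sw3_param_lin[OF W hmod_mod[OF M] phiI_closed])
   (auto intro!: cur_tri[OF M V p _ v] lin_comp[OF act_lin2[OF M] bil_l[OF p]] closed_abS act_closed[OF V] v)
 thus "klin M W (%m. cur M V W p m v)" by (simp add: cur_def v)
qed

text \<open>The mirror image of the equivariance of evaluation: now two legs meet in \<open>h\<^sub>1 \<beta> S(h\<^sub>2) = \<epsilon>(h) \<beta>\<close>.\<close>

lemma cur_act:
 assumes M: "hmod M" and V: "hmod V" and W: "hmod W" and p: "eqb M V W p"
  and m: "m : M" and h: "h : H"
 shows "cur M V W p (act M h m) = act (hh V W) h (cur M V W p m)"
proof (rule lin_eqI[where k = k and V = V and W = W])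
 note mW = hmod_mod[OF W] and pb = eqb_bil[OF p]
 note cc = cur_closed[OF M V mW pb]
 show "cur M V W p (act M h m) \<in> lin k V W" by (rule cc[OF act_closed[OF M h m]])
 show "act (hh V W) h (cur M V W p m) \<in> lin k V W"
  using act_closed[OF hhom_hmod[OF V W] h] cc[OF m] by (simp add: hhom_simps)
 fix v assume v: "v : V"
 let ?P = "%a b c. p (act M a m) (act V (b * beta H * aS c) v)"
 note P = cur_tri[OF M V pb m v]
 note cl = copl_closed[OF cop_cl[OF h]] copr_closed[OF cop_cl[OF h]]
 have pl: "bil k M V W p" by (rule pb)
 have "act (hh V W) h (cur M V W p m) v
  = sm2 W (cop h) (%x y. act W x (sm3 W phiI (%a b c.
    p (act M a m) (act V (b * beta H * aS c) (act V (aS y) v)))))"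
  unfolding hhom_act_eval[OF V W cc[OF m] h v]
  by (rule sw2_cong) (simp add: cur_def act_closed[OF V] antip_closed v)
 also have "... = sm2 W (cop h) (%x y. sm3 W phiI (%a b c.
    sm2 W (cop x) (%x1 x2. ?P (x1 * a) (x2 * b) (y * c))))"
 proof (rule sw2_cong, goal_cases)
  case (1 x y)
  have v': "act V (aS y) v : V" using 1 v by (simp add: act_closed[OF V] antip_closed)
  show ?case
   unfolding sw3_push[OF mW mW cur_tri[OF M V pb m v'] act_lin2[OF W 1(1)] phiI_closed]
  proof (rule sw3_cong, goal_cases)
   case (1 a b c)
   have "act V x2 (act V (b * beta H * aS c) (act V (aS y) v))
     = act V (x2 * b * beta H * aS (y * c)) v" if "x2 : H" for x2
   proof -
    have "x2 * b * beta H * aS (y * c)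
     = x2 * ((b * beta H * aS c) * aS y)"
     using that 1 \<open>y : H\<close> by (simp add: antip_mult antip_closed beta_closed m_assoc)
    thus ?thesis using that 1 \<open>y : H\<close> v
     by (simp add: act_mult[OF V] antip_closed beta_closed act_closed[OF V])
   qed
   thus ?case using 1 \<open>x : H\<close> v'
    by (simp add: eqb_act[OF p] act_closed[OF M] act_closed[OF V] closed_abS m act_mult[OF M] cong: sw2_cong)
  qed
 qed
 also have "... = sm2 W (cop h) (%x y. sm2 W (cop x) (%x1 x2.
    sm3 W phiI (%a b c. ?P (x1 * a) (x2 * b) (y * c))))"
 proof (rule sw2_cong, goal_cases)
  case (1 x y)
  show ?case
  proof (rule sw2_sw3_swap[OF mW cop_cl[OF 1(1)] phiI_closed, symmetric], goal_cases)
   case (1 a b c)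
   have t: "tri k H H H W (%x1 x2 y. ?P (x1 * a) (x2 * b) (y * c))"
    by (rule tri_comp[OF P mult_lin(2)[OF alg_H 1(1)] mult_lin(2)[OF alg_H 1(2)] mult_lin(2)[OF alg_H 1(3)]])
   show ?case using \<open>y : H\<close> by (intro bilI tri_1[OF t] tri_2[OF t])
  next
   case (2 x1 x2)
   show ?case by (rule tri_shift[OF P 2 \<open>y : H\<close>])
  qed
 qed
 also have "... = sm3 W (copl (cop h) *\<^sub>3 phiI) ?P"
  unfolding sw3_mult[OF mW P cl(1) phiI_closed]
  using sw3_copl[OF mW sw3_mult_inner[OF mW P phiI_closed] cop_cl[OF h]] by simp
 also have "... = sm3 W (phiI *\<^sub>3 copr (cop h)) ?P" by (simp add: coassoc_inv h)
 also have "... = sm3 W phiI (%a b c. sm3 W (copr (cop h)) (%x y z.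
   ?P (a * x) (b * y) (c * z)))"
  by (rule sw3_mult[OF mW P phiI_closed cl(2)])
 also have "... = sm3 W phiI (%a b c. ?P (a * h) b c)"
 proof (rule sw3_cong, goal_cases)
  case (1 a b c)
  have "sm3 W (copr (cop h)) (%x y z. ?P (a * x) (b * y) (c * z))
   = sm2 W (cop h) (%x z. sm2 W (cop z) (%y z. ?P (a * x) (b * y) (c * z)))"
   by (rule sw3_copr[OF mW tri_shift[OF P 1] cop_cl[OF h]])
  also have "... = sm2 W (cop h) (%x z. eps z \<odot>\<^bsub>W\<^esub> ?P (a * x) b c)"
  proof (rule sw2_cong, goal_cases)
   case (1 x z)
   let ?g = "%u. p (act M (a * x) m) (act V (b * u * aS c) v)"
   have g: "klin H W ?g"
    using 1 \<open>a : H\<close> \<open>b : H\<close> \<open>c : H\<close>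
    by (intro lin_comp[OF lin_comp[OF mult_lin(1)[OF alg_H] mult_lin(2)[OF alg_H]]
      lin_comp[OF act_lin1[OF V v] bil_r[OF pb]]]) (simp_all add: antip_closed act_closed[OF M] m)
   have "sm2 W (cop z) (%y z. ?P (a * x) (b * y) (c * z))
     = sm2 W (cop z) (%y z. ?g (y * beta H * aS z))"
    using \<open>b : H\<close> \<open>c : H\<close>
    by (intro sw2_cong) (simp add: antip_mult antip_closed beta_closed m_assoc)
   thus ?case using beta_collapse[OF mW g 1(2)] by simp
  qed
  also have "... = ?P (a * h) b c"
   by (rule counit_right_apply[OF mW lin_comp[OF mult_lin(1)[OF alg_H 1(1)] tri_1[OF P 1(2,3)]] h])
  finally show ?case .
 qed
 also have "... = cur M V W p (act M h m) v"
  unfolding cur_def using v h m by (auto intro!: sw3_cong simp: act_mult[OF M])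
 finally show "cur M V W p (act M h m) v = act (hh V W) h (cur M V W p m) v" by simp
qed

text \<open>By equivariance of \<open>p\<close> all of \<open>H\<close> acts on \<open>m\<close> and \<open>v\<close>, through an element that the pentagon rewrites as a
product of three factors. Two of them collapse, against \<open>\<alpha>\<close> and against \<open>\<beta>\<close>, and the third contributes
\<open>x \<beta> S(y) \<alpha> z = 1\<close>, where \<open>\<phi> = x \<otimes> y \<otimes> z\<close>.\<close>

lemma evp_cur:
 assumes M: "hmod M" and V: "hmod V" and W: "hmod W" and p: "eqb M V W p"
  and m: "m : M" and v: "v : V"
 shows "evp V W (cur M V W p m) v = p m v"
proof -
 note mW = hmod_mod[OF W] and pb = eqb_bil[OF p]
 let ?Q = "%a b c d. p (act M a m) (act V (b * beta H * aS c * alpha H * d) v)"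
 have xad: "bil k H H H (%x d. x * alpha H * d)"
  by (rule bil_comp[OF alg_mult_bil[OF alg_H] mult_lin(2)[OF alg_H alpha_closed] lin_id])
 have Q: "quad k H H H H W ?Q"
  by (rule quad_234[OF tri_lin[OF act_lin1[OF V v] tri_left[OF beta_bil xad]] bil_comp[OF pb act_lin1[OF M m] lin_id]])
 note cl = pent_closed
 have "evp V W (cur M V W p m) v = sm3 W ph (%x y z. act W x (sm3 W phiI (%a b c.
   p (act M a m) (act V (b * beta H * aS c) (act V (aS y * alpha H * z) v)))))"
  unfolding evp_def by (rule sw3_cong) (simp add: cur_def act_closed[OF V] closed_abS v)
 also have "... = sm3 W ph (%x y z. sm3 W phiI (%a b c. sm2 W (cop x) (%x1 x2.
   ?Q (x1 * a) (x2 * b) (y * c) (z * oneH))))"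
 proof (rule sw3_cong, goal_cases)
  case (1 x y z)
  have v': "act V (aS y * alpha H * z) v : V" using 1 v by (simp add: act_closed[OF V] closed_abS)
  show ?case
   unfolding sw3_push[OF mW mW cur_tri[OF M V pb m v'] act_lin2[OF W 1(1)] phiI_closed]
  proof (rule sw3_cong, goal_cases)
   case (1 a b c)
   have "act V x2 (act V (b * beta H * aS c) (act V (aS y * alpha H * z) v))
     = act V (x2 * b * beta H * aS (y * c) * alpha H * (z * oneH)) v"
    if "x2 : H" for x2
   proof -
    have "x2 * b * beta H * aS (y * c) * alpha H * (z * oneH)
     = x2 * ((b * beta H * aS c) * (aS y * alpha H * z))"
     using that 1 \<open>y : H\<close> \<open>z : H\<close>
     by (simp add: antip_mult antip_closed beta_closed alpha_closed m_assoc)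
    thus ?thesis using that 1 \<open>y : H\<close> \<open>z : H\<close> v
     by (simp add: act_mult[OF V] closed_abS act_closed[OF V])
   qed
   thus ?case using 1 \<open>x : H\<close> v'
    by (simp add: eqb_act[OF p] act_closed[OF M] act_closed[OF V] closed_abS m act_mult[OF M] cong: sw2_cong)
  qed
 qed
 also have "... = sm3 W ph (%x y z. sm2 W (cop x) (%x1 x2. sm3 W phiI (%a b c.
   ?Q (x1 * a) (x2 * b) (y * c) (z * oneH))))"
 proof (rule sw3_cong, goal_cases)
  case (1 x y z)
  show ?case
  proof (rule sw2_sw3_swap[OF mW cop_cl[OF 1(1)] phiI_closed, symmetric], goal_cases)
   case (1 a b c)
   have t: "quad k H H H H W (%x1 x2 y z. ?Q (x1 * a) (x2 * b) (y * c) (z * oneH))"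
    by (rule quad_shift'[OF Q 1 one_H_closed])
   show ?case using \<open>y : H\<close> \<open>z : H\<close> by (intro bilI quad_1[OF t] quad_2[OF t])
  next
   case (2 x1 x2)
   show ?case by (rule tri_leg123[OF quad_shift[OF Q 2 \<open>y : H\<close> \<open>z : H\<close>]])
  qed
 qed
 also have "... = sw4 W (cop1 ph *\<^sub>4 leg123 phiI) ?Q"
  unfolding sw4_mult[OF mW Q cl(3,6)]
  using sw4_cop1[OF mW sw4_mult_inner[OF mW Q cl(6)] phi_closed]
  by (simp add: sw4_leg123[OF mW quad_shift[OF Q] phiI_closed] cop_cl cong: sw3_cong sw2_cong)
 also have "... = sw4 W (cop3 phiI *\<^sub>4 (leg234 ph *\<^sub>4 cop2 ph)) ?Q"
  by (simp add: pent_inv1)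
 also have "... = sw4 W (leg234 ph *\<^sub>4 cop2 ph) ?Q"
  unfolding sw4_mult'[OF mW Q alg_mult_closed[OF alg_H4 cl(2,4)] cl(10)]
 proof (rule sw4_cong, goal_cases)
  case (1 a b c d)
  have "sm2 W (cop z) (%z1 z2. ?Q (x * a) (y * b) (z1 * c) (z2 * d))
   = eps z \<odot>\<^bsub>W\<^esub> ?Q (x * a) (y * b) c d" if "x : H" "y : H" "z : H" for x y z
  proof -
   note el = that 1
   let ?g = "%u. p (act M (x * a) m) (act V ((y * b) * beta H * aS c * u * d) v)"
   have g: "klin H W ?g" using el
    by (intro lin_comp[OF lin_comp[OF mult_lin(1)[OF alg_H] mult_lin(2)[OF alg_H]]
      lin_comp[OF act_lin1[OF V v] bil_r[OF pb]]]) (simp_all add: closed_abS antip_closed act_closed[OF M] m)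
   have "sm2 W (cop z) (%z1 z2. ?Q (x * a) (y * b) (z1 * c) (z2 * d))
    = sm2 W (cop z) (%z1 z2. ?g (aS z1 * alpha H * z2))"
    using el by (intro sw2_cong) (simp add: antip_mult antip_closed beta_closed alpha_closed m_assoc)
   thus ?thesis using alpha_collapse[OF mW g el(3)] by simp
  qed
  thus ?case using cop_collapse(2)[OF mW quad_shift'[OF Q 1] phi_disj(2)] 1 by simp
 qed
 also have "... = sw4 W (leg234 ph) ?Q"
  unfolding sw4_mult[OF mW Q cl(2,4)]
 proof (rule sw4_cong, goal_cases)
  case (1 a b c d)
  have "sm2 W (cop y) (%y1 y2. ?Q (a * x) (b * y1) (c * y2) (d * z))
   = eps y \<odot>\<^bsub>W\<^esub> ?Q (a * x) b c (d * z)" if "x : H" "y : H" "z : H" for x y z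
  proof -
   note el = that 1
   let ?g = "%u. p (act M (a * x) m) (act V (b * u * (aS c * alpha H * (d * z))) v)"
   have g: "klin H W ?g" using el
    by (intro lin_comp[OF lin_comp[OF mult_lin(1)[OF alg_H] mult_lin(2)[OF alg_H]]
      lin_comp[OF act_lin1[OF V v] bil_r[OF pb]]]) (simp_all add: closed_abS antip_closed act_closed[OF M] m)
   have "sm2 W (cop y) (%y1 y2. ?Q (a * x) (b * y1) (c * y2) (d * z))
    = sm2 W (cop y) (%y1 y2. ?g (y1 * beta H * aS y2))"
    using el by (intro sw2_cong) (simp add: antip_mult antip_closed beta_closed alpha_closed m_assoc)
   moreover have "?g (beta H) = ?Q (a * x) b c (d * z)"
    using el by (simp add: antip_closed beta_closed alpha_closed m_assoc)
   ultimately show ?thesis using beta_collapse[OF mW g el(2)] by simp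
  qed
  thus ?case using cop_collapse(1)[OF mW quad_shift[OF Q 1] phi_disj(1)] 1 by simp
 qed
 also have "... = sm3 W ph (%b c d. p m (act V (b * beta H * aS c * alpha H * d) v))"
  unfolding sw4_leg234[OF mW Q phi_closed] by (simp add: act_one[OF M m])
 also have "... = p m (act V (sm3 H ph (%b c d. b * beta H * aS c * alpha H * d)) v)"
  by (rule sw3_push[OF mod_H mW tri_left[OF beta_bil xad] lin_comp[OF act_lin1[OF V v] bil_r[OF pb m]] phi_closed, symmetric])
 also have "... = p m v" by (simp add: antip_phi act_one[OF V v])
 finally show ?thesis .
qed

text \<open>The same argument with \<open>\<phi>\<close> and its inverse interchanged; the last factor contributes
\<open>S(x) \<alpha> y \<beta> S(z) = 1\<close>, where now \<open>x \<otimes> y \<otimes> z\<close> is the inverse of \<open>\<phi>\<close>.\<close>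

lemma cur_evp:
 assumes V: "hmod V" and W: "hmod W" and L: "L \<in> lin k V W"
 shows "cur (hh V W) V W (evp V W) L = L"
proof (rule lin_eqI[OF cur_closed[OF hhom_hmod[OF V W] V hmod_mod[OF W] evp_bil[OF V W]] L])
 show "L : hh V W" using L by (simp add: hhom_simps)
 fix v assume v: "v : V"
 note mW = hmod_mod[OF W] and l = lin_is_lin[OF L]
 let ?Q = "%a b c d. act W a (L (act V (aS b * alpha H * c * beta H * aS d) v))"
 have tr: "tri k H H H H (%b c d. aS b * alpha H * c * beta H * aS d)"
  by (rule tri_left[OF alpha_bil beta_bil])
 have Q: "quad k H H H H W ?Q"
  by (rule quad_234[OF tri_lin[OF lin_comp[OF act_lin1[OF V v] l] tr] act_bil[OF W]])
 note cl = pent_closed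
 have "cur (hh V W) V W (evp V W) L v
  = sm3 W phiI (%a b c. evp V W (act (hh V W) a L) (act V (b * beta H * aS c) v))"
  by (simp add: cur_def v)
 also have "... = sm3 W phiI (%a b c. sm2 W (cop a) (%a1 a2. sm3 W ph (%x y z.
   ?Q (x * a1) (y * a2) (z * b) (oneH * c))))"
 proof (rule sw3_cong, goal_cases)
  case (1 a b c)
  show ?case
   unfolding evp_act[OF V W L v 1(1) closed_abS(2)[OF 1(2,3)]]
   by (intro sw2_cong sw3_cong) (use 1 in \<open>simp add: antip_mult antip_closed beta_closed alpha_closed m_assoc\<close>)
 qed
 also have "... = sw4 W (leg123 ph *\<^sub>4 cop1 phiI) ?Q"
  unfolding sw4_mult'[OF mW Q cl(8,1)]
  using sw4_cop1[OF mW sw4_mult'_inner[OF mW Q cl(1)] phiI_closed]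
  by (simp add: sw4_leg123[OF mW quad_shift'[OF Q] phi_closed] cop_cl cong: sw3_cong sw2_cong)
 also have "... = sw4 W (cop2 phiI *\<^sub>4 (leg234 phiI *\<^sub>4 cop3 ph)) ?Q"
  by (simp add: pent_inv2)
 also have "... = sw4 W (leg234 phiI *\<^sub>4 cop3 ph) ?Q"
  unfolding sw4_mult'[OF mW Q alg_mult_closed[OF alg_H4 cl(7,5)] cl(9)]
 proof (rule sw4_cong, goal_cases)
  case (1 a b c d)
  have "sm2 W (cop y) (%y1 y2. ?Q (x * a) (y1 * b) (y2 * c) (z * d))
   = eps y \<odot>\<^bsub>W\<^esub> ?Q (x * a) b c (z * d)" if "x : H" "y : H" "z : H" for x y z
  proof -
   note el = that 1
   let ?g = "%u. act W (x * a) (L (act V (aS b * u * (c * beta H * aS (z * d))) v))"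
   have g: "klin H W ?g" using el
    by (intro lin_comp[OF lin_comp[OF mult_lin(1)[OF alg_H] mult_lin(2)[OF alg_H]]
      lin_comp[OF lin_comp[OF act_lin1[OF V v] l] act_lin2[OF W]]]) (simp_all add: closed_abS antip_closed)
   have "sm2 W (cop y) (%y1 y2. ?Q (x * a) (y1 * b) (y2 * c) (z * d))
    = sm2 W (cop y) (%y1 y2. ?g (aS y1 * alpha H * y2))"
    using el by (intro sw2_cong) (simp add: antip_mult antip_closed beta_closed alpha_closed m_assoc)
   moreover have "?g (alpha H) = ?Q (x * a) b c (z * d)"
    using el by (simp add: antip_closed beta_closed alpha_closed m_assoc)
   ultimately show ?thesis using alpha_collapse[OF mW g el(2)] by simp
  qed
  thus ?case using cop_collapse(1)[OF mW quad_shift'[OF Q 1] phi_disj(2)] 1 by simp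
 qed
 also have "... = sw4 W (leg234 phiI) ?Q"
  unfolding sw4_mult[OF mW Q cl(7,5)]
 proof (rule sw4_cong, goal_cases)
  case (1 a b c d)
  have "sm2 W (cop z) (%z1 z2. ?Q (a * x) (b * y) (c * z1) (d * z2))
   = eps z \<odot>\<^bsub>W\<^esub> ?Q (a * x) (b * y) c d" if "x : H" "y : H" "z : H" for x y z
  proof -
   note el = that 1
   let ?g = "%u. act W (a * x) (L (act V (aS (b * y) * alpha H * c * u * aS d) v))"
   have g: "klin H W ?g" using el
    by (intro lin_comp[OF lin_comp[OF mult_lin(1)[OF alg_H] mult_lin(2)[OF alg_H]]
      lin_comp[OF lin_comp[OF act_lin1[OF V v] l] act_lin2[OF W]]]) (simp_all add: closed_abS antip_closed)
   have "sm2 W (cop z) (%z1 z2. ?Q (a * x) (b * y) (c * z1) (d * z2))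
    = sm2 W (cop z) (%z1 z2. ?g (z1 * beta H * aS z2))"
    using el by (intro sw2_cong) (simp add: antip_mult antip_closed beta_closed alpha_closed m_assoc)
   thus ?thesis using beta_collapse[OF mW g el(3)] by simp
  qed
  thus ?case using cop_collapse(2)[OF mW quad_shift[OF Q 1] phi_disj(1)] 1 by simp
 qed
 also have "... = sm3 W phiI (%b c d. L (act V (aS b * alpha H * c * beta H * aS d) v))"
  unfolding sw4_leg234[OF mW Q phiI_closed]
  by (rule sw3_cong) (simp add: act_one[OF W] lin_closed[OF l] act_closed[OF V] closed_abS v)
 also have "... = L (act V (sm3 H phiI (%b c d. aS b * alpha H * c * beta H * aS d)) v)"
  by (rule sw3_push[OF mod_H mW tr lin_comp[OF act_lin1[OF V v] l] phiI_closed, symmetric])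
 also have "... = L v" by (simp add: antip_phi_inv act_one[OF V v])
 finally show "cur (hh V W) V W (evp V W) L v = L v" .
qed

text \<open>Currying recovers \<open>L\<close> from the evaluations of its translates.\<close>

lemma evp_nondegenerate:
 assumes V: "hmod V" and W: "hmod W" and L: "L \<in> lin k V W" "L' \<in> lin k V W"
  and eq: "!!h v. h : H ==> v : V
   ==> evp V W (act (hh V W) h L) v = evp V W (act (hh V W) h L') v"
 shows "L = L'"
proof -
 have "cur (hh V W) V W (evp V W) L = cur (hh V W) V W (evp V W) L'"
  unfolding cur_def by (intro restrict_ext sw3_cong eq) (simp_all add: closed_abS act_closed[OF V])
 thus ?thesis by (simp add: cur_evp[OF V W] L)
qed

end

section \<open>The tensor product of modules and composition of internal homs\<close>

context quasi_bialgebra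
begin

lemma is_hmor_lin: "hmor V W f ==> klin V W f"
 and is_hmor_act: "hmor V W f ==> h : H ==> v : V ==> f (act V h v) = act W h (f v)"
 by (simp_all add: is_hmor_def)

lemmas is_hmor_closed = lin_closed[OF is_hmor_lin]

lemma hten_simps:
 "carrier (ht V W) = carrier (tmod k V W)" "add (ht V W) = add (tmod k V W)"
 "zero (ht V W) = zero (tmod k V W)" "smult (ht V W) = smult (tmod k V W)"
 by (simp_all add: hten_def mk_hmod_simps)

lemma lin_hten:
 "klin (ht V W) X f <-> klin (tmod k V W) X f"
 "klin X (ht V W) g <-> klin X (tmod k V W) g"
 by (simp_all add: is_lin_def hten_simps)

lemma hten_module: "kmod V ==> kmod W ==> kmod (ht V W)"
 unfolding hten_def by (rule module_mk_hmod[OF tmod_module])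

lemma hten_pure_closed: "kmod V ==> kmod W ==> v : V ==> w : W
  ==> pure k V W v w : ht V W"
 unfolding hten_simps by (rule pure_closed)

lemma hten_pure_bil: "kmod V ==> kmod W ==> bil k V W (ht V W) (pure k V W)"
 using pure_bil by (simp add: bil_def lin_hten)

text \<open>\<open>T\<close> is spanned by the values of the bilinear map \<open>p\<close>; sums suffice, since scalars can be moved
 into an argument.\<close>

definition spans where
 "spans V W T p <-> bil k V W T p \<and>
   (\<forall>S. (\<forall>v\<in>carrier V. \<forall>w\<in>carrier W. p v w \<in> S) -->
    (\<forall>s\<in>carrier T. \<forall>t\<in>carrier T. s \<in> S --> t \<in> S --> s \<oplus>\<^bsub>T\<^esub> t \<in> S) --> carrier T \<subseteq> S)"

lemma spans_induct [consumes 2, case_names pure add]: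
 assumes "spans V W T p" "t : T"
  and "!!v w. v : V ==> w : W ==> P (p v w)"
  and "!!s t. s : T ==> t : T ==> P s ==> P t ==> P (s \<oplus>\<^bsub>T\<^esub> t)"
 shows "P t"
proof -
 have "\<forall>S. (\<forall>v\<in>carrier V. \<forall>w\<in>carrier W. p v w \<in> S) -->
    (\<forall>s\<in>carrier T. \<forall>t\<in>carrier T. s \<in> S --> t \<in> S --> s \<oplus>\<^bsub>T\<^esub> t \<in> S) --> carrier T \<subseteq> S"
  using assms(1) by (simp add: spans_def)
 from spec[OF this, of "Collect P"] show ?thesis using assms(2-4) by auto
qed

lemma spans_lin_eq:
 assumes "spans V W T p" "klin T X f" "klin T X g"
  and "!!v w. v : V ==> w : W ==> f (p v w) = g (p v w)" and "t : T"
 shows "f t = g t"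
 using assms(1,5)
 by (induction t rule: spans_induct) (simp_all add: assms(4) lin_add[OF assms(2)] lin_add[OF assms(3)])

lemma spans_bil: "spans V W T p ==> bil k V W T p"
 by (simp add: spans_def)

lemma spans_pure: "kmod V ==> kmod W ==> spans V W (ht V W) (pure k V W)"
 unfolding spans_def
proof (intro conjI allI impI subsetI)
 fix S t assume *: "kmod V" "kmod W" "t : ht V W"
  and "\<forall>v\<in>carrier V. \<forall>w\<in>carrier W. pure k V W v w \<in> S"
  and "\<forall>s\<in>carrier (ht V W). \<forall>t\<in>carrier (ht V W). s \<in> S --> t \<in> S --> s \<oplus>\<^bsub>ht V W\<^esub> t \<in> S"
 with tmod_induct[OF *(1,2), of t "%t. t \<in> S"] show "t \<in> S" unfolding hten_simps by blast
qed (rule hten_pure_bil)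

text \<open>A linear action that is given on generators by the coproduct satisfies the axioms of a module because the
coproduct is an algebra homomorphism; a linear map that is given on generators by an equivariant product is
equivariant.\<close>

lemma hmod_of_spans:
 assumes hm: "hmod V" "hmod W" and T: "kmod T" and p: "spans V W T p"
  and l: "!!h. h : H ==> klin T T (act T h)" "!!t. t : T ==> klin H T (%h. act T h t)"
  and a: "!!h v w. h : H ==> v : V ==> w : W ==> act T h (p v w) = sm2 T (cop h) (%a b. p (act V a v) (act W b w))"
 shows "hmod T"
proof -
 note b = bil_act[OF hm spans_bil[OF p]]
 have mult: "act T (g * h) t = act T g (act T h t)" if g: "g : H" and h: "h : H" and t: "t : T" for g h t
 proof (rule spans_lin_eq[OF p l(1) lin_comp[OF l(1)[OF h] l(1)[OF g]] _ t])
  show gh: "g * h : H" using g h by simp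
  fix v w assume el: "v : V" "w : W"
  have "act T g (act T h (p v w)) = sm2 T (cop h)
    (%a b. sm2 T (cop g) (%c d. p (act V c (act V a v)) (act W d (act W b w))))"
   unfolding a[OF h el] sw2_push[OF T T b[OF el] l(1)[OF g] cop_cl[OF h]]
   by (rule sw2_cong) (simp add: a[OF g] act_closed hm el)
  also have "... = act T (g * h) (p v w)"
   unfolding a[OF gh el] comult_mult[OF g h] sw2_mult'[OF T b[OF el] cop_cl[OF h] cop_cl[OF g]]
   by (intro sw2_cong) (simp add: act_mult hm el)
  finally show "act T (g * h) (p v w) = act T g (act T h (p v w))" by simp
 qed
 have one: "act T oneH t = t" if t: "t : T" for t
  by (rule spans_lin_eq[OF p l(1)[OF one_H_closed] lin_id _ t]) (simp add: a comult_one sw2_pure[OF T b] act_one hm)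
 show ?thesis unfolding is_hmod_def using T l mult one by auto
qed

lemma hmor_of_spans:
 assumes p: "eqb V W T p" "spans V W T p" and f: "eqb V W X f" and g: "klin T X g" "!!v w. v : V ==> w : W ==> g (p v w) = f v w"
  and hm: "hmod V" "hmod W" "hmod T" "hmod X"
 shows "hmor T X g"
proof -
 have "g (act T h t) = act X h (g t)" if h: "h : H" and t: "t : T" for h t
 proof (rule spans_lin_eq[OF p(2) lin_comp[OF act_lin2[OF hm(3) h] g(1)] lin_comp[OF g(1) act_lin2[OF hm(4) h]] _ t])
  fix v w assume el: "v : V" "w : W"
  show "g (act T h (p v w)) = act X h (g (p v w))"
   unfolding eqb_act[OF p(1) h el] g(2)[OF el] eqb_act[OF f h el]
    sw2_push[OF hmod_mod[OF hm(3)] hmod_mod[OF hm(4)] bil_act[OF hm(1,2) eqb_bil[OF p(1)] el] g(1) cop_cl[OF h]]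
   using el by (simp add: g(2) act_closed hm cong: sw2_cong)
 qed
 thus ?thesis using g(1) by (simp add: is_hmor_def)
qed

text \<open>Equivariance of a product of \<open>T\<close> with \<open>X\<close> may be tested on \<open>(v w) x\<close>.\<close>

lemma eqb_of_eql_spans:
 assumes F: "eql V W X R (%v w x. f (p v w) x)" and p: "eqb V W T p" "spans V W T p" and f: "bil k T X R f"
  and hm: "hmod V" "hmod W" "hmod X" "hmod T" "hmod R"
 shows "eqb T X R f"
 unfolding eqb_def
proof (intro conjI f ballI)
 note mR = hmod_mod[OF hm(5)]
 fix h t x assume h: "h : H" and t: "t : T" and x: "x : X"
 show "act R h (f t x) = sm2 R (cop h) (%a b. f (act T a t) (act X b x))"
 proof (rule spans_lin_eq[OF p(2) lin_comp[OF bil_l[OF f x] act_lin2[OF hm(5) h]]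
    bil_l[OF bil_rel[OF hm(4,3) mR f cop_cl[OF h]] x] _ t])
  fix v w assume *: "v : V" "w : W"
  show "act R h (f (p v w) x) = sm2 R (cop h) (%a b. f (act T a (p v w)) (act X b x))"
   using F h x * by (simp add: eqt_def sw3_copl_apply[OF hm(1-4) mR f p(1) cop_cl[OF h]])
 qed
qed

lemma hten_act_bil:
 assumes V: "hmod V" and W: "hmod W" and h: "h : H"
 shows "bil k V W (tmod k V W) (%v w. sm2 (tmod k V W) (cop h) (%a b. pure k V W (act V a v) (act W b w)))"
 by (rule bil_rel[OF V W tmod_module[OF hmod_mod[OF V] hmod_mod[OF W]]
    pure_bil[OF hmod_mod[OF V] hmod_mod[OF W]] cop_cl[OF h]])

lemma hten_act_pure:
 assumes V: "hmod V" and W: "hmod W" and h: "h : H" and v: "v : V" and w: "w : W"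
 shows "act (ht V W) h (pure k V W v w)
  = sm2 (tmod k V W) (cop h) (%a b. pure k V W (act V a v) (act W b w))"
 unfolding hten_def mk_hmod_simps
 by (rule tlift_pure[OF hmod_mod[OF V] hmod_mod[OF W] tmod_module[OF hmod_mod[OF V] hmod_mod[OF W]]
    hten_act_bil[OF V W h] v w])

text \<open>The tensor product over \<open>k\<close> and its \<open>H\<close>-module share their addition, hence their sums.\<close>

lemma sw_mod_cong:
 assumes "carrier X = carrier Y" "add X = add Y" "smult X = smult Y"
 shows "sm2 X t f = sm2 Y t f" "sm3 X u g = sm3 Y u g"
proof -
 have l: "lin k Z X = lin k Z Y" for Z :: "('k, 'z, 'zz) module_scheme"
  using assms by (auto simp: lin_def is_lin_def)
 show 2: "sm2 X t f = sm2 Y t f" for t f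
  unfolding sw2_def tlift_def by (simp add: l)
 show "sm3 X u g = sm3 Y u g"
  unfolding sw3_def tlift_def by (simp add: l 2)
qed

lemma sw_hten:
 "sm2 (ht V W) t f = sm2 (tmod k V W) t f" "sm3 (ht V W) u g = sm3 (tmod k V W) u g"
 by (rule sw_mod_cong; simp add: hten_simps)+

lemma hten_hmod:
 assumes V: "hmod V" and W: "hmod W"
 shows "hmod (ht V W)"
proof (rule hmod_of_spans[OF V W hten_module spans_pure])
 let ?T = "ht V W"
 note mV = hmod_mod[OF V] and mW = hmod_mod[OF W]
 note mT = tmod_module[OF mV mW]
 have act_eq: "act ?T h = tlift k V W (tmod k V W) (%v w.
   sm2 (tmod k V W) (cop h) (%a b. pure k V W (act V a v) (act W b w)))" for h
  by (simp add: hten_def mk_hmod_simps)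
 show "klin ?T ?T (act ?T h)" if "h : H" for h
  unfolding act_eq lin_hten by (rule tlift_lin[OF mV mW mT hten_act_bil[OF V W that]])
 show "klin H ?T (%h. act ?T h t)" if t: "t : ?T" for t
  unfolding act_eq lin_hten
  by (rule tlift_param_lin[OF mV mW mT mod_H hten_act_bil[OF V W] _ t[unfolded hten_simps]])
   (auto intro!: sw2_comult_lin[OF mT] bil_act[OF V W pure_bil[OF mV mW]])
qed (simp_all add: hmod_mod V W hten_act_pure sw_hten)

lemma pure_eqb:
 assumes V: "hmod V" and W: "hmod W"
 shows "eqb V W (ht V W) (pure k V W)"
 unfolding eqb_def sw_hten using hten_pure_bil[OF hmod_mod[OF V] hmod_mod[OF W]]
 by (simp add: hten_act_pure[OF V W])

lemma hmor_eqb: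
 assumes V: "hmod V" and W: "hmod W" and X: "hmod X" and f: "hmor (ht V W) X f"
 shows "eqb V W X (%v w. f (pure k V W v w))"
proof -
 note mV = hmod_mod[OF V] and mW = hmod_mod[OF W] and mX = hmod_mod[OF X]
 note pb = hten_pure_bil[OF mV mW] and fl = is_hmor_lin[OF f]
 show ?thesis unfolding eqb_def
 proof (intro conjI ballI)
  show "bil k V W X (%v w. f (pure k V W v w))" by (rule bil_lin[OF fl pb])
  fix h v w assume *: "h : H" "v : V" "w : W"
  have "act X h (f (pure k V W v w)) = f (act (ht V W) h (pure k V W v w))"
   using is_hmor_act[OF f *(1) hten_pure_closed[OF mV mW *(2,3)]] by simp
  also have "... = sm2 X (cop h) (%a b. f (pure k V W (act V a v) (act W b w)))"
   unfolding eqb_act[OF pure_eqb[OF V W] *]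
   by (rule sw2_push[OF hten_module[OF mV mW] mX bil_act[OF V W pb *(2,3)] fl cop_cl[OF *(1)]])
  finally show "act X h (f (pure k V W v w)) = sm2 X (cop h) (%a b. f (pure k V W (act V a v) (act W b w)))" .
 qed
qed

lemma hten_lift_hmor:
 assumes V: "hmod V" and W: "hmod W" and X: "hmod X" and f: "eqb V W X f"
 shows "hmor (ht V W) X (tlift k V W X f)"
proof -
 note m = hmod_mod[OF V] hmod_mod[OF W] hmod_mod[OF X]
 show ?thesis
  by (rule hmor_of_spans[OF pure_eqb[OF V W] spans_pure[OF m(1,2)] f _ tlift_pure[OF m eqb_bil[OF f]] V W hten_hmod[OF V W] X])
   (simp_all add: lin_hten tlift_lin[OF m eqb_bil[OF f]])
qed

lemma tri_lift_bil:
 assumes V: "kmod V" and W: "kmod W" and X: "kmod X" and R: "kmod R" and F: "tri k V W X R F"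
 shows "bil k (tmod k V W) X R (%t x. tlift k V W R (%v w. F v w x) t)"
  and "!!v w x. v : V ==> w : W ==> x : X
   ==> tlift k V W R (%v w. F v w x) (pure k V W v w) = F v w x"
proof -
 have b: "bil k V W R (%v w. F v w x)" if "x : X" for x
  using that by (intro bilI tri_1[OF F] tri_2[OF F])
 show "bil k (tmod k V W) X R (%t x. tlift k V W R (%v w. F v w x) t)"
 proof (rule bilI)
  fix t assume "t : tmod k V W"
  thus "klin X R (%x. tlift k V W R (%v w. F v w x) t)"
   by (intro tlift_param_lin[OF V W R X]) (auto intro: b tri_3[OF F])
 qed (rule tlift_lin[OF V W R b])
 fix v w x assume *: "v : V" "w : W" "x : X"
 show "tlift k V W R (%v w. F v w x) (pure k V W v w) = F v w x" by (rule tlift_pure[OF V W R b[OF *(3)] *(1,2)])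
qed

lemma bil_hten_dom: "bil k (ht V W) X R f <-> bil k (tmod k V W) X R f"
 by (simp add: bil_def lin_hten hten_simps)

lemma tmod_cong_simps:
 assumes "carrier V = carrier V'" "add V = add V'" "smult V = smult V'"
  and "carrier W = carrier W'" "add W = add W'" "smult W = smult W'"
 shows "tmod k V W = tmod k V' W'" "pure k V W = pure k V' W'"
 using assms by (auto simp: tmod_def tens_null_def tens_rels_def pure_def fun_eq_iff)

lemma Phi_pure:
 assumes V: "hmod V" and W: "hmod W" and X: "hmod X"
  and el: "v : V" "w : W" "x : X"
 shows "Phi k H V W X (pure k (ht V W) X (pure k V W v w) x)
  = sm3 (ht V (ht W X)) ph (%a b c.
    pure k V (ht W X) (act V a v) (pure k W X (act W b w) (act X c x)))" (is ?P)
  and "klin (ht (ht V W) X) (ht V (ht W X)) (Phi k H V W X)" (is ?L)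
  and "hmor (ht (ht V W) X) (ht V (ht W X)) (Phi k H V W X)" (is ?M)
proof -
 note mV = hmod_mod[OF V] and mW = hmod_mod[OF W] and mX = hmod_mod[OF X]
 note VW = hten_hmod[OF V W] and WX = hten_hmod[OF W X]
 let ?R = "ht V (ht W X)"
 note R = hten_hmod[OF V WX]
 note mVW = hmod_mod[OF VW] and mWX = hmod_mod[OF WX] and mR = hmod_mod[OF R]
 let ?G = "%v w x. pure k V (ht W X) v (pure k W X w x)"
 let ?F = "%v w x. sm3 ?R ph (%a b c. ?G (act V a v) (act W b w) (act X c x))"
 have G: "eqr V W X ?R ?G" by (rule eqr_right[OF pure_eqb[OF W X] pure_eqb[OF V WX] V W X WX mR])
 have r: "rel3 V W X ?R ?F ?G ph" by (simp add: rel3_def)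
 have F: "tri k V W X ?R ?F" by (rule tri_rel[OF V W X mR eqt_tri[OF G] phi_closed])
 let ?f = "%t x. tlift k V W ?R (%v w. ?F v w x) t"
 have bf: "bil k (ht V W) X ?R ?f" using tri_lift_bil(1)[OF mV mW mX mR F] by (simp add: bil_hten_dom)
 note fp = tri_lift_bil(2)[OF mV mW mX mR F]
 have e: "eql V W X ?R (%v w x. ?f (pure k V W v w) x)"
 proof -
  have "rel3 V W X ?R (%v w x. ?f (pure k V W v w) x) ?G ph"
   unfolding rel3_def by (simp add: fp)
  thus ?thesis by (rule eql_rel[OF V W X R G])
 qed
 have P: "Phi k H V W X = tlift k (ht V W) X ?R ?f" by (simp add: Phi_def)
 show ?P unfolding P using tlift_pure[OF mVW mX mR bf hten_pure_closed[OF mV mW el(1,2)] el(3)] fp[OF el] by simp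
 show ?M unfolding P by (rule hten_lift_hmor[OF VW X R eqb_of_eql_spans[OF e pure_eqb[OF V W] spans_pure[OF mV mW] bf V W X VW R]])
 thus ?L by (rule is_hmor_lin)
qed

lemma tmap_pure:
 assumes V: "kmod V" "kmod V'" and W: "kmod W" "kmod W'"
  and f: "klin V V' f" and g: "klin W W' g"
 shows "klin (ht V W) (ht V' W') (tmap k V W V' W' f g)"
  and "v : V ==> w : W ==> tmap k V W V' W' f g (pure k V W v w) = pure k V' W' (f v) (g w)"
proof -
 have b: "bil k V W (tmod k V' W') (%v w. pure k V' W' (f v) (g w))" by (rule bil_comp[OF pure_bil[OF V(2) W(2)] f g])
 note m = tmod_module[OF V(2) W(2)]
 show "klin (ht V W) (ht V' W') (tmap k V W V' W' f g)"
  unfolding tmap_def lin_hten by (rule tlift_lin[OF V(1) W(1) m b])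
 show "v : V ==> w : W ==> tmap k V W V' W' f g (pure k V W v w) = pure k V' W' (f v) (g w)"
  unfolding tmap_def by (rule tlift_pure[OF V(1) W(1) m b])
qed

end

context quasi_Hopf_algebra
begin

lemma ev_pure:
 assumes V: "hmod V" and W: "hmod W"
 shows "L \<in> lin k V W ==> v : V ==> ev k H V W (pure k (hh V W) V L v) = evp V W L v"
  and "klin (ht (hh V W) V) W (ev k H V W)"
proof -
 note m = hmod_mod[OF hhom_hmod[OF V W]] hmod_mod[OF V] hmod_mod[OF W]
 have e: "ev k H V W = tlift k (hh V W) V W (evp V W)" by (simp add: ev_def evp_def[abs_def])
 show "L \<in> lin k V W ==> v : V ==> ev k H V W (pure k (hh V W) V L v) = evp V W L v"
  unfolding e using tlift_pure[OF m evp_bil[OF V W]] by (simp add: hhom_simps)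
 show "klin (ht (hh V W) V) W (ev k H V W)"
  unfolding e lin_hten by (rule tlift_lin[OF m evp_bil[OF V W]])
qed

text \<open>The translates in the criterion above become values at other arguments, by equivariance.\<close>

lemma eqb_nondegenerate:
 assumes V: "hmod V" and W: "hmod W" and X: "hmod X" and Y: "hmod Y"
  and f: "eqb X Y (hh V W) f" and g: "eqb X Y (hh V W) g"
  and eq: "!!x y v. x : X ==> y : Y ==> v : V ==> evp V W (f x y) v = evp V W (g x y) v"
  and el: "x : X" "y : Y"
 shows "f x y = g x y"
proof (rule evp_nondegenerate[OF V W])
 note E = hhom_hmod[OF V W] and mW = hmod_mod[OF W]
 show "f x y \<in> lin k V W" "g x y \<in> lin k V W" using eqb_closed[OF f el] eqb_closed[OF g el] by (simp_all add: hhom_simps)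
 fix h v assume h: "h : H" and v: "v : V"
 have "evp V W (act (hh V W) h (u x y)) v = sm2 W (cop h) (%a b. evp V W (u (act X a x) (act Y b y)) v)"
  if u: "eqb X Y (hh V W) u" for u
  unfolding eqb_act[OF u h el]
  by (rule sw2_push[OF hmod_mod[OF E] mW bil_act[OF X Y eqb_bil[OF u] el] bil_l[OF evp_bil[OF V W] v] cop_cl[OF h]])
 from this[OF f] this[OF g] show "evp V W (act (hh V W) h (f x y)) v = evp V W (act (hh V W) h (g x y)) v"
  using eq v by (simp add: act_closed X Y el cong: sw2_cong)
qed

lemma eql_nondegenerate:
 assumes V: "hmod V" and W: "hmod W" and X: "hmod X" and Y: "hmod Y" and Z: "hmod Z"
  and f: "eql X Y Z (hh V W) f" and g: "eql X Y Z (hh V W) g"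
  and eq: "!!x y z v. x : X ==> y : Y ==> z : Z ==> v : V
   ==> evp V W (f x y z) v = evp V W (g x y z) v"
  and el: "x : X" "y : Y" "z : Z"
 shows "f x y z = g x y z"
proof (rule evp_nondegenerate[OF V W])
 note E = hhom_hmod[OF V W] and mW = hmod_mod[OF W]
 show "f x y z \<in> lin k V W" "g x y z \<in> lin k V W"
  using tri_closed[OF eqt_tri[OF f] el] tri_closed[OF eqt_tri[OF g] el] by (simp_all add: hhom_simps)
 fix h v assume h: "h : H" and v: "v : V"
 have "evp V W (act (hh V W) h (u x y z)) v
   = sm3 W (copl (cop h)) (%a b c. evp V W (u (act X a x) (act Y b y) (act Z c z)) v)"
  if u: "eql X Y Z (hh V W) u" for u
 proof -
  have "act (hh V W) h (u x y z)
    = sm3 (hh V W) (copl (cop h)) (%a b c. u (act X a x) (act Y b y) (act Z c z))"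
   using u h el by (simp add: eqt_def)
  thus ?thesis
   using sw3_push[OF hmod_mod[OF E] mW tri_act[OF X Y Z eqt_tri[OF u] el] bil_l[OF evp_bil[OF V W] v]
     copl_closed[OF cop_cl[OF h]]] by simp
 qed
 from this[OF f] this[OF g] show "evp V W (act (hh V W) h (f x y z)) v = evp V W (act (hh V W) h (g x y z)) v"
  using eq v by (simp add: act_closed X Y Z el cong: sw3_cong)
qed

definition cmp where
 "cmp V W X L L' = hcomp k H V W X (pure k (hh W X) (hh V W) L L')"

text \<open>The composition is the curried form of iterated evaluation. The product to be curried is equivariant because
\<open>\<phi>\<close> exchanges the two kinds of equivariance, and the uniqueness in the definition of composition is
nondegeneracy.\<close>

lemma hcomp_props:
 assumes V: "hmod V" and W: "hmod W" and X: "hmod X"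
 shows "eqb (hh W X) (hh V W) (hh V X) (cmp V W X)"
  and "rel3 (hh W X) (hh V W) V X (%L L' v. evp V X (cmp V W X L L') v)
   (%L L' v. evp W X L (evp V W L' v)) ph"
proof -
 let ?B = "hh W X" and ?C = "hh V W" and ?D = "hh V X"
 note B = hhom_hmod[OF W X] and C = hhom_hmod[OF V W] and D = hhom_hmod[OF V X]
 note mB = hmod_mod[OF B] and mC = hmod_mod[OF C] and mD = hmod_mod[OF D]
 note mV = hmod_mod[OF V] and mW = hmod_mod[OF W] and mX = hmod_mod[OF X]
 let ?T = "ht ?B ?C"
 note T = hten_hmod[OF B C] note mT = hmod_mod[OF T]
 let ?G = "%L L' v. evp W X L (evp V W L' v)"
 let ?g = "ev k H W X \<circ> tmap k ?B (ht ?C V) ?B W id (ev k H V W) \<circ> Phi k H ?B ?C V"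
 have G: "eqr ?B ?C V X ?G" by (rule eqr_right[OF evp_eqb[OF V W] evp_eqb[OF W X] B C V W mX])
 note CV = hten_hmod[OF C V] note mCV = hmod_mod[OF CV]
 have idl: "klin ?B ?B id" by (auto intro: is_linI)
 note tm = tmap_pure[OF mB mB mCV mW idl ev_pure(2)[OF V W]]
 note tml = lin_comp[OF tm(1) ev_pure(2)[OF W X]]
 have ge: "?g (pure k ?T V (pure k ?B ?C L L') v)
   = sm3 X ph (%a b c. ?G (act ?B a L) (act ?C b L') (act V c v))"
  if el: "L : ?B" "L' : ?C" "v : V" for L L' v
 proof -
  let ?R = "ht ?B (ht ?C V)"
  have t: "tri k H H H ?R (%a b c. pure k ?B (ht ?C V) (act ?B a L) (pure k ?C V (act ?C b L') (act V c v)))"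
   by (rule tri_act[OF B C V tri_right[OF hten_pure_bil[OF mC mV] hten_pure_bil[OF mB mCV]] el])
  show ?thesis unfolding comp_def Phi_pure(1)[OF B C V el]
    sw3_push[OF hmod_mod[OF hten_hmod[OF B CV]] mX t tml phi_closed]
  proof (rule sw3_cong, goal_cases)
   case (1 a b c)
   have *: "act ?B a L : ?B" "act ?C b L' : ?C" "act V c v : V"
    using 1 el by (auto intro: act_closed[OF B] act_closed[OF C] act_closed[OF V])
   have **: "evp V W (act ?C b L') (act V c v) : W" by (rule eqb_closed[OF evp_eqb[OF V W] *(2,3)])
   show ?case using * **
    by (simp add: tm(2) hten_pure_closed[OF mC mV] ev_pure(1)[OF V W] ev_pure(1)[OF W X] hhom_simps)
  qed
 qed
 have gl: "klin (ht ?T V) X ?g"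
  unfolding comp_def
  by (rule lin_comp[OF is_hmor_lin[OF Phi_pure(3)[OF B C V module_zero_closed[OF mB] module_zero_closed[OF mC]
      module_zero_closed[OF mV]]] tml])
 define p where "p = (%t v. ?g (pure k ?T V t v))"
 have pb: "bil k ?T V X p" unfolding p_def by (rule bil_lin[OF gl hten_pure_bil[OF mT mV]])
 have rel: "rel3 ?B ?C V X (%L L' v. p (pure k ?B ?C L L') v) ?G ph"
  unfolding rel3_def p_def using ge by simp
 have peq: "eqb ?T V X p"
  by (rule eqb_of_eql_spans[OF eql_rel[OF B C V X G rel] pure_eqb[OF B C] spans_pure[OF mB mC] pb B C V T X])
 let ?c = "\<lambda>t\<in>carrier ?T. cur ?T V X p t"
 have ccl: "cur ?T V X p t \<in> lin k V X" if "t : ?T" for t by (rule cur_closed[OF T V mX pb that])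
 have cmor: "hmor ?T ?D ?c"
  unfolding is_hmor_def
  using lin_cong[OF mT cur_lin[OF T V mX pb], of ?c] cur_act[OF T V X peq] act_closed[OF T] by auto
 have idV: "klin V V id" by (auto intro: is_linI)
 have evc: "(ev k H V X \<circ> tmap k ?T V ?D V f id) (pure k ?T V t v) = evp V X (f t) v"
  if f: "klin ?T ?D f" and t: "t : ?T" "v : V" for f t v
  using tmap_pure(2)[OF mT mD mV mV f idV t] lin_closed[OF f t(1)] ev_pure(1)[OF V X _ t(2), of "f t"]
  by (simp add: hhom_simps)
 have evcl: "klin (ht ?T V) X (ev k H V X \<circ> tmap k ?T V ?D V f id)" if f: "klin ?T ?D f" for f
  unfolding comp_def by (rule lin_comp[OF tmap_pure(1)[OF mT mD mV mV f idV] ev_pure(2)[OF V X]])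
 have char: "(\<forall>t\<in>carrier (ht ?T V). (ev k H V X \<circ> tmap k ?T V ?D V f id) t = ?g t)
   <-> (\<forall>t\<in>carrier ?T. \<forall>v\<in>carrier V. evp V X (f t) v = p t v)" if f: "klin ?T ?D f" for f
 proof
  assume "\<forall>t\<in>carrier (ht ?T V). (ev k H V X \<circ> tmap k ?T V ?D V f id) t = ?g t"
  thus "\<forall>t\<in>carrier ?T. \<forall>v\<in>carrier V. evp V X (f t) v = p t v"
   unfolding p_def using evc[OF f] hten_pure_closed[OF mT mV] by metis
 next
  assume *: "\<forall>t\<in>carrier ?T. \<forall>v\<in>carrier V. evp V X (f t) v = p t v"
  show "\<forall>t\<in>carrier (ht ?T V). (ev k H V X \<circ> tmap k ?T V ?D V f id) t = ?g t"
   using tmod_lin_eqI[OF mT mV evcl[OF f, unfolded lin_hten] gl[unfolded lin_hten]] evc[OF f] *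
   unfolding hten_simps(1)[of ?T V] p_def by simp
 qed
 have hc: "hcomp k H V W X = ?c"
  unfolding hcomp_def
 proof (rule the_equality, intro conjI)
  show "?c \<in> extensional (carrier ?T)" by simp
  show "hmor ?T ?D ?c" by (rule cmor)
  show "\<forall>t\<in>carrier (ht ?T V). (ev k H V X \<circ> tmap k ?T V ?D V ?c id) t = ?g t"
   unfolding char[OF is_hmor_lin[OF cmor]] using evp_cur[OF T V X peq] by simp
 next
  fix f assume f: "f \<in> extensional (carrier ?T) \<and> hmor ?T ?D f
   \<and> (\<forall>t\<in>carrier (ht ?T V). (ev k H V X \<circ> tmap k ?T V ?D V f id) t = ?g t)"
  hence fm: "hmor ?T ?D f" by simp
  have fe: "\<forall>t\<in>carrier ?T. \<forall>v\<in>carrier V. evp V X (f t) v = p t v"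
   using f char[OF is_hmor_lin[OF fm]] by simp
  show "f = ?c"
  proof (rule extensionalityI[where A = "carrier ?T"])
   fix t assume t: "t : ?T"
   have "f t = cur ?T V X p t"
   proof (rule evp_nondegenerate[OF V X _ ccl[OF t]])
    show "f t \<in> lin k V X" using is_hmor_closed[OF fm t] by (simp add: hhom_simps)
    fix h v assume h: "h : H" "v : V"
    show "evp V X (act ?D h (f t)) v = evp V X (act ?D h (cur ?T V X p t)) v"
     using fe h t by (simp add: is_hmor_act[OF fm, symmetric] cur_act[OF T V X peq, symmetric]
       act_closed[OF T] evp_cur[OF T V X peq])
   qed
   thus "f t = ?c t" using t by simp
  qed (use f in auto)
 qed
 have cmp: "cmp V W X = (%L L'. hcomp k H V W X (pure k ?B ?C L L'))" by (intro ext) (simp add: cmp_def)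
 show "eqb ?B ?C ?D (cmp V W X)" unfolding cmp hc by (rule hmor_eqb[OF B C D cmor])
 show "rel3 ?B ?C V X (%L L' v. evp V X (cmp V W X L L') v) ?G ph"
  using rel evp_cur[OF T V X peq] hten_pure_closed[OF mB mC]
  unfolding rel3_def cmp_def hc by simp
qed

end

section \<open>Generators and the transfer of relations to them\<close>

context quasi_bialgebra
begin

text \<open>Converses of the lemmas on relations between subexpressions: a factor that takes no part can be fixed, and
a relation between functions of a product \<open>f w x\<close> passes to all arguments if these products span.\<close>

lemma rel4_leg123D:
 assumes "rel4 W X Y Z R F G (leg123 t)" "quad k W X Y Z R G" "t : HHH" "kmod R"
  and hm: "hmod W" "hmod X" "hmod Y" "hmod Z" and z: "z : Z"
 shows "rel3 W X Y R (%w x y. F w x y z) (%w x y. G w x y z) t"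
 using assms(1) z unfolding rel3_def rel4_def
 by (simp add: sw4_leg123[OF assms(4) quad_act[OF hm assms(2)] assms(3)] act_one[OF hm(4)])

lemma rel4_leg234D:
 assumes "rel4 W X Y Z R F G (leg234 t)" "quad k W X Y Z R G" "t : HHH" "kmod R"
  and hm: "hmod W" "hmod X" "hmod Y" "hmod Z" and w: "w : W"
 shows "rel3 X Y Z R (%x y z. F w x y z) (%x y z. G w x y z) t"
 using assms(1) w unfolding rel3_def rel4_def
 by (simp add: sw4_leg234[OF assms(4) quad_act[OF hm assms(2)] assms(3)] act_one[OF hm(1)])

lemma rel3_of_cop1:
 assumes r: "rel4 W X Y Z R (%w x y z. G (f w x) y z) (%w x y z. K (f w x) y z) (cop1 t)"
  and f: "eqb W X P f" "spans W X P f" and G: "tri k P Y Z R G" and K: "tri k P Y Z R K" and t: "t : HHH"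
  and hm: "hmod W" "hmod X" "hmod Y" "hmod Z" "hmod P" "kmod R"
 shows "rel3 P Y Z R G K t"
 unfolding rel3_def
proof (intro ballI)
 fix p y z assume *: "p : P" "y : Y" "z : Z"
 show "G p y z = sm3 R t (%a b c. K (act P a p) (act Y b y) (act Z c z))"
  using r * by (intro spans_lin_eq[OF f(2) tri_1[OF G *(2,3)] tri_1[OF tri_rel[OF hm(5,3,4,6) K t] *(2,3)] _ *(1)])
   (simp add: rel4_def sw4_cop1_apply[OF hm K f(1) t])
qed

lemma rel3_of_cop2:
 assumes r: "rel4 W X Y Z R (%w x y z. G w (f x y) z) (%w x y z. K w (f x y) z) (cop2 t)"
  and f: "eqb X Y P f" "spans X Y P f" and G: "tri k W P Z R G" and K: "tri k W P Z R K" and t: "t : HHH"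
  and hm: "hmod W" "hmod X" "hmod Y" "hmod Z" "hmod P" "kmod R"
 shows "rel3 W P Z R G K t"
 unfolding rel3_def
proof (intro ballI)
 fix w p z assume *: "w : W" "p : P" "z : Z"
 show "G w p z = sm3 R t (%a b c. K (act W a w) (act P b p) (act Z c z))"
  using r * by (intro spans_lin_eq[OF f(2) tri_2[OF G *(1,3)] tri_2[OF tri_rel[OF hm(1,5,4,6) K t] *(1,3)] _ *(2)])
   (simp add: rel4_def sw4_cop2_apply[OF hm K f(1) t])
qed

lemma rel3_of_cop3:
 assumes r: "rel4 W X Y Z R (%w x y z. G w x (f y z)) (%w x y z. K w x (f y z)) (cop3 t)"
  and f: "eqb Y Z P f" "spans Y Z P f" and G: "tri k W X P R G" and K: "tri k W X P R K" and t: "t : HHH"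
  and hm: "hmod W" "hmod X" "hmod Y" "hmod Z" "hmod P" "kmod R"
 shows "rel3 W X P R G K t"
 unfolding rel3_def
proof (intro ballI)
 fix w x p assume *: "w : W" "x : X" "p : P"
 show "G w x p = sm3 R t (%a b c. K (act W a w) (act X b x) (act P c p))"
  using r * by (intro spans_lin_eq[OF f(2) tri_3[OF G *(1,2)] tri_3[OF tri_rel[OF hm(1,2,5,6) K t] *(1,2)] _ *(3)])
   (simp add: rel4_def sw4_cop3_apply[OF hm K f(1) t])
qed

lemma rel2_of_copl:
 assumes r: "rel3 X Y Z R (%x y z. G (f x y) z) (%x y z. K (f x y) z) (copl t)"
  and f: "eqb X Y P f" "spans X Y P f" and G: "bil k P Z R G" and K: "bil k P Z R K" and t: "t : HH"
  and hm: "hmod X" "hmod Y" "hmod Z" "hmod P" "kmod R"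
 shows "rel2 P Z R G K t"
 unfolding rel2_def
proof (intro ballI)
 fix p z assume *: "p : P" "z : Z"
 show "G p z = sm2 R t (%a b. K (act P a p) (act Z b z))"
  using r * by (intro spans_lin_eq[OF f(2) bil_l[OF G *(2)] bil_l[OF bil_rel[OF hm(4,3,5) K t] *(2)] _ *(1)])
   (simp add: rel3_def sw3_copl_apply[OF hm K f(1) t])
qed

lemma rel2_of_copr:
 assumes r: "rel3 X Y Z R (%x y z. G x (f y z)) (%x y z. K x (f y z)) (copr t)"
  and f: "eqb Y Z P f" "spans Y Z P f" and G: "bil k X P R G" and K: "bil k X P R K" and t: "t : HH"
  and hm: "hmod X" "hmod Y" "hmod Z" "hmod P" "kmod R"
 shows "rel2 X P R G K t"
 unfolding rel2_def
proof (intro ballI)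
 fix x p assume *: "x : X" "p : P"
 show "G x p = sm2 R t (%a b. K (act X a x) (act P b p))"
  using r * by (intro spans_lin_eq[OF f(2) bil_r[OF G *(1)] bil_r[OF bil_rel[OF hm(1,4,5) K t] *(1)] _ *(2)])
   (simp add: rel3_def sw3_copr_apply[OF hm K f(1) t])
qed

lemma eqb_of_eqr_spans:
 assumes F: "eqr X V W R (%x v w. f x (p v w))" and p: "eqb V W T p" "spans V W T p" and f: "bil k X T R f"
  and hm: "hmod X" "hmod V" "hmod W" "hmod T" "hmod R"
 shows "eqb X T R f"
 unfolding eqb_def
proof (intro conjI f ballI)
 note mR = hmod_mod[OF hm(5)]
 fix h x t assume h: "h : H" and x: "x : X" and t: "t : T"
 show "act R h (f x t) = sm2 R (cop h) (%a b. f (act X a x) (act T b t))"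
 proof (rule spans_lin_eq[OF p(2) lin_comp[OF bil_r[OF f x] act_lin2[OF hm(5) h]]
    bil_r[OF bil_rel[OF hm(1,4) mR f cop_cl[OF h]] x] _ t])
  fix v w assume *: "v : V" "w : W"
  show "act R h (f x (p v w)) = sm2 R (cop h) (%a b. f (act X a x) (act T b (p v w)))"
   using F h x * by (simp add: eqt_def sw3_copr_apply[OF hm(1-4) mR f p(1) cop_cl[OF h]])
 qed
qed

end

section \<open>Bimodules\<close>

lemma mk_bimod_simps:
 "carrier (mk_bimod M l r) = carrier M" "add (mk_bimod M l r) = add M" "zero (mk_bimod M l r) = zero M"
 "smult (mk_bimod M l r) = smult M" "act (mk_bimod M l r) = act M" "lact (mk_bimod M l r) = l" "ract (mk_bimod M l r) = r"
 by (simp_all add: mk_bimod_def)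

lemma tlift_cong_modules:
 assumes "carrier V = carrier V'" "add V = add V'" "smult V = smult V'"
  and "carrier W = carrier W'" "add W = add W'" "smult W = smult W'"
  and "carrier X = carrier X'" "add X = add X'" "smult X = smult X'"
 shows "tlift k V W X f = tlift k V' W' X' f"
proof -
 have t: "tmod k V W = tmod k V' W'" "pure k V W = pure k V' W'"
  using assms by (auto simp: tmod_def tens_null_def tens_rels_def pure_def fun_eq_iff)
 have "lin k (tmod k V W) X = lin k (tmod k V' W') X'"
  unfolding t using assms by (auto simp: lin_def is_lin_def)
 thus ?thesis unfolding tlift_def t using assms by simp
qed

locale algebra_setting = quasitriangular_quasi_Hopf_algebra k H
 for k :: "'k ring" and H :: "('k, 'h) qqH" +
 fixes A :: "('k, 'h, 'a) halg"
 assumes halg: "is_halg k H A"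
begin

abbreviation al where "al V \<equiv> lm k A V"
abbreviation ar where "ar V \<equiv> rm k A V"
abbreviation am where "am \<equiv> mm k A"
abbreviation ten (infixr "**" 75) where "V**W \<equiv> tensA k H A V W"
abbreviation pr where "pr V W \<equiv> pureA k H A V W"

lemma hmod_A: "hmod A" and mu_hmor: "hmor (ht A A) A (mu A)"
 using halg by (simp_all add: is_halg_def)

lemmas mod_A = hmod_mod[OF hmod_A]

lemma am_eqb: "eqb A A A am"
 using hmor_eqb[OF hmod_A hmod_A hmod_A mu_hmor] by (simp add: mm_def[abs_def])

text \<open>A bimodule enters the arguments below through its three associativity laws, with \<open>\<phi>\<close> on the same side.\<close>

definition bim where
 "bim V <-> hmod V \<and> hmor (ht A V) V (lact V) \<and> hmor (ht V A) V (ract V) \<and>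
   rel3 V A A V (%v a b. ar V (ar V v a) b) (%v a b. ar V v (am a b)) ph \<and>
   rel3 A A V V (%a b v. al V (am a b) v) (%a b v. al V a (al V b v)) ph \<and>
   rel3 A V A V (%a v b. ar V (al V a v) b) (%a v b. al V a (ar V v b)) ph"

lemma bim_hmod: "bim V ==> hmod V"
 and bim_lact: "bim V ==> hmor (ht A V) V (lact V)"
 and bim_ract: "bim V ==> hmor (ht V A) V (ract V)"
 by (simp_all add: bim_def)

lemmas bim_module = hmod_mod[OF bim_hmod]

lemma al_eqb: "bim V ==> eqb A V V (al V)"
 using hmor_eqb[OF hmod_A bim_hmod bim_hmod bim_lact] by (simp add: lm_def[abs_def])

lemma ar_eqb: "bim V ==> eqb V A V (ar V)"
 using hmor_eqb[OF bim_hmod hmod_A bim_hmod bim_ract] by (simp add: rm_def[abs_def])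

lemma am_closed: "a : A ==> b : A ==> am a b : A"
 by (rule eqb_closed[OF am_eqb])

lemma is_bimod_bim:
 assumes "is_bimod k H A V" shows "bim V"
proof -
 have h: "hmod V" "hmor (ht A V) V (lact V)" "hmor (ht V A) V (ract V)" using assms by (simp_all add: is_bimod_def)
 note b = eqb_bil[OF am_eqb] eqb_bil[OF hmor_eqb[OF hmod_A h(1,1,2)]] eqb_bil[OF hmor_eqb[OF h(1) hmod_A h(1,3)]]
 note b' = b(1) b(2)[folded lm_def] b(3)[folded rm_def]
 have "rel3 A A V V (%a b v. al V (am a b) v) (%a b v. al V a (al V b v)) ph"
  by (rule rel3_inv[OF hmod_A hmod_A h(1) hmod_mod[OF h(1)] tri_left[OF b'(1,2)] _ ipair_sym[OF phi_ipair]])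
   (use assms in \<open>simp add: rel3_def is_bimod_def\<close>)
 moreover have "rel3 A V A V (%a v b. ar V (al V a v) b) (%a v b. al V a (ar V v b)) ph"
  by (rule rel3_inv[OF hmod_A h(1) hmod_A hmod_mod[OF h(1)] tri_left[OF b'(2,3)] _ ipair_sym[OF phi_ipair]])
   (use assms in \<open>simp add: rel3_def is_bimod_def\<close>)
 ultimately show ?thesis using assms by (simp add: bim_def is_bimod_def rel3_def)
qed

text \<open>Bimodule structures are maps on tensor products, but are constructed as products of elements.\<close>

lemma bimI:
 fixes V :: "('k, 'h, 'a, 'v) bimod"
 assumes V: "hmod V" and l: "eqb A V V l" and r: "eqb V A V r"
  and lV: "lact V = tlift k A V V l" and rV: "ract V = tlift k V A V r"
  and rr: "rel3 V A A V (%v a b. r (r v a) b) (%v a b. r v (am a b)) ph"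
  and ll: "rel3 A A V V (%a b v. l (am a b) v) (%a b v. l a (l b v)) ph"
  and lr: "rel3 A V A V (%a v b. r (l a v) b) (%a v b. l a (r v b)) ph"
 shows "bim V" and "!!a v. a : A ==> v : V ==> al V a v = l a v"
  and "!!a v. a : A ==> v : V ==> ar V v a = r v a"
proof -
 note mV = hmod_mod[OF V]
 show al: "al V a v = l a v" if "a : A" "v : V" for a v
  unfolding lm_def lV by (rule tlift_pure[OF mod_A mV mV eqb_bil[OF l] that])
 show ar: "ar V v a = r v a" if "a : A" "v : V" for a v
  unfolding rm_def rV by (rule tlift_pure[OF mV mod_A mV eqb_bil[OF r] that(2,1)])
 note cl = eqb_closed[OF l] eqb_closed[OF r] act_closed[OF V] act_closed[OF hmod_A] am_closed
 show "bim V"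
  unfolding bim_def
  using V hten_lift_hmor[OF hmod_A V V l] hten_lift_hmor[OF V hmod_A V r] rr ll lr
  by (auto simp: lV rV al ar cl rel3_def cong: sw3_cong)
qed

subsection \<open>The universal property of the tensor product over the algebra\<close>

text \<open>One-sided data: this is all that the definition of \<open>V \<otimes>\<^sub>A W\<close> refers to, and for \<open>hom\<close> and \<open>V \<otimes> A\<close> the quotient
is formed before the bimodule laws are known.\<close>

definition wr where "wr V <-> hmod V \<and> klin (ht V A) V (ract V)"
definition wl where "wl V <-> hmod V \<and> klin (ht A V) V (lact V)"

lemma bim_wl_wr: "bim V ==> wl V" "bim V ==> wr V"
 by (auto simp: wl_def wr_def bim_def is_hmor_def)

lemma w_bil: "wl V ==> bil k A V V (al V)" "wr V ==> bil k V A V (ar V)"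
 using bil_lin[where g = "lact V" and R = V, OF _ hten_pure_bil[OF mod_A hmod_mod]]
  bil_lin[where g = "ract V" and R = V, OF _ hten_pure_bil[OF hmod_mod mod_A]]
 by (auto simp: wl_def wr_def lm_def[abs_def] rm_def[abs_def])

text \<open>The bilinear maps that factor through \<open>V \<otimes>\<^sub>A W\<close>.\<close>

definition bal where
 "bal V W X f <-> bil k V W X f \<and> rel3 V A W X (%v a w. f (ar V v a) w) (%v a w. f v (al W a w)) ph"

lemma tmodA_simps:
 "carrier (V**W) = carrier (tmodA k H A V W)" "add (V**W) = add (tmodA k H A V W)"
 "zero (V**W) = zero (tmodA k H A V W)" "smult (V**W) = smult (tmodA k H A V W)"
 by (simp_all add: tensA_def mk_bimod_simps mk_hmod_simps)

lemma lin_tmodA: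
 "klin (tmodA k H A V W) X f <-> klin (V**W) X f"
 "klin X (tmodA k H A V W) g <-> klin X (V**W) g"
 by (simp_all add: is_lin_def tmodA_simps)

lemma sw_tmodA:
 "sm2 (tmodA k H A V W) t f = sm2 (V**W) t f" "sm3 (tmodA k H A V W) u g = sm3 (V**W) u g"
 by (rule sw_mod_cong; simp add: tmodA_simps)+

lemma tliftA_ten: "tliftA k H A V W (tmodA k H A V' W') f = tliftA k H A V W (V'**W') f"
proof -
 have "lin k Z (tmodA k H A V' W') = lin k Z (V'**W')" for Z :: "('k, 'z, 'zz) module_scheme"
  by (auto simp: lin_def is_lin_def tmodA_simps)
 from this[of "tmodA k H A V W"] show ?thesis by (simp add: tliftA_def)
qed

context
 fixes V :: "('k, 'h, 'a, 'v) bimod" and W :: "('k, 'h, 'a, 'w) bimod"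
 assumes V: "wr V" and W: "wl W"
begin

private lemma hV: "hmod V" and hW: "hmod W"
 using V W by (auto simp: wr_def wl_def)

private lemmas mV = hmod_mod[OF hV] and mW = hmod_mod[OF hW]
private lemmas T3 = hten_hmod[OF hten_hmod[OF hV hmod_A] hW]

definition "nullmap = (%t. tmap k (ht V A) W V W (ract V) id t
    \<ominus>\<^bsub>ht V W\<^esub> (tmap k V (ht A W) V W id (lact W) \<circ> Phi k H V A W) t)"

private lemma id_lin: "klin X X id"
 by (auto intro: is_linI)

private lemmas tm1 = tmap_pure[OF hmod_mod[OF hten_hmod[OF hV hmod_A]] mV mW mW conjunct2[OF V[unfolded wr_def]] id_lin]
private lemmas tm2 = tmap_pure[OF mV mV hmod_mod[OF hten_hmod[OF hmod_A hW]] mW id_lin conjunct2[OF W[unfolded wl_def]]]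
private lemmas Phi_l = is_hmor_lin[OF Phi_pure(3)[OF hV hmod_A hW module_zero_closed[OF mV] module_zero_closed[OF mod_A]
      module_zero_closed[OF mW]]]

lemma nullmap_lin: "klin (ht (ht V A) W) (ht V W) nullmap"
 unfolding nullmap_def comp_def
 by (rule lin_minusf[OF hten_module[OF mV mW] tm1(1) lin_comp[OF Phi_l tm2(1)]])

lemma nullmap_pure:
 assumes el: "v : V" "a : A" "w : W"
 shows "nullmap (pure k (ht V A) W (pure k V A v a) w) = pure k V W (ar V v a) w
   \<ominus>\<^bsub>ht V W\<^esub> sm3 (ht V W) ph (%x y z. pure k V W (act V x v) (al W (act A y a) (act W z w)))"
proof -
 have t: "tri k H H H (ht V (ht A W)) (%x y z. pure k V (ht A W) (act V x v) (pure k A W (act A y a) (act W z w)))"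
  by (rule tri_act[OF hV hmod_A hW tri_right[OF hten_pure_bil[OF mod_A mW] hten_pure_bil[OF mV hten_module[OF mod_A mW]]] el])
 have "tmap k V (ht A W) V W id (lact W) (Phi k H V A W (pure k (ht V A) W (pure k V A v a) w))
  = sm3 (ht V W) ph (%x y z. pure k V W (act V x v) (al W (act A y a) (act W z w)))"
  unfolding Phi_pure(1)[OF hV hmod_A hW el]
   sw3_push[OF hten_module[OF mV hten_module[OF mod_A mW]] hten_module[OF mV mW] t tm2(1) phi_closed]
  by (rule sw3_cong) (simp add: tm2(2) hten_pure_closed[OF mod_A mW] act_closed hV hmod_A hW el lm_def)
 thus ?thesis by (simp add: nullmap_def tm1(2) hten_pure_closed[OF mV mod_A] el rm_def)
qed

lemma tensA_null_eq: "tensA_null k H A V W = nullmap ` carrier (ht (ht V A) W)"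
 by (simp add: tensA_null_def nullmap_def)

lemma tensA_null_submodule: "submodule (tensA_null k H A V W) k (ht V W)"
 unfolding tensA_null_eq by (rule image_submodule[OF hmod_mod[OF T3] hten_module[OF mV mW] nullmap_lin])

lemma ten_module: "kmod (V**W)"
 by (rule module_cong[OF quot_module_module[OF hten_module[OF mV mW] tensA_null_submodule]])
  (simp_all add: tmodA_simps tmodA_def)

lemma proj_lin: "klin (ht V W) (V**W) (%t. tensA_null k H A V W +>\<^bsub>ht V W\<^esub> t)"
 using quot_proj_lin[OF hten_module[OF mV mW] tensA_null_submodule] by (simp add: tmodA_def[symmetric] lin_tmodA)

lemma pr_bil: "bil k V W (V**W) (pr V W)"
 using bil_lin[OF proj_lin hten_pure_bil[OF mV mW]] by (simp add: pureA_def[abs_def])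

lemma pr_spans: "spans V W (V**W) (pr V W)"
 unfolding spans_def
proof (intro conjI allI impI subsetI pr_bil)
 fix S t assume t: "t : V**W" and p: "\<forall>v\<in>carrier V. \<forall>w\<in>carrier W. pr V W v w \<in> S"
  and a: "\<forall>s\<in>carrier (V**W). \<forall>t\<in>carrier (V**W). s \<in> S --> t \<in> S --> s \<oplus>\<^bsub>V**W\<^esub> t \<in> S"
 from t obtain s where s: "s : ht V W" "t = tensA_null k H A V W +>\<^bsub>ht V W\<^esub> s"
  unfolding tmodA_simps tmodA_def by (elim quot_carrierE[OF hten_module[OF mV mW] tensA_null_submodule])
 show "t \<in> S" unfolding s(2) using spans_pure[OF mV mW] s(1)
 proof (induction s rule: spans_induct)
  case (add s t)
  thus ?case using a lin_closed[OF proj_lin] by (simp add: lin_add[OF proj_lin])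
 qed (use p in \<open>simp add: pureA_def\<close>)
qed

lemma pr_balanced: "rel3 V A W (V**W) (%v a w. pr V W (ar V v a) w) (%v a w. pr V W v (al W a w)) ph"
 unfolding rel3_def
proof (intro ballI)
 fix v a w assume el: "v : V" "a : A" "w : W"
 note b = w_bil(2)[OF V] w_bil(1)[OF W] and hb = hten_pure_bil[OF mV mW]
 have t: "tri k H H H (ht V W) (%x y z. pure k V W (act V x v) (al W (act A y a) (act W z w)))"
  by (rule tri_act[OF hV hmod_A hW tri_right[OF b(2) hb] el])
 let ?s = "sm3 (ht V W) ph (%x y z. pure k V W (act V x v) (al W (act A y a) (act W z w)))"
 have c: "pure k V W (ar V v a) w : ht V W" "?s : ht V W"
  using bil_closed[OF hb bil_closed[OF b(1) el(1,2)] el(3)] sw3_closed[OF hten_module[OF mV mW] t phi_closed] .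
 have "pure k V W (ar V v a) w \<ominus>\<^bsub>ht V W\<^esub> ?s \<in> tensA_null k H A V W"
  unfolding nullmap_pure[OF el, symmetric] tensA_null_eq
  by (rule imageI) (simp add: hten_pure_closed hmod_mod hten_hmod hV hW hmod_A el)
 hence "pr V W (ar V v a) w = tensA_null k H A V W +>\<^bsub>ht V W\<^esub> ?s"
  unfolding pureA_def using quot_eq_iff[OF hten_module[OF mV mW] tensA_null_submodule c] by simp
 also have "... = sm3 (V**W) ph (%x y z. pr V W (act V x v) (al W (act A y a) (act W z w)))"
  unfolding pureA_def by (rule sw3_push[OF hten_module[OF mV mW] ten_module t proj_lin phi_closed])
 finally show "pr V W (ar V v a) w
  = sm3 (V**W) ph (%x y z. pr V W (act V x v) (al W (act A y a) (act W z w)))" .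
qed

text \<open>The relations of \<open>V \<otimes>\<^sub>A W\<close> are the image of a linear map. On generators the lift of \<open>f\<close> sends them to the
defect of balancing, so it descends to the quotient.\<close>

lemma tliftA_props:
 assumes X: "kmod X" and f: "bal V W X f"
 shows "tliftA k H A V W X f \<in> lin k (tmodA k H A V W) X"
  and "v : V ==> w : W ==> tliftA k H A V W X f (pr V W v w) = f v w"
  and "!!g. g \<in> lin k (tmodA k H A V W) X ==> (!!v w. v : V ==> w : W ==> g (pr V W v w) = f v w)
   ==> g = tliftA k H A V W X f"
proof -
 have fb: "bil k V W X f" using f by (simp add: bal_def)
 let ?F = "tlift k V W X f"
 have Fl: "klin (ht V W) X ?F" unfolding lin_hten by (rule tlift_lin[OF mV mW X fb])
 have Fp: "?F (pure k V W v w) = f v w" if "v : V" "w : W" for v w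
  by (rule tlift_pure[OF mV mW X fb that])
 note b = w_bil(2)[OF V] w_bil(1)[OF W] and hb = hten_pure_bil[OF mV mW] and mVW = hten_module[OF mV mW]
 have "?F (nullmap t) = \<zero>\<^bsub>X\<^esub>" if t: "t : ht (ht V A) W" for t
 proof -
  have "?F (nullmap (pure k (ht V A) W s w)) = \<zero>\<^bsub>X\<^esub>" if s: "s : ht V A" and w: "w : W" for s w
  proof (rule spans_lin_eq[OF spans_pure[OF mV mod_A] _ lin_zerof[OF X] _ s])
   show "klin (ht V A) X (%s. ?F (nullmap (pure k (ht V A) W s w)))"
    by (rule lin_comp[OF lin_comp[OF bil_l[OF hten_pure_bil[OF hten_module[OF mV mod_A] mW] w] nullmap_lin] Fl])
   fix v a assume *: "v : V" "a : A"
   note el = * w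
   have t: "tri k H H H (ht V W) (%x y z. pure k V W (act V x v) (al W (act A y a) (act W z w)))"
    by (rule tri_act[OF hV hmod_A hW tri_right[OF b(2) hb] el])
   have arc: "ar V v a : V" by (rule bil_closed[OF b(1) *])
   have "?F (sm3 (ht V W) ph (%x y z. pure k V W (act V x v) (al W (act A y a) (act W z w)))) = f (ar V v a) w"
    unfolding sw3_push[OF mVW X t Fl phi_closed] using f el
    by (auto simp: bal_def rel3_def Fp act_closed hV hW hmod_A bil_closed[OF b(2)] cong: sw3_cong)
   thus "?F (nullmap (pure k (ht V A) W (pure k V A v a) w)) = \<zero>\<^bsub>X\<^esub>"
    unfolding nullmap_pure[OF el]
    using lin_minus[OF mVW X Fl bil_closed[OF hb arc w] sw3_closed[OF mVW t phi_closed]] Fp[OF arc w]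
     module_minus_eq_zero_iff[OF X bil_closed[OF fb arc w] bil_closed[OF fb arc w]] by simp
  qed
  thus ?thesis
   by (intro spans_lin_eq[OF spans_pure[OF hten_module[OF mV mod_A] mW] lin_comp[OF nullmap_lin Fl] lin_zerof[OF X] _ t])
 qed
 hence null: "?F n = \<zero>\<^bsub>X\<^esub>" if "n \<in> tensA_null k H A V W" for n
  using that unfolding tensA_null_eq by auto
 obtain g where g: "g \<in> lin k (tmodA k H A V W) X"
   "\<forall>x\<in>carrier (ht V W). g (tensA_null k H A V W +>\<^bsub>ht V W\<^esub> x) = ?F x"
  using quot_lift[OF mVW tensA_null_submodule X Fl null] by (auto simp: tmodA_def)
 have uni: "g1 = g2" if "g1 \<in> lin k (tmodA k H A V W) X" "g2 \<in> lin k (tmodA k H A V W) X"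
  "!!v w. v : V ==> w : W ==> g1 (pr V W v w) = g2 (pr V W v w)" for g1 g2
  by (rule lin_eqI[OF that(1,2)], rule spans_lin_eq[OF pr_spans])
   (use that in \<open>auto simp: lin_def lin_tmodA tmodA_simps\<close>)
 have gp: "\<forall>v\<in>carrier V. \<forall>w\<in>carrier W. g (pr V W v w) = f v w"
  unfolding pureA_def using g(2) hten_pure_closed[OF mV mW] Fp by simp
 have "\<exists>!g. g \<in> lin k (tmodA k H A V W) X \<and> (\<forall>v\<in>carrier V. \<forall>w\<in>carrier W. g (pr V W v w) = f v w)"
  using g(1) gp by (intro ex1I[of _ g] conjI) (auto intro!: uni)
 from theI'[OF this]
 have l: "tliftA k H A V W X f \<in> lin k (tmodA k H A V W) X"
  "!!v w. v : V ==> w : W ==> tliftA k H A V W X f (pr V W v w) = f v w"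
  unfolding tliftA_def by auto
 show "tliftA k H A V W X f \<in> lin k (tmodA k H A V W) X" by (rule l(1))
 show "v : V ==> w : W ==> tliftA k H A V W X f (pr V W v w) = f v w" by (rule l(2))
 show "!!g. g \<in> lin k (tmodA k H A V W) X ==> (!!v w. v : V ==> w : W ==> g (pr V W v w) = f v w)
   ==> g = tliftA k H A V W X f"
  by (rule uni) (auto simp: l)
qed

lemma tliftA_lin: "kmod X ==> bal V W X f ==> klin (V**W) X (tliftA k H A V W X f)"
 using tliftA_props(1) by (auto simp: lin_def lin_tmodA)

lemma tliftA_param_lin:
 assumes "kmod X" "kmod U" "!!u. u : U ==> bal V W X (f u)"
  and "!!v w. v : V ==> w : W ==> klin U X (%u. f u v w)" and "t : V**W"
 shows "klin U X (%u. tliftA k H A V W X (f u) t)"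
 using pr_spans assms(5)
proof (induction t rule: spans_induct)
 case (pure v w)
 show ?case by (rule lin_cong[OF assms(2) assms(4)[OF pure]]) (simp add: tliftA_props(2)[OF assms(1,3)] pure)
next
 case (add s t)
 show ?case by (rule lin_cong[OF assms(2) lin_addf[OF assms(1) add(3,4)]])
   (simp add: lin_add[OF tliftA_lin[OF assms(1,3)]] add)
qed

end

end

section \<open>Associativity up to the associator\<close>

context quasi_bialgebra
begin

text \<open>The products \<open>(x y) z\<close> and \<open>x (y z)\<close>, formed with \<open>f\<close>, \<open>g\<close> and \<open>f'\<close>, \<open>g'\<close>, correspond under \<open>\<phi>\<close>.
 Algebras, bimodules, tensor products, evaluations and compositions all satisfy this one law.\<close>

definition asc where
 "asc X Y Z R f g f' g' <-> rel3 X Y Z R (%x y z. g (f x y) z) (%x y z. g' x (f' y z)) ph"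

lemma asc_apply: "asc X Y Z R f g f' g' ==> x : X ==> y : Y ==> z : Z
  ==> g (f x y) z = sm3 R ph (%a b c. g' (act X a x) (f' (act Y b y) (act Z c z)))"
 by (simp add: asc_def rel3_def)

lemma rel3_unique:
 assumes hm: "hmod V" "hmod W" "hmod X" "kmod R"
  and t: "tri k V W X R G" "tri k V W X R K" and r: "rel3 V W X R F G s" "rel3 V W X R F K s" and s: "ipair HHH s s'"
  and el: "v : V" "w : W" "x : X"
 shows "G v w x = K v w x"
 using rel3D[OF rel3_inv[OF hm t(1) r(1) s] el] rel3D[OF rel3_inv[OF hm t(2) r(2) s] el] by simp

context
 fixes W X Y Z WX XY YZ WXY XYZ R p12 p23 p34 p12_3 p1_23 p23_4 p2_34 p123_4 p1_234 p12_34
 assumes hm: "hmod W" "hmod X" "hmod Y" "hmod Z"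
  and hp: "hmod WX" "hmod XY" "hmod YZ" "hmod WXY" "hmod XYZ" "hmod R"
  and e: "eqb W X WX p12" "eqb X Y XY p23" "eqb Y Z YZ p34" "eqb WX Y WXY p12_3" "eqb W XY WXY p1_23"
   "eqb XY Z XYZ p23_4" "eqb X YZ XYZ p2_34" "eqb WXY Z R p123_4" "eqb W XYZ R p1_234" "eqb WX YZ R p12_34"
begin

private lemmas eb = e[THEN eqb_bil]
private lemmas mp = hp[THEN hmod_mod]

private lemma quads:
 "quad k W X Y Z R (%w x y z. p123_4 (p12_3 (p12 w x) y) z)"
 "quad k W X Y Z R (%w x y z. p123_4 (p1_23 w (p23 x y)) z)"
 "quad k W X Y Z R (%w x y z. p1_234 w (p23_4 (p23 x y) z))"
 "quad k W X Y Z R (%w x y z. p1_234 w (p2_34 x (p34 y z)))"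
 "quad k W X Y Z R (%w x y z. p12_34 (p12 w x) (p34 y z))"
 by (rule quad_123[OF tri_left[OF eb(1,4)] eb(8)] quad_123[OF tri_right[OF eb(2,5)] eb(8)]
   quad_234[OF tri_left[OF eb(2,6)] eb(9)] quad_234[OF tri_right[OF eb(3,7)] eb(9)]
   quad_12[OF eb(1) tri_right[OF eb(3,10)]])+

private lemma sides:
 "asc W X Y WXY p12 p12_3 p23 p1_23 ==> rel4 W X Y Z R
  (%w x y z. p123_4 (p12_3 (p12 w x) y) z) (%w x y z. p123_4 (p1_23 w (p23 x y)) z) pLR"
 "asc W XY Z R p1_23 p123_4 p23_4 p1_234 ==> rel4 W X Y Z R
  (%w x y z. p123_4 (p1_23 w (p23 x y)) z) (%w x y z. p1_234 w (p23_4 (p23 x y) z)) pM"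
 "asc X Y Z XYZ p23 p23_4 p34 p2_34 ==> rel4 W X Y Z R
  (%w x y z. p1_234 w (p23_4 (p23 x y) z)) (%w x y z. p1_234 w (p2_34 x (p34 y z))) pRR"
 "asc WX Y Z R p12_3 p123_4 p34 p12_34 ==> rel4 W X Y Z R
  (%w x y z. p123_4 (p12_3 (p12 w x) y) z) (%w x y z. p12_34 (p12 w x) (p34 y z)) pA"
 "asc W X YZ R p12 p12_34 p2_34 p1_234 ==> rel4 W X Y Z R
  (%w x y z. p12_34 (p12 w x) (p34 y z)) (%w x y z. p1_234 w (p2_34 x (p34 y z))) pB"
 unfolding asc_def
 by (rule rel4_leg123[OF _ eb(8) tri_right[OF eb(2,5)] phi_closed hm mp(4,6)]
   rel4_cop2[OF _ e(2) tri_right[OF eb(6,9)] phi_closed hm hp(2) mp(6)]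
   rel4_leg234[OF _ eb(9) tri_right[OF eb(3,7)] phi_closed hm mp(5,6)]
   rel4_cop1[OF _ e(1) tri_right[OF eb(3,10)] phi_closed hm hp(1) mp(6)]
   rel4_cop3[OF _ e(3) tri_right[OF eb(7,9)] phi_closed hm hp(3) mp(6)]; assumption)+

text \<open>Four of the five associativity laws around the pentagon imply the fifth, on generators.\<close>

lemma asc_pent_123_4:
 assumes "asc W X Y WXY p12 p12_3 p23 p1_23" "asc W XY Z R p1_23 p123_4 p23_4 p1_234"
  "asc X Y Z XYZ p23 p23_4 p34 p2_34" "asc W X YZ R p12 p12_34 p2_34 p1_234" and s: "spans W X WX p12"
 shows "asc WX Y Z R p12_3 p123_4 p34 p12_34"
 unfolding asc_def
 by (rule rel3_of_cop1[OF pent_15[OF hm mp(6) quads(2-5) sides(1)[OF assms(1)] sides(2)[OF assms(2)]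
    sides(3)[OF assms(3)] sides(5)[OF assms(4)]] e(1) s tri_left[OF eb(4,8)] tri_right[OF eb(3,10)]
    phi_closed hm hp(1) mp(6)])

lemma asc_pent_1_2_34:
 assumes "asc W X Y WXY p12 p12_3 p23 p1_23" "asc W XY Z R p1_23 p123_4 p23_4 p1_234"
  "asc X Y Z XYZ p23 p23_4 p34 p2_34" "asc WX Y Z R p12_3 p123_4 p34 p12_34" and s: "spans Y Z YZ p34"
 shows "asc W X YZ R p12 p12_34 p2_34 p1_234"
 unfolding asc_def
 by (rule rel3_of_cop3[OF pent_54[OF hm mp(6) quads(2-5) sides(1)[OF assms(1)] sides(2)[OF assms(2)]
    sides(3)[OF assms(3)] sides(4)[OF assms(4)] quads(1)] e(3) s tri_left[OF eb(1,10)] tri_right[OF eb(7,9)]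
    phi_closed hm hp(3) mp(6)])

lemma asc_pent_1_23_4:
 assumes "asc W X Y WXY p12 p12_3 p23 p1_23" "asc X Y Z XYZ p23 p23_4 p34 p2_34"
  "asc WX Y Z R p12_3 p123_4 p34 p12_34" "asc W X YZ R p12 p12_34 p2_34 p1_234" and s: "spans X Y XY p23"
 shows "asc W XY Z R p1_23 p123_4 p23_4 p1_234"
 unfolding asc_def
 by (rule rel3_of_cop2[OF pent_23[OF hm mp(6) quads(2-5) sides(1)[OF assms(1)] sides(3)[OF assms(2)]
    sides(4)[OF assms(3)] sides(5)[OF assms(4)] quads(1)] e(2) s tri_left[OF eb(5,8)] tri_right[OF eb(6,9)]
    phi_closed hm hp(2) mp(6)])

text \<open>The innermost product cannot be isolated from the outer one: the law for \<open>w\<close>, \<open>x\<close>, \<open>y\<close> holds only after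
multiplication with \<open>z\<close>. When that multiplication is evaluation, nondegeneracy removes it.\<close>

lemma asc_pent_123:
 assumes "asc W XY Z R p1_23 p123_4 p23_4 p1_234" "asc X Y Z XYZ p23 p23_4 p34 p2_34"
  "asc WX Y Z R p12_3 p123_4 p34 p12_34" "asc W X YZ R p12 p12_34 p2_34 p1_234"
  and el: "w : W" "x : X" "y : Y" "z : Z"
 shows "p123_4 (p12_3 (p12 w x) y) z
  = p123_4 (sm3 WXY ph (%a b c. p1_23 (act W a w) (p23 (act X b x) (act Y c y)))) z"
proof -
 have "rel4 W X Y Z R (%w x y z. p123_4 (p12_3 (p12 w x) y) z) (%w x y z. p123_4 (p1_23 w (p23 x y)) z) pLR"
  by (rule pent_12[OF hm mp(6) quads(2-5) sides(2)[OF assms(1)] sides(3)[OF assms(2)]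
    sides(4)[OF assms(3)] sides(5)[OF assms(4)]])
 thus ?thesis using el by (simp add: rel4_def sw4_leg123_apply[OF hm mp(4,6) tri_right[OF eb(2,5)] eb(8) phi_closed])
qed

end

end

section \<open>The monoidal category of bimodules\<close>

context algebra_setting
begin

lemma asc_rr: "bim V ==> asc V A A V (ar V) (ar V) am (ar V)"
 and asc_ll: "bim V ==> asc A A V V am (al V) (al V) (al V)"
 and asc_lr: "bim V ==> asc A V A V (al V) (ar V) (ar V) (al V)"
 by (simp_all add: asc_def bim_def)

lemma asc_balanced: "wr V ==> wl W ==> asc V A W (V**W) (ar V) (pr V W) (al W) (pr V W)"
 by (simp add: asc_def pr_balanced)

lemma bal_asc: "bal V W X f <-> bil k V W X f \<and> asc V A W X (ar V) f (al W) f"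
 by (simp add: bal_def asc_def)

text \<open>A product of \<open>V \<otimes>\<^sub>A W\<close> with \<open>X\<close>, prescribed by \<open>(v \<otimes> w) x = v (w x)\<close>, is well defined if the two
 products on the right are \<open>A\<close>-balanced, respectively left \<open>A\<close>-linear: this is the pentagon for
 \<open>v\<close>, \<open>a\<close>, \<open>w\<close>, \<open>x\<close>.\<close>

definition mixr where
 "mixr V W X R p q t x = tliftA k H A V W R (%v w. sm3 R ph (%a b c.
   q (act V a v) (p (act W b w) (act X c x)))) t"

definition mixl where
 "mixl X V W R p q x t = tliftA k H A V W R (%v w. sm3 R phiI (%a b c.
   q (p (act X a x) (act V b v)) (act W c w))) t"

context
 fixes V W X P R
 assumes V: "bim V" and W: "bim W" and X: "hmod X" and P: "bim P" and R: "hmod R"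
begin

private lemmas h_m = bim_hmod[OF V] bim_hmod[OF W] bim_hmod[OF P]
private lemmas mR_m = hmod_mod[OF R]
private lemmas Vp_m = bim_wl_wr(2)[OF V] and Wp_m = bim_wl_wr(1)[OF W]

lemma mixr_balanced:
 assumes p: "eqb W X P p" and q: "eqb V P R q"
  and lp: "asc A W X P (al W) p p (al P)" and bq: "asc V A P R (ar V) q (al P) q" and x: "x : X"
 shows "bal V W R (%v w. sm3 R ph (%a b c. q (act V a v) (p (act W b w) (act X c x))))"
proof -
 note b = eqb_bil[OF p] eqb_bil[OF q]
 let ?S = "%v w x. sm3 R ph (%a b c. q (act V a v) (p (act W b w) (act X c x)))"
 have r: "rel3 V W X R ?S (%v w x. q v (p w x)) ph" by (simp add: rel3_def)
 have tK: "tri k V W X R (%v w x. q v (p w x))" by (rule tri_right[OF b])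
 have S: "tri k V W X R ?S" by (rule tri_rel[OF h_m(1,2) X mR_m tK phi_closed])
 note hm = h_m(1) hmod_A h_m(2) X
 note lb = eqb_bil[OF al_eqb[OF W]] eqb_bil[OF ar_eqb[OF V]] eqb_bil[OF al_eqb[OF P]]
 note q2 = quad_23[OF lb(1) S] and q3 = quad_234[OF tri_left[OF lb(1) b(1)] b(2)]
  and q4 = quad_234[OF tri_right[OF b(1) lb(3)] b(2)] and q5 = quad_12[OF lb(2) tK]
 have "rel4 V A W X R (%v a w x. ?S (ar V v a) w x) (%v a w x. ?S v (al W a w) x) pLR"
  by (rule pent_12[OF hm mR_m q2 q3 q4 q5 rel4_cop2[OF r al_eqb[OF W] tK phi_closed hm h_m(2) mR_m]
     rel4_leg234[OF lp[unfolded asc_def] b(2) tri_right[OF b(1) lb(3)] phi_closed hm bim_module[OF P] mR_m]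
     rel4_cop1[OF r ar_eqb[OF V] tK phi_closed hm h_m(1) mR_m]
     rel4_cop3[OF bq[unfolded asc_def] p tri_right[OF lb(3) b(2)] phi_closed hm h_m(3) mR_m]])
 from rel4_leg123D[OF this q2 phi_closed mR_m hm x] x show ?thesis
  unfolding bal_def by (auto intro!: bilI intro: tri_1[OF S] tri_2[OF S])
qed

lemma mixr_props:
 assumes p: "eqb W X P p" and q: "eqb V P R q"
  and lp: "asc A W X P (al W) p p (al P)" and bq: "asc V A P R (ar V) q (al P) q" and T: "hmod (V**W)"
  and eT: "eqb V W (V**W) (pr V W)"
 shows "eqb (V**W) X R (mixr V W X R p q)" and "asc V W X R (pr V W) (mixr V W X R p q) p q"
proof -
 note bl = mixr_balanced[OF p q lp bq]
 have tK: "tri k V W X R (%v w x. q v (p w x))" by (rule tri_right[OF eqb_bil[OF p] eqb_bil[OF q]])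
 have mb: "bil k (V**W) X R (mixr V W X R p q)"
  unfolding mixr_def
 proof (rule bilI)
  fix t assume t: "t : V**W"
  show "klin X R (%x. tliftA k H A V W R (%v w. sm3 R ph (%a b c.
    q (act V a v) (p (act W b w) (act X c x)))) t)"
   by (rule tliftA_param_lin[OF Vp_m Wp_m mR_m hmod_mod[OF X] bl tri_3[OF tri_rel[OF h_m(1,2) X mR_m tK phi_closed]] t])
 qed (rule tliftA_lin[OF Vp_m Wp_m mR_m bl])
 show a: "asc V W X R (pr V W) (mixr V W X R p q) p q"
  by (simp add: asc_def rel3_def mixr_def tliftA_props(2)[OF Vp_m Wp_m mR_m bl])
 show "eqb (V**W) X R (mixr V W X R p q)"
  by (rule eqb_of_eql_spans[OF eql_rel[OF h_m(1,2) X R eqr_right[OF p q h_m(1,2) X h_m(3) mR_m] a[unfolded asc_def]]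
    eT pr_spans[OF Vp_m Wp_m] mb h_m(1,2) X T R])
qed

lemma mixl_balanced:
 assumes p: "eqb X V P p" and q: "eqb P W R q"
  and rp: "asc X V A P p (ar P) (ar V) p" and bq: "asc P A W R (ar P) q (al W) q" and x: "x : X"
 shows "bal V W R (%v w. sm3 R phiI (%a b c. q (p (act X a x) (act V b v)) (act W c w)))"
proof -
 note b = eqb_bil[OF p] eqb_bil[OF q]
 let ?S = "%x v w. sm3 R phiI (%a b c. q (p (act X a x) (act V b v)) (act W c w))"
 have r: "rel3 X V W R ?S (%x v w. q (p x v) w) phiI" by (simp add: rel3_def)
 have tK: "tri k X V W R (%x v w. q (p x v) w)" by (rule tri_left[OF b])
 have S: "tri k X V W R ?S" by (rule tri_rel[OF X h_m(1,2) mR_m tK phiI_closed])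
 have r': "rel3 X V W R (%x v w. q (p x v) w) ?S ph"
  by (rule rel3_inv[OF X h_m(1,2) mR_m tK r ipair_sym[OF phi_ipair]])
 note hm = X h_m(1) hmod_A h_m(2)
 note lb = eqb_bil[OF al_eqb[OF W]] eqb_bil[OF ar_eqb[OF V]] eqb_bil[OF ar_eqb[OF P]]
 note q1 = quad_123[OF tri_left[OF b(1) lb(3)] b(2)] and q2 = quad_123[OF tri_right[OF lb(2) b(1)] b(2)]
  and q3 = quad_23[OF lb(2) S] and q4 = quad_34[OF lb(1) S] and q5 = quad_12[OF b(1) tri_right[OF lb(1) b(2)]]
 have "rel4 X V A W R (%x v a w. ?S x (ar V v a) w) (%x v a w. ?S x v (al W a w)) pRR"
  by (rule pent_34[OF hm mR_m q2 q3 q4 q5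
     rel4_leg123[OF rp[unfolded asc_def] b(2) tri_right[OF lb(2) b(1)] phi_closed hm bim_module[OF P] mR_m]
     rel4_cop2[OF r' ar_eqb[OF V] S phi_closed hm h_m(1) mR_m]
     rel4_cop1[OF bq[unfolded asc_def] p tri_right[OF lb(1) b(2)] phi_closed hm h_m(3) mR_m]
     rel4_cop3[OF r' al_eqb[OF W] S phi_closed hm h_m(2) mR_m] q1])
 from rel4_leg234D[OF this q4 phi_closed mR_m hm x] x show ?thesis
  unfolding bal_def by (auto intro!: bilI intro: tri_2[OF S] tri_3[OF S])
qed

lemma mixl_props:
 assumes p: "eqb X V P p" and q: "eqb P W R q"
  and rp: "asc X V A P p (ar P) (ar V) p" and bq: "asc P A W R (ar P) q (al W) q" and T: "hmod (V**W)"
  and eT: "eqb V W (V**W) (pr V W)"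
 shows "eqb X (V**W) R (mixl X V W R p q)" and "asc X V W R p q (pr V W) (mixl X V W R p q)"
proof -
 note bl = mixl_balanced[OF p q rp bq]
 have tK: "tri k X V W R (%x v w. q (p x v) w)" by (rule tri_left[OF eqb_bil[OF p] eqb_bil[OF q]])
 have mb: "bil k X (V**W) R (mixl X V W R p q)"
  unfolding mixl_def
 proof (rule bilI)
  fix t assume t: "t : V**W"
  show "klin X R (%x. tliftA k H A V W R (%v w. sm3 R phiI (%a b c.
    q (p (act X a x) (act V b v)) (act W c w))) t)"
   by (rule tliftA_param_lin[OF Vp_m Wp_m mR_m hmod_mod[OF X] bl tri_1[OF tri_rel[OF X h_m(1,2) mR_m tK phiI_closed]] t])
 qed (rule tliftA_lin[OF Vp_m Wp_m mR_m bl])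
 have r: "rel3 X V W R (%x v w. mixl X V W R p q x (pr V W v w)) (%x v w. q (p x v) w) phiI"
  by (simp add: rel3_def mixl_def tliftA_props(2)[OF Vp_m Wp_m mR_m bl])
 show "asc X V W R p q (pr V W) (mixl X V W R p q)"
  unfolding asc_def by (rule rel3_inv[OF X h_m(1,2) mR_m tK r ipair_sym[OF phi_ipair]])
 show "eqb X (V**W) R (mixl X V W R p q)"
  by (rule eqb_of_eqr_spans[OF eqr_rel[OF X h_m(1,2) R eql_left[OF p q X h_m(1,2) h_m(3) mR_m] r]
    eT pr_spans[OF Vp_m Wp_m] mb X h_m(1,2) T R])
qed

end

subsection \<open>The tensor product of bimodules is a bimodule\<close>

context
 fixes V W
 assumes V: "bim V" and W: "bim W"
begin

private lemmas h_t = bim_hmod[OF V] bim_hmod[OF W]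
private lemmas Vp_t = bim_wl_wr(2)[OF V] and Wp_t = bim_wl_wr(1)[OF W]
private lemmas mT_t = ten_module[OF Vp_t Wp_t] and pb_t = pr_bil[OF Vp_t Wp_t] and psp_t = pr_spans[OF Vp_t Wp_t]
private lemmas lb_t = eqb_bil[OF al_eqb[OF W]] eqb_bil[OF ar_eqb[OF V]]

private abbreviation "actT x v w \<equiv> sm2 (V**W) (cop x) (%a b. pr V W (act V a v) (act W b w))"

text \<open>The action of \<open>H\<close> respects balancing because the products on both sides are equivariant and quasi-coassociativity
exchanges the two iterated coproducts.\<close>

private lemma actT_bal_t: "x : H ==> bal V W (V**W) (actT x)"
 unfolding bal_def rel3_def
proof (intro conjI ballI)
 assume x: "x : H"
 note cl = cop_cl[OF x]
 note cc = copl_closed[OF cl] copr_closed[OF cl]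
 show "bil k V W (V**W) (actT x)" by (rule bil_rel[OF h_t mT_t pb_t cl])
 fix v a w assume el: "v : V" "a : A" "w : W"
 let ?G = "%v a w. pr V W v (al W a w)"
 have G: "tri k V A W (V**W) ?G" by (rule tri_right[OF lb_t(1) pb_t])
 note hm = h_t(1) hmod_A h_t(2)
 have "actT x (ar V v a) w = sm3 (V**W) (copl (cop x))
   (%b c d. pr V W (ar V (act V b v) (act A c a)) (act W d w))"
  by (rule sw3_copl_apply[OF hm h_t(1) mT_t pb_t ar_eqb[OF V] cl el, symmetric])
 also have "... = sm3 (V**W) (ph *\<^sub>3 copl (cop x)) (%b c d. ?G (act V b v) (act A c a) (act W d w))"
  unfolding sw3_act_mult[OF hm mT_t G el phi_closed cc(1)]
  by (rule sw3_cong) (simp add: rel3D[OF pr_balanced[OF Vp_t Wp_t]] act_closed hm el)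
 also have "... = sm3 (V**W) (copr (cop x) *\<^sub>3 ph) (%b c d. ?G (act V b v) (act A c a) (act W d w))"
  by (simp add: coassoc x)
 also have "... = sm3 (V**W) ph (%b c d. actT x (act V b v) (al W (act A c a) (act W d w)))"
  unfolding sw3_act_mult[OF hm mT_t G el cc(2) phi_closed]
  by (rule sw3_cong) (simp add: sw3_copr_apply[OF hm h_t(2) mT_t pb_t al_eqb[OF W] cl] act_closed hm el)
 finally show "actT x (ar V v a) w
  = sm3 (V**W) ph (%b c d. actT x (act V b v) (al W (act A c a) (act W d w)))" .
qed

private lemma ten_act_t: "act (V**W) = (%x. tliftA k H A V W (V**W) (actT x))"
proof -
 have "act (V**W) = (%x. tliftA k H A V W (tmodA k H A V W) (%v w.
   sm2 (tmodA k H A V W) (cop x) (%a b. pr V W (act V a v) (act W b w))))"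
  by (simp only: tensA_def mk_bimod_simps mk_hmod_simps)
 thus ?thesis unfolding tliftA_ten sw_tmodA .
qed

private lemma ten_act_pr_t: "x : H ==> v : V ==> w : W ==> act (V**W) x (pr V W v w) = actT x v w"
 unfolding ten_act_t by (rule tliftA_props(2)[OF Vp_t Wp_t mT_t actT_bal_t])

lemma ten_hmod: "hmod (V**W)"
proof (rule hmod_of_spans[OF h_t mT_t psp_t _ _ ten_act_pr_t])
 show "klin (V**W) (V**W) (act (V**W) x)" if "x : H" for x
  unfolding ten_act_t by (rule tliftA_lin[OF Vp_t Wp_t mT_t actT_bal_t[OF that]])
 show "klin H (V**W) (%x. act (V**W) x t)" if t: "t : V**W" for t
  unfolding ten_act_t
  by (rule tliftA_param_lin[OF Vp_t Wp_t mT_t mod_H actT_bal_t sw2_comult_lin[OF mT_t bil_act[OF h_t pb_t]] t])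
qed

lemma pr_eqb: "eqb V W (V**W) (pr V W)"
 unfolding eqb_def using pb_t by (simp add: ten_act_pr_t)

private abbreviation "lT \<equiv> mixl A V W (V**W) (al V) (pr V W)"
private abbreviation "rT \<equiv> mixr V W A (V**W) (ar W) (pr V W)"

private lemmas lT = mixl_props[OF V W hmod_A V ten_hmod al_eqb[OF V] pr_eqb asc_lr[OF V] asc_balanced[OF Vp_t Wp_t] ten_hmod pr_eqb]
private lemmas rT = mixr_props[OF V W hmod_A W ten_hmod ar_eqb[OF W] pr_eqb asc_lr[OF W] asc_balanced[OF Vp_t Wp_t] ten_hmod pr_eqb]

private lemma ten_lact_t: "lact (V**W) = tlift k A (V**W) (V**W) lT"
proof -
 have "lact (V**W) = tlift k A (tmodA k H A V W) (tmodA k H A V W) (%x. tliftA k H A V W (tmodA k H A V W) (%v w.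
   sm3 (tmodA k H A V W) phiI (%a b c. pr V W (al V (act A a x) (act V b v)) (act W c w))))"
  by (simp only: tensA_def mk_bimod_simps mk_hmod_simps)
 also have "... = tlift k A (tmodA k H A V W) (tmodA k H A V W) lT"
  unfolding tliftA_ten sw_tmodA mixl_def[abs_def] ..
 also have "... = tlift k A (V**W) (V**W) lT" by (rule tlift_cong_modules) (simp_all add: tmodA_simps)
 finally show ?thesis .
qed

private lemma ten_ract_t: "ract (V**W) = tlift k (V**W) A (V**W) rT"
proof -
 have "ract (V**W) = tlift k (tmodA k H A V W) A (tmodA k H A V W) (%t x. tliftA k H A V W (tmodA k H A V W) (%v w.
   sm3 (tmodA k H A V W) ph (%a b c. pr V W (act V a v) (ar W (act W b w) (act A c x)))) t)"
  by (simp only: tensA_def mk_bimod_simps mk_hmod_simps)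
 also have "... = tlift k (tmodA k H A V W) A (tmodA k H A V W) rT"
  unfolding tliftA_ten sw_tmodA mixr_def[abs_def] ..
 also have "... = tlift k (V**W) A (V**W) rT" by (rule tlift_cong_modules) (simp_all add: tmodA_simps)
 finally show ?thesis .
qed

text \<open>The two defining formulas for the actions are associativity laws, and each law of a bimodule is
then a side of a pentagon with two factors in \<open>A\<close> whose other sides are known.\<close>

lemma ten_props:
 shows ten_bim: "bim (V**W)"
  and asc_al_pr: "asc A V W (V**W) (al V) (pr V W) (pr V W) (al (V**W))"
  and asc_pr_ar: "asc V W A (V**W) (pr V W) (ar (V**W)) (ar W) (pr V W)"
proof -
 let ?T = "V**W"
 note T = ten_hmod and Ah = hmod_A
 note eV = al_eqb[OF V] ar_eqb[OF V] and eW = al_eqb[OF W] ar_eqb[OF W]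
 have rr: "asc ?T A A ?T rT rT am rT"
  by (rule asc_pent_123_4[OF h_t Ah Ah T h_t(2) Ah T h_t(2) T pr_eqb eW(2) am_eqb rT(1) pr_eqb eW(2) eW(2) rT(1) pr_eqb rT(1)
    rT(2) rT(2) asc_rr[OF W] rT(2) psp_t])
 have ll: "asc A A ?T ?T am lT lT lT"
  by (rule asc_pent_1_2_34[OF Ah Ah h_t Ah h_t(1) T h_t(1) T T am_eqb eV(1) pr_eqb eV(1) eV(1) pr_eqb lT(1) pr_eqb lT(1) lT(1)
    asc_ll[OF V] lT(2) lT(2) lT(2) psp_t])
 have lr: "asc A ?T A ?T lT rT rT lT"
  by (rule asc_pent_1_23_4[OF Ah h_t Ah h_t(1) T h_t(2) T T T eV(1) pr_eqb eW(2) pr_eqb lT(1) rT(1) pr_eqb rT(1) lT(1) pr_eqb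
    lT(2) rT(2) rT(2) lT(2) psp_t])
 note B = bimI[OF T lT(1) rT(1) ten_lact_t ten_ract_t rr[unfolded asc_def] ll[unfolded asc_def] lr[unfolded asc_def]]
 show "bim ?T" by (rule B(1))
 show "asc A V W ?T (al V) (pr V W) (pr V W) (al ?T)"
  using lT(2) unfolding asc_def rel3_def by (simp add: B(2) act_closed Ah h_t eqb_closed[OF pr_eqb] cong: sw3_cong)
 show "asc V W A ?T (pr V W) (ar ?T) (ar W) (pr V W)"
  using rT(2) unfolding asc_def rel3_def by (simp add: B(3) act_closed Ah h_t eqb_closed[OF pr_eqb] cong: sw3_cong)
qed

end

subsection \<open>Bimodule morphisms out of a tensor product\<close>

abbreviation bmor where "bmor V W f \<equiv> is_bimor k H A V W f"

lemma bmor_hmor: "bmor V W f ==> hmor V W f"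
 and bmor_al: "bmor V W f ==> a : A ==> v : V ==> f (al V a v) = al W a (f v)"
 and bmor_ar: "bmor V W f ==> a : A ==> v : V ==> f (ar V v a) = ar W (f v) a"
 by (simp_all add: is_bimor_def)

lemmas bmor_lin = is_hmor_lin[OF bmor_hmor] and bmor_act = is_hmor_act[OF bmor_hmor]
lemmas bmor_closed = lin_closed[OF bmor_lin]

lemma bmor_comp: "bmor V W f ==> bmor W X g ==> bmor V X (%v. g (f v))"
 unfolding is_bimor_def is_hmor_def using lin_comp[of k V W f X g] by (auto simp: lin_closed)

lemma bmor_id: "bmor V V (%v. v)"
 by (simp add: is_bimor_def is_hmor_def lin_id)

lemma bmor_cong:
 assumes V: "bim V" and f: "bmor V W f" and eq: "!!v. v : V ==> g v = f v"
 shows "bmor V W g"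
 using f eq lin_cong[OF bim_module[OF V] bmor_lin[OF f] eq]
 by (auto simp: is_bimor_def is_hmor_def act_closed bim_hmod[OF V] eqb_closed[OF al_eqb[OF V]] eqb_closed[OF ar_eqb[OF V]])

text \<open>The products \<open>V \<times> W \<rightarrow> X\<close> that correspond to bimodule morphisms \<open>V \<otimes>\<^sub>A W \<rightarrow> X\<close>.\<close>

definition bimap where
 "bimap V W X f <-> eqb V W X f \<and> asc V A W X (ar V) f (al W) f \<and> asc A V W X (al V) f f (al X)
   \<and> asc V W A X f (ar X) (ar W) f"

lemma bimap_eqb: "bimap V W X f ==> eqb V W X f"
 and bimap_bal: "bimap V W X f ==> asc V A W X (ar V) f (al W) f"
 and bimap_l: "bimap V W X f ==> asc A V W X (al V) f f (al X)"
 and bimap_r: "bimap V W X f ==> asc V W A X f (ar X) (ar W) f"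
 by (simp_all add: bimap_def)

lemmas bimap_bil = eqb_bil[OF bimap_eqb]

lemma pr_bimap: "bim V ==> bim W ==> bimap V W (V**W) (pr V W)"
 by (simp add: bimap_def pr_eqb asc_al_pr asc_pr_ar asc_balanced bim_wl_wr)

lemma pr_in: "bim V ==> bim W ==> v : V ==> w : W ==> pr V W v w : V**W"
 by (rule eqb_closed[OF pr_eqb])

lemma ten_spans: "bim V ==> bim W ==> spans V W (V**W) (pr V W)"
 by (intro pr_spans bim_wl_wr)

lemma asc_post:
 assumes a: "asc X Y Z R f g f' g'" and hm: "hmod X" "hmod Y" "hmod Z" "kmod R" "kmod R'"
  and u: "klin R R' u" and b: "bil k Y Z YZ f'" "bil k X YZ R g'"
 shows "asc X Y Z R' f (%s z. u (g s z)) f' (%x s. u (g' x s))"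
 unfolding asc_def rel3_def
 by (auto simp: asc_apply[OF a] sw3_push[OF hm(4,5) tri_act[OF hm(1-3) tri_right[OF b]] u phi_closed])

lemma bimap_post:
 assumes hm: "bim V" "bim W" "bim X" "bim Y" and f: "bimap V W X f" and g: "bmor X Y g"
 shows "bimap V W Y (%v w. g (f v w))"
proof -
 note h = hm[THEN bim_hmod] and m = hm[THEN bim_module]
 note b = bimap_bil[OF f] and gl = bmor_lin[OF g]
 have e: "eqb V W Y (%v w. g (f v w))"
  unfolding eqb_def using bil_lin[OF gl b]
  by (auto simp: bmor_act[OF g, symmetric] eqb_closed[OF bimap_eqb[OF f]] eqb_act[OF bimap_eqb[OF f]]
    sw2_push[OF m(3,4) bil_act[OF h(1,2) b] gl cop_cl])
 note eq = bmor_al[OF g] bmor_ar[OF g]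
 have 1: "asc V A W Y (ar V) (%v w. g (f v w)) (al W) (%v w. g (f v w))"
  by (rule asc_post[OF bimap_bal[OF f] h(1) hmod_A h(2) m(3,4) gl eqb_bil[OF al_eqb[OF hm(2)]] b])
 have 2: "asc A V W Y (al V) (%v w. g (f v w)) f (%a x. g (al X a x))"
  by (rule asc_post[OF bimap_l[OF f] hmod_A h(1,2) m(3,4) gl b eqb_bil[OF al_eqb[OF hm(3)]]])
 have 3: "asc V W A Y f (%x a. g (ar X x a)) (ar W) (%v w. g (f v w))"
  by (rule asc_post[OF bimap_r[OF f] h(1,2) hmod_A m(3,4) gl eqb_bil[OF ar_eqb[OF hm(2)]] b])
 have l2: "asc A V W Y (al V) (%v w. g (f v w)) (%v w. g (f v w)) (al Y)"
  using 2 unfolding asc_def by (rule rel3_cong) (simp_all add: eq bil_closed[OF b] hmod_A h)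
 have l3: "asc V W A Y (%v w. g (f v w)) (ar Y) (ar W) (%v w. g (f v w))"
  using 3 unfolding asc_def by (rule rel3_cong) (simp_all add: eq bil_closed[OF b] hmod_A h)
 show ?thesis unfolding bimap_def using e 1 l2 l3 by simp
qed

lemma bimap_pre:
 assumes hm: "bim V" "bim W" "bim V'" "bim W'" "bim X" and f: "bimap V' W' X f" and u: "bmor V V' u" and v: "bmor W W' v"
 shows "bimap V W X (%x y. f (u x) (v y))"
proof -
 note h = hm[THEN bim_hmod]
 note e = bimap_eqb[OF f] and c = bmor_closed[OF u] bmor_closed[OF v]
 note eq = bmor_act[OF u] bmor_act[OF v] bmor_al[OF u] bmor_al[OF v] bmor_ar[OF u] bmor_ar[OF v]
 note cl = act_closed h hmod_A eqb_closed[OF al_eqb] eqb_closed[OF ar_eqb] hm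
 show ?thesis
  unfolding bimap_def eqb_def asc_def rel3_def
  using bil_comp[OF eqb_bil[OF e] bmor_lin[OF u] bmor_lin[OF v]]
  by (auto simp: eqb_act[OF e] c eq cl asc_apply[OF bimap_bal[OF f]] asc_apply[OF bimap_l[OF f]] asc_apply[OF bimap_r[OF f]]
    cong: sw3_cong sw2_cong)
qed

context
 fixes V W X f
 assumes V: "bim V" and W: "bim W" and X: "bim X" and f: "bimap V W X f"
begin

private lemmas Vp_f = bim_wl_wr(2)[OF V] and Wp_f = bim_wl_wr(1)[OF W]
private lemmas h_f = bim_hmod[OF V] bim_hmod[OF W] bim_hmod[OF X] and mX_f = bim_module[OF X]

private lemma f_bal_f: "bal V W X f"
 using f by (simp add: bal_asc bimap_def eqb_bil)

lemma lift_pr: "v : V ==> w : W ==> tliftA k H A V W X f (pr V W v w) = f v w"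
 by (rule tliftA_props(2)[OF Vp_f Wp_f mX_f f_bal_f])

lemma lift_bmor: "bmor (V**W) X (tliftA k H A V W X f)"
proof -
 let ?g = "tliftA k H A V W X f" and ?T = "V**W"
 note gl = tliftA_lin[OF Vp_f Wp_f mX_f f_bal_f] and T = ten_hmod[OF V W] and B = ten_bim[OF V W]
 note mT = hmod_mod[OF T] and sp = ten_spans[OF V W] and e = bimap_eqb[OF f] and pe = pr_eqb[OF V W]
 have h: "hmor ?T X ?g" by (rule hmor_of_spans[OF pe sp e gl lift_pr h_f(1,2) T h_f(3)])
 have l: "?g (al ?T a t) = al X a (?g t)" if a: "a : A" and t: "t : ?T" for a t
 proof (rule spans_lin_eq[OF sp lin_comp[OF bil_r[OF eqb_bil[OF al_eqb[OF B]] a] gl]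
    lin_comp[OF gl bil_r[OF eqb_bil[OF al_eqb[OF X]] a]] _ t])
  fix v w assume el: "v : V" "w : W"
  have 1: "rel3 A V W X (%a v w. f (al V a v) w) (%a v w. ?g (al ?T a (pr V W v w))) ph"
   using asc_post[OF asc_al_pr[OF V W] hmod_A h_f(1,2) mT mX_f gl eqb_bil[OF pe] eqb_bil[OF al_eqb[OF B]]] unfolding asc_def
   by (rule rel3_cong) (simp_all add: lift_pr eqb_closed[OF al_eqb[OF V]] hmod_A h_f)
  show "?g (al ?T a (pr V W v w)) = al X a (?g (pr V W v w))"
   unfolding lift_pr[OF el]
   by (rule rel3_unique[OF hmod_A h_f(1,2) mX_f tri_right[OF eqb_bil[OF pe] bil_lin[OF gl eqb_bil[OF al_eqb[OF B]]]]
      tri_right[OF eqb_bil[OF e] eqb_bil[OF al_eqb[OF X]]] 1 bimap_l[OF f, unfolded asc_def] phi_ipair a el])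
 qed
 have r: "?g (ar ?T t a) = ar X (?g t) a" if a: "a : A" and t: "t : ?T" for a t
 proof (rule spans_lin_eq[OF sp lin_comp[OF bil_l[OF eqb_bil[OF ar_eqb[OF B]] a] gl]
    lin_comp[OF gl bil_l[OF eqb_bil[OF ar_eqb[OF X]] a]] _ t])
  fix v w assume el: "v : V" "w : W"
  show "?g (ar ?T (pr V W v w) a) = ar X (?g (pr V W v w)) a"
   unfolding asc_apply[OF asc_pr_ar[OF V W] el a] lift_pr[OF el] asc_apply[OF bimap_r[OF f] el a]
    sw3_push[OF mT mX_f tri_act[OF h_f(1,2) hmod_A tri_right[OF eqb_bil[OF ar_eqb[OF W]] eqb_bil[OF pe]] el a] gl phi_closed]
   using el a by (intro sw3_cong) (simp add: lift_pr act_closed h_f hmod_A eqb_closed[OF ar_eqb[OF W]])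
 qed
 show ?thesis unfolding is_bimor_def using h l r by simp
qed

end

lemma ten_ext:
 assumes "bim V" "bim W" "bmor (V**W) X f" "bmor (V**W) X g" "t : V**W"
  and "!!v w. v : V ==> w : W ==> f (pr V W v w) = g (pr V W v w)"
 shows "f t = g t"
 by (rule spans_lin_eq[OF ten_spans[OF assms(1,2)] bmor_lin[OF assms(3)] bmor_lin[OF assms(4)] assms(6,5)])

abbreviation tm where "tm V W V' W' f g \<equiv> tmapA k H A V W V' W' f g"

lemma tm_pr:
 assumes "bim V" "bim W" "bim V'" "bim W'" "bmor V V' f" "bmor W W' g"
 shows "v : V ==> w : W ==> tm V W V' W' f g (pr V W v w) = pr V' W' (f v) (g w)"
  and "bmor (V**W) (V'**W') (tm V W V' W' f g)"
proof -
 note B = bimap_pre[OF assms(1-4) ten_bim[OF assms(3,4)] pr_bimap[OF assms(3,4)] assms(5,6)]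
 show "v : V ==> w : W ==> tm V W V' W' f g (pr V W v w) = pr V' W' (f v) (g w)"
  unfolding tmapA_def by (rule lift_pr[OF assms(1,2) ten_bim[OF assms(3,4)] B])
 show "bmor (V**W) (V'**W') (tm V W V' W' f g)"
  unfolding tmapA_def by (rule lift_bmor[OF assms(1,2) ten_bim[OF assms(3,4)] B])
qed

subsection \<open>The associator\<close>

abbreviation Ph where "Ph V W X \<equiv> PhiA k H A V W X"

context
 fixes V W X
 assumes V: "bim V" and W: "bim W" and X: "bim X"
begin

private lemmas h_P = bim_hmod[OF V] bim_hmod[OF W] bim_hmod[OF X]
private lemmas VW_P = ten_bim[OF V W] and WX_P = ten_bim[OF W X]
private lemmas R_P = ten_bim[OF V WX_P] and L_P = ten_bim[OF VW_P X]
private lemmas hp_P = bim_hmod[OF VW_P] bim_hmod[OF WX_P] bim_hmod[OF R_P] bim_hmod[OF L_P]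
private lemmas pe_P = pr_eqb[OF V W] pr_eqb[OF W X] pr_eqb[OF V WX_P] pr_eqb[OF VW_P X]

private abbreviation "st \<equiv> mixr V W X (V**W**X) (pr W X) (pr V (W**X))"
private abbreviation "sl \<equiv> mixl V W X ((V**W)**X) (pr V W) (pr (V**W) X)"

private lemmas st = mixr_props[OF V W h_P(3) WX_P hp_P(3) pe_P(2,3) asc_al_pr[OF W X] asc_balanced[OF bim_wl_wr(2)[OF V] bim_wl_wr(1)[OF WX_P]]
 hp_P(1) pe_P(1)]
private lemmas sl = mixl_props[OF W X h_P(1) VW_P hp_P(4) pe_P(1,4) asc_pr_ar[OF V W] asc_balanced[OF bim_wl_wr(2)[OF VW_P] bim_wl_wr(1)[OF X]]
 hp_P(2) pe_P(2)]

private lemma st_bimap_P: "bimap (V**W) X (V**W**X) st"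
 unfolding bimap_def
proof (intro conjI st(1))
 note wV = bim_wl_wr(2)[OF V] and wW = bim_wl_wr(2)[OF W] and wX = bim_wl_wr(1)[OF X]
 show "asc (V**W) A X (V**W**X) (ar (V**W)) st (al X) st"
  by (rule asc_pent_123_4[OF h_P(1,2) hmod_A h_P(3) hp_P(1) h_P(2) h_P(3) hp_P(1,2,3) pe_P(1) ar_eqb[OF W] al_eqb[OF X] ar_eqb[OF VW_P]
     pe_P(1,2,2) st(1) pe_P(3) st(1) asc_pr_ar[OF V W] st(2) asc_balanced[OF wW wX] st(2) ten_spans[OF V W]])
 show "asc A (V**W) X (V**W**X) (al (V**W)) st st (al (V**W**X))"
  by (rule asc_pent_1_23_4[OF hmod_A h_P h_P(1) hp_P(1,2,1,3,3) al_eqb[OF V] pe_P(1,2,1) al_eqb[OF VW_P] st(1) pe_P(3) st(1) al_eqb[OF R_P] pe_P(3)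
     asc_al_pr[OF V W] st(2) st(2) asc_al_pr[OF V WX_P] ten_spans[OF V W]])
 show "asc (V**W) X A (V**W**X) st (ar (V**W**X)) (ar X) st"
  by (rule asc_pent_123_4[OF h_P hmod_A hp_P(1,2) h_P(3) hp_P(3,2,3) pe_P(1,2) ar_eqb[OF X] st(1) pe_P(3) ar_eqb[OF WX_P] pe_P(2) ar_eqb[OF R_P] pe_P(3)
     st(1) st(2) asc_pr_ar[OF V WX_P] asc_pr_ar[OF W X] st(2) ten_spans[OF V W]])
qed

private lemma Ph_eq_P: "Ph V W X = tliftA k H A (V**W) X (V**W**X) st"
 by (simp add: PhiA_def mixr_def[abs_def])

lemma Ph_bmor: "bmor ((V**W)**X) (V**W**X) (Ph V W X)"
 unfolding Ph_eq_P by (rule lift_bmor[OF VW_P X R_P st_bimap_P])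

private lemma Ph_st_P: "t : V**W ==> x : X ==> Ph V W X (pr (V**W) X t x) = st t x"
 unfolding Ph_eq_P by (rule lift_pr[OF VW_P X R_P st_bimap_P])

lemma Ph_rel: "rel3 V W X (V**W**X) (%v w x. Ph V W X (pr (V**W) X (pr V W v w) x))
  (%v w x. pr V (W**X) v (pr W X w x)) ph"
 using st(2) unfolding asc_def by (rule rel3_cong) (simp_all add: Ph_st_P eqb_closed[OF pe_P(1)] h_P)

lemma asc_Ph: "asc V W X (V**W**X) (pr V W) (%t x. Ph V W X (pr (V**W) X t x)) (pr W X) (pr V (W**X))"
 using Ph_rel by (simp add: asc_def)

private lemma sl_bal_P: "bal V (W**X) ((V**W)**X) sl"
 unfolding bal_asc
proof (intro conjI eqb_bil[OF sl(1)])
 note wV = bim_wl_wr(2)[OF V] and wW = bim_wl_wr(1)[OF W]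
 show "asc V A (W**X) ((V**W)**X) (ar V) sl (al (W**X)) sl"
  by (rule asc_pent_1_2_34[OF h_P(1) hmod_A h_P(2,3) h_P(1,2) hp_P(2,1,2,4) ar_eqb[OF V] al_eqb[OF W] pe_P(2,1,1,2) al_eqb[OF WX_P] pe_P(4) sl(1) sl(1)
     asc_balanced[OF wV wW] sl(2) asc_al_pr[OF W X] sl(2) ten_spans[OF W X]])
qed

text \<open>The inverse is the product in mirrored form, built with \<open>phi_inv\<close>. Both composites fix triple products of
generators, where the two elements cancel.\<close>

lemma Ph_inverse:
 obtains g where "klin (V**W**X) ((V**W)**X) g"
  and "!!t. t : V**W**X ==> Ph V W X (g t) = t"
  and "!!t. t : (V**W)**X ==> g (Ph V W X t) = t"
proof -
 let ?R_P = "V**W**X" and ?L_P = "(V**W)**X"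
 define g where "g = tliftA k H A V (W**X) ?L_P sl"
 note w = bim_wl_wr(2)[OF V] bim_wl_wr(1)[OF WX_P] and mL = hmod_mod[OF hp_P(4)] and mR = hmod_mod[OF hp_P(3)]
 have gl: "klin ?R_P ?L_P g" unfolding g_def by (rule tliftA_lin[OF w mL sl_bal_P])
 have gp: "g (pr V (W**X) v s) = sl v s" if "v : V" "s : W**X" for v s
  unfolding g_def by (rule tliftA_props(2)[OF w mL sl_bal_P that])
 let ?F = "%v w x. pr (V**W) X (pr V W v w) x" and ?G = "%v w x. pr V (W**X) v (pr W X w x)"
 have tF: "tri k V W X ?L_P ?F" by (rule tri_left[OF eqb_bil[OF pe_P(1)] eqb_bil[OF pe_P(4)]])
 have tG: "tri k V W X ?R_P ?G" by (rule tri_right[OF eqb_bil[OF pe_P(2)] eqb_bil[OF pe_P(3)]])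
 note Pl = bmor_lin[OF Ph_bmor]
 have r: "rel3 V W X ?L_P ?F (%v w x. g (?G v w x)) ph"
  using sl(2) unfolding asc_def by (rule rel3_cong) (simp_all add: gp eqb_closed[OF pe_P(2)] h_P)
 have 1: "Ph V W X (g t) = t" if t: "t : ?R_P" for t
 proof (rule spans_lin_eq[OF ten_spans[OF V WX_P] lin_comp[OF gl Pl] lin_id _ t])
  fix v s assume v: "v : V" and s: "s : W**X"
  show "Ph V W X (g (pr V (W**X) v s)) = pr V (W**X) v s"
  proof (rule spans_lin_eq[OF ten_spans[OF W X] lin_comp[OF bil_r[OF eqb_bil[OF pe_P(3)] v] lin_comp[OF gl Pl]] bil_r[OF eqb_bil[OF pe_P(3)] v] _ s])
   fix y x assume el: "y : W" "x : X"
   have "rel3 V W X ?R_P (%v w x. Ph V W X (?F v w x)) (%v w x. Ph V W X (g (?G v w x))) ph"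
    using rel3D[OF r] sw3_push[OF mL mR tri_act[OF h_P tri_lin[OF gl tG]] Pl phi_closed] by (simp add: rel3_def)
   from rel3_unique[OF h_P mR tri_lin[OF lin_comp[OF gl Pl] tG] tG this Ph_rel phi_ipair v el]
   show "Ph V W X (g (pr V (W**X) v (pr W X y x))) = pr V (W**X) v (pr W X y x)" .
  qed
 qed
 have 2: "g (Ph V W X t) = t" if t: "t : ?L_P" for t
 proof (rule spans_lin_eq[OF ten_spans[OF VW_P X] lin_comp[OF Pl gl] lin_id _ t])
  fix s x assume s: "s : V**W" and x: "x : X"
  show "g (Ph V W X (pr (V**W) X s x)) = pr (V**W) X s x"
  proof (rule spans_lin_eq[OF ten_spans[OF V W] lin_comp[OF bil_l[OF eqb_bil[OF pe_P(4)] x] lin_comp[OF Pl gl]] bil_l[OF eqb_bil[OF pe_P(4)] x] _ s])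
   fix v y assume el: "v : V" "y : W"
   show "g (Ph V W X (pr (V**W) X (pr V W v y) x)) = pr (V**W) X (pr V W v y) x"
    unfolding rel3D[OF Ph_rel el x] sw3_push[OF mR mL tri_act[OF h_P tG el x] gl phi_closed]
    by (rule rel3D[OF r el x, symmetric])
  qed
 qed
 show ?thesis by (rule that[OF gl 1 2])
qed

lemma Ph_bij: "bij_betw (Ph V W X) (carrier ((V**W)**X)) (carrier (V**W**X))"
proof -
 obtain g where g: "klin (V**W**X) ((V**W)**X) g"
  "!!t. t : V**W**X ==> Ph V W X (g t) = t"
  "!!t. t : (V**W)**X ==> g (Ph V W X t) = t" using Ph_inverse by blast
 show ?thesis
  by (rule bij_betwI[where g = g]) (auto simp: g lin_closed[OF g(1)] bmor_closed[OF Ph_bmor])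
qed

end

abbreviation Pi where "Pi V W X \<equiv> PhiA_inv k H A V W X"

lemma Pi_inverse:
 assumes "bim V" "bim W" "bim X"
 shows "t : V**W**X ==> Pi V W X t : (V**W)**X"
  and "t : V**W**X ==> Ph V W X (Pi V W X t) = t"
  and "s : (V**W)**X ==> Pi V W X (Ph V W X s) = s"
 using bij_betw_inv_into[OF Ph_bij[OF assms]] Ph_bij[OF assms]
 by (auto simp: PhiA_inv_def bij_betw_def f_inv_into_f inv_into_into)

lemma inverse_bmor:
 assumes V: "bim V" and W: "bim W" and f: "bmor V W f" and g: "!!w. w : W ==> g w : V"
  and fg: "!!w. w : W ==> f (g w) = w" and gf: "!!v. v : V ==> g (f v) = v"
 shows "bmor W V g"
proof -
 note h = bim_hmod[OF V] bim_hmod[OF W] and m = bim_module[OF V] bim_module[OF W]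
 note c = module_add_closed[OF m(1)] module_smult_closed[OF m(1)] act_closed[OF h(1)] eqb_closed[OF al_eqb[OF V]] eqb_closed[OF ar_eqb[OF V]]
  module_add_closed[OF m(2)] module_smult_closed[OF m(2)] act_closed[OF h(2)] eqb_closed[OF al_eqb[OF W]] eqb_closed[OF ar_eqb[OF W]]
 have inj: "x = y" if "x : V" "y : V" "f x = f y" for x y
  using gf that by metis
 note e = lin_add[OF bmor_lin[OF f]] lin_smult[OF bmor_lin[OF f]] bmor_act[OF f] bmor_al[OF f] bmor_ar[OF f]
 show ?thesis unfolding is_bimor_def is_hmor_def is_lin_def
  by (auto intro!: inj simp: e c g fg)
qed

lemma Pi_bmor: "bim V ==> bim W ==> bim X ==> bmor (V**W**X) ((V**W)**X) (Pi V W X)"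
 by (rule inverse_bmor[OF _ _ Ph_bmor Pi_inverse(1,2,3)]) (simp_all add: ten_bim)

end

section \<open>The internal hom of bimodules\<close>

context quasi_bialgebra
begin

lemma is_hmod_cong:
 assumes "hmod V" "carrier W = carrier V" "add W = add V" "zero W = zero V" "smult W = smult V" "act W = act V"
 shows "hmod W"
 using assms(1) module_cong[OF hmod_mod[OF assms(1)] assms(2-5)]
 by (simp add: is_hmod_def is_lin_def assms(2-6))

text \<open>\<open>N\<close> is a submodule of \<open>M\<close>, stable under \<open>H\<close>, with the inherited operations. Sums with summands in \<open>N\<close> agree in
\<open>N\<close> and in \<open>M\<close>, so equivariance and associativity restrict.\<close>

definition sub_hmod where
 "sub_hmod N M <-> hmod N \<and> carrier N \<subseteq> carrier M \<and> add N = add M \<and> smult N = smult M \<and> act N = act M"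

lemma sub_hmodD:
 assumes "sub_hmod N M"
 shows "hmod N" "x : N ==> x : M" "add N = add M" "smult N = smult M" "act N = act M"
 using assms by (auto simp: sub_hmod_def)

lemma sub_incl_lin: "sub_hmod N M ==> klin N M (%x. x)"
 by (auto simp: is_lin_def sub_hmod_def)

lemma sub_sw3:
 assumes N: "sub_hmod N M" and M: "kmod M" and f: "tri k H H H N f" and t: "t : HHH"
 shows "sm3 M t f = sm3 N t f"
 using sw3_push[OF hmod_mod[OF sub_hmodD(1)[OF N]] M f sub_incl_lin[OF N] t] by simp

lemma sub_sw2:
 assumes N: "sub_hmod N M" and M: "kmod M" and f: "bil k H H N f" and t: "t : HH"
 shows "sm2 M t f = sm2 N t f"
 using sw2_push[OF hmod_mod[OF sub_hmodD(1)[OF N]] M f sub_incl_lin[OF N] t] by simp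

lemma eqb_pre:
 assumes f: "eqb V' W' X f" and u: "hmor V V' u" and v: "hmor W W' v"
 shows "eqb V W X (%x y. f (u x) (v y))"
 unfolding eqb_def using bil_comp[OF eqb_bil[OF f] is_hmor_lin[OF u] is_hmor_lin[OF v]]
 by (auto simp: eqb_act[OF f] is_hmor_closed[OF u] is_hmor_closed[OF v] is_hmor_act[OF u] is_hmor_act[OF v] cong: sw2_cong)

lemma sub_hmor: "sub_hmod N M ==> hmor N M (%x. x)"
 by (simp add: is_hmor_def sub_incl_lin sub_hmodD)

lemma hmor_id: "hmor V V (%x. x)"
 by (simp add: is_hmor_def lin_id)

lemma eqb_into_sub:
 assumes f: "eqb V W M f" and N: "sub_hmod N M" and M: "kmod M" and V: "hmod V" and W: "hmod W"
  and cl: "!!v w. v : V ==> w : W ==> f v w : N"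
 shows "eqb V W N f"
proof -
 have b: "bil k V W N f"
  using eqb_bil[OF f] cl sub_hmodD(3,4)[OF N] by (auto simp: bil_def is_lin_def)
 have "act N h (f v w) = sm2 N (cop h) (%a b. f (act V a v) (act W b w))"
  if "h : H" "v : V" "w : W" for h v w
  using eqb_act[OF f that] sub_sw2[OF N M bil_act[OF V W b that(2,3)] cop_cl[OF that(1)]] sub_hmodD(5)[OF N] by simp
 thus ?thesis using b by (simp add: eqb_def)
qed

lemma asc_into_sub:
 assumes a: "asc X Y Z M f g f' g'" and N: "sub_hmod N M" and M: "kmod M"
  and hm: "hmod X" "hmod Y" "hmod Z" and b: "bil k Y Z YZ f'" "bil k X YZ N g'"
 shows "asc X Y Z N f g f' g'"
 unfolding asc_def rel3_def
 by (auto simp: asc_apply[OF a] sub_sw3[OF N M tri_act[OF hm tri_right[OF b]] phi_closed])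

end

context algebra_setting
begin

abbreviation hE where "hE V W \<equiv> hh V W"
abbreviation bE where "bE V W \<equiv> bhom k H A V W"
abbreviation Hom where "Hom V W \<equiv> homA k H A V W"

text \<open>The actions of \<open>A\<close> on \<open>hom(V, W)\<close>. By the law for composition and evaluation, they are characterised by
\<open>ev(a L, v) = a ev(L, v)\<close> and \<open>ev(L a, v) = ev(L, a v)\<close>, up to \<open>\<phi>\<close>.\<close>

definition hl where "hl V W a L = cmp V W W (lhat k H A W a) L"
definition hr where "hr V W L a = cmp V V W L (lhat k H A V a)"

lemma lhat_cur: "lhat k H A V a = cur A V V (al V) a"
 by (simp add: lhat_def cur_def)

lemma lhat_hmor: "bim V ==> hmor A (hE V V) (lhat k H A V)"
 unfolding is_hmor_def lhat_cur[abs_def]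
 using cur_lin[OF hmod_A bim_hmod bim_module eqb_bil[OF al_eqb]] cur_act[OF hmod_A bim_hmod bim_hmod al_eqb] by auto

lemma evp_lhat: "bim V ==> a : A ==> v : V ==> evp V V (lhat k H A V a) v = al V a v"
 unfolding lhat_cur by (rule evp_cur[OF hmod_A bim_hmod bim_hmod al_eqb])

lemma evp_hmor_eqb: "hmod V ==> hmod W ==> hmor M (hE V W) u ==> eqb M V W (%m v. evp V W (u m) v)"
 by (rule eqb_pre[OF evp_eqb _ hmor_id])

context
 fixes V W
 assumes V: "bim V" and W: "bim W"
begin

private lemmas hH = bim_hmod[OF V] bim_hmod[OF W]
private lemmas mHW = bim_module[OF W]
private lemmas EH = hhom_hmod[OF hH]
private lemmas lrV = asc_lr[OF V]

lemma hl_eqb: "eqb A (hE V W) (hE V W) (hl V W)"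
 unfolding hl_def[abs_def] by (rule eqb_pre[OF hcomp_props(1)[OF hH(1,2,2)] lhat_hmor[OF W] hmor_id])

lemma hr_eqb: "eqb (hE V W) A (hE V W) (hr V W)"
 unfolding hr_def[abs_def] by (rule eqb_pre[OF hcomp_props(1)[OF hH(1,1,2)] hmor_id lhat_hmor[OF V]])

lemma asc_hl: "asc A (hE V W) V W (hl V W) (evp V W) (evp V W) (al W)"
 unfolding asc_def rel3_def hl_def
 using rel3D[OF hcomp_props(2)[OF hH(1,2,2)] is_hmor_closed[OF lhat_hmor[OF W]]]
 by (auto simp: is_hmor_act[OF lhat_hmor[OF W], symmetric] evp_lhat[OF W] act_closed hmod_A EH hH eqb_closed[OF evp_eqb[OF hH]]
   cong: sw3_cong)

lemma asc_hr: "asc (hE V W) A V W (hr V W) (evp V W) (al V) (evp V W)"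
 unfolding asc_def rel3_def hr_def
 using rel3D[OF hcomp_props(2)[OF hH(1,1,2)] _ is_hmor_closed[OF lhat_hmor[OF V]]]
 by (auto simp: is_hmor_act[OF lhat_hmor[OF V], symmetric] evp_lhat[OF V] act_closed hmod_A EH hH cong: sw3_cong)

private lemma bE_simps:
 "carrier (bE V W) = carrier (hE V W)" "add (bE V W) = add (hE V W)" "zero (bE V W) = zero (hE V W)"
 "smult (bE V W) = smult (hE V W)" "act (bE V W) = act (hE V W)"
 by (simp_all add: bhom_def mk_bimod_simps)

private lemma bE_hmod: "hmod (bE V W)"
 by (rule is_hmod_cong[OF EH]) (simp_all add: bE_simps)

private lemma bE_lin: "klin (bE V W) X f <-> klin (hE V W) X f" "klin X (bE V W) g <-> klin X (hE V W) g"
 by (simp_all add: is_lin_def bE_simps)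

private lemma bE_al: "a : A ==> L : hE V W ==> al (bE V W) a L = hl V W a L"
 and bE_ar: "a : A ==> L : hE V W ==> ar (bE V W) L a = hr V W L a"
 and bE_wr: "wr (bE V W)"
proof -
 note mE = hmod_mod[OF EH]
 have p: "pure k A (bE V W) = pure k A (hE V W)" "pure k (bE V W) A = pure k (hE V W) A"
  "tmod k (bE V W) A = tmod k (hE V W) A"
  by (rule tmod_cong_simps; simp add: bE_simps)+
 have l: "lact (bE V W) = tlift k A (hE V W) (hE V W) (hl V W)" "ract (bE V W) = tlift k (hE V W) A (hE V W) (hr V W)"
  by (simp_all add: bhom_def mk_bimod_simps hl_def[abs_def] hr_def[abs_def] cmp_def)
 show "a : A ==> L : hE V W ==> al (bE V W) a L = hl V W a L"
  unfolding lm_def l p by (rule tlift_pure[OF mod_A mE mE eqb_bil[OF hl_eqb]])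
 show "a : A ==> L : hE V W ==> ar (bE V W) L a = hr V W L a"
  unfolding rm_def l p by (rule tlift_pure[OF mE mod_A mE eqb_bil[OF hr_eqb]])
 show "wr (bE V W)"
  unfolding wr_def lin_hten bE_lin l p using bE_hmod tlift_lin[OF mE mod_A mE eqb_bil[OF hr_eqb]] by simp
qed

private lemma bal_bE:
 assumes f: "eqb (hE V W) X Y f" "asc (hE V W) A X Y (hr V W) f (al X) f" and X: "hmod X"
  and g: "!!L x. L : hE V W ==> x : X ==> g L x = f L x" and al: "bil k A X X (al X)"
 shows "bal (bE V W) X Y g"
proof -
 note b = eqb_bil[OF f(1)]
 have 1: "bil k (hE V W) X Y g"
  by (rule bilI; rule lin_cong[OF hmod_mod[OF X] bil_r[OF b]] lin_cong[OF hmod_mod[OF EH] bil_l[OF b]])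
   (simp_all add: g)
 have "rel3 (hE V W) A X Y (%L a x. g (ar (bE V W) L a) x) (%L a x. g L (al X a x)) ph"
  using f(2) unfolding asc_def
  by (rule rel3_cong) (simp_all add: g bE_ar EH hmod_A X eqb_closed[OF hr_eqb] bil_closed[OF al])
 thus ?thesis using 1 unfolding bal_def rel3_def bil_def by (simp add: bE_simps bE_lin)
qed

private lemma ev_desc_pr:
 assumes "L : hE V W" "v : V"
 shows "ev_desc k H A V W (pr (bE V W) V L v) = evp V W L v"
proof -
 have e: "ev k H V W (pure k (hE V W) V L v) = evp V W L v" if "L : hE V W" "v : V" for L v
  using ev_pure(1)[OF hH] that by (simp add: hhom_simps)
 have "bal (bE V W) V W (%L v. ev k H V W (pure k (hE V W) V L v))"
  by (rule bal_bE[OF evp_eqb[OF hH] asc_hr hH(1) e eqb_bil[OF al_eqb[OF V]]])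
 from tliftA_props(2)[OF bE_wr bim_wl_wr(1)[OF V] mHW this] assms show ?thesis
  by (simp add: ev_desc_def bE_simps e)
qed

subsection \<open>Right linear maps\<close>

private abbreviation "VA \<equiv> bten k H A V (self_bimod A)"

private lemma self_simps: "carrier (self_bimod A) = carrier A" "add (self_bimod A) = add A" "zero (self_bimod A) = zero A"
 "smult (self_bimod A) = smult A" "act (self_bimod A) = act A"
 by (simp_all add: self_bimod_def mk_bimod_simps)

private lemma pS: "pure k V (self_bimod A) = pure k V A" "tmod k V (self_bimod A) = tmod k V A"
 by (rule tmod_cong_simps; simp add: self_simps)+

private lemma tlS: "tlift k V (self_bimod A) X f = tlift k V A X f"
 by (rule tlift_cong_modules) (simp_all add: self_simps)

private lemma hS: "ht V (self_bimod A) = ht V A"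
 by (simp add: hten_def pS tlS self_simps)

private lemma VA_simps: "carrier VA = carrier (ht V A)" "add VA = add (ht V A)" "zero VA = zero (ht V A)"
 "smult VA = smult (ht V A)" "act VA = act (ht V A)"
 by (simp_all add: bten_def mk_bimod_simps hS)

private lemmas hVA = hten_hmod[OF hH(1) hmod_A] and mVA = hten_module[OF hmod_mod[OF hH(1)] mod_A]
private lemmas eVA = pure_eqb[OF hH(1) hmod_A] and spVA = spans_pure[OF hmod_mod[OF hH(1)] mod_A]

private lemma VA_hmod: "hmod VA"
 by (rule is_hmod_cong[OF hVA]) (simp_all add: VA_simps)

private lemma VA_lin: "klin VA X f <-> klin (ht V A) X f" "klin X VA g <-> klin X (ht V A) g"
 by (simp_all add: is_lin_def VA_simps)

private abbreviation "lVA a v b \<equiv> sm3 (ht V A) phiI (%x y z.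
  pure k V A (al V (act A x a) (act V y v)) (act A z b))"

private lemma lVA_tri: "tri k A V A (ht V A) lVA"
 by (rule tri_rel[OF hmod_A hH(1) hmod_A mVA tri_left[OF eqb_bil[OF al_eqb[OF V]] eqb_bil[OF eVA]] phiI_closed])

private lemma VA_lact:
 shows VA_wl: "wl VA"
  and VA_al: "a : A ==> v : V ==> b : A ==> al VA a (pure k V A v b) = lVA a v b"
  and VA_asc: "asc A V A (ht V A) (al V) (pure k V A) (pure k V A) (al VA)"
  and VA_eqb: "eqb A (ht V A) (ht V A) (al VA)"
proof -
 let ?T = "ht V A"
 note mV = hmod_mod[OF hH(1)]
 let ?l = "%a. tlift k V A ?T (lVA a)"
 have lact: "lact VA = tlift k A ?T ?T ?l"
  by (simp add: bten_def mk_bimod_simps hS tlS pS self_simps)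
 have p: "pure k A VA = pure k A ?T" "tmod k A VA = tmod k A ?T" by (rule tmod_cong_simps; simp add: VA_simps)+
 have b: "bil k A ?T ?T ?l"
 proof (rule bilI)
  fix t assume t: "t : ?T"
  show "klin A ?T (%a. ?l a t)"
   by (rule tlift_param_lin[OF mV mod_A mVA mod_A tri_bil[OF lVA_tri] tri_1[OF lVA_tri] t[unfolded hten_simps]])
 next
  fix a assume a: "a : A"
  show "klin ?T ?T (?l a)" unfolding lin_hten(1) by (rule tlift_lin[OF mV mod_A mVA tri_bil[OF lVA_tri a]])
 qed
 show "wl VA" unfolding wl_def VA_lin lin_hten(1) lact p using tlift_lin[OF mod_A mVA mVA b] VA_hmod by simp
 have al: "al VA a t = ?l a t" if "a : A" "t : ?T" for a t
 proof -
  have "al VA a t = lact VA (pure k A VA a t)" by (simp add: lm_def)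
  also have "... = tlift k A ?T ?T ?l (pure k A ?T a t)" by (simp only: lact p)
  also have "... = ?l a t" by (rule tlift_pure[OF mod_A mVA mVA b that])
  finally show ?thesis .
 qed
 show alp: "al VA a (pure k V A v b) = lVA a v b" if "a : A" "v : V" "b : A" for a v b
  unfolding al[OF that(1) hten_pure_closed[OF mV mod_A that(2,3)]]
  by (rule tlift_pure[OF mV mod_A mVA tri_bil[OF lVA_tri that(1)] that(2,3)])
 have r: "rel3 A V A ?T (%a v b. al VA a (pure k V A v b)) (%a v b. pure k V A (al V a v) b) phiI"
  by (simp add: rel3_def alp)
 note tr = tri_left[OF eqb_bil[OF al_eqb[OF V]] eqb_bil[OF eVA]]
 show "asc A V A ?T (al V) (pure k V A) (pure k V A) (al VA)"
  unfolding asc_def by (rule rel3_inv[OF hmod_A hH(1) hmod_A mVA tr r ipair_sym[OF phi_ipair]])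
 have bl: "bil k A ?T ?T (al VA)"
  by (rule bilI; rule lin_cong[OF mVA bil_r[OF b]] lin_cong[OF mod_A bil_l[OF b]]) (simp_all add: al)
 show "eqb A ?T ?T (al VA)"
  by (rule eqb_of_eqr_spans[OF eqr_rel[OF hmod_A hH(1) hmod_A hVA eql_left[OF al_eqb[OF V] eVA hmod_A hH(1) hmod_A hH(1) mVA] r]
     eVA spVA bl hmod_A hH(1) hmod_A hVA hVA])
qed

text \<open>The two products whose equality defines right linearity, \<open>ev(L, v a)\<close> and \<open>ev(L, v) a\<close>. As products of
\<open>hom(V, W)\<close> with \<open>V \<otimes> A\<close> both are balanced over \<open>A\<close>, so they are the maps from which \<open>hom\<^sub>A\<close> is defined.\<close>

private abbreviation "G1 L t \<equiv> evp V W L (ract V t)"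
private abbreviation "G2 L v b \<equiv> sm3 W phiI (%x y z. ar W (evp V W (act (hE V W) x L) (act V y v)) (act A z b))"

private definition "F2 L t = tlift k V A W (G2 L) t"

private lemma G2_tri: "tri k (hE V W) V A W G2"
 by (rule tri_rel[OF EH hH(1) hmod_A mHW tri_left[OF eqb_bil[OF evp_eqb[OF hH]] eqb_bil[OF ar_eqb[OF W]]] phiI_closed])

private lemma F1_eqb: "eqb (hE V W) (ht V A) W G1"
 by (rule eqb_pre[OF evp_eqb[OF hH] hmor_id bim_ract[OF V]])

private lemma ract_al: "a : A ==> t : ht V A ==> ract V (al VA a t) = al V a (ract V t)"
proof (rule spans_lin_eq[OF spVA])
 note rl = is_hmor_lin[OF bim_ract[OF V]]
 assume a: "a : A"
 show "klin (ht V A) V (%t. ract V (al VA a t))" by (rule lin_comp[OF bil_r[OF eqb_bil[OF VA_eqb] a] rl])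
 show "klin (ht V A) V (%t. al V a (ract V t))" by (rule lin_comp[OF rl bil_r[OF eqb_bil[OF al_eqb[OF V]] a]])
 fix v b assume el: "v : V" "b : A"
 have "ract V (al VA a (pure k V A v b))
   = sm3 V phiI (%x y z. ar V (al V (act A x a) (act V y v)) (act A z b))"
  unfolding VA_al[OF a el] rm_def
  by (rule sw3_push[OF mVA bim_module[OF V] tri_act[OF hmod_A hH(1) hmod_A tri_left[OF eqb_bil[OF al_eqb[OF V]] eqb_bil[OF eVA]] a el]
    rl phiI_closed])
 also have "... = al V a (ar V v b)"
  using rel3_inv[OF hmod_A hH(1) hmod_A bim_module[OF V] tri_right[OF eqb_bil[OF ar_eqb[OF V]] eqb_bil[OF al_eqb[OF V]]]
   asc_lr[OF V, unfolded asc_def] phi_ipair] a el by (simp add: rel3_def)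
 finally show "ract V (al VA a (pure k V A v b)) = al V a (ract V (pure k V A v b))" by (simp add: rm_def)
qed

private lemma F1_bal: "asc (hE V W) A (ht V A) W (hr V W) G1 (al VA) G1"
 unfolding asc_def rel3_def
 using is_hmor_closed[OF bim_ract[OF V]]
 by (auto simp: asc_apply[OF asc_hr] ract_al act_closed hmod_A hVA is_hmor_act[OF bim_ract[OF V]] cong: sw3_cong)

private lemma F2_pure: "L : hE V W ==> v : V ==> b : A ==> F2 L (pure k V A v b) = G2 L v b"
 unfolding F2_def by (rule tlift_pure[OF hmod_mod[OF hH(1)] mod_A mHW tri_bil[OF G2_tri]])

private lemma F2_asc: "asc (hE V W) V A W (evp V W) (ar W) (pure k V A) F2"
 and F2_eqb: "eqb (hE V W) (ht V A) W F2"
proof -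
 note mE = hmod_mod[OF EH] and mV = hmod_mod[OF hH(1)]
 have b: "bil k (hE V W) (ht V A) W F2" unfolding F2_def[abs_def]
 proof (rule bilI)
  fix t assume t: "t : ht V A"
  show "klin (hE V W) W (%L. tlift k V A W (G2 L) t)"
   by (rule tlift_param_lin[OF mV mod_A mHW mE tri_bil[OF G2_tri] tri_1[OF G2_tri] t[unfolded hten_simps]])
 next
  fix L assume L: "L : hE V W"
  show "klin (ht V A) W (%t. tlift k V A W (G2 L) t)"
   unfolding lin_hten by (rule tlift_lin[OF mV mod_A mHW tri_bil[OF G2_tri L]])
 qed
 have r: "rel3 (hE V W) V A W (%L v a. F2 L (pure k V A v a)) (%L v a. ar W (evp V W L v) a) phiI"
  by (simp add: rel3_def F2_pure)
 note tr = tri_left[OF eqb_bil[OF evp_eqb[OF hH]] eqb_bil[OF ar_eqb[OF W]]]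
 show "asc (hE V W) V A W (evp V W) (ar W) (pure k V A) F2"
  unfolding asc_def by (rule rel3_inv[OF EH hH(1) hmod_A mHW tr r ipair_sym[OF phi_ipair]])
 show "eqb (hE V W) (ht V A) W F2"
  by (rule eqb_of_eqr_spans[OF eqr_rel[OF EH hH(1) hmod_A hH(2) eql_left[OF evp_eqb[OF hH] ar_eqb[OF W] EH hH(1) hmod_A hH(2) mHW] r]
     eVA spVA b EH hH(1) hmod_A hVA hH(2)])
qed

private lemma F2_bal: "asc (hE V W) A (ht V A) W (hr V W) F2 (al VA) F2"
 by (rule asc_pent_1_2_34[OF EH hmod_A hH(1) hmod_A EH hH(1) hVA hH(2) hVA hH(2) hr_eqb al_eqb[OF V] eVA evp_eqb[OF hH] evp_eqb[OF hH]
    eVA VA_eqb ar_eqb[OF W] F2_eqb F2_eqb asc_hr F2_asc VA_asc F2_asc spVA])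

private lemma f1_pr: "L : hE V W ==> t : ht V A ==> f1 k H A V W (pr (bE V W) VA L t) = G1 L t"
 and f2_pr: "L : hE V W ==> t : ht V A ==> f2 k H A V W (pr (bE V W) VA L t) = F2 L t"
proof -
 note mV = hmod_mod[OF hH(1)]
 have alb: "bil k A VA VA (al VA)" using eqb_bil[OF VA_eqb] by (simp add: bil_def VA_lin VA_simps)
 have ebVA: "eqb (hE V W) VA W f" "asc (hE V W) A VA W (hr V W) f (al VA) f"
  if "eqb (hE V W) (ht V A) W f" "asc (hE V W) A (ht V A) W (hr V W) f (al VA) f" for f
  using that by (auto simp: eqb_def bil_def VA_lin VA_simps asc_def rel3_def)
 have 1: "tlift k V A W (%v a. ev_desc k H A V W (pr (bE V W) V L (ar V v a))) t = G1 L t"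
  if L: "L : hE V W" and t: "t : VA" for L t
 proof -
  note t = t[unfolded VA_simps(1)]
  have b: "bil k V A W (%v a. evp V W L (ar V v a))"
   by (rule bil_lin[OF bil_r[OF evp_bil[OF hH] L] eqb_bil[OF ar_eqb[OF V]]])
  have "tlift k V A W (%v a. ev_desc k H A V W (pr (bE V W) V L (ar V v a))) = tlift k V A W (%v a. evp V W L (ar V v a))"
   by (rule tlift_cong) (simp add: ev_desc_pr L eqb_closed[OF ar_eqb[OF V]])
  moreover have "tlift k V A W (%v a. evp V W L (ar V v a)) t = G1 L t"
   by (rule tmod_lin_eqI[OF mV mod_A tlift_lin[OF mV mod_A mHW b] bil_r[OF eqb_bil[OF F1_eqb] L, unfolded lin_hten] _ t[unfolded hten_simps]],
    subst tlift_pure[OF mV mod_A mHW b], assumption+, simp add: rm_def)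
  ultimately show ?thesis by simp
 qed
 have 2: "tlift k V A W (%v a. sm3 W phiI (%p1 p2 p3.
    ar W (ev_desc k H A V W (pr (bE V W) V (act (bE V W) p1 L) (act V p2 v))) (act A p3 a))) t = F2 L t"
  if L: "L : hE V W" for L t
 proof -
  have "tlift k V A W (%v a. sm3 W phiI (%p1 p2 p3.
    ar W (ev_desc k H A V W (pr (bE V W) V (act (bE V W) p1 L) (act V p2 v))) (act A p3 a))) = tlift k V A W (G2 L)"
   by (intro tlift_cong sw3_cong) (simp add: bE_simps ev_desc_pr act_closed EH L hH)
  thus ?thesis by (simp add: F2_def)
 qed
 note B1 = bal_bE[OF ebVA[OF F1_eqb F1_bal] VA_hmod 1 alb] and B2 = bal_bE[OF ebVA[OF F2_eqb F2_bal] VA_hmod 2 alb]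
 show "f1 k H A V W (pr (bE V W) VA L t) = G1 L t" if L: "L : hE V W" and t: "t : ht V A"
  unfolding f1_def by (rule trans[OF tliftA_props(2)[OF bE_wr VA_wl mHW B1 L[folded bE_simps] t[folded VA_simps]] 1[OF L t[folded VA_simps(1)]]])
 show "f2 k H A V W (pr (bE V W) VA L t) = F2 L t" if L: "L : hE V W" and t: "t : ht V A"
  unfolding f2_def by (rule trans[OF tliftA_props(2)[OF bE_wr VA_wl mHW B2 L[folded bE_simps] t[folded VA_simps]] 2[OF L]])
qed

private lemma D_cur:
 assumes "L : hE V W"
  and "!!L t. L : hE V W ==> t : ht V A ==> f (pr (bE V W) VA L t) = F L t"
 shows "D k H A V W f L = cur (hE V W) (ht V A) W F L"
 unfolding D_def cur_def Let_def VA_simps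
 by (intro restrict_ext sw3_cong) (simp add: assms bE_simps VA_simps act_closed EH hVA closed_abS)

lemma Hom_carrier: "carrier (Hom V W) = {L \<in> carrier (hE V W).
  cur (hE V W) (ht V A) W G1 L = cur (hE V W) (ht V A) W F2 L}"
proof -
 have "D k H A V W (f1 k H A V W) L = cur (hE V W) (ht V A) W G1 L" if "L : hE V W" for L
  using f1_pr by (intro D_cur that)
 moreover have "D k H A V W (f2 k H A V W) L = cur (hE V W) (ht V A) W F2 L" if "L : hE V W" for L
  using f2_pr by (intro D_cur that)
 ultimately show ?thesis by (auto simp: homA_def mk_bimod_simps homA_hmod_def)
qed

text \<open>Two maps with equal curried form have equal evaluations, also on translates since currying is equivariant;
conversely the curried form is a combination of such evaluations.\<close>

lemma Hom_iff: "L : Hom V W <-> L : hE V W \<and>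
  (\<forall>h\<in>carrier H. \<forall>v\<in>carrier V. \<forall>a\<in>carrier A. evp V W (act (hE V W) h L) (ar V v a) = G2 (act (hE V W) h L) v a)"
  (is "_ <-> _ \<and> ?R L")
proof (cases "L : hE V W")
 case L: True
 let ?c = "cur (hE V W) (ht V A) W"
 note ec = evp_cur[OF EH hVA hH(2)] and hL = act_closed[OF EH _ L]
 have "?c G1 L = ?c F2 L <-> ?R L"
 proof
  assume eq: "?c G1 L = ?c F2 L"
  show "?R L"
  proof (intro ballI)
   fix h v a assume *: "h : H" "v : V" "a : A"
   have p: "pure k V A v a : ht V A" by (rule eqb_closed[OF eVA *(2,3)])
   have "?c G1 (act (hE V W) h L) = ?c F2 (act (hE V W) h L)"
    using eq by (simp add: cur_act[OF EH hVA hH(2) F1_eqb L *(1)] cur_act[OF EH hVA hH(2) F2_eqb L *(1)])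
   hence "G1 (act (hE V W) h L) (pure k V A v a) = F2 (act (hE V W) h L) (pure k V A v a)"
    using ec[OF F1_eqb hL[OF *(1)] p] ec[OF F2_eqb hL[OF *(1)] p] by simp
   thus "evp V W (act (hE V W) h L) (ar V v a) = G2 (act (hE V W) h L) v a"
    by (simp add: F2_pure hL * rm_def)
  qed
 next
  assume R: "?R L"
  have "G1 (act (hE V W) h L) t = F2 (act (hE V W) h L) t" if h: "h : H" and t: "t : ht V A" for h t
   by (rule spans_lin_eq[OF spVA bil_r[OF eqb_bil[OF F1_eqb] hL[OF h]] bil_r[OF eqb_bil[OF F2_eqb] hL[OF h]] _ t])
    (use R h in \<open>simp add: F2_pure hL rm_def\<close>)
  thus "?c G1 L = ?c F2 L" unfolding cur_def by (intro restrict_ext sw3_cong) (simp add: act_closed hVA closed_abS)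
 qed
 thus ?thesis using L by (simp add: Hom_carrier)
qed (simp add: Hom_carrier)

private lemma Hom_simps: "add (Hom V W) = add (hE V W)" "zero (Hom V W) = zero (hE V W)" "smult (Hom V W) = smult (hE V W)"
 "act (Hom V W) = act (hE V W)"
 by (simp_all add: homA_def mk_bimod_simps homA_hmod_def)

lemma Hom_sub: "sub_hmod (Hom V W) (hE V W)"
proof -
 note mE = hmod_mod[OF EH] and mD = hmod_mod[OF hhom_hmod[OF hVA hH(2)]]
 let ?c = "cur (hE V W) (ht V A) W" and ?D = "hE (ht V A) W"
 note c1 = cur_lin[OF EH hVA mHW eqb_bil[OF F1_eqb]] and c2 = cur_lin[OF EH hVA mHW eqb_bil[OF F2_eqb]]
 have car: "carrier (Hom V W) = {L \<in> carrier (hE V W). ?c G1 L \<ominus>\<^bsub>?D\<^esub> ?c F2 L = \<zero>\<^bsub>?D\<^esub>}"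
  unfolding Hom_carrier using module_minus_eq_zero_iff[OF mD] lin_closed[OF c1] lin_closed[OF c2] by auto
 have "submodule (carrier (Hom V W)) k (hE V W)"
  unfolding car by (rule kernel_submodule[OF mE mD lin_minusf[OF mD c1 c2]])
 from module_cong[OF submodule.submodule_is_module[OF this mE], of "Hom V W"]
 have m: "kmod (Hom V W)" by (simp add: Hom_simps)
 have ac: "act (hE V W) h L : Hom V W" if h: "h : H" and L: "L : Hom V W" for h L
 proof -
  have L': "L : hE V W" "?c G1 L = ?c F2 L" using L by (auto simp: Hom_carrier)
  show ?thesis using L'(2) act_closed[OF EH h L'(1)]
   by (simp add: Hom_carrier cur_act[OF EH hVA hH(2) F1_eqb L'(1) h] cur_act[OF EH hVA hH(2) F2_eqb L'(1) h])
 qed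
 have s: "carrier (Hom V W) \<subseteq> carrier (hE V W)" by (auto simp: Hom_carrier)
 have "hmod (Hom V W)"
  unfolding is_hmod_def
 proof (intro conjI ballI m)
  fix h assume h: "h : H"
  show "klin (Hom V W) (Hom V W) (act (Hom V W) h)"
   using act_lin2[OF EH h] s ac[OF h] by (simp add: is_lin_def Hom_simps subset_iff)
 next
  fix L assume "L : Hom V W"
  thus "klin H (Hom V W) (%h. act (Hom V W) h L)"
   using act_lin1[OF EH, of L] s ac by (simp add: is_lin_def Hom_simps subset_iff Pi_iff)
 qed (use s EH in \<open>auto simp: Hom_simps act_mult act_one\<close>)
 thus ?thesis using s by (simp add: sub_hmod_def Hom_simps)
qed

lemmas Hom_hmod = sub_hmodD(1)[OF Hom_sub]

lemma Hom_evp_eqb: "eqb (Hom V W) V W (evp V W)"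
 by (rule eqb_pre[OF evp_eqb[OF hH] sub_hmor[OF Hom_sub] hmor_id])

lemma asc_evp: "asc (Hom V W) V A W (evp V W) (ar W) (ar V) (evp V W)"
 unfolding asc_def
proof (rule rel3_inv[OF Hom_hmod hH(1) hmod_A mHW _ _ ipair_sym[OF phi_ipair]])
 show "tri k (Hom V W) V A W (%L v a. ar W (evp V W L v) a)"
  by (rule tri_left[OF eqb_bil[OF Hom_evp_eqb] eqb_bil[OF ar_eqb[OF W]]])
 show "rel3 (Hom V W) V A W (%L v a. evp V W L (ar V v a)) (%L v a. ar W (evp V W L v) a) phiI"
  unfolding rel3_def
 proof (intro ballI)
  fix L v a assume *: "L : Hom V W" "v : V" "a : A"
  have L: "act (hE V W) oneH L = L" using * by (intro act_one[OF EH]) (simp add: sub_hmodD(2)[OF Hom_sub])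
  from * Hom_iff[of L] have "\<forall>h\<in>carrier H. \<forall>v\<in>carrier V. \<forall>a\<in>carrier A.
    evp V W (act (hE V W) h L) (ar V v a) = G2 (act (hE V W) h L) v a" by simp
  from this[rule_format, OF one_H_closed *(2,3)]
  show "evp V W L (ar V v a) = sm3 W phiI (%x y z. ar W (evp V W (act (Hom V W) x L) (act V y v)) (act A z a))"
   by (simp add: L Hom_simps)
 qed
qed

text \<open>For an equivariant family the translates in the criterion are members of the family.\<close>

lemma Hom_crit:
 assumes M: "hmod M" and u: "hmor M (hE V W) u"
  and a: "asc M V A W (%m v. evp V W (u m) v) (ar W) (ar V) (%m v. evp V W (u m) v)" and m: "m : M"
 shows "u m : Hom V W"
 unfolding Hom_iff
proof (intro conjI ballI is_hmor_closed[OF u m])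
 note e = evp_hmor_eqb[OF hH u]
 have r: "rel3 M V A W (%m v a. evp V W (u m) (ar V v a)) (%m v a. ar W (evp V W (u m) v) a) phiI"
  by (rule rel3_inv[OF M hH(1) hmod_A mHW tri_right[OF eqb_bil[OF ar_eqb[OF V]] eqb_bil[OF e]] a[unfolded asc_def] phi_ipair])
 fix h v a assume *: "h : H" "v : V" "a : A"
 have hm: "act M h m : M" by (rule act_closed[OF M *(1) m])
 show "evp V W (act (hE V W) h (u m)) (ar V v a) = G2 (act (hE V W) h (u m)) v a"
  using rel3D[OF r hm *(2,3)] by (simp add: is_hmor_act[OF u] m hm * cong: sw3_cong)
qed

subsection \<open>The bimodule structure\<close>

private lemmas NsH = sub_hmodD(2)[OF Hom_sub]
private lemma asc_hl_Hom: "asc A (Hom V W) V W (hl V W) (evp V W) (evp V W) (al W)"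
 and asc_hr_Hom: "asc (Hom V W) A V W (hr V W) (evp V W) (al V) (evp V W)"
 using asc_hl asc_hr unfolding asc_def rel3_def by (auto simp: NsH Hom_simps)

private lemmas hlN = eqb_pre[OF hl_eqb hmor_id sub_hmor[OF Hom_sub]]
private lemmas hrN = eqb_pre[OF hr_eqb sub_hmor[OF Hom_sub] hmor_id]

text \<open>The maps \<open>a L\<close> and \<open>L a\<close> form equivariant families over \<open>A \<otimes> hom\<^sub>A\<close> and \<open>hom\<^sub>A \<otimes> A\<close>. Their evaluations are
right linear by the pentagon for \<open>a\<close>, \<open>L\<close>, \<open>v\<close>, \<open>b\<close> (respectively \<open>L\<close>, \<open>a\<close>, \<open>v\<close>, \<open>b\<close>).\<close>

private lemma Hom_closed:
 assumes a: "a : A" and L: "L : Hom V W"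
 shows "hl V W a L : Hom V W" "hr V W L a : Hom V W"
proof -
 note N = Hom_hmod and mN = hmod_mod[OF Hom_hmod] and mE = hmod_mod[OF EH]
 have idV: "hmor V V (%x. x)" by (rule hmor_id)
 let ?M = "ht A (Hom V W)" and ?u = "tlift k A (Hom V W) (hE V W) (hl V W)"
 note M = hten_hmod[OF hmod_A N] and u = hten_lift_hmor[OF hmod_A N EH hlN]
 have up: "?u (pure k A (Hom V W) a L) = hl V W a L" if "a : A" "L : Hom V W" for a L
  by (rule tlift_pure[OF mod_A mN mE eqb_bil[OF hlN] that])
 note p = evp_hmor_eqb[OF hH u] and pe = pure_eqb[OF hmod_A N]
 have l: "asc A (Hom V W) V W (pure k A (Hom V W)) (%m v. evp V W (?u m) v) (evp V W) (al W)"
  using asc_hl_Hom unfolding asc_def by (rule rel3_cong) (simp_all add: up hmod_A N hH)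
 have "asc ?M V A W (%m v. evp V W (?u m) v) (ar W) (ar V) (%m v. evp V W (?u m) v)"
  by (rule asc_pent_123_4[OF hmod_A N hH(1) hmod_A M hH(2,1,2,2,2) pe Hom_evp_eqb ar_eqb[OF V] p al_eqb[OF W] ar_eqb[OF W] Hom_evp_eqb
     ar_eqb[OF W] al_eqb[OF W] p l asc_lr[OF W] asc_evp l spans_pure[OF mod_A mN]])
 from Hom_crit[OF M u this eqb_closed[OF pe a L]] show "hl V W a L : Hom V W" by (simp add: up a L)
 let ?M' = "ht (Hom V W) A" and ?u' = "tlift k (Hom V W) A (hE V W) (hr V W)"
 note M' = hten_hmod[OF N hmod_A] and u' = hten_lift_hmor[OF N hmod_A EH hrN]
 have up': "?u' (pure k (Hom V W) A L a) = hr V W L a" if "a : A" "L : Hom V W" for a L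
  by (rule tlift_pure[OF mN mod_A mE eqb_bil[OF hrN] that(2,1)])
 note p' = evp_hmor_eqb[OF hH u'] and pe' = pure_eqb[OF N hmod_A]
 have l': "asc (Hom V W) A V W (pure k (Hom V W) A) (%m v. evp V W (?u' m) v) (al V) (evp V W)"
  using asc_hr_Hom unfolding asc_def by (rule rel3_cong) (simp_all add: up' hmod_A N hH)
 have "asc ?M' V A W (%m v. evp V W (?u' m) v) (ar W) (ar V) (%m v. evp V W (?u' m) v)"
  by (rule asc_pent_123_4[OF N hmod_A hH(1) hmod_A M' hH(1,1,2,1,2) pe' al_eqb[OF V] ar_eqb[OF V] p' Hom_evp_eqb ar_eqb[OF V] al_eqb[OF V]
     ar_eqb[OF W] Hom_evp_eqb p' l' asc_evp lrV l' spans_pure[OF mN mod_A]])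
 from Hom_crit[OF M' u' this eqb_closed[OF pe' L a]] show "hr V W L a : Hom V W" by (simp add: up' a L)
qed

private lemma hlNN: "eqb A (Hom V W) (Hom V W) (hl V W)"
 by (rule eqb_into_sub[OF hlN Hom_sub hmod_mod[OF EH] hmod_A Hom_hmod Hom_closed(1)])
private lemma hrNN: "eqb (Hom V W) A (Hom V W) (hr V W)"
 by (rule eqb_into_sub[OF hrN Hom_sub hmod_mod[OF EH] Hom_hmod hmod_A Hom_closed(2)])

text \<open>Associativity laws with values in \<open>hom\<^sub>A\<close> hold if they hold after evaluation, because both sides are
equivariant for the same bracketing.\<close>

private lemma asc_Hom:
 assumes hm: "hmod X" "hmod Y" "hmod Z" "hmod XY" "hmod YZ"
  and e: "eqb X Y XY f" "eqb Y Z YZ f'" "eqb XY Z (hE V W) g" "eqb X YZ (hE V W) g'" and b: "eqb X YZ (Hom V W) g'"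
  and eq: "!!x y z v. x : X ==> y : Y ==> z : Z ==> v : V ==> evp V W (g (f x y) z) v
   = evp V W (sm3 (hE V W) ph (%a b c. g' (act X a x) (f' (act Y b y) (act Z c z)))) v"
 shows "asc X Y Z (Hom V W) f g f' g'"
proof (rule asc_into_sub[OF _ Hom_sub hmod_mod[OF EH] hm(1-3) eqb_bil[OF e(2)] eqb_bil[OF b]])
 note mE = hmod_mod[OF EH]
 have l: "eql X Y Z (hE V W) (%x y z. g (f x y) z)" by (rule eql_left[OF e(1,3) hm(1-4) mE])
 have r: "eql X Y Z (hE V W) (%x y z. sm3 (hE V W) ph (%a b c. g' (act X a x) (f' (act Y b y) (act Z c z))))"
  by (rule eql_rel[OF hm(1-3) EH eqr_right[OF e(2,4) hm(1-3,5) mE]]) (simp add: rel3_def)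
 show "asc X Y Z (hE V W) f g f' g'"
  unfolding asc_def rel3_def using eql_nondegenerate[OF hH hm(1-3) l r eq] by blast
qed

text \<open>After evaluation each law of a bimodule is the innermost side of a pentagon, with the element of \<open>V\<close> as the
last factor.\<close>

lemma Hom_props:
 shows Hom_bim: "bim (Hom V W)"
  and Hom_al: "a : A ==> L : Hom V W ==> al (Hom V W) a L = hl V W a L"
  and Hom_ar: "a : A ==> L : Hom V W ==> ar (Hom V W) L a = hr V W L a"
proof -
 let ?N = "Hom V W"
 note N = Hom_hmod and Ah = hmod_A and ev = evp_eqb[OF hH]
 note eN = Hom_evp_eqb and alV = al_eqb[OF V] and alW = al_eqb[OF W]
 have ll: "asc A A ?N ?N am (hl V W) (hl V W) (hl V W)"
  by (rule asc_Hom[OF Ah Ah N Ah N am_eqb hlNN hlN hlN hlNN],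
   rule asc_pent_123[OF Ah Ah N hH(1) Ah N hH(2) EH hH(2) hH(2) am_eqb hlNN eN hlN hlN eN alW ev alW alW
    asc_hl_Hom asc_hl_Hom asc_hl_Hom asc_ll[OF W]])
 have rr: "asc ?N A A ?N (hr V W) (hr V W) am (hr V W)"
  by (rule asc_Hom[OF N Ah Ah N Ah hrNN am_eqb hrN hrN hrNN],
   rule asc_pent_123[OF N Ah Ah hH(1) N Ah hH(1) EH hH(1) hH(2) hrNN am_eqb alV hrN hrN alV alV ev eN eN
    asc_hr_Hom asc_ll[OF V] asc_hr_Hom asc_hr_Hom])
 have lr: "asc A ?N A ?N (hl V W) (hr V W) (hr V W) (hl V W)"
  by (rule asc_Hom[OF Ah N Ah N N hlNN hrNN hrN hlN hlNN],
   rule asc_pent_123[OF Ah N Ah hH(1) N N hH(1) EH hH(2) hH(2) hlNN hrNN alV hrN hlN eN eN ev alW eN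
    asc_hl_Hom asc_hr_Hom asc_hr_Hom asc_hl_Hom])
 have ops: "lact ?N = tlift k A ?N ?N (hl V W)" "ract ?N = tlift k ?N A ?N (hr V W)"
 proof -
  let ?M = "homA_hmod k H A V W"
  have M: "carrier ?M = carrier ?N" "add ?M = add ?N" "smult ?M = smult ?N" by (simp_all add: homA_def mk_bimod_simps)
  have "lact ?N = tlift k A ?M ?M (%a L. al (bE V W) a L)" by (simp add: homA_def mk_bimod_simps)
  also have "... = tlift k A ?M ?M (hl V W)" by (rule tlift_cong) (simp add: bE_al M NsH)
  also have "... = tlift k A ?N ?N (hl V W)" by (rule tlift_cong_modules) (simp_all add: M)
  finally show "lact ?N = tlift k A ?N ?N (hl V W)" .
  have "ract ?N = tlift k ?M A ?M (%L a. ar (bE V W) L a)" by (simp add: homA_def mk_bimod_simps)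
  also have "... = tlift k ?M A ?M (hr V W)" by (rule tlift_cong) (simp add: bE_ar M NsH)
  also have "... = tlift k ?N A ?N (hr V W)" by (rule tlift_cong_modules) (simp_all add: M)
  finally show "ract ?N = tlift k ?N A ?N (hr V W)" .
 qed
 note B = bimI[OF N hlNN hrNN ops rr[unfolded asc_def] ll[unfolded asc_def] lr[unfolded asc_def]]
 show "bim ?N" by (rule B(1))
 show "a : A ==> L : Hom V W ==> al (Hom V W) a L = hl V W a L" by (rule B(2))
 show "a : A ==> L : Hom V W ==> ar (Hom V W) L a = hr V W L a" by (rule B(3))
qed

lemma evp_bimap: "bimap (Hom V W) V W (evp V W)"
proof -
 have 1: "asc A (Hom V W) V W (al (Hom V W)) (evp V W) (evp V W) (al W)"
  using asc_hl_Hom unfolding asc_def by (rule rel3_cong) (simp_all add: Hom_al hmod_A Hom_hmod hH)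
 have 2: "asc (Hom V W) A V W (ar (Hom V W)) (evp V W) (al V) (evp V W)"
  using asc_hr_Hom unfolding asc_def by (rule rel3_cong) (simp_all add: Hom_ar hmod_A Hom_hmod hH)
 show ?thesis unfolding bimap_def using Hom_evp_eqb 1 2 asc_evp by simp
qed

lemma evA_pr: "L : Hom V W ==> v : V ==> evA k H A V W (pr (Hom V W) V L v) = evp V W L v"
 and evA_bmor: "bmor ((Hom V W)**V) W (evA k H A V W)"
proof -
 have "evA k H A V W = tliftA k H A (Hom V W) V W (evp V W)"
 proof -
  have "(\<forall>L\<in>carrier (Hom V W). \<forall>v\<in>carrier V. g (pr (Hom V W) V L v) = ev_desc k H A V W (pr (bE V W) V L v))
   <-> (\<forall>L\<in>carrier (Hom V W). \<forall>v\<in>carrier V. g (pr (Hom V W) V L v) = evp V W L v)" for g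
   using ev_desc_pr NsH by auto
  thus ?thesis by (simp add: evA_def tliftA_def)
 qed
 thus "L : Hom V W ==> v : V ==> evA k H A V W (pr (Hom V W) V L v) = evp V W L v"
  "bmor ((Hom V W)**V) W (evA k H A V W)"
  using lift_pr[OF Hom_bim V W evp_bimap] lift_bmor[OF Hom_bim V W evp_bimap] by simp_all
qed

text \<open>The curried map takes values in \<open>hom\<^sub>A\<close> by the criterion above, and is \<open>A\<close>-linear since its evaluation is; it
is unique because evaluation is nondegenerate.\<close>

lemma curry:
 assumes M: "bim M" and p: "bimap M V W p"
 shows curry_bmor: "bmor M (Hom V W) (cur M V W p)"
  and curry_evp: "m : M ==> v : V ==> evp V W (cur M V W p m) v = p m v"
  and curry_unique: "bmor M (Hom V W) g ==> (!!m v. m : M ==> v : V ==> evp V W (g m) v = p m v)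
   ==> m : M ==> g m = cur M V W p m"
proof -
 let ?c = "cur M V W p"
 note hM = bim_hmod[OF M] and e = bimap_eqb[OF p]
 have u: "hmor M (hE V W) ?c"
  unfolding is_hmor_def using cur_lin[OF hM hH(1) mHW eqb_bil[OF e]] cur_act[OF hM hH e] by simp
 show ev: "evp V W (?c m) v = p m v" if "m : M" "v : V" for m v by (rule evp_cur[OF hM hH e that])
 have a: "asc M V A W (%m v. evp V W (?c m) v) (ar W) (ar V) (%m v. evp V W (?c m) v)"
  using bimap_r[OF p] unfolding asc_def by (rule rel3_cong) (simp_all add: ev hM hH hmod_A eqb_closed[OF ar_eqb[OF V]])
 have cN: "?c m : Hom V W" if "m : M" for m by (rule Hom_crit[OF hM u a that])
 have al: "?c (al M a m) = al (Hom V W) a (?c m)" if "a : A" "m : M" for a m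
  unfolding Hom_al[OF that(1) cN[OF that(2)]]
 proof (rule eqb_nondegenerate[OF hH hmod_A hM _ _ _ that])
  have "hmor A A (%x. x)" by (rule hmor_id)
  show "eqb A M (hE V W) (%a m. hl V W a (?c m))" by (rule eqb_pre[OF hl_eqb hmor_id u])
  show "eqb A M (hE V W) (%a m. ?c (al M a m))"
   using al_eqb[OF M] u hmod_mod[OF hM] hmod_mod[OF EH]
   by (auto simp: eqb_def is_hmor_act[OF u, symmetric] bil_closed[OF eqb_bil[OF al_eqb[OF M]]]
     sw2_push[OF hmod_mod[OF hM] hmod_mod[OF EH] bil_act[OF hmod_A hM eqb_bil[OF al_eqb[OF M]]] is_hmor_lin[OF u] cop_cl]
     intro: bil_lin is_hmor_lin)
  fix a m v assume *: "a : A" "m : M" "v : V"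
  show "evp V W (?c (al M a m)) v = evp V W (hl V W a (?c m)) v"
   using * by (simp add: ev eqb_closed[OF al_eqb[OF M]] asc_apply[OF bimap_l[OF p]] asc_apply[OF asc_hl] is_hmor_closed[OF u]
     is_hmor_act[OF u, symmetric] act_closed hM hH cong: sw3_cong)
 qed
 have ar: "?c (ar M m a) = ar (Hom V W) (?c m) a" if "a : A" "m : M" for a m
  unfolding Hom_ar[OF that(1) cN[OF that(2)]]
 proof (rule eqb_nondegenerate[OF hH hM hmod_A _ _ _ that(2,1)])
  show "eqb M A (hE V W) (%m a. hr V W (?c m) a)" by (rule eqb_pre[OF hr_eqb u hmor_id])
  show "eqb M A (hE V W) (%m a. ?c (ar M m a))"
   using ar_eqb[OF M] u hmod_mod[OF hM] hmod_mod[OF EH]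
   by (auto simp: eqb_def is_hmor_act[OF u, symmetric] bil_closed[OF eqb_bil[OF ar_eqb[OF M]]]
     sw2_push[OF hmod_mod[OF hM] hmod_mod[OF EH] bil_act[OF hM hmod_A eqb_bil[OF ar_eqb[OF M]]] is_hmor_lin[OF u] cop_cl]
     intro: bil_lin is_hmor_lin)
  fix m a v assume *: "m : M" "a : A" "v : V"
  show "evp V W (?c (ar M m a)) v = evp V W (hr V W (?c m) a) v"
   using * by (simp add: ev eqb_closed[OF ar_eqb[OF M]] eqb_closed[OF al_eqb[OF V]] asc_apply[OF bimap_bal[OF p]] asc_apply[OF asc_hr]
     is_hmor_closed[OF u] is_hmor_act[OF u, symmetric] act_closed hM hH hmod_A cong: sw3_cong)
 qed
 show "bmor M (Hom V W) ?c"
  using u cN al ar by (auto simp: is_bimor_def is_hmor_def is_lin_def Hom_simps)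
 assume g: "bmor M (Hom V W) g" and eq: "!!m v. m : M ==> v : V ==> evp V W (g m) v = p m v" and m: "m : M"
 show "g m = ?c m"
 proof (rule evp_nondegenerate[OF hH])
  show "g m \<in> lin k V W" "?c m \<in> lin k V W" using NsH[OF bmor_closed[OF g m]] NsH[OF cN[OF m]] by (simp_all add: hhom_simps)
  fix h v assume *: "h : H" "v : V"
  show "evp V W (act (hE V W) h (g m)) v = evp V W (act (hE V W) h (?c m)) v"
   using eq[OF act_closed[OF hM *(1) m] *(2)] ev[OF act_closed[OF hM *(1) m] *(2)]
   by (simp add: bmor_act[OF g *(1) m] is_hmor_act[OF u *(1) m] Hom_simps)
 qed
qed

lemma Hom_ext:
 assumes M: "bim M" and f: "bmor M (Hom V W) f" and g: "bmor M (Hom V W) g"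
  and eq: "!!m v. m : M ==> v : V ==> evp V W (f m) v = evp V W (g m) v" and m: "m : M"
 shows "f m = g m"
proof -
 have p: "bimap M V W (%m v. evp V W (g m) v)" by (rule bimap_pre[OF M V Hom_bim V W evp_bimap g bmor_id])
 show ?thesis using curry_unique[OF M p f eq m] curry_unique[OF M p g refl m] by simp
qed

text \<open>The description of a morphism by its evaluation, as in the definition of \<open>\<boxtimes>\<^sub>A\<close>, is met by the curried form alone.\<close>

lemma the_curry:
 assumes M: "bim M" and G: "bmor (M**V) W G"
 shows "(THE f. f \<in> extensional (carrier M) \<and> bmor M (Hom V W) f \<and>
    (\<forall>t\<in>carrier (M**V). (evA k H A V W \<circ> tm M V (Hom V W) V f id) t = G t))
  = (\<lambda>m\<in>carrier M. cur M V W (%m v. G (pr M V m v)) m)" (is "(THE f. ?P f) = ?c")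
proof (rule the_equality)
 note p = bimap_post[OF M V ten_bim[OF M V] W pr_bimap[OF M V] G]
 have idV: "bmor V V id" using bmor_id[of V] by (simp add: id_def)
 have ev: "(evA k H A V W \<circ> tm M V (Hom V W) V f id) (pr M V m v) = evp V W (f m) v"
  if f: "bmor M (Hom V W) f" and el: "m : M" "v : V" for f m v
  by (simp add: tm_pr(1)[OF M V Hom_bim V f idV el] evA_pr bmor_closed[OF f] el)
 have evb: "bmor (M**V) W (evA k H A V W \<circ> tm M V (Hom V W) V f id)" if f: "bmor M (Hom V W) f" for f
  unfolding comp_def by (rule bmor_comp[OF tm_pr(2)[OF M V Hom_bim V f idV] evA_bmor])
 have c: "bmor M (Hom V W) ?c" by (rule bmor_cong[OF M curry_bmor[OF M p]]) simp
 show "?P ?c"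
 proof (intro conjI ballI c)
  fix t assume t: "t : M**V"
  show "(evA k H A V W \<circ> tm M V (Hom V W) V ?c id) t = G t"
   by (rule ten_ext[OF M V evb[OF c] G t]) (simp only: ev[OF c], simp add: curry_evp[OF M p])
 qed simp
 fix f assume f: "?P f"
 hence fb: "bmor M (Hom V W) f" by simp
 show "f = ?c"
 proof (rule extensionalityI[where A = "carrier M"])
  fix m assume m: "m : M"
  have "f m = cur M V W (%m v. G (pr M V m v)) m"
  proof (rule curry_unique[OF M p fb _ m])
   fix m v assume el: "m : M" "v : V"
   show "evp V W (f m) v = G (pr M V m v)" using f ev[OF fb el] pr_in[OF M V el] by simp
  qed
  thus "f m = ?c m" using m by simp
 qed (use f in auto)
qed

end

end

section \<open>Composition and conjugation as curried morphisms\<close>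

context algebra_setting
begin

lemma eqb_post:
 assumes f: "eqb V W X f" and hm: "hmod V" "hmod W" "hmod X" "hmod Y" and u: "hmor X Y u"
 shows "eqb V W Y (%v w. u (f v w))"
 unfolding eqb_def
proof (intro conjI ballI bil_lin[OF is_hmor_lin[OF u] eqb_bil[OF f]])
 fix h v w assume *: "h : H" "v : V" "w : W"
 show "act Y h (u (f v w)) = sm2 Y (cop h) (%a b. u (f (act V a v) (act W b w)))"
  unfolding is_hmor_act[OF u *(1) eqb_closed[OF f *(2,3)], symmetric] eqb_act[OF f *]
  by (rule sw2_push[OF hmod_mod[OF hm(3)] hmod_mod[OF hm(4)] bil_act[OF hm(1,2) eqb_bil[OF f] *(2,3)] is_hmor_lin[OF u] cop_cl[OF *(1)]])
qed

text \<open>The value of the description of a morphism by its evaluation; the restriction to the carrier is part of that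
description.\<close>

definition cr where "cr M V W G = (\<lambda>m\<in>carrier M. cur M V W (%m v. G (pr M V m v)) m)"

lemma cr:
 assumes M: "bim M" and V: "bim V" and W: "bim W" and G: "bmor (M**V) W G"
 shows cr_bmor: "bmor M (Hom V W) (cr M V W G)"
  and cr_evp: "m : M ==> v : V ==> evp V W (cr M V W G m) v = G (pr M V m v)"
proof -
 note p = bimap_post[OF M V ten_bim[OF M V] W pr_bimap[OF M V] G]
 show "bmor M (Hom V W) (cr M V W G)" by (rule bmor_cong[OF M curry_bmor[OF V W M p]]) (simp add: cr_def)
 show "m : M ==> v : V ==> evp V W (cr M V W G m) v = G (pr M V m v)"
  by (simp add: cr_def curry_evp[OF V W M p])
qed

lemma tliftA_cong:
 assumes "!!v w. v : V ==> w : W ==> f v w = g v w"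
 shows "tliftA k H A V W X f = tliftA k H A V W X g"
proof -
 have "(\<forall>v\<in>carrier V. \<forall>w\<in>carrier W. h (pr V W v w) = f v w) <->
    (\<forall>v\<in>carrier V. \<forall>w\<in>carrier W. h (pr V W v w) = g v w)" for h
  using assms by auto
 thus ?thesis by (simp add: tliftA_def)
qed

context
 fixes V W X
 assumes V: "bim V" and W: "bim W" and X: "bim X"
begin

private abbreviation "B \<equiv> Hom W X"
private abbreviation "C \<equiv> Hom V W"
private lemmas bB = Hom_bim[OF W X] and bC = Hom_bim[OF V W] and bE = Hom_bim[OF V X]
private lemmas BC = ten_bim[OF bB bC] and CV = ten_bim[OF bC V]
private lemmas h_VV = bim_hmod[OF V] and h_WW = bim_hmod[OF W] and hX = bim_hmod[OF X] and hB = bim_hmod[OF bB] and hC = bim_hmod[OF bC]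
private lemmas sB = Hom_sub[OF W X] and sC = Hom_sub[OF V W] and sE = Hom_sub[OF V X]

definition "comp_ev t = evA k H A W X (tm B (C**V) B W id (evA k H A V W) (Ph B C V t))"

private lemmas tmb = tm_pr[OF bB CV bB W bmor_id[folded id_def] evA_bmor[OF V W]]

lemma comp_ev_bmor: "bmor ((B**C)**V) X comp_ev"
 unfolding comp_ev_def by (rule bmor_comp[OF bmor_comp[OF Ph_bmor[OF bB bC V] tmb(2)] evA_bmor[OF W X]])

private lemma comp_ev_asc: "asc B C V X (pr B C) (%t v. comp_ev (pr (B**C) V t v)) (evp V W) (evp W X)"
proof -
 let ?R = "B**C**V"
 note R = ten_bim[OF bB CV]
 note u = bmor_comp[OF tmb(2) evA_bmor[OF W X]]
 have "asc B C V X (pr B C) (%t v. comp_ev (pr (B**C) V t v)) (pr C V)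
   (%L s. evA k H A W X (tm B (C**V) B W id (evA k H A V W) (pr B (C**V) L s)))"
  unfolding comp_ev_def
  by (rule asc_post[OF asc_Ph[OF bB bC V] hB hC h_VV bim_module[OF R] bim_module[OF X] bmor_lin[OF u] eqb_bil[OF pr_eqb[OF bC V]] eqb_bil[OF pr_eqb[OF bB CV]]])
 thus ?thesis unfolding asc_def
  by (rule rel3_cong) (simp_all add: tmb(1) pr_in bC V evA_pr[OF V W] evA_pr[OF W X] eqb_closed[OF Hom_evp_eqb[OF V W]] hB hC h_VV)
qed

text \<open>The composition on \<open>hom\<^sub>A\<close> is defined by restricting the composition of linear maps. Both it and the curried
form of iterated evaluation have the same evaluations, hence agree.\<close>

lemma compA:
 shows compA_bmor: "bmor (B**C) (Hom V X) (compA k H A V W X)"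
  and compA_evp: "t : B**C ==> v : V ==> evp V X (compA k H A V W X t) v = comp_ev (pr (B**C) V t v)"
proof -
 let ?c = "cr (B**C) V X comp_ev"
 note c = cr[OF BC V X comp_ev_bmor]
 have p: "bimap B C (Hom V X) (%L L'. ?c (pr B C L L'))" by (rule bimap_post[OF bB bC BC bE pr_bimap[OF bB bC] c(1)])
 have a: "asc B C V X (cmp V W X) (evp V X) (evp V W) (evp W X)"
  using hcomp_props(2)[OF h_VV h_WW hX] unfolding asc_def rel3_def
  by (simp add: sub_hmodD[OF sB] sub_hmodD[OF sC])
 have eq: "?c (pr B C L L') = cmp V W X L L'" if "L : B" "L' : C" for L L'
 proof (rule eqb_nondegenerate[OF h_VV hX hB hC _ _ _ that])
  show "eqb B C (hE V X) (%L L'. ?c (pr B C L L'))"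
   by (rule eqb_post[OF bimap_eqb[OF p] hB hC bim_hmod[OF bE] hhom_hmod[OF h_VV hX] sub_hmor[OF sE]])
  show "eqb B C (hE V X) (cmp V W X)" by (rule eqb_pre[OF hcomp_props(1)[OF h_VV h_WW hX] sub_hmor[OF sB] sub_hmor[OF sC]])
  fix L L' v assume *: "L : B" "L' : C" "v : V"
  show "evp V X (?c (pr B C L L')) v = evp V X (cmp V W X L L') v"
   unfolding c(2)[OF pr_in[OF bB bC *(1,2)] *(3)] asc_apply[OF comp_ev_asc *] asc_apply[OF a *] ..
 qed
 have cA: "compA k H A V W X = tliftA k H A B C (Hom V X) (%L L'. ?c (pr B C L L'))"
  unfolding compA_def by (rule tliftA_cong) (simp add: eq cmp_def)
 show b: "bmor (B**C) (Hom V X) (compA k H A V W X)" unfolding cA by (rule lift_bmor[OF bB bC bE p])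
 have "compA k H A V W X t = ?c t" if t: "t : B**C" for t
  by (rule ten_ext[OF bB bC b c(1) t]) (simp add: cA lift_pr[OF bB bC bE p])
 thus "t : B**C ==> v : V ==> evp V X (compA k H A V W X t) v = comp_ev (pr (B**C) V t v)"
  by (simp add: c(2))
qed

end

text \<open>Conjugation is composition of underlying maps, while evaluation twists a map by \<open>\<phi>\<close> and the antipode. Writing
\<open>L\<close> as a combination of evaluations of translates reduces one to the other.\<close>

lemma hom_conj:
 assumes S: "bim S" and T: "bim T" and S': "bim S'" and T': "bim T'" and f: "bmor S' S f" and g: "bmor T T' g"
 defines "F \<equiv> %L. restrict (g \<circ> L \<circ> f) (carrier S')"
 shows conj_bmor: "bmor (Hom S T) (Hom S' T') F"
  and conj_evp: "L : Hom S T ==> s : S' ==> evp S' T' (F L) s = g (evp S T L (f s))"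
proof -
 note N = Hom_bim[OF S T] and hS = bim_hmod[OF S] and hT = bim_hmod[OF T]
 note mT = bim_module[OF T] and mT' = bim_module[OF T'] and E = hhom_hmod[OF hS hT]
 let ?p = "%L s. g (evp S T L (f s))"
 have p: "bimap (Hom S T) S' T' ?p"
  by (rule bimap_post[OF N S' T T' bimap_pre[OF N S' N S T evp_bimap[OF S T] bmor_id f] g])
 have eq: "F L = cur (Hom S T) S' T' ?p L" if L: "L : Hom S T" for L
 proof -
  have L': "L \<in> lin k S T" using sub_hmodD(2)[OF Hom_sub[OF S T] L] by (simp add: hhom_simps)
  have a: "act (Hom S T) = act (hE S T)" by (rule sub_hmodD(5)[OF Hom_sub[OF S T]])
  have "g (L (f s)) = sm3 T' phiI (%a b c. ?p (act (Hom S T) a L) (act S' (b * beta H * aS c) s))"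
   if s: "s : S'" for s
  proof -
   note fs = bmor_closed[OF f s]
   have "L (f s) = sm3 T phiI (%a b c. evp S T (act (hE S T) a L) (act S (b * beta H * aS c) (f s)))"
    using arg_cong[OF cur_evp[OF hS hT L'], of "%L. L (f s)"] by (simp add: cur_def fs)
   hence "g (L (f s)) = sm3 T' phiI (%a b c. g (evp S T (act (hE S T) a L) (act S (b * beta H * aS c) (f s))))"
    using sw3_push[OF mT mT' cur_tri[OF E hS evp_bil[OF hS hT] _ fs] bmor_lin[OF g] phiI_closed] L' by (simp add: hhom_simps)
   thus ?thesis using s by (simp add: a bmor_act[OF f] closed_abS cong: sw3_cong)
  qed
  thus ?thesis unfolding F_def cur_def by (intro restrict_ext) simp
 qed
 show "bmor (Hom S T) (Hom S' T') F" by (rule bmor_cong[OF N curry_bmor[OF S' T' N p] eq])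
 show "L : Hom S T ==> s : S' ==> evp S' T' (F L) s = g (evp S T L (f s))"
  by (simp add: eq curry_evp[OF S' T' N p])
qed

end

section \<open>The hexagons\<close>

context quasi_bialgebra
begin

lemma ipair_mult:
 assumes B: "assoc_algebra k B" and u: "ipair B u u'" "ipair B v v'"
 shows "ipair B (u \<otimes>\<^bsub>B\<^esub> v) (v' \<otimes>\<^bsub>B\<^esub> u')"
proof -
 interpret B: ring B by (rule alg_ring[OF B])
 have c: "u : B" "u' : B" "v : B" "v' : B" using u by (auto simp: ipair_def)
 have "u \<otimes>\<^bsub>B\<^esub> v \<otimes>\<^bsub>B\<^esub> (v' \<otimes>\<^bsub>B\<^esub> u') = u \<otimes>\<^bsub>B\<^esub> (v \<otimes>\<^bsub>B\<^esub> v') \<otimes>\<^bsub>B\<^esub> u'"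
  "v' \<otimes>\<^bsub>B\<^esub> u' \<otimes>\<^bsub>B\<^esub> (u \<otimes>\<^bsub>B\<^esub> v) = v' \<otimes>\<^bsub>B\<^esub> (u' \<otimes>\<^bsub>B\<^esub> u) \<otimes>\<^bsub>B\<^esub> v" using c by (simp_all add: B.m_assoc)
 thus ?thesis using u c by (simp add: ipair_def)
qed

context
 fixes X Y Z R
 assumes hm: "hmod X" "hmod Y" "hmod Z" "kmod R"
begin

lemma rel3_cancel_l:
 assumes "rel3 X Y Z R F K (t *\<^sub>3 u)" "rel3 X Y Z R G K t" "tri k X Y Z R K" "tri k X Y Z R G"
  and tt: "ipair HHH t t'" and u: "u : HHH"
 shows "rel3 X Y Z R F G u"
proof -
 interpret H3: ring HHH by (rule ring_H3)
 have tc: "t : HHH" "t' : HHH" using tt by (auto simp: ipair_def)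
 have "rel3 X Y Z R F G (t' *\<^sub>3 (t *\<^sub>3 u))"
  by (rule rel3_trans[OF hm assms(4,1) rel3_inv[OF hm assms(3,2) tt]]) (simp_all add: tc u)
 thus ?thesis using tt u tc by (simp add: ipair_def flip: H3.m_assoc)
qed

lemma rel3_cancel_r:
 assumes "rel3 X Y Z R F K (u *\<^sub>3 s)" "rel3 X Y Z R F G s" "tri k X Y Z R K" "tri k X Y Z R G"
  and ss: "ipair HHH s s'" and u: "u : HHH"
 shows "rel3 X Y Z R G K u"
proof -
 interpret H3: ring HHH by (rule ring_H3)
 have sc: "s : HHH" "s' : HHH" using ss by (auto simp: ipair_def)
 have "rel3 X Y Z R G K ((u *\<^sub>3 s) *\<^sub>3 s')"
  by (rule rel3_trans[OF hm assms(3) rel3_inv[OF hm assms(4,2) ss] assms(1)]) (simp_all add: sc u)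
 thus ?thesis using ss u sc by (simp add: ipair_def H3.m_assoc)
qed

end

end

context quasitriangular_quasi_Hopf_algebra
begin

abbreviation "RR \<equiv> Rmat H"
abbreviation "RI \<equiv> inv\<^bsub>HH\<^esub> (Rmat H)"

lemmas R_ipair = ipair_unit[OF alg_H2 Rmat_unit]

lemma R_closed: "RR : HH" and RI_closed: "RI : HH"
 using R_ipair by (auto simp: ipair_def)

lemmas hex_ipairs = leg_hom[THEN ipair_hom, OF R_ipair] perm_hom[THEN ipair_hom, OF phi_ipair]

lemmas hex_closed = leg_closed[OF R_closed] copl_closed[OF R_closed] copr_closed[OF R_closed]
 perm_closed[OF phi_closed] perm_closed(2,4)[OF phiI_closed] phi_closed phiI_closed

text \<open>The axioms for the coproducts of \<open>R\<close>, as equations of paths around two hexagons.\<close>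

lemma hexA: "leg13 RR *\<^sub>3 (perm213 ph *\<^sub>3 leg12 RR) = perm231 ph *\<^sub>3 (copr RR *\<^sub>3 ph)"
 and copr_R_ipair: "\<exists>c. ipair HHH (copr RR) c"
proof -
 interpret H3: ring HHH by (rule ring_H3)
 have c: "copr RR = perm231 phiI *\<^sub>3 leg13 RR *\<^sub>3 perm213 ph *\<^sub>3 leg12 RR *\<^sub>3 phiI"
  using Rmat_right ipair_inv[OF alg_H3 hex_ipairs(5)]
  by (simp add: copr_def leg13_def leg12_def perm213_def perm231_def)
 note i = hex_ipairs(5) phi_ipair
 have [simp]: "perm231 ph *\<^sub>3 (perm231 phiI *\<^sub>3 z) = z"
  if "z : HHH" for z using hex_ipairs(5) that by (simp add: ipair_def flip: H3.m_assoc)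
 show "leg13 RR *\<^sub>3 (perm213 ph *\<^sub>3 leg12 RR) = perm231 ph *\<^sub>3 (copr RR *\<^sub>3 ph)"
  unfolding c using phi_ipair by (simp add: H3.m_assoc hex_closed ipair_def)
 show "\<exists>c. ipair HHH (copr RR) c"
  unfolding c by (intro exI, rule ipair_mult[OF alg_H3 ipair_mult[OF alg_H3 ipair_mult[OF alg_H3 ipair_mult[OF alg_H3
   ipair_sym[OF hex_ipairs(5)] hex_ipairs(2)] hex_ipairs(4)] hex_ipairs(1)] ipair_sym[OF phi_ipair]])
qed

lemma hexB: "copl RR = perm312 ph *\<^sub>3 (leg13 RR *\<^sub>3 (perm132 phiI *\<^sub>3 (leg23 RR *\<^sub>3 ph)))"
proof -
 interpret H3: ring HHH by (rule ring_H3)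
 have "copl RR = perm312 ph *\<^sub>3 leg13 RR *\<^sub>3 perm132 phiI *\<^sub>3 leg23 RR *\<^sub>3 ph"
  using Rmat_left ipair_inv[OF alg_H3 hex_ipairs(7)]
  by (simp add: copl_def leg13_def leg23_def perm312_def perm132_def)
 thus ?thesis by (simp add: H3.m_assoc hex_closed)
qed

context
 fixes X Y Z R G2 G3 G4 G5 G6
 assumes hm: "hmod X" "hmod Y" "hmod Z" "kmod R"
  and t: "tri k X Y Z R G2" "tri k X Y Z R G3" "tri k X Y Z R G4" "tri k X Y Z R G5" "tri k X Y Z R G6"
begin

private abbreviation "rh \<equiv> rel3 X Y Z R"

text \<open>For a braiding across a product \<open>y z\<close>: the functions \<open>G1\<close>, ..., \<open>G6\<close> stand for
 \<open>(x y) z\<close>, \<open>(y x) z\<close>, \<open>y (x z)\<close>, \<open>y (z x)\<close>, \<open>(y z) x\<close>, \<open>x (y z)\<close>. Five sides of the hexagon give the sixth.\<close>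

lemma hexA_phi:
 assumes "rh G1 G2 (leg12 RR)" "rh G2 G3 (perm213 ph)" "rh G3 G4 (leg13 RR)"
  "rh G5 G4 (perm231 ph)" "rh G6 G5 (copr RR)"
 shows "rh G1 G6 ph"
proof -
 interpret H3: ring HHH by (rule ring_H3)
 have "rh G1 G4 (leg13 RR *\<^sub>3 (perm213 ph *\<^sub>3 leg12 RR))"
  by (rule rel3_trans[OF hm t(3) rel3_trans[OF hm t(2) assms(1,2)] assms(3)]) (simp_all add: hex_closed)
 from rel3_cancel_l[OF hm this[unfolded hexA] assms(4) t(3,4) hex_ipairs(5)]
 have "rh G1 G5 (copr RR *\<^sub>3 ph)" by (simp add: hex_closed)
 thus ?thesis using copr_R_ipair rel3_cancel_l[OF hm _ assms(5) t(4,5)] hex_closed by blast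
qed

lemma hexA_copr:
 assumes "rh G1 G2 (leg12 RR)" "rh G2 G3 (perm213 ph)" "rh G3 G4 (leg13 RR)"
  "rh G5 G4 (perm231 ph)" "rh G1 G6 ph"
 shows "rh G6 G5 (copr RR)"
proof -
 interpret H3: ring HHH by (rule ring_H3)
 have "rh G1 G4 (leg13 RR *\<^sub>3 (perm213 ph *\<^sub>3 leg12 RR))"
  by (rule rel3_trans[OF hm t(3) rel3_trans[OF hm t(2) assms(1,2)] assms(3)]) (simp_all add: hex_closed)
 from rel3_cancel_l[OF hm this[unfolded hexA] assms(4) t(3,4) hex_ipairs(5)]
 have "rh G1 G5 (copr RR *\<^sub>3 ph)" by (simp add: hex_closed)
 from rel3_cancel_r[OF hm this assms(5) t(4,5) phi_ipair] show ?thesis by (simp add: hex_closed)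
qed

lemma hexA_leg12:
 assumes "rh G2 G3 (perm213 ph)" "rh G3 G4 (leg13 RR)"
  "rh G5 G4 (perm231 ph)" "rh G6 G5 (copr RR)" "rh G1 G6 ph"
 shows "rh G1 G2 (leg12 RR)"
proof -
 interpret H3: ring HHH by (rule ring_H3)
 have "rh G1 G4 (perm231 ph *\<^sub>3 (copr RR *\<^sub>3 ph))"
  by (rule rel3_trans[OF hm t(3) rel3_trans[OF hm t(4) assms(5,4)] assms(3)]) (simp_all add: hex_closed)
 from rel3_cancel_l[OF hm this[folded hexA] assms(2) t(3,2) hex_ipairs(2)]
 have "rh G1 G3 (perm213 ph *\<^sub>3 leg12 RR)" by (simp add: hex_closed)
 from rel3_cancel_l[OF hm this assms(1) t(2,1) hex_ipairs(4)] show ?thesis by (simp add: hex_closed)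
qed

text \<open>For a braiding across a product \<open>x y\<close>: here they stand for
 \<open>(x y) z\<close>, \<open>x (y z)\<close>, \<open>x (z y)\<close>, \<open>(x z) y\<close>, \<open>(z x) y\<close>, \<open>z (x y)\<close>.\<close>

lemma hexB_copl:
 assumes "rh G1 G2 ph" "rh G2 G3 (leg23 RR)" "rh G4 G3 (perm132 ph)"
  "rh G4 G5 (leg13 RR)" "rh G5 G6 (perm312 ph)"
 shows "rh G1 G6 (copl RR)"
proof -
 interpret H3: ring HHH by (rule ring_H3)
 show ?thesis unfolding hexB
  by (rule rel3_trans[OF hm t(5) rel3_trans[OF hm t(4) rel3_trans[OF hm t(3) rel3_trans[OF hm t(2) assms(1,2)]
     rel3_inv[OF hm t(2) assms(3) hex_ipairs(7)]] assms(4)] assms(5)]) (simp_all add: hex_closed)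
qed

lemma hexB_phi:
 assumes "rh G1 G6 (copl RR)" "rh G2 G3 (leg23 RR)" "rh G4 G3 (perm132 ph)"
  "rh G4 G5 (leg13 RR)" "rh G5 G6 (perm312 ph)"
 shows "rh G1 G2 ph"
proof -
 interpret H3: ring HHH by (rule ring_H3)
 note c = rel3_cancel_l[OF hm]
 show ?thesis
  by (rule c[OF c[OF c[OF c[OF assms(1)[unfolded hexB] assms(5) t(5,4) hex_ipairs(6)] assms(4) t(4,3) hex_ipairs(2)]
     rel3_inv[OF hm t(2) assms(3) hex_ipairs(7)] t(3,2) ipair_sym[OF hex_ipairs(7)]] assms(2) t(2,1) hex_ipairs(3)])
   (simp_all add: hex_closed)
qed

lemma hexB_leg13:
 assumes "rh G1 G6 (copl RR)" "rh G1 G2 ph" "rh G2 G3 (leg23 RR)" "rh G4 G3 (perm132 ph)"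
  "rh G5 G6 (perm312 ph)"
 shows "rh G4 G5 (leg13 RR)"
proof -
 interpret H3: ring HHH by (rule ring_H3)
 note c = rel3_cancel_r[OF hm]
 have 1: "rh G1 G5 (((leg13 RR *\<^sub>3 perm132 phiI) *\<^sub>3 leg23 RR) *\<^sub>3 ph)"
  using rel3_cancel_l[OF hm assms(1)[unfolded hexB] assms(5) t(5,4) hex_ipairs(6)] by (simp add: hex_closed H3.m_assoc)
 show ?thesis
  by (rule c[OF c[OF c[OF 1 assms(2) t(4,1) phi_ipair] assms(3) t(4,2) hex_ipairs(3)]
     rel3_inv[OF hm t(2) assms(4) hex_ipairs(7)] t(4,3) ipair_sym[OF hex_ipairs(7)]])
   (simp_all add: hex_closed)
qed

end

end

section \<open>Symmetric bimodules and the braiding\<close>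

context algebra_setting
begin

text \<open>A product remains equivariant after braiding its arguments, since \<open>R\<close> intertwines the coproduct with its
opposite.\<close>

lemma eqb_twist:
 assumes hm: "hmod V" "hmod W" "hmod X" and f: "eqb W V X f"
 shows "eqb V W X (%v w. sm2 X RR (%a b. f (act W b w) (act V a v)))"
 unfolding eqb_def
proof (intro conjI ballI)
 note mX = hmod_mod[OF hm(3)]
 interpret H2: ring HH by (rule ring_H2)
 let ?G = "%v w. f w v"
 have G: "bil k V W X ?G" by (rule bil_flip[OF eqb_bil[OF f]])
 show "bil k V W X (%v w. sm2 X RR (%a b. f (act W b w) (act V a v)))" by (rule bil_rel[OF hm(1,2) mX G R_closed])
 fix h v w assume h: "h : H" and el: "v : V" "w : W"
 let ?op = "sm2 HH (cop h) (%h1 h2. p2 k H h2 h1)"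
 note c = cop_cl[OF h]
 have F: "bil k H H X (%a b. ?G (act V a v) (act W b w))" if "v : V" "w : W" for v w
  by (rule bil_act[OF hm(1,2) G that])
 have mult: "sm2 X t (%a b. sm2 X s (%c d. ?G (act V c (act V a v)) (act W d (act W b w))))
   = sm2 X (s *\<^sub>2 t) (%a b. ?G (act V a v) (act W b w))"
  if "s : HH" "t : HH" for s t
  unfolding sw2_mult'[OF mX F[OF el] that(2,1)] by (intro sw2_cong) (simp add: act_mult hm el)
 have pb: "bil k H H HH (%h1 h2. p2 k H h2 h1)"
  by (rule bil_flip[OF p2_bil])
 have opc: "?op : HH" by (rule sw2_closed[OF mod_H2 pb c])
 have op: "act X h (?G v w) = sm2 X ?op (%a b. ?G (act V a v) (act W b w))" if "v : V" "w : W" for v w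
  unfolding sw2_push[OF mod_H2 mX pb sw2_lin[OF mX F[OF that]] c] eqb_act[OF f h that(2,1)]
  by (rule sw2_cong) (simp add: sw2_pure[OF mX F[OF that]])
 have "act X h (sm2 X RR (%a b. ?G (act V a v) (act W b w)))
   = sm2 X RR (%a b. sm2 X ?op (%c d. ?G (act V c (act V a v)) (act W d (act W b w))))"
  unfolding sw2_push[OF mX mX F[OF el] act_lin2[OF hm(3) h] R_closed]
  by (rule sw2_cong) (simp add: op act_closed hm el)
 also have "... = sm2 X (?op *\<^sub>2 RR) (%a b. ?G (act V a v) (act W b w))"
  by (rule mult[OF opc R_closed])
 also have "?op *\<^sub>2 RR = RR *\<^sub>2 cop h"
  using Rmat_comult[OF h] R_ipair R_closed RI_closed c by (simp add: ipair_def H2.m_assoc)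
 also have "sm2 X (RR *\<^sub>2 cop h) (%a b. ?G (act V a v) (act W b w))
   = sm2 X (cop h) (%a b. sm2 X RR (%c d. ?G (act V c (act V a v)) (act W d (act W b w))))"
  by (rule mult[OF R_closed c, symmetric])
 finally show "act X h (sm2 X RR (%a b. f (act W b w) (act V a v)))
   = sm2 X (cop h) (%a b. sm2 X RR (%c d. f (act W d (act W b w)) (act V c (act V a v))))" .
qed

text \<open>Symmetry as a pair of relations by \<open>R\<close> between the two actions.\<close>

definition sym where
 "sym V <-> bim V \<and> rel2 A V V (al V) (%a v. ar V v a) RR \<and> rel2 V A V (ar V) (%v a. al V a v) RR"

lemma symD: "sym V ==> bim V" "sym V ==> rel2 A V V (al V) (%a v. ar V v a) RR"
 "sym V ==> rel2 V A V (ar V) (%v a. al V a v) RR"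
 by (simp_all add: sym_def)

lemma tau_pure:
 assumes V: "hmod V" and W: "hmod W" and el: "v : V" "w : W"
 shows "tau k H V W (pure k V W v w) = sm2 (ht W V) RR (%a b. pure k W V (act W b w) (act V a v))"
 unfolding tau_def
 by (rule tlift_pure[OF hmod_mod[OF V] hmod_mod[OF W] hten_module[OF hmod_mod[OF W] hmod_mod[OF V]]
   bil_rel[OF V W hten_module[OF hmod_mod[OF W] hmod_mod[OF V]]
    bil_flip[OF hten_pure_bil[OF hmod_mod[OF W] hmod_mod[OF V]]] R_closed] el])

lemma is_sym_bimod_sym:
 assumes "is_sym_bimod k H A V"
 shows "sym V"
proof -
 have V: "bim V" and l: "\<forall>t\<in>carrier (ht A V). ract V (tau k H A V t) = lact V t"
  and r: "\<forall>t\<in>carrier (ht V A). lact V (tau k H V A t) = ract V t"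
  using assms is_bimod_bim[of V] by (simp_all add: is_sym_bimod_def)
 note h = bim_hmod[OF V] and m = bim_module[OF V]
 have "al V a v = sm2 V RR (%b c. ar V (act V c v) (act A b a))" if "a : A" "v : V" for a v
  using bspec[OF l hten_pure_closed[OF mod_A m that]]
   sw2_push[OF hten_module[OF m mod_A] m bil_act[OF hmod_A h bil_flip[OF hten_pure_bil[OF m mod_A]] that] is_hmor_lin[OF bim_ract[OF V]] R_closed]
  by (simp add: tau_pure hmod_A h that lm_def rm_def)
 moreover have "ar V v a = sm2 V RR (%b c. al V (act A c a) (act V b v))" if "a : A" "v : V" for a v
  using bspec[OF r hten_pure_closed[OF m mod_A that(2,1)]]
   sw2_push[OF hten_module[OF mod_A m] m bil_act[OF h hmod_A bil_flip[OF hten_pure_bil[OF mod_A m]] that(2,1)] is_hmor_lin[OF bim_lact[OF V]] R_closed]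
  by (simp add: tau_pure hmod_A h that lm_def rm_def)
 ultimately show ?thesis using V by (simp add: sym_def rel2_def)
qed

context
 fixes V W
 assumes V: "sym V" and W: "sym W"
begin

private lemmas bV = symD(1)[OF V] and bW = symD(1)[OF W]
private lemmas h_V = bim_hmod[OF bV] and h_W = bim_hmod[OF bW] and m_V = bim_module[OF bV] and m_W = bim_module[OF bW]
private lemmas e = al_eqb[OF bV] ar_eqb[OF bV] al_eqb[OF bW] ar_eqb[OF bW]
private lemmas lrb = e[THEN eqb_bil]

text \<open>The braiding on generators.\<close>

definition "tp v w = sm2 (W**V) RR (%x y. pr W V (act W y w) (act V x v))"

lemma tp_rel: "rel2 V W (W**V) tp (%v w. pr W V w v) RR"
 by (simp add: rel2_def tp_def)

text \<open>Each of the three laws is a hexagon: right linearity for \<open>v\<close>, \<open>w\<close>, \<open>a\<close>, left linearity for \<open>a\<close>, \<open>v\<close>, \<open>w\<close> and balancing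
for \<open>v\<close>, \<open>a\<close>, \<open>w\<close>. The sides that braid \<open>a\<close> with \<open>v\<close> or \<open>w\<close> are the symmetry of \<open>V\<close> or \<open>W\<close>.\<close>

lemma tp_bimap: "bimap V W (W**V) tp"
proof -
 let ?T = "W**V"
 note bT = ten_bim[OF bW bV] note hT = bim_hmod[OF bT] and mT = bim_module[OF bT]
 note eT = al_eqb[OF bT] ar_eqb[OF bT] and p = pr_eqb[OF bW bV]
 note bT' = eT[THEN eqb_bil] and pb = eqb_bil[OF p]
 have te: "eqb V W ?T tp" using eqb_twist[OF h_V h_W hT p] by (simp add: tp_def[abs_def])
 note tb = eqb_bil[OF te] and fl = bil_flip[OF pb]
 have al: "asc A W V ?T (al W) (pr W V) (pr W V) (al ?T)" by (rule asc_al_pr[OF bW bV])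
 have ar: "asc W V A ?T (pr W V) (ar ?T) (ar V) (pr W V)" by (rule asc_pr_ar[OF bW bV])
 have ba: "asc W A V ?T (ar W) (pr W V) (al V) (pr W V)" by (rule asc_balanced[OF bim_wl_wr(2)[OF bW] bim_wl_wr(1)[OF bV]])
 have r: "asc V W A ?T tp (ar ?T) (ar W) tp"
  unfolding asc_def
 by (rule hexA_phi[OF h_V h_W hmod_A mT
    tri_perm213[OF tri_left[OF pb bT'(2)]]
    tri_perm213[OF tri_right[OF lrb(2) pb]]
    tri_perm312[OF tri_right[OF lrb(1) pb]]
    tri_perm312[OF tri_left[OF lrb(4) pb]]
    tri_right[OF lrb(4) tb]
    rel3_leg12[OF tp_rel bT'(2) fl R_closed h_V h_W hmod_A mT mT]
    rel3_perm213[OF ar[unfolded asc_def] tri_right[OF lrb(2) pb] phi_closed mT h_V h_W hmod_A]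
    rel3_leg13_r[OF symD(3)[OF V] pb bil_flip[OF lrb(1)] R_closed h_V h_W hmod_A m_V mT]
    rel3_perm231[OF ba[unfolded asc_def] tri_right[OF lrb(1) pb] phi_closed mT h_V h_W hmod_A]
    rel3_copr[OF tp_rel e(4) fl R_closed h_V h_W hmod_A h_W mT]])
 have l: "asc A V W ?T (al V) tp tp (al ?T)"
  unfolding asc_def
 by (rule hexB_phi[OF hmod_A h_V h_W mT
    tri_right[OF tb bT'(1)]
    tri_right[OF fl bT'(1)]
    tri_perm132[OF tri_left[OF lrb(3) pb]]
    tri_perm231[OF tri_left[OF lrb(4) pb]]
    tri_perm231[OF tri_right[OF lrb(1) pb]]
    rel3_copl[OF tp_rel e(1) fl R_closed hmod_A h_V h_W h_V mT]
    rel3_leg23[OF tp_rel bT'(1) fl R_closed hmod_A h_V h_W mT mT]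
    rel3_perm132[OF al[unfolded asc_def] tri_right[OF pb bT'(1)] phi_closed mT hmod_A h_V h_W]
    rel3_leg13_l[OF symD(2)[OF W] pb bil_flip[OF lrb(4)] R_closed hmod_A h_V h_W m_W mT]
    rel3_perm312[OF ba[unfolded asc_def] tri_right[OF lrb(1) pb] phi_closed mT hmod_A h_V h_W]])
 have bal: "asc V A W ?T (ar V) tp (al W) tp"
  unfolding asc_def
 by (rule hexB_phi[OF h_V hmod_A h_W mT
    tri_right[OF lrb(3) tb]
    tri_right[OF bil_flip[OF lrb(4)] tb]
    tri_perm132[OF tri_left[OF tb bT'(2)]]
    tri_perm231[OF tri_left[OF pb bT'(2)]]
    tri_perm231[OF tri_right[OF lrb(2) pb]]
    rel3_copl[OF tp_rel e(2) fl R_closed h_V hmod_A h_W h_V mT]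
    rel3_leg23[OF symD(2)[OF W] tb bil_flip[OF lrb(4)] R_closed h_V hmod_A h_W m_W mT]
    rel3_perm132[OF r[unfolded asc_def] tri_right[OF lrb(4) tb] phi_closed mT h_V hmod_A h_W]
    rel3_leg13_l[OF tp_rel bT'(2) fl R_closed h_V hmod_A h_W mT mT]
    rel3_perm312[OF ar[unfolded asc_def] tri_right[OF lrb(2) pb] phi_closed mT h_V hmod_A h_W]])
 show ?thesis by (simp add: bimap_def te bal l r)
qed

lemma tau_pr: "v : V ==> w : W ==> tauA k H A V W (pr V W v w) = tp v w"
 and tau_bmor: "bmor (V**W) (W**V) (tauA k H A V W)"
 using lift_pr[OF bV bW ten_bim[OF bW bV] tp_bimap] lift_bmor[OF bV bW ten_bim[OF bW bV] tp_bimap]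
 by (simp_all add: tauA_def tp_def[abs_def])

text \<open>Braiding \<open>a\<close> past \<open>v w\<close> is braiding it past \<open>v\<close> and then past \<open>w\<close>; the hexagon yields the relation on generators.\<close>

lemma sym_ten: "sym (V**W)"
proof -
 let ?T = "V**W"
 note bT = ten_bim[OF bV bW] note hT = bim_hmod[OF bT] and mT = bim_module[OF bT]
 note eT = al_eqb[OF bT] ar_eqb[OF bT] and p = pr_eqb[OF bV bW] and sp = ten_spans[OF bV bW]
 note bT' = eT[THEN eqb_bil] and pb = eqb_bil[OF p]
 have al: "asc A V W ?T (al V) (pr V W) (pr V W) (al ?T)" by (rule asc_al_pr[OF bV bW])
 have ar: "asc V W A ?T (pr V W) (ar ?T) (ar W) (pr V W)" by (rule asc_pr_ar[OF bV bW])
 have ba: "asc V A W ?T (ar V) (pr V W) (al W) (pr V W)" by (rule asc_balanced[OF bim_wl_wr(2)[OF bV] bim_wl_wr(1)[OF bW]])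
 have "rel3 A V W ?T (%a v w. al ?T a (pr V W v w)) (%a v w. ar ?T (pr V W v w) a) (copr RR)"
 by (rule hexA_copr[OF hmod_A h_V h_W mT
    tri_left[OF bil_flip[OF lrb(2)] pb]
    tri_perm213[OF tri_right[OF lrb(3) pb]]
    tri_perm312[OF tri_right[OF lrb(4) pb]]
    tri_perm312[OF tri_left[OF pb bT'(2)]]
    tri_right[OF pb bT'(1)]
    rel3_leg12[OF symD(2)[OF V] pb bil_flip[OF lrb(2)] R_closed hmod_A h_V h_W m_V mT]
    rel3_perm213[OF ba[unfolded asc_def] tri_right[OF lrb(3) pb] phi_closed mT hmod_A h_V h_W]
    rel3_leg13_r[OF symD(2)[OF W] pb bil_flip[OF lrb(4)] R_closed hmod_A h_V h_W m_W mT]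
    rel3_perm231[OF ar[unfolded asc_def] tri_right[OF lrb(4) pb] phi_closed mT hmod_A h_V h_W]
    al[unfolded asc_def]])
 from rel2_of_copr[OF this p sp bT'(1) bil_flip[OF bT'(2)] R_closed hmod_A h_V h_W hT mT]
 have l: "rel2 A ?T ?T (al ?T) (%a t. ar ?T t a) RR" .
 have "rel3 V W A ?T (%v w a. ar ?T (pr V W v w) a) (%v w a. al ?T a (pr V W v w)) (copl RR)"
 by (rule hexB_copl[OF h_V h_W hmod_A mT
    tri_right[OF lrb(4) pb]
    tri_right[OF bil_flip[OF lrb(3)] pb]
    tri_perm132[OF tri_left[OF lrb(2) pb]]
    tri_perm231[OF tri_left[OF lrb(1) pb]]
    tri_perm231[OF tri_right[OF pb bT'(1)]]
    ar[unfolded asc_def]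
    rel3_leg23[OF symD(3)[OF W] pb bil_flip[OF lrb(3)] R_closed h_V h_W hmod_A m_W mT]
    rel3_perm132[OF ba[unfolded asc_def] tri_right[OF lrb(3) pb] phi_closed mT h_V h_W hmod_A]
    rel3_leg13_l[OF symD(3)[OF V] pb bil_flip[OF lrb(1)] R_closed h_V h_W hmod_A m_V mT]
    rel3_perm312[OF al[unfolded asc_def] tri_right[OF pb bT'(1)] phi_closed mT h_V h_W hmod_A]])
 from rel2_of_copl[OF this p sp bT'(2) bil_flip[OF bT'(1)] R_closed h_V h_W hmod_A hT mT]
 have r: "rel2 ?T A ?T (ar ?T) (%t a. al ?T a t) RR" .
 show ?thesis using bT l r by (simp add: sym_def)
qed

text \<open>The hexagons for \<open>a\<close>, \<open>L\<close>, \<open>v\<close> and \<open>L\<close>, \<open>v\<close>, \<open>a\<close> with evaluation as the product: all sides but the symmetry of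
\<open>hom\<^sub>A\<close> are known. Evaluation is then removed by nondegeneracy.\<close>

lemma sym_Hom: "sym (Hom V W)"
proof -
 let ?N = "Hom V W" and ?ev = "evp V W" and ?E = "hE V W"
 note bN = Hom_bim[OF bV bW] note hN = bim_hmod[OF bN] and mN = bim_module[OF bN]
 note eN = al_eqb[OF bN] ar_eqb[OF bN] and p = evp_bimap[OF bV bW]
 note bN' = eN[THEN eqb_bil] and pe = bimap_eqb[OF p] and pb = bimap_bil[OF p]
 note al = bimap_l[OF p, unfolded asc_def] and ar = bimap_r[OF p, unfolded asc_def] and ba = bimap_bal[OF p, unfolded asc_def]
 note inc = sub_hmor[OF Hom_sub[OF bV bW]] and E = hhom_hmod[OF h_V h_W]
 have "rel3 A ?N V W (%a L v. ?ev (al ?N a L) v) (%a L v. ?ev (ar ?N L a) v) (leg12 RR)"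
 by (rule hexA_leg12[OF hmod_A hN h_V m_W
    tri_left[OF bil_flip[OF bN'(2)] pb]
    tri_perm213[OF tri_right[OF lrb(1) pb]]
    tri_perm312[OF tri_right[OF lrb(2) pb]]
    tri_perm312[OF tri_left[OF pb lrb(4)]]
    tri_right[OF pb lrb(3)]
    rel3_perm213[OF ba tri_right[OF lrb(1) pb] phi_closed m_W hmod_A hN h_V]
    rel3_leg13_r[OF symD(2)[OF V] pb bil_flip[OF lrb(2)] R_closed hmod_A hN h_V m_V m_W]
    rel3_perm231[OF ar tri_right[OF lrb(2) pb] phi_closed m_W hmod_A hN h_V]
    rel3_copr[OF symD(2)[OF W] pe bil_flip[OF lrb(4)] R_closed hmod_A hN h_V h_W m_W]
    al])
 hence el: "?ev (al ?N a L) v = ?ev (sm2 ?N RR (%x y. ar ?N (act ?N y L) (act A x a))) v"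
  if "a : A" "L : ?N" "v : V" for a L v
  using sw3_leg12_apply[OF hmod_A hN h_V mN m_W bil_flip[OF bN'(2)] pb R_closed that] that by (simp add: rel3_def)
 have l: "rel2 A ?N ?N (al ?N) (%a L. ar ?N L a) RR"
  unfolding rel2_def
  by (intro ballI eqb_nondegenerate[OF h_V h_W hmod_A hN eqb_post[OF eN(1) hmod_A hN hN E inc]
    eqb_post[OF eqb_twist[OF hmod_A hN hN eN(2)] hmod_A hN hN E inc] el])
 have "rel3 ?N V A W (%L v a. ?ev (ar ?N L a) v) (%L v a. ?ev (al ?N a L) v) (leg13 RR)"
 by (rule hexB_leg13[OF hN h_V hmod_A m_W
    tri_right[OF lrb(2) pb]
    tri_right[OF bil_flip[OF lrb(1)] pb]
    tri_perm132[OF tri_left[OF bN'(2) pb]]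
    tri_perm231[OF tri_left[OF bN'(1) pb]]
    tri_perm231[OF tri_right[OF pb lrb(3)]]
    rel3_copl[OF symD(3)[OF W] pe bil_flip[OF lrb(3)] R_closed hN h_V hmod_A h_W m_W]
    ar
    rel3_leg23[OF symD(3)[OF V] pb bil_flip[OF lrb(1)] R_closed hN h_V hmod_A m_V m_W]
    rel3_perm132[OF ba tri_right[OF lrb(1) pb] phi_closed m_W hN h_V hmod_A]
    rel3_perm312[OF al tri_right[OF pb lrb(3)] phi_closed m_W hN h_V hmod_A]])
 hence er: "?ev (ar ?N L a) v = ?ev (sm2 ?N RR (%x y. al ?N (act A y a) (act ?N x L))) v"
  if "L : ?N" "a : A" "v : V" for a L v
  using sw3_leg13_apply_l[OF hN h_V hmod_A mN m_W bil_flip[OF bN'(1)] pb R_closed that(1,3,2)] that by (simp add: rel3_def)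
 have r: "rel2 ?N A ?N (ar ?N) (%L a. al ?N a L) RR"
  unfolding rel2_def
  by (intro ballI eqb_nondegenerate[OF h_V h_W hN hmod_A eqb_post[OF eN(2) hN hmod_A hN E inc]
    eqb_post[OF eqb_twist[OF hN hmod_A hN eN(1)] hN hmod_A hN E inc] er])
 show ?thesis using bN l r by (simp add: sym_def)
qed

end

end

section \<open>Coherence of the braided monoidal category\<close>

context algebra_setting
begin

abbreviation lw where "lw P X Y f \<equiv> tm P X P Y id f"
abbreviation rw where "rw X Y P f \<equiv> tm X P Y P f id"

text \<open>Whiskered structure maps carry their source and target in their arguments.\<close>

abbreviation lPh where "lPh P V W X \<equiv> lw P ((V**W)**X) (V**W**X) (Ph V W X)"
abbreviation rPh where "rPh P V W X \<equiv> rw ((V**W)**X) (V**W**X) P (Ph V W X)"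
abbreviation llPh where "llPh P Q V W X \<equiv> lw P (Q**(V**W)**X) (Q**V**W**X) (lPh Q V W X)"
abbreviation tau' where "tau' V W \<equiv> tauA k H A V W"
abbreviation ltau' where "ltau' P V W \<equiv> lw P (V**W) (W**V) (tau' V W)"
abbreviation rtau' where "rtau' P V W \<equiv> rw (V**W) (W**V) P (tau' V W)"

lemma bmor_id': "bmor V V id"
 using bmor_id[of V] by (simp add: id_def)

lemma lw_bmor: "bim P ==> bim X ==> bim Y ==> bmor X Y f ==> bmor (P**X) (P**Y) (lw P X Y f)"
 by (rule tm_pr(2)[OF _ _ _ _ bmor_id'])

lemma rw_bmor: "bim P ==> bim X ==> bim Y ==> bmor X Y f ==> bmor (X**P) (Y**P) (rw X Y P f)"
 by (rule tm_pr(2)[OF _ _ _ _ _ bmor_id'])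

lemma tm_cong:
 "(!!v. v : V ==> f v = f' v) ==> (!!w. w : W ==> g w = g' w) ==> tm V W V' W' f g = tm V W V' W' f' g'"
 unfolding tmapA_def by (rule tliftA_cong) simp

lemma tm_id: "bim V ==> bim W ==> t : V**W ==> tm V W V W id id t = t"
 by (rule ten_ext[OF _ _ tm_pr(2)[OF _ _ _ _ bmor_id' bmor_id'] bmor_id]) (simp_all add: tm_pr(1) bmor_id')

lemma tm_comp:
 assumes b: "bim V" "bim W" "bim V'" "bim W'" "bim V''" "bim W''"
  and m: "bmor V V' f" "bmor W W' f'" "bmor V' V'' g" "bmor W' W'' g'" and t: "t : V**W"
 shows "tm V' W' V'' W'' g g' (tm V W V' W' f f' t) = tm V W V'' W'' (%x. g (f x)) (%x. g' (f' x)) t"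
proof (rule ten_ext[OF b(1,2) bmor_comp[OF tm_pr(2)[OF b(1-4) m(1,2)] tm_pr(2)[OF b(3-6) m(3,4)]]
   tm_pr(2)[OF b(1,2,5,6) bmor_comp[OF m(1,3)] bmor_comp[OF m(2,4)]] t])
 fix v w assume *: "v : V" "w : W"
 show "tm V' W' V'' W'' g g' (tm V W V' W' f f' (pr V W v w)) = tm V W V'' W'' (%x. g (f x)) (%x. g' (f' x)) (pr V W v w)"
  by (simp only: tm_pr(1)[OF b(1-4) m(1,2) *] tm_pr(1)[OF b(3-6) m(3,4) bmor_closed[OF m(1) *(1)] bmor_closed[OF m(2) *(2)]]
   tm_pr(1)[OF b(1,2,5,6) bmor_comp[OF m(1,3)] bmor_comp[OF m(2,4)] *])
qed

lemma tm_lr: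
 assumes b: "bim V" "bim W" "bim V'" "bim W'" and m: "bmor V V' f" "bmor W W' g" and t: "t : V**W"
 shows "tm V W V' W' f g t = lw V' W W' g (rw V V' W f t)" "tm V W V' W' f g t = rw V V' W' f (lw V W W' g t)"
 by (simp_all only: tm_comp[OF b(1,2,3,2,3,4) m(1) bmor_id' bmor_id' m(2) t] tm_comp[OF b(1,2,1,4,3,4) bmor_id' m(2) m(1) bmor_id' t] id_apply)

lemma lw_comp:
 assumes "bim P" "bim X" "bim Y" "bim Z" "bmor X Y f" "bmor Y Z g" "t : P**X"
 shows "lw P Y Z g (lw P X Y f t) = lw P X Z (%x. g (f x)) t"
 using tm_comp[OF assms(1,2,1,3,1,4) bmor_id' assms(5) bmor_id' assms(6,7)] by (simp add: id_def)

lemma rw_comp: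
 assumes "bim P" "bim X" "bim Y" "bim Z" "bmor X Y f" "bmor Y Z g" "t : X**P"
 shows "rw Y Z P g (rw X Y P f t) = rw X Z P (%x. g (f x)) t"
 using tm_comp[OF assms(2,1,3,1,4,1,5) bmor_id' assms(6) bmor_id' assms(7)] by (simp add: id_def)

lemma ten3_ext:
 assumes b: "bim V" "bim W" "bim X" and f: "bmor ((V**W)**X) R f" and g: "bmor ((V**W)**X) R g"
  and eq: "!!v w x. v : V ==> w : W ==> x : X
   ==> f (pr (V**W) X (pr V W v w) x) = g (pr (V**W) X (pr V W v w) x)"
  and t: "t : (V**W)**X"
 shows "f t = g t"
proof (rule ten_ext[OF ten_bim[OF b(1,2)] b(3) f g t])
 fix s x assume s: "s : V**W" and x: "x : X"
 note l = bil_l[OF eqb_bil[OF pr_eqb[OF ten_bim[OF b(1,2)] b(3)]] x]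
 show "f (pr (V**W) X s x) = g (pr (V**W) X s x)"
  by (rule spans_lin_eq[OF ten_spans[OF b(1,2)] lin_comp[OF l bmor_lin[OF f]] lin_comp[OF l bmor_lin[OF g]] _ s])
   (rule eq[OF _ _ x])
qed

text \<open>The image of a triple product under a morphism after the associator is a Sweedler sum. Equations between
morphisms out of \<open>(V \<otimes> W) \<otimes> X\<close> thereby become relations by \<open>\<phi>\<close>.\<close>

lemma push_Ph:
 assumes b: "bim V" "bim W" "bim X" "bim R" and g: "bmor (V**W**X) R g"
  and el: "v : V" "w : W" "x : X"
 shows "g (Ph V W X (pr (V**W) X (pr V W v w) x))
  = sm3 R ph (%p q r. g (pr V (W**X) (act V p v) (pr W X (act W q w) (act X r x))))"
 unfolding rel3D[OF Ph_rel[OF b(1-3)] el]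
 by (rule sw3_push[OF bim_module[OF ten_bim[OF b(1) ten_bim[OF b(2,3)]]] bim_module[OF b(4)]
   tri_act[OF b(1-3)[THEN bim_hmod] tri_right[OF eqb_bil[OF pr_eqb[OF b(2,3)]] eqb_bil[OF pr_eqb[OF b(1) ten_bim[OF b(2,3)]]]] el]
   bmor_lin[OF g] phi_closed])

lemma Ph_nat:
 assumes b: "bim V" "bim W" "bim X" "bim V'" "bim W'" "bim X'" and m: "bmor V V' f" "bmor W W' g" "bmor X X' h"
  and t: "t : (V**W)**X"
 shows "Ph V' W' X' (tm (V**W) X (V'**W') X' (tm V W V' W' f g) h t)
  = tm V (W**X) V' (W'**X') f (tm W X W' X' g h) (Ph V W X t)"
proof -
 note VW = tm_pr[OF b(1,2,4,5) m(1,2)] and WX = tm_pr[OF b(2,3,5,6) m(2,3)]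
 note bb = ten_bim[OF b(1,2)] ten_bim[OF b(2,3)] ten_bim[OF b(4,5)] ten_bim[OF b(5,6)]
 note L = tm_pr[OF bb(1) b(3) bb(3) b(6) VW(2) m(3)] and R = tm_pr[OF b(1) bb(2) b(4) bb(4) m(1) WX(2)]
 show ?thesis
 proof (rule ten3_ext[OF b(1-3) bmor_comp[OF L(2) Ph_bmor[OF b(4-6)]] bmor_comp[OF Ph_bmor[OF b(1-3)] R(2)] _ t])
  fix v w x assume el: "v : V" "w : W" "x : X"
  note c = bmor_closed[OF m(1)] bmor_closed[OF m(2)] bmor_closed[OF m(3)] act_closed[OF b(1)[THEN bim_hmod]] act_closed[OF b(2)[THEN bim_hmod]]
   act_closed[OF b(3)[THEN bim_hmod]]
  show "Ph V' W' X' (tm (V**W) X (V'**W') X' (tm V W V' W' f g) h (pr (V**W) X (pr V W v w) x))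
   = tm V (W**X) V' (W'**X') f (tm W X W' X' g h) (Ph V W X (pr (V**W) X (pr V W v w) x))"
   unfolding push_Ph[OF b(1-3) ten_bim[OF b(4) bb(4)] R(2) el] L(1)[OF pr_in[OF b(1,2) el(1,2)] el(3)] VW(1)[OF el(1,2)]
    rel3D[OF Ph_rel[OF b(4-6)] c(1)[OF el(1)] c(2)[OF el(2)] c(3)[OF el(3)]]
   by (rule sw3_cong) (simp add: R(1) WX(1) c el pr_in b bmor_act[OF m(1)] bmor_act[OF m(2)] bmor_act[OF m(3)])
 qed
qed

context
 fixes V W X
 assumes b: "bim V" "bim W" "bim X"
begin

lemma Ph_nat_r: "bim Y ==> bmor X Y f ==> t : (V**W)**X ==>
  Ph V W Y (lw (V**W) X Y f t) = lw V (W**X) (W**Y) (lw W X Y f) (Ph V W X t)"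
 using Ph_nat[OF b b(1,2) _ bmor_id' bmor_id', of Y f t] tm_cong[of "V**W" "tm V W V W id id" id X f f "V**W" Y]
 by (simp add: tm_id b)

lemma Ph_nat_m: "bim Y ==> bmor W Y f ==> t : (V**W)**X ==>
  Ph V Y X (rw (V**W) (V**Y) X (lw V W Y f) t) = lw V (W**X) (Y**X) (rw W Y X f) (Ph V W X t)"
 using Ph_nat[OF b b(1) _ b(3) bmor_id' _ bmor_id', of Y f t] by simp

lemma Ph_nat_l: "bim Y ==> bmor V Y f ==> t : (V**W)**X ==>
  Ph Y W X (rw (V**W) (Y**W) X (rw V Y W f) t) = rw V Y (W**X) f (Ph V W X t)"
 using Ph_nat[OF b _ b(2,3) _ bmor_id' bmor_id', of Y f t] tm_cong[of V f f "W**X" "tm W X W X id id" id Y "W**X"]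
 by (simp add: tm_id b)

lemma Ph_inj: "s : (V**W)**X ==> t : (V**W)**X ==> Ph V W X s = Ph V W X t ==> s = t"
 using Pi_inverse(3)[OF b] by metis

end

lemma rw_iso:
 assumes b: "bim P" "bim X" "bim Y" and m: "bmor X Y f" "bmor Y X g" and gf: "!!x. x : X ==> g (f x) = x"
  and t: "t : X**P"
 shows "rw Y X P g (rw X Y P f t) = t"
 using rw_comp[OF b(1,2,3,2) m t] gf tm_cong[of X "%x. g (f x)" id P id id X P] tm_id[OF b(2,1) t] by simp

text \<open>On generators both sides are the product bracketed to the right, with the two sides of the pentagon axiom
applied to the four arguments.\<close>

lemma pentagonA:
 assumes b: "bim V" "bim W" "bim X" "bim Y" and t: "t : ((V**W)**X)**Y"
 shows "lPh V W X Y (Ph V (W**X) Y (rPh Y V W X t))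
  = Ph V W (X**Y) (Ph (V**W) X Y t)"
proof -
 note b2 = ten_bim[OF b(1,2)] ten_bim[OF b(2,3)] ten_bim[OF b(3,4)]
 note b3 = ten_bim[OF b(1) b2(2)] ten_bim[OF b(2) b2(3)] ten_bim[OF b2(2) b(4)] ten_bim[OF b2(1) b(3)]
 note R = ten_bim[OF b(1) b3(2)]
 note r = rw_bmor[OF b(4) b3(4) b3(1) Ph_bmor[OF b(1-3)]] and l = lw_bmor[OF b(1) b3(3) b3(2) Ph_bmor[OF b(2-4)]]
 note u = bmor_comp[OF Ph_bmor[OF b(1) b2(2) b(4)] l]
 note h = b[THEN bim_hmod] and p = pr_bimap[THEN bimap_eqb]
 note pp = bimap_post[OF _ _ _ _ pr_bimap]
 let ?p123_4 = "%s y. lPh V W X Y (Ph V (W**X) Y (pr (V**W**X) Y s y))"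
 let ?p12_34 = "%t u. Ph V W (X**Y) (pr (V**W) (X**Y) t u)"
 have e1: "eqb (V**W) X (V**W**X) (%t x. Ph V W X (pr (V**W) X t x))"
  by (rule bimap_eqb[OF pp[OF b2(1) b(3) b3(4) b3(1) b2(1) b(3) Ph_bmor[OF b(1-3)]]])
 have e2: "eqb (W**X) Y (W**X**Y) (%t x. Ph W X Y (pr (W**X) Y t x))"
  by (rule bimap_eqb[OF pp[OF b2(2) b(4) b3(3) b3(2) b2(2) b(4) Ph_bmor[OF b(2-4)]]])
 have e3: "eqb (V**W**X) Y (V**W**X**Y) ?p123_4"
  by (rule bimap_eqb[OF pp[OF b3(1) b(4) ten_bim[OF b3(1) b(4)] R b3(1) b(4) u]])
 have e4: "eqb (V**W) (X**Y) (V**W**X**Y) ?p12_34"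
  by (rule bimap_eqb[OF pp[OF b2(1,3) ten_bim[OF b2(1,3)] R b2(1,3) Ph_bmor[OF b(1,2) b2(3)]]])
 have a: "asc V (W**X) Y (V**W**X**Y) (pr V (W**X)) ?p123_4 (%t x. Ph W X Y (pr (W**X) Y t x)) (pr V (W**X**Y))"
 proof -
  have "asc V (W**X) Y (V**W**X**Y) (pr V (W**X)) ?p123_4 (pr (W**X) Y)
    (%v s. lPh V W X Y (pr V ((W**X)**Y) v s))"
   by (rule asc_post[OF asc_Ph[OF b(1) b2(2) b(4)] h(1) bim_hmod[OF b2(2)] h(4) bim_module[OF ten_bim[OF b(1) b3(3)]] bim_module[OF R] bmor_lin[OF l]
      eqb_bil[OF p[OF b2(2) b(4)]] eqb_bil[OF p[OF b(1) b3(3)]]])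
  thus ?thesis unfolding asc_def
   by (rule rel3_cong) (simp_all add: tm_pr(1)[OF b(1) b3(3) b(1) b3(2) bmor_id' Ph_bmor[OF b(2-4)]] pr_in b b2 bim_hmod h)
 qed
 have c: "asc (V**W) X Y (V**W**X**Y) (%t x. Ph V W X (pr (V**W) X t x)) ?p123_4 (pr X Y) ?p12_34"
  by (rule asc_pent_123_4[OF h b2(1)[THEN bim_hmod] b2(2)[THEN bim_hmod] b2(3)[THEN bim_hmod] b3(1)[THEN bim_hmod] b3(2)[THEN bim_hmod] R[THEN bim_hmod]
     p[OF b(1,2)] p[OF b(2,3)] p[OF b(3,4)] e1 p[OF b(1) b2(2)] e2 p[OF b(2) b2(3)] e3 p[OF b(1) b3(2)] e4
     asc_Ph[OF b(1-3)] a asc_Ph[OF b(2-4)] asc_Ph[OF b(1,2) b2(3)] ten_spans[OF b(1,2)]])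
 show ?thesis
 proof (rule ten3_ext[OF b2(1) b(3,4) bmor_comp[OF r u] bmor_comp[OF Ph_bmor[OF b2(1) b(3,4)] Ph_bmor[OF b(1,2) b2(3)]] _ t])
  fix s x y assume el: "s : V**W" "x : X" "y : Y"
  have 1: "rPh Y V W X (pr ((V**W)**X) Y (pr (V**W) X s x) y)
    = pr (V**W**X) Y (Ph V W X (pr (V**W) X s x)) y"
   using tm_pr(1)[OF b3(4) b(4) b3(1) b(4) Ph_bmor[OF b(1-3)] bmor_id' pr_in[OF b2(1) b(3) el(1,2)] el(3)] by simp
  show "lPh V W X Y (Ph V (W**X) Y (rPh Y V W X
    (pr ((V**W)**X) Y (pr (V**W) X s x) y)))
   = Ph V W (X**Y) (Ph (V**W) X Y (pr ((V**W)**X) Y (pr (V**W) X s x) y))"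
   unfolding 1 push_Ph[OF b2(1) b(3,4) R Ph_bmor[OF b(1,2) b2(3)] el]
   by (rule asc_apply[OF c el])
 qed
qed

lemma tau_nat:
 assumes s: "sym V" "sym W" "sym V'" "sym W'" and m: "bmor V V' f" "bmor W W' g" and t: "t : V**W"
 shows "tauA k H A V' W' (tm V W V' W' f g t) = tm W V W' V' g f (tauA k H A V W t)"
proof -
 note b = s[THEN symD(1)]
 note F = tm_pr[OF b m] and G = tm_pr[OF b(2,1,4,3) m(2,1)]
 show ?thesis
 proof (rule ten_ext[OF b(1,2) bmor_comp[OF F(2) tau_bmor[OF s(3,4)]] bmor_comp[OF tau_bmor[OF s(1,2)] G(2)] t])
  fix v w assume el: "v : V" "w : W"
  note h = b(1,2)[THEN bim_hmod] and c = bmor_closed[OF m(1)] bmor_closed[OF m(2)]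
  show "tauA k H A V' W' (tm V W V' W' f g (pr V W v w)) = tm W V W' V' g f (tauA k H A V W (pr V W v w))"
   unfolding F(1)[OF el] tau_pr[OF s(3,4) c(1)[OF el(1)] c(2)[OF el(2)]] tau_pr[OF s(1,2) el] tp_def[OF s(1,2)] tp_def[OF s(3,4)]
    sw2_push[OF bim_module[OF ten_bim[OF b(2,1)]] bim_module[OF ten_bim[OF b(4,3)]] bil_act[OF h bil_flip[OF eqb_bil[OF pr_eqb[OF b(2,1)]]] el]
     bmor_lin[OF G(2)] R_closed]
   by (rule sw2_cong) (simp add: G(1) act_closed h el bmor_act[OF m(1)] bmor_act[OF m(2)])
 qed
qed

end

context algebra_setting
begin


lemma rel2_push:
 assumes "rel2 V W R F G t" "hmod V" "hmod W" "kmod R" "kmod R'" "bil k V W R G" "t : HH" "klin R R' u"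
 shows "rel2 V W R' (%v w. u (F v w)) (%v w. u (G v w)) t"
 using assms(1) unfolding rel2_def by (simp add: sw2_push[OF assms(4,5) bil_act[OF assms(2,3,6)] assms(8,7)])

text \<open>The braiding of the first two of three factors bracketed to the right, the building block of all exchanges.\<close>

definition ss where
 "ss N V X t = Ph V N X (rtau' X N V (Pi N V X t))"

abbreviation lss where "lss P V W X \<equiv> lw P (V**W**X) (W**V**X) (ss V W X)"
abbreviation rss where "rss P V W X \<equiv> rw (V**W**X) (W**V**X) P (ss V W X)"
abbreviation llss where "llss P Q V W X \<equiv> lw P (Q**V**W**X) (Q**W**V**X) (lss Q V W X)"

context
 fixes V W X
 assumes s: "sym V" "sym W" "sym X"
begin

private lemmas b = s[THEN symD(1)]
private lemmas h = b[THEN bim_hmod]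

lemma ss_bmor: "bmor (V**W**X) (W**V**X) (ss V W X)"
 unfolding ss_def[abs_def]
 by (rule bmor_comp[OF bmor_comp[OF Pi_bmor[OF b] rw_bmor[OF b(3) ten_bim[OF b(1,2)] ten_bim[OF b(2,1)] tau_bmor[OF s(1,2)]]] Ph_bmor[OF b(2,1,3)]])

lemma ss_Ph: "t : (V**W)**X ==> ss V W X (Ph V W X t) = Ph W V X (rtau' X V W t)"
 by (simp add: ss_def Pi_inverse(3)[OF b])

text \<open>On generators, the image of \<open>(v w) x\<close> under either side is one of the functions in a hexagon for \<open>v\<close> past \<open>w x\<close>,
whose other sides are braidings of two factors and associators.\<close>

lemma hexagon_right:
 assumes t: "t : (V**W)**X"
 shows "Ph W X V (tau' V (W**X) (Ph V W X t))
  = ltau' W V X (Ph W V X (rtau' X V W t))"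
proof -
 note VW = ten_bim[OF b(1,2)] and WV = ten_bim[OF b(2,1)] and WX = ten_bim[OF b(2,3)] and VX = ten_bim[OF b(1,3)] and XV = ten_bim[OF b(3,1)]
 note sWX = sym_ten[OF s(2,3)]
 let ?R = "W**X**V"
 note R = ten_bim[OF b(2) XV] and mR = bim_module[OF ten_bim[OF b(2) XV]]
 let ?c = "%t. ltau' W V X (Ph W V X t)"
 note l = lw_bmor[OF b(2) VX XV tau_bmor[OF s(1,3)]]
 note c = bmor_comp[OF Ph_bmor[OF b(2,1,3)] l]
 note r = rw_bmor[OF b(3) VW WV tau_bmor[OF s(1,2)]]
 note Q = bmor_comp[OF tau_bmor[OF s(1) sWX] Ph_bmor[OF b(2,3,1)]]
 note p = pr_eqb[THEN eqb_bil]
 note cb = bimap_bil[OF bimap_post[OF WV b(3) ten_bim[OF WV b(3)] R pr_bimap[OF WV b(3)] c]]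
 note Pb = bimap_bil[OF bimap_post[OF WX b(1) ten_bim[OF WX b(1)] R pr_bimap[OF WX b(1)] Ph_bmor[OF b(2,3,1)]]]
 have lp: "ltau' W V X (pr W (V**X) w u) = pr W (X**V) w (tau' V X u)" if "w : W" "u : V**X" for w u
  using tm_pr(1)[OF b(2) VX b(2) XV bmor_id' tau_bmor[OF s(1,3)] that] by simp
 have rp: "rtau' X V W (pr (V**W) X u x) = pr (W**V) X (tau' V W u) x" if "u : V**W" "x : X" for u x
  using tm_pr(1)[OF VW b(3) WV b(3) tau_bmor[OF s(1,2)] bmor_id' that] by simp
 have r23: "rel3 W V X ?R (%w v x. ?c (pr (W**V) X (pr W V w v) x)) (%w v x. pr W (X**V) w (tp V X v x)) ph"
  unfolding rel3_def
  by (auto simp: push_Ph[OF b(2,1,3) R l] lp act_closed h pr_in b tau_pr[OF s(1,3)] cong: sw3_cong)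
 note tpb = bimap_bil[OF tp_bimap[OF s(1,3)]] and tpb2 = bimap_bil[OF tp_bimap[OF s(1) sWX]]
 have main: "rel3 V W X ?R (%v w x. ?c (pr (W**V) X (tp V W v w) x)) (%v w x. Ph W X V (tp V (W**X) v (pr W X w x))) ph"
 by (rule hexA_phi[OF h mR
    tri_perm213[OF tri_left[OF p[OF b(2,1)] cb]]
    tri_perm213[OF tri_right[OF tpb p[OF b(2) XV]]]
    tri_perm312[OF tri_right[OF p[OF b(3,1)] p[OF b(2) XV]]]
    tri_perm312[OF tri_left[OF p[OF b(2,3)] Pb]]
    tri_right[OF p[OF b(2,3)] bil_lin[OF bmor_lin[OF Ph_bmor[OF b(2,3,1)]] tpb2]]
    rel3_leg12[OF tp_rel[OF s(1,2)] cb bil_flip[OF p[OF b(2,1)]] R_closed h bim_module[OF WV] mR]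
    rel3_perm213[OF r23 tri_right[OF tpb p[OF b(2) XV]] phi_closed mR h]
    rel3_leg13_r[OF tp_rel[OF s(1,3)] p[OF b(2) XV] bil_flip[OF p[OF b(3,1)]] R_closed h bim_module[OF XV] mR]
    rel3_perm231[OF Ph_rel[OF b(2,3,1)] tri_right[OF p[OF b(3,1)] p[OF b(2) XV]] phi_closed mR h]
    rel3_copr[OF rel2_push[OF tp_rel[OF s(1) sWX] h(1) bim_hmod[OF WX] bim_module[OF ten_bim[OF WX b(1)]] mR bil_flip[OF p[OF WX b(1)]] R_closed bmor_lin[OF Ph_bmor[OF b(2,3,1)]]] pr_eqb[OF b(2,3)] bil_flip[OF Pb] R_closed h bim_hmod[OF WX] mR]])
 show ?thesis
 proof (rule ten3_ext[OF b bmor_comp[OF Ph_bmor[OF b] Q] bmor_comp[OF r c] _ t])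
  fix v w x assume el: "v : V" "w : W" "x : X"
  show "Ph W X V (tau' V (W**X) (Ph V W X (pr (V**W) X (pr V W v w) x)))
   = ltau' W V X (Ph W V X (rtau' X V W (pr (V**W) X (pr V W v w) x)))"
   unfolding push_Ph[OF b R Q el] rp[OF pr_in[OF b(1,2) el(1,2)] el(3)] tau_pr[OF s(1,2) el(1,2)] rel3D[OF main el]
   by (rule sw3_cong) (simp add: tau_pr[OF s(1) sWX] act_closed h el pr_in b)
 qed
qed

text \<open>The morphism \<open>c\<close> is \<open>ss V X W\<close>, known here only through its composite with the associator: that is the side of
the hexagon in which \<open>v\<close> and \<open>x\<close> are braided.\<close>

lemma hexagon_left_aux:
 assumes sWXV: "bmor (V**X**W) (X**V**W) c"
  and cP: "!!t. t : (V**X)**W ==> c (Ph V X W t) = Ph X V W (rtau' W V X t)"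
  and t: "t : (V**W)**X"
 shows "tau' (V**W) X t = c (ltau' V W X (Ph V W X t))"
proof -
 note c = sWXV
 note VW = ten_bim[OF b(1,2)] and XW = ten_bim[OF b(3,2)] and WX = ten_bim[OF b(2,3)] and VX = ten_bim[OF b(1,3)] and XV = ten_bim[OF b(3,1)]
 note sVW = sym_ten[OF s(1,2)]
 let ?R = "X**V**W"
 note R = ten_bim[OF b(3) VW] and mR = bim_module[OF ten_bim[OF b(3) VW]]
 note l = lw_bmor[OF b(1) WX XW tau_bmor[OF s(2,3)]]
 note Q = bmor_comp[OF l c]
 note p = pr_eqb[THEN eqb_bil]
 note cb = bimap_bil[OF bimap_post[OF b(1) XW ten_bim[OF b(1) XW] R pr_bimap[OF b(1) XW] c]]
 note Pb = bimap_bil[OF bimap_post[OF XV b(2) ten_bim[OF XV b(2)] R pr_bimap[OF XV b(2)] Ph_bmor[OF b(3,1,2)]]]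
 have lp: "ltau' V W X (pr V (W**X) v u) = pr V (X**W) v (tau' W X u)" if "v : V" "u : W**X" for v u
  using tm_pr(1)[OF b(1) WX b(1) XW bmor_id' tau_bmor[OF s(2,3)] that] by simp
 have rp: "rtau' W V X (pr (V**X) W u w) = pr (X**V) W (tau' V X u) w" if "u : V**X" "w : W" for u w
  using tm_pr(1)[OF VX b(2) XV b(2) tau_bmor[OF s(1,3)] bmor_id' that] by simp
 have r43: "rel3 V X W ?R (%v x w. Ph X V W (pr (X**V) W (tp V X v x) w)) (%v x w. c (pr V (X**W) v (pr X W x w))) ph"
  unfolding rel3_def
 proof (intro ballI)
  fix v x w assume el: "v : V" "x : X" "w : W"
  have "Ph X V W (pr (X**V) W (tp V X v x) w) = c (Ph V X W (pr (V**X) W (pr V X v x) w))"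
   by (simp add: cP pr_in b VX el rp tau_pr[OF s(1,3)])
  thus "Ph X V W (pr (X**V) W (tp V X v x) w) = sm3 ?R ph (%p q r. c (pr V (X**W) (act V p v) (pr X W (act X q x) (act W r w))))"
   using push_Ph[OF b(1,3,2) R c el] by simp
 qed
 note tpb = bimap_bil[OF tp_bimap[OF s(1,3)]] and tpb2 = bimap_bil[OF tp_bimap[OF s(2,3)]]
 have main: "rel3 V W X ?R (%v w x. tp (V**W) X (pr V W v w) x) (%v w x. c (pr V (X**W) v (tp W X w x))) ph"
 by (rule hexB_phi[OF h mR
    tri_right[OF tpb2 cb]
    tri_right[OF bil_flip[OF p[OF b(3,2)]] cb]
    tri_perm132[OF tri_left[OF tpb Pb]]
    tri_perm231[OF tri_left[OF p[OF b(3,1)] Pb]]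
    tri_perm231[OF tri_right[OF p[OF b(1,2)] p[OF b(3) VW]]]
    rel3_copl[OF tp_rel[OF sVW s(3)] pr_eqb[OF b(1,2)] bil_flip[OF p[OF b(3) VW]] R_closed h bim_hmod[OF VW] mR]
    rel3_leg23[OF tp_rel[OF s(2,3)] cb bil_flip[OF p[OF b(3,2)]] R_closed h bim_module[OF XW] mR]
    rel3_perm132[OF r43 tri_right[OF p[OF b(3,2)] cb] phi_closed mR h]
    rel3_leg13_l[OF tp_rel[OF s(1,3)] Pb bil_flip[OF p[OF b(3,1)]] R_closed h bim_module[OF XV] mR]
    rel3_perm312[OF Ph_rel[OF b(3,1,2)] tri_right[OF p[OF b(1,2)] p[OF b(3) VW]] phi_closed mR h]])
 show ?thesis
 proof (rule ten3_ext[OF b tau_bmor[OF sVW s(3)] bmor_comp[OF Ph_bmor[OF b] Q] _ t])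
  fix v w x assume el: "v : V" "w : W" "x : X"
  show "tau' (V**W) X (pr (V**W) X (pr V W v w) x) = c (ltau' V W X (Ph V W X (pr (V**W) X (pr V W v w) x)))"
   unfolding push_Ph[OF b R Q el] tau_pr[OF sVW s(3) pr_in[OF b(1,2) el(1,2)] el(3)] rel3D[OF main el]
   by (rule sw3_cong) (simp add: lp tau_pr[OF s(2,3)] act_closed h el pr_in b)
 qed
qed

end

lemma hexagon_left:
 assumes "sym V" "sym W" "sym X" "t : (V**W)**X"
 shows "tau' (V**W) X t = ss V X W (ltau' V W X (Ph V W X t))"
 by (rule hexagon_left_aux[OF assms(1-3) ss_bmor[OF assms(1,3,2)] ss_Ph[OF assms(1,3,2)] assms(4)])

end

context algebra_setting
begin


lemma lw_cl: "bim P ==> bim X ==> bim Y ==> bmor X Y f ==> t : P**X ==> lw P X Y f t : P**Y"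
 by (rule bmor_closed[OF lw_bmor])

lemma rw_cl: "bim P ==> bim X ==> bim Y ==> bmor X Y f ==> t : X**P ==> rw X Y P f t : Y**P"
 by (rule bmor_closed[OF rw_bmor])

lemma Ph_cl: "bim P ==> bim X ==> bim Y ==> t : (P**X)**Y ==> Ph P X Y t : P**X**Y"
 by (rule bmor_closed[OF Ph_bmor])

lemma tau_cl: "sym X ==> sym Y ==> t : X**Y ==> tau' X Y t : Y**X"
 by (rule bmor_closed[OF tau_bmor])

lemma ss_cl: "sym X ==> sym Y ==> sym P ==> t : X**Y**P ==> ss X Y P t : Y**X**P"
 by (rule bmor_closed[OF ss_bmor])

lemmas cat = ten_bim lw_bmor rw_bmor Ph_bmor Pi_bmor tau_bmor ss_bmor bmor_id' sym_ten lw_cl rw_cl Ph_cl Pi_inverse(1) tau_cl ss_cl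

lemma lw_tri:
 assumes "bim P" "bim X" "bim Y" "bim Z" "bmor X Y f" "bmor Y Z g" "!!x. x : X ==> g (f x) = h x" "t : P**X"
 shows "lw P Y Z g (lw P X Y f t) = lw P X Z h t"
proof -
 have "lw P X Z (%x. g (f x)) = lw P X Z h" by (rule tm_cong) (simp_all add: assms(7))
 thus ?thesis by (simp add: lw_comp[OF assms(1-6,8)])
qed

lemma rw_tri:
 assumes "bim P" "bim X" "bim Y" "bim Z" "bmor X Y f" "bmor Y Z g" "!!x. x : X ==> g (f x) = h x" "t : X**P"
 shows "rw Y Z P g (rw X Y P f t) = rw X Z P h t"
proof -
 have "rw X Z P (%x. g (f x)) = rw X Z P h" by (rule tm_cong) (simp_all add: assms(7))
 thus ?thesis by (simp add: rw_comp[OF assms(1-6,8)])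
qed

lemma lw_sq:
 assumes "bim P" "bim X" "bim Y" "bim Y'" "bim Z" "bmor X Y f" "bmor Y Z g" "bmor X Y' f'" "bmor Y' Z g'"
  and "!!x. x : X ==> g (f x) = g' (f' x)" "t : P**X"
 shows "lw P Y Z g (lw P X Y f t) = lw P Y' Z g' (lw P X Y' f' t)"
 using lw_tri[OF assms(1-3,5-7,10,11)] lw_comp[OF assms(1,2,4,5,8,9,11)] by simp

lemma rw_sq:
 assumes "bim P" "bim X" "bim Y" "bim Y'" "bim Z" "bmor X Y f" "bmor Y Z g" "bmor X Y' f'" "bmor Y' Z g'"
  and "!!x. x : X ==> g (f x) = g' (f' x)" "t : X**P"
 shows "rw Y Z P g (rw X Y P f t) = rw Y' Z P g' (rw X Y' P f' t)"
 using rw_tri[OF assms(1-3,5-7,10,11)] rw_comp[OF assms(1,2,4,5,8,9,11)] by simp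

text \<open>For the image of an element of \<open>((Q \<otimes> K) \<otimes> T) \<otimes> Z\<close>, the pentagon turns both sides into associators after the
braiding of \<open>Q\<close> and \<open>K\<close>, with which they commute by naturality.\<close>

lemma ss_past_product:
 assumes s: "sym Q" "sym K" "sym T" "sym Z" and t: "t : (Q**K**T)**Z"
 shows "lPh K Q T Z (Ph K (Q**T) Z (rss Z Q K T t))
  = ss Q K (T**Z) (lPh Q K T Z (Ph Q (K**T) Z t))"
proof -
 note b = s[THEN symD(1)]
 define u where "u = rw (Q**K**T) ((Q**K)**T) Z (Pi Q K T) t"
 have u: "u : ((Q**K)**T)**Z" using t by (simp add: u_def cat b)
 have tu: "t = rPh Z Q K T u"
  unfolding u_def by (rule rw_iso[symmetric]) (simp_all add: cat b t Pi_inverse(2))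
 have 1: "rss Z Q K T t
   = rPh Z K Q T (rw ((Q**K)**T) ((K**Q)**T) Z (rtau' T Q K) u)"
  unfolding tu by (rule rw_sq[OF _ _ _ _ _ _ _ _ _ _ u]) (simp_all add: cat b s ss_Ph)
 have "lPh K Q T Z (Ph K (Q**T) Z (rss Z Q K T t))
  = Ph K Q (T**Z) (rtau' (T**Z) Q K (Ph (Q**K) T Z u))"
  unfolding 1 using u by (simp add: pentagonA Ph_nat_l cat b s)
 moreover have "lPh Q K T Z (Ph Q (K**T) Z t) = Ph Q K (T**Z) (Ph (Q**K) T Z u)"
  unfolding tu using u by (simp add: pentagonA b)
 ultimately show ?thesis using u by (simp add: ss_Ph cat b s)
qed

text \<open>The hexagon identities for \<open>ss\<close>: braiding past a product is braiding past its factors, in the presence of a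
further factor to the right.\<close>

lemma ss_hexagon_right:
 assumes s: "sym Q" "sym K" "sym U" "sym T" and t: "t : Q**(K**U)**T"
 shows "Ph K U (Q**T) (ss Q (K**U) T t)
  = lss K Q U T (ss Q K (U**T) (lPh Q K U T t))"
proof -
 note b = s[THEN symD(1)]
 define u where "u = Pi Q (K**U) T t"
 have u: "u : (Q**K**U)**T" using t by (simp add: u_def cat b)
 have tu: "t = Ph Q (K**U) T u" unfolding u_def using t by (simp add: Pi_inverse(2) cat b)
 let ?x = "rss T Q K U u"
 have 1: "rPh T K U Q (rtau' T Q (K**U) u)
   = rw (K**Q**U) (K**U**Q) T (ltau' K Q U) ?x"
 proof -
  have "Ph K U Q (tau' Q (K**U) x) = ltau' K Q U (ss Q K U x)" if "x : Q**K**U" for x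
   using hexagon_right[OF s(1-3), of "Pi Q K U x"] that by (simp add: Pi_inverse(1,2) b ss_def)
  thus ?thesis by (intro rw_sq[OF _ _ _ _ _ _ _ _ _ _ u]) (simp_all add: cat b s)
 qed
 have "Ph K U (Q**T) (ss Q (K**U) T t) = Ph K U (Q**T) (Ph (K**U) Q T (rtau' T Q (K**U) u))"
  unfolding tu using u by (simp add: ss_Ph cat b s)
 also have "... = lPh K U Q T (Ph K (U**Q) T
   (rPh T K U Q (rtau' T Q (K**U) u)))"
  by (rule pentagonA[symmetric]) (simp_all add: cat b s u)
 also have "... = lPh K U Q T (lw K ((Q**U)**T) ((U**Q)**T) (rtau' T Q U) (Ph K (Q**U) T ?x))"
  unfolding 1 using u by (simp add: Ph_nat_m cat b s)
 also have "... = lss K Q U T (lPh K Q U T (Ph K (Q**U) T ?x))"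
  by (rule lw_sq) (simp_all add: cat b s u ss_Ph)
 also have "... = lss K Q U T (ss Q K (U**T) (lPh Q K U T t))"
  unfolding tu using u by (simp add: ss_past_product[OF s])
 finally show ?thesis .
qed

lemma ss_hexagon_left:
 assumes s: "sym Q" "sym T" "sym U" "sym W" and t: "t : (Q**T)**U**W"
 shows "lPh U Q T W (ss (Q**T) U W t)
  = ss Q U (T**W) (lss Q T U W (Ph Q T (U**W) t))"
proof -
 note b = s[THEN symD(1)]
 define u where "u = Pi (Q**T) U W t"
 have u: "u : ((Q**T)**U)**W" using t by (simp add: u_def cat b)
 have tu: "t = Ph (Q**T) U W u" unfolding u_def using t by (simp add: Pi_inverse(2) cat b)
 let ?x = "rPh W Q T U u"
 let ?y = "rw (Q**T**U) (Q**U**T) W (ltau' Q T U) ?x"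
 have x: "?x : (Q**T**U)**W" using u by (simp add: cat b s)
 have 1: "rtau' W (Q**T) U u = rss W Q U T ?y"
 proof -
  note m = bmor_comp[OF Ph_bmor[OF b(1-3)] lw_bmor[OF b(1) ten_bim[OF b(2,3)] ten_bim[OF b(3,2)] tau_bmor[OF s(2,3)]]]
  have 1: "?y = rw ((Q**T)**U) (Q**U**T) W (%x. ltau' Q T U (Ph Q T U x)) u"
   by (rule rw_comp) (simp_all add: cat b s u)
  show ?thesis unfolding 1
   by (rule rw_tri[OF _ _ _ _ m, symmetric]) (simp_all add: cat b s u hexagon_left)
 qed
 have "lPh U Q T W (ss (Q**T) U W t)
  = lPh U Q T W (Ph U (Q**T) W (rss W Q U T ?y))"
  unfolding tu using u by (simp add: ss_Ph cat b s 1)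
 also have "... = ss Q U (T**W) (lPh Q U T W (Ph Q (U**T) W ?y))"
  by (rule ss_past_product[OF s(1,3,2,4)]) (simp add: cat b s x)
 also have "lPh Q U T W (Ph Q (U**T) W ?y)
   = lss Q T U W (lPh Q T U W (Ph Q (T**U) W ?x))"
 proof -
  have 2: "Ph Q (U**T) W ?y = lw Q ((T**U)**W) ((U**T)**W) (rtau' W T U) (Ph Q (T**U) W ?x)"
   by (rule Ph_nat_m) (simp_all add: cat b s x)
  show ?thesis unfolding 2 by (rule lw_sq) (simp_all add: cat b s x ss_Ph)
 qed
 also have "lPh Q T U W (Ph Q (T**U) W ?x) = Ph Q T (U**W) t"
  unfolding tu by (rule pentagonA[OF b u])
 finally show ?thesis .
qed

subsection \<open>The exchange of the middle factors\<close>

lemma Pi_nat: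
 assumes b: "bim V" "bim W" "bim X" "bim V'" "bim W'" "bim X'" and m: "bmor V V' f" "bmor W W' g" "bmor X X' h"
  and t: "t : V**W**X"
 shows "Pi V' W' X' (tm V (W**X) V' (W'**X') f (tm W X W' X' g h) t)
  = tm (V**W) X (V'**W') X' (tm V W V' W' f g) h (Pi V W X t)"
proof -
 note P = Pi_inverse[OF b(1-3)] and P' = Pi_inverse[OF b(4-6)]
 note T = tm_pr(2)[OF ten_bim[OF b(1,2)] b(3) ten_bim[OF b(4,5)] b(6) tm_pr(2)[OF b(1,2,4,5) m(1,2)] m(3)]
 show ?thesis using Ph_nat[OF b m P(1)[OF t]] P(2)[OF t] P'(3)[OF bmor_closed[OF T P(1)[OF t]]] by simp
qed

lemma ss_nat:
 assumes s: "sym N" "sym V" "sym X" "sym N'" "sym V'" "sym X'" and m: "bmor N N' g" "bmor V V' h" "bmor X X' l"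
  and t: "t : N**V**X"
 shows "ss N' V' X' (tm N (V**X) N' (V'**X') g (tm V X V' X' h l) t)
  = tm V (N**X) V' (N'**X') h (tm N X N' X' g l) (ss N V X t)"
proof -
 note b = s[THEN symD(1)]
 note NV = tm_pr(2)[OF b(1,2,4,5) m(1,2)] and VN = tm_pr(2)[OF b(2,1,5,4) m(2,1)]
 define u where "u = Pi N V X t"
 have u: "u : (N**V)**X" using t by (simp add: u_def cat b)
 have "rtau' X' N' V' (tm (N**V) X (N'**V') X' (tm N V N' V' g h) l u)
   = tm (N**V) X (V'**N') X' (%x. tau' N' V' (tm N V N' V' g h x)) l u"
  using tm_comp[OF _ b(3) _ b(6) _ b(6) NV m(3) tau_bmor[OF s(4,5)] bmor_id' u] by (simp add: cat b)
 also have "... = tm (N**V) X (V'**N') X' (%x. tm V N V' N' h g (tau' N V x)) l u"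
  by (rule arg_cong[where f="%f. f u"], rule tm_cong) (simp_all add: tau_nat[OF s(1,2,4,5) m(1,2)])
 also have "... = tm (V**N) X (V'**N') X' (tm V N V' N' h g) l (rtau' X N V u)"
  using tm_comp[OF _ b(3) _ b(3) _ b(6) tau_bmor[OF s(1,2)] bmor_id' VN m(3) u] by (simp add: cat b)
 finally show ?thesis
  unfolding ss_def Pi_nat[OF b m t]
  using Ph_nat[OF b(2,1,3,5,4,6) m(2,1,3), of "rtau' X N V u"] u by (simp add: u_def cat b s)
qed

lemma ss_nat_r:
 assumes s: "sym N" "sym V" "sym X" "sym X'" and m: "bmor X X' l" and t: "t : N**V**X"
 shows "ss N V X' (lw N (V**X) (V**X') (lw V X X' l) t) = lw V (N**X) (N**X') (lw N X X' l) (ss N V X t)"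
 by (rule ss_nat[OF s(1-3,1,2,4) bmor_id' bmor_id' m t])

abbreviation ex where "ex M N V X \<equiv> exchA k H A M N V X"
abbreviation lex where "lex P M N V X \<equiv> lw P ((M**N)**V**X) ((M**V)**N**X) (ex M N V X)"
abbreviation rex where "rex P M N V X \<equiv> rw ((M**N)**V**X) ((M**V)**N**X) P (ex M N V X)"

context
 fixes M N V X
 assumes s: "sym M" "sym N" "sym V" "sym X"
begin

private lemmas bs = s[THEN symD(1)]

text \<open>The exchange is \<open>ss\<close> on the last three factors, between two associators.\<close>

lemma ex_Pi:
 assumes t: "t : (M**N)**V**X"
 shows "ex M N V X t = Pi M V (N**X) (lss M N V X (Ph M N (V**X) t))"
proof -
 let ?u = "Ph M N (V**X) t"
 have u: "?u : M**N**V**X" using t by (simp add: cat bs)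
 have m: "bmor (N**V**X) ((V**N)**X) (%x. rtau' X N V (Pi N V X x))"
  by (rule bmor_comp[OF Pi_bmor rw_bmor]) (simp_all add: cat bs s)
 have "lw M ((N**V)**X) ((V**N)**X) (rtau' X N V) (lw M (N**V**X) ((N**V)**X) (Pi N V X) ?u)
   = lw M (N**V**X) ((V**N)**X) (%x. rtau' X N V (Pi N V X x)) ?u"
  by (rule lw_comp) (simp_all add: cat bs s u)
 moreover have "lPh M V N X (lw M (N**V**X) ((V**N)**X) (%x. rtau' X N V (Pi N V X x)) ?u)
   = lss M N V X ?u"
  unfolding ss_def[abs_def] by (rule lw_comp[OF _ _ _ _ m]) (simp_all add: cat bs u)
 ultimately show ?thesis by (simp add: exchA_def)
qed

lemma ex_bmor: "bmor ((M**N)**V**X) ((M**V)**N**X) (ex M N V X)"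
 by (rule bmor_cong[OF _ bmor_comp[OF bmor_comp[OF Ph_bmor lw_bmor[OF _ _ _ ss_bmor]] Pi_bmor] ex_Pi]) (simp_all add: cat bs s)

lemma ex_Ph:
 assumes t: "t : (M**N)**V**X"
 shows "Ph M V (N**X) (ex M N V X t) = lss M N V X (Ph M N (V**X) t)"
 using t by (simp add: ex_Pi Pi_inverse(2) cat bs s)

lemma ex_cl: "t : (M**N)**V**X ==> ex M N V X t : (M**V)**N**X"
 by (rule bmor_closed[OF ex_bmor])

end

lemma ex_nat:
 assumes s: "sym M" "sym N" "sym V" "sym X" "sym M'" "sym N'" "sym V'" "sym X'"
  and m: "bmor M M' f" "bmor N N' g" "bmor V V' h" "bmor X X' l" and t: "t : (M**N)**V**X"
 shows "ex M' N' V' X' (tm (M**N) (V**X) (M'**N') (V'**X') (tm M N M' N' f g) (tm V X V' X' h l) t)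
  = tm (M**V) (N**X) (M'**V') (N'**X') (tm M V M' V' f h) (tm N X N' X' g l) (ex M N V X t)"
proof -
 note b = s[THEN symD(1)]
 note MN = tm_pr(2)[OF b(1,2,5,6) m(1,2)] and VX = tm_pr(2)[OF b(3,4,7,8) m(3,4)] and MV = tm_pr(2)[OF b(1,3,5,7) m(1,3)]
  and NX = tm_pr(2)[OF b(2,4,6,8) m(2,4)]
 note bs = cat b s
 note NVX = tm_pr(2)[OF b(2) ten_bim[OF b(3,4)] b(6) ten_bim[OF b(7,8)] m(2) VX]
  and VNX = tm_pr(2)[OF b(3) ten_bim[OF b(2,4)] b(7) ten_bim[OF b(6,8)] m(3) NX]
 note T = tm_pr(2)[OF ten_bim[OF b(1,2)] ten_bim[OF b(3,4)] ten_bim[OF b(5,6)] ten_bim[OF b(7,8)] MN VX]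
  and T' = tm_pr(2)[OF ten_bim[OF b(1,3)] ten_bim[OF b(2,4)] ten_bim[OF b(5,7)] ten_bim[OF b(6,8)] MV NX]
 let ?u = "Ph M N (V**X) t"
 have u: "?u : M**N**V**X" using t by (simp add: bs)
 have "lss M' N' V' X' (tm M (N**V**X) M' (N'**V'**X') f (tm N (V**X) N' (V'**X') g (tm V X V' X' h l)) ?u)
   = tm M (N**V**X) M' (V'**N'**X') f (%x. ss N' V' X' (tm N (V**X) N' (V'**X') g (tm V X V' X' h l) x)) ?u"
  using tm_comp[OF b(1) _ b(5) _ b(5) _ m(1) NVX bmor_id' ss_bmor[OF s(6-8)] u] by (simp add: bs)
 also have "... = tm M (N**V**X) M' (V'**N'**X') f (%x. tm V (N**X) V' (N'**X') h (tm N X N' X' g l) (ss N V X x)) ?u"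
  by (rule arg_cong[where f="%f. f _"], rule tm_cong) (simp_all add: ss_nat[OF s(2-4,6-8) m(2-4)])
 also have "... = tm M (V**N**X) M' (V'**N'**X') f (tm V (N**X) V' (N'**X') h (tm N X N' X' g l)) (lss M N V X ?u)"
  using tm_comp[OF b(1) _ b(1) _ b(5) _ bmor_id' ss_bmor[OF s(2-4)] m(1) VNX u] by (simp add: bs)
 finally have "Ph M' V' (N'**X') (ex M' N' V' X' (tm (M**N) (V**X) (M'**N') (V'**X') (tm M N M' N' f g) (tm V X V' X' h l) t))
  = Ph M' V' (N'**X') (tm (M**V) (N**X) (M'**V') (N'**X') (tm M V M' V' f h) (tm N X N' X' g l) (ex M N V X t))"
  using ex_Ph[OF s(5-8) bmor_closed[OF T t]] Ph_nat[OF b(1,2) ten_bim[OF b(3,4)] b(5,6) ten_bim[OF b(7,8)] m(1,2) VX t]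
   Ph_nat[OF b(1,3) ten_bim[OF b(2,4)] b(5,7) ten_bim[OF b(6,8)] m(1,3) NX ex_cl[OF s(1-4) t]] ex_Ph[OF s(1-4) t] by simp
 thus ?thesis
  by (rule Ph_inj[OF b(5,7) ten_bim[OF b(6,8)] ex_cl[OF s(5-8) bmor_closed[OF T t]] bmor_closed[OF T' ex_cl[OF s(1-4) t]]])
qed

lemma lw_cancel:
 assumes "bim P" "bim X" "bim Y" "bmor X Y f" "bmor Y X g" "!!x. x : X ==> g (f x) = x" "t : P**X"
 shows "lw P Y X g (lw P X Y f t) = t"
 using lw_tri[where h=id, OF assms(1-3,2,4,5) _ assms(7)] tm_id[OF assms(1,2,7)] assms(6) by simp

lemma lw_Ph_inj:
 assumes b: "bim P" "bim K" "bim U" "bim X" and el: "s : P**(K**U)**X" "t : P**(K**U)**X"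
  and eq: "lPh P K U X s = lPh P K U X t"
 shows "s = t"
 using lw_cancel[OF b(1) ten_bim[OF ten_bim[OF b(2,3)] b(4)] ten_bim[OF b(2) ten_bim[OF b(3,4)]] Ph_bmor[OF b(2-4)] Pi_bmor[OF b(2-4)] Pi_inverse(3)[OF b(2-4)]]
  el eq by metis

text \<open>Both sides are compared after rebracketing everything to the right, where each exchange becomes a composite of
morphisms \<open>ss\<close>. The left side moves \<open>Q\<close> past \<open>K\<close> and then \<open>Q T\<close> past \<open>U\<close>, the right side moves \<open>T\<close> past \<open>U\<close> and
then \<open>Q\<close> past \<open>K U\<close>. The two hexagons for \<open>ss\<close> split these moves into braidings of single factors, among which
those of \<open>Q\<close>, \<open>K\<close> and of \<open>T\<close>, \<open>U\<close> commute by naturality.\<close>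

lemma ex_comp:
 assumes s: "sym P" "sym Q" "sym K" "sym T" "sym U" "sym W" and t: "x : ((P**Q)**K**T)**U**W"
 shows "tm ((P**K)**U) ((Q**T)**W) (P**K**U) (Q**T**W) (Ph P K U) (Ph Q T W)
    (ex (P**K) (Q**T) U W (rex (U**W) P Q K T x))
  = ex P Q (K**U) (T**W) (lex (P**Q) K T U W (Ph (P**Q) (K**T) (U**W) x))"
  (is "?L = ?R")
proof -
 note b = s[THEN symD(1)]
 note bs = cat b s ex_bmor ex_cl tm_pr(2)
 let ?Z = "U**W" and ?X = "Q**T**W"
 (* The argument bracketed to the right, and the two parts into which both sides factor:
    first Q past K, then T and Q past U. *)
 define y where "y = Ph P Q ((K**T)**?Z) (Ph (P**Q) (K**T) ?Z x)"
 define h where "h = (%v. ss Q U (T**W) (lss Q T U W v))"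
 define n where "n = (%v. ss Q K (T**?Z) (lPh Q K T ?Z v))"
 have hm: "bmor (Q**T**?Z) (U**?X) h" unfolding h_def by (rule bmor_comp[OF lw_bmor ss_bmor]) (simp_all add: bs)
 have nm: "bmor (Q**(K**T)**?Z) (K**Q**T**?Z) n" unfolding n_def by (rule bmor_comp[OF lw_bmor ss_bmor]) (simp_all add: bs)
 have y: "y : P**Q**(K**T)**?Z" unfolding y_def using t by (simp add: bs)
 (* An isomorphism that brings the common codomain into the bracketing to the right. *)
 let ?i = "%t. lPh P K U ?X (Ph P (K**U) ?X t)"
 have L: "?i ?L = lw P (K**Q**T**?Z) (K**U**?X) (lw K (Q**T**?Z) (U**?X) h) (lw P (Q**(K**T)**?Z) (K**Q**T**?Z) n y)"
 proof -
  define x1 where "x1 = rex ?Z P Q K T x"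
  have x1: "x1 : ((P**K)**Q**T)**?Z" unfolding x1_def using t by (simp add: bs)
  define e where "e = ex (P**K) (Q**T) U W x1"
  have e: "e : ((P**K)**U)**(Q**T)**W" unfolding e_def using x1 by (simp add: bs)
  define w where "w = Ph (P**K) (Q**T) ?Z x1"
  have w: "w : (P**K)**(Q**T)**?Z" unfolding w_def using x1 by (simp add: bs)
  define x2 where "x2 = rPh ?Z P Q (K**T) x"
  have x2: "x2 : (P**Q**K**T)**?Z" unfolding x2_def using t by (simp add: bs)
  define q where "q = Ph P (Q**K**T) ?Z x2"
  have q: "q : P**(Q**K**T)**?Z" unfolding q_def using x2 by (simp add: bs)
  have "?L = rPh ?X P K U (lPh ((P**K)**U) Q T W e)"
   unfolding e_def x1_def by (rule tm_lr(2)) (simp_all add: bs t)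
  hence 1: "?i ?L = Ph P K (U**?X) (Ph (P**K) U ?X (lPh ((P**K)**U) Q T W e))"
   using pentagonA[OF b(1,3,5), of ?X] e by (simp add: bs)
  have 2: "Ph (P**K) U ?X (lPh ((P**K)**U) Q T W e)
    = llPh (P**K) U Q T W (Ph (P**K) U ((Q**T)**W) e)"
   by (rule Ph_nat_r) (simp_all add: bs e)
  have 3: "Ph (P**K) U ((Q**T)**W) e = lss (P**K) (Q**T) U W w"
   unfolding e_def w_def by (rule ex_Ph) (simp_all add: bs x1)
  have 4: "llPh (P**K) U Q T W (lss (P**K) (Q**T) U W w)
    = lw (P**K) (Q**T**?Z) (U**?X) h (lPh (P**K) Q T ?Z w)"
   by (rule lw_sq) (simp_all add: bs w hm, simp add: h_def ss_hexagon_left s)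
  have 5: "Ph P K (U**?X) (lw (P**K) (Q**T**?Z) (U**?X) h (lPh (P**K) Q T ?Z w))
    = lw P (K**Q**T**?Z) (K**U**?X) (lw K (Q**T**?Z) (U**?X) h) (lw P (K**(Q**T)**?Z) (K**Q**T**?Z)
     (lPh K Q T ?Z) (Ph P K ((Q**T)**?Z) w))"
   using w hm by (simp add: Ph_nat_r bs)
  have 6: "Ph P K ((Q**T)**?Z) w = lPh P K (Q**T) ?Z (Ph P (K**Q**T) ?Z
    (rPh ?Z P K (Q**T) x1))"
   unfolding w_def by (rule pentagonA[symmetric]) (simp_all add: bs x1)
  have 7: "rPh ?Z P K (Q**T) x1
    = rw (P**Q**K**T) (P**K**Q**T) ?Z (lss P Q K T) x2"
   unfolding x1_def x2_def by (rule rw_sq) (simp_all add: bs t ex_Ph)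
  have 8: "Ph P (K**Q**T) ?Z (rw (P**Q**K**T) (P**K**Q**T) ?Z (lss P Q K T) x2)
    = lw P ((Q**K**T)**?Z) ((K**Q**T)**?Z) (rss ?Z Q K T) q"
   unfolding q_def by (rule Ph_nat_m) (simp_all add: bs x2)
  have m1: "bmor ((Q**K**T)**?Z) (K**(Q**T)**?Z) (%v. Ph K (Q**T) ?Z (rss ?Z Q K T v))"
   by (rule bmor_comp[OF rw_bmor Ph_bmor]) (simp_all add: bs)
  have 9: "lPh P K (Q**T) ?Z (lw P ((Q**K**T)**?Z) ((K**Q**T)**?Z) (rss ?Z Q K T) q)
    = lw P ((Q**K**T)**?Z) (K**(Q**T)**?Z) (%v. Ph K (Q**T) ?Z (rss ?Z Q K T v)) q"
   by (rule lw_comp) (simp_all add: bs q)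
  have 10: "llPh P K Q T ?Z
     (lw P ((Q**K**T)**?Z) (K**(Q**T)**?Z) (%v. Ph K (Q**T) ?Z (rss ?Z Q K T v)) q)
    = lw P (Q**(K**T)**?Z) (K**Q**T**?Z) n (lPh P Q (K**T) ?Z q)"
   by (rule lw_sq[OF _ _ _ _ _ m1]) (simp_all add: bs q nm, simp add: n_def ss_past_product s sym_ten)
  have 11: "lPh P Q (K**T) ?Z q = y"
   unfolding q_def x2_def y_def by (rule pentagonA) (simp_all add: bs t)
  show ?thesis unfolding 1 2 3 4 5 6 7 8 9 10 11 ..
 qed
 have R: "?i ?R = lw P (K**Q**T**?Z) (K**U**?X) (lw K (Q**T**?Z) (U**?X) h) (lw P (Q**(K**T)**?Z) (K**Q**T**?Z) n y)"
 proof -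
  define r where "r = Ph (P**Q) (K**T) ?Z x"
  have r: "r : (P**Q)**(K**T)**?Z" unfolding r_def using t by (simp add: bs)
  have 1: "Ph P (K**U) ?X ?R = lss P Q (K**U) (T**W)
    (lw P (Q**(K**T)**?Z) (Q**(K**U)**T**W) (lex Q K T U W) y)"
   unfolding y_def r_def[symmetric] using r by (simp add: ex_Ph Ph_nat_r bs)
  have B: "Ph K U ?X (ss Q (K**U) (T**W) (lex Q K T U W v)) = lw K (Q**T**?Z) (U**?X) h (n v)"
   if v: "v : Q**(K**T)**?Z" for v
  proof -
   define z where "z = lPh Q K T ?Z v"
   have z: "z : Q**K**T**?Z" unfolding z_def using v by (simp add: bs)
   have "lPh Q K U (T**W) (lex Q K T U W v)
     = llss Q K T U W z"
    unfolding z_def by (rule lw_sq) (simp_all add: bs v ex_Ph)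
   hence "Ph K U ?X (ss Q (K**U) (T**W) (lex Q K T U W v))
     = lss K Q U (T**W) (llss K Q T U W (ss Q K (T**?Z) z))"
    using v z by (simp add: ss_hexagon_right ss_nat_r bs)
   also have "... = lw K (Q**T**?Z) (U**?X) h (ss Q K (T**?Z) z)"
    unfolding h_def by (rule lw_comp) (simp_all add: bs z)
   finally show ?thesis by (simp add: n_def z_def)
  qed
  have m: "bmor (Q**(K**T)**?Z) ((K**U)**?X) (%v. ss Q (K**U) (T**W) (lex Q K T U W v))"
   by (rule bmor_comp[OF lw_bmor ss_bmor]) (simp_all add: bs)
  have 2: "Ph P (K**U) ?X ?R = lw P (Q**(K**T)**?Z) ((K**U)**?X) (%v. ss Q (K**U) (T**W) (lex Q K T U W v)) y"
   unfolding 1 by (rule lw_comp) (simp_all add: bs y)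
  show ?thesis unfolding 2 by (rule lw_sq[OF _ _ _ _ _ m]) (simp_all add: bs y nm hm B)
 qed
 have c: "?L : (P**K**U)**?X" "?R : (P**K**U)**?X"
  using t by (simp_all add: bs bmor_closed[OF tm_pr(2)[OF _ _ _ _ Ph_bmor Ph_bmor]])
 have "Ph P (K**U) ?X ?L = Ph P (K**U) ?X ?R"
  by (rule lw_Ph_inj[OF b(1,3,5) _ _ _ trans[OF L R[symmetric]]]) (simp_all only: bs c)
 thus ?thesis by (rule Ph_inj[rotated -1]) (simp_all only: bs c)
qed

text \<open>Again both sides are compared after rebracketing to the right. On the left side \<open>L\<close> moves past \<open>U W\<close> and then \<open>N\<close>
past \<open>U\<close>; on the right side \<open>N L\<close> moves past \<open>U\<close> and then \<open>L\<close> past \<open>W\<close>. Split by the hexagons, both become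
\<open>L\<close> past \<open>U\<close> followed by \<open>N\<close> past \<open>U\<close> and \<open>L\<close> past \<open>W\<close>, in orders that agree by naturality.\<close>

lemma ex_assoc:
 assumes s: "sym M" "sym N" "sym L" "sym U" "sym W" "sym Y" and t: "x : ((M**N)**L)**(U**W)**Y"
 shows "Ph (M**U) (N**W) (L**Y) (rex (L**Y) M N U W (ex (M**N) L (U**W) Y x))
  = lex (M**U) N L W Y (ex M (N**L) U (W**Y)
    (tm ((M**N)**L) ((U**W)**Y) (M**N**L) (U**W**Y) (Ph M N L) (Ph U W Y) x))"
  (is "?L = ?R")
proof -
 note b = s[THEN symD(1)]
 note bs = cat b s ex_bmor ex_cl tm_pr(2)
 let ?D = "L**Y" and ?C = "(U**W)**Y" and ?B = "U**W**Y"
 define y where "y = Ph M N (L**?C) (Ph (M**N) L ?C x)"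
 have y: "y : M**N**L**?C" unfolding y_def using t by (simp add: bs)
 define n where "n = (%v. ss N U (W**?D) (lPh N U W ?D v))"
 define g where "g = (%v. llss U N L W Y (ss N U (L**W**Y) (lss N L U (W**Y) v)))"
 have nm: "bmor (N**(U**W)**?D) (U**N**W**?D) n" unfolding n_def by (rule bmor_comp[OF lw_bmor ss_bmor]) (simp_all add: bs)
 have gm: "bmor (N**L**?B) (U**N**W**?D) g" unfolding g_def
  by (rule bmor_comp[OF bmor_comp[OF lw_bmor ss_bmor] lw_bmor]) (simp_all add: bs)
 let ?i = "%t. llPh M U N W ?D (Ph M U ((N**W)**?D) t)"
 have L: "?i ?L = lw M (N**(U**W)**?D) (U**N**W**?D) n (llss M N L (U**W) Y y)"
 proof -
  define e where "e = ex (M**N) L (U**W) Y x"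
  have e: "e : ((M**N)**U**W)**?D" unfolding e_def using t by (simp add: bs)
  define r where "r = rex ?D M N U W e"
  have r: "r : ((M**U)**N**W)**?D" unfolding r_def using e by (simp add: bs)
  define e2 where "e2 = rPh ?D M N (U**W) e"
  have e2: "e2 : (M**N**U**W)**?D" unfolding e2_def using e by (simp add: bs)
  define q where "q = Ph M (N**U**W) ?D e2"
  have q: "q : M**(N**U**W)**?D" unfolding q_def using e2 by (simp add: bs)
  have 1: "Ph M U ((N**W)**?D) ?L = lPh M U (N**W) ?D (Ph M (U**N**W) ?D
    (rPh ?D M U (N**W) r))"
   unfolding e_def[symmetric] r_def[symmetric] by (rule pentagonA[symmetric]) (simp_all add: bs r)
  have 2: "rPh ?D M U (N**W) r
    = rw (M**N**U**W) (M**U**N**W) ?D (lss M N U W) e2"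
   unfolding r_def e2_def by (rule rw_sq) (simp_all add: bs e ex_Ph)
  have 3: "Ph M (U**N**W) ?D (rw (M**N**U**W) (M**U**N**W) ?D (lss M N U W) e2)
    = lw M ((N**U**W)**?D) ((U**N**W)**?D) (rss ?D N U W) q"
   unfolding q_def by (rule Ph_nat_m) (simp_all add: bs e2)
  have m1: "bmor ((N**U**W)**?D) (U**(N**W)**?D) (%v. Ph U (N**W) ?D (rss ?D N U W v))"
   by (rule bmor_comp[OF rw_bmor Ph_bmor]) (simp_all add: bs)
  have 4: "lPh M U (N**W) ?D (lw M ((N**U**W)**?D) ((U**N**W)**?D) (rss ?D N U W) q)
    = lw M ((N**U**W)**?D) (U**(N**W)**?D) (%v. Ph U (N**W) ?D (rss ?D N U W v)) q"
   by (rule lw_comp) (simp_all add: bs q)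
  have 5: "llPh M U N W ?D
     (lw M ((N**U**W)**?D) (U**(N**W)**?D) (%v. Ph U (N**W) ?D (rss ?D N U W v)) q)
    = lw M (N**(U**W)**?D) (U**N**W**?D) n (lPh M N (U**W) ?D q)"
   by (rule lw_sq[OF _ _ _ _ _ m1]) (simp_all add: bs q nm, simp add: n_def ss_past_product s sym_ten)
  have 6: "lPh M N (U**W) ?D q = Ph M N ((U**W)**?D) (Ph (M**N) (U**W) ?D e)"
   unfolding q_def e2_def by (rule pentagonA) (simp_all add: bs e)
  have 7: "Ph M N ((U**W)**?D) (Ph (M**N) (U**W) ?D e) = llss M N L (U**W) Y y"
   unfolding y_def e_def using t by (simp add: ex_Ph Ph_nat_r bs)
  show ?thesis unfolding 1 2 3 4 5 6 7 ..
 qed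
 have R: "?i ?R = lw M (N**L**?B) (U**N**W**?D) g (lw M (N**L**?C) (N**L**?B) (llPh N L U W Y) y)"
 proof -
  define x1 where "x1 = lPh ((M**N)**L) U W Y x"
  have x1: "x1 : ((M**N)**L)**?B" unfolding x1_def using t by (simp add: bs)
  define x2 where "x2 = rPh ?B M N L x1"
  have x2: "x2 : (M**N**L)**?B" unfolding x2_def using x1 by (simp add: bs)
  have tx: "tm ((M**N)**L) ?C (M**N**L) ?B (Ph M N L) (Ph U W Y) x = x2"
   unfolding x2_def x1_def by (rule tm_lr(2)) (simp_all add: bs t)
  define q where "q = Ph M (N**L) ?B x2"
  have q: "q : M**(N**L)**?B" unfolding q_def using x2 by (simp add: bs)
  have 1: "Ph M U ((N**W)**?D) ?R = lw M (U**(N**L)**W**Y) (U**(N**W)**?D) (lex U N L W Y)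
    (lss M (N**L) U (W**Y) q)"
   unfolding tx q_def using x2 by (simp add: ex_Ph Ph_nat_r bs)
  have m: "bmor ((N**L)**?B) (U**(N**W)**?D) (%v. lex U N L W Y (ss (N**L) U (W**Y) v))"
   by (rule bmor_comp[OF ss_bmor lw_bmor]) (simp_all add: bs)
  have 2: "Ph M U ((N**W)**?D) ?R = lw M ((N**L)**?B) (U**(N**W)**?D) (%v. lex U N L W Y (ss (N**L) U (W**Y) v)) q"
   unfolding 1 by (rule lw_comp) (simp_all add: bs q)
  have B: "lPh U N W ?D (lex U N L W Y (ss (N**L) U (W**Y) v)) = g (Ph N L ?B v)"
   if v: "v : (N**L)**?B" for v
  proof -
   have "lPh U N W ?D (lex U N L W Y (ss (N**L) U (W**Y) v))
    = llss U N L W Y (lPh U N L (W**Y) (ss (N**L) U (W**Y) v))"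
    by (rule lw_sq) (simp_all add: bs v ex_Ph)
   thus ?thesis using v by (simp add: ss_hexagon_left bs g_def)
  qed
  have 3: "?i ?R = lw M (N**L**?B) (U**N**W**?D) g (lPh M N L ?B q)"
   unfolding 2 by (rule lw_sq[OF _ _ _ _ _ m]) (simp_all add: bs q gm B)
  have 4: "lPh M N L ?B q = Ph M N (L**?B) (Ph (M**N) L ?B x1)"
   unfolding q_def x2_def by (rule pentagonA) (simp_all add: bs x1)
  have 5: "Ph M N (L**?B) (Ph (M**N) L ?B x1) = lw M (N**L**?C) (N**L**?B) (llPh N L U W Y) y"
   unfolding x1_def y_def using t by (simp add: Ph_nat_r bs)
  show ?thesis unfolding 3 4 5 ..
 qed
 have B: "n (lss N L (U**W) Y v) = g (llPh N L U W Y v)"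
  if v: "v : N**L**?C" for v
 proof -
  define z where "z = llPh N L U W Y v"
  have z: "z : N**L**?B" unfolding z_def using v by (simp add: bs)
  have m: "bmor (L**?B) (U**W**?D) (%z. lss U L W Y (ss L U (W**Y) z))"
   by (rule bmor_comp[OF ss_bmor lw_bmor]) (simp_all add: bs)
  have "lPh N U W ?D (lss N L (U**W) Y v)
    = lw N (L**?B) (U**W**?D) (%z. lss U L W Y (ss L U (W**Y) z)) z"
   unfolding z_def by (rule lw_sq[OF _ _ _ _ _ _ _ _ m]) (simp_all add: bs v ss_hexagon_right)
  also have "... = llss N U L W Y (lss N L U (W**Y) z)"
   by (rule lw_comp[symmetric]) (simp_all add: bs z)
  finally show ?thesis unfolding z_def[symmetric] n_def g_def using z by (simp add: ss_nat_r bs)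
 qed
 have eq: "?i ?L = ?i ?R" unfolding L R by (rule lw_sq) (simp_all add: bs y nm gm B)
 have c: "?L : (M**U)**(N**W)**?D" "?R : (M**U)**(N**W)**?D"
  using t by (simp_all add: bs bmor_closed[OF tm_pr(2)[OF _ _ _ _ Ph_bmor Ph_bmor]])
 have i: "lw M (U**N**W**?D) (U**(N**W)**?D) (lw U (N**W**?D) ((N**W)**?D) (Pi N W ?D)) (?i v) = Ph M U ((N**W)**?D) v"
  if v: "v : (M**U)**(N**W)**?D" for v
  by (rule lw_cancel; (rule lw_cancel)?) (simp_all add: bs v Pi_inverse(3))
 have "Ph M U ((N**W)**?D) ?L = Ph M U ((N**W)**?D) ?R" using i[OF c(1)] i[OF c(2)] eq by metis
 thus ?thesis by (rule Ph_inj[rotated -1]) (simp_all only: bs c)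
qed

end

section \<open>The tensor product morphisms\<close>

context algebra_setting
begin

abbreviation evA' where "evA' V W \<equiv> evA k H A V W"
abbreviation box where "box V W X Y \<equiv> boxA k H A V W X Y"
abbreviation cm where "cm V W X \<equiv> compA k H A V W X"

lemma ex_nat_l:
 assumes s: "sym M" "sym N" "sym V" "sym X" "sym M'" "sym N'" and m: "bmor M M' f" "bmor N N' g" and t: "t : (M**N)**V**X"
 shows "ex M' N' V X (rw (M**N) (M'**N') (V**X) (tm M N M' N' f g) t)
  = tm (M**V) (N**X) (M'**V) (N'**X) (rw M M' V f) (rw N N' X g) (ex M N V X t)"
proof -
 have "tm (M**N) (V**X) (M'**N') (V**X) (tm M N M' N' f g) (tm V X V X id id) = rw (M**N) (M'**N') (V**X) (tm M N M' N' f g)"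
  by (rule tm_cong) (simp_all add: tm_id s symD(1))
 thus ?thesis using ex_nat[OF s(1-6,3,4) m bmor_id' bmor_id' t] by simp
qed

lemma ex_nat_r:
 assumes s: "sym M" "sym N" "sym V" "sym X" "sym V'" "sym X'" and m: "bmor V V' h" "bmor X X' l" and t: "t : (M**N)**V**X"
 shows "ex M N V' X' (lw (M**N) (V**X) (V'**X') (tm V X V' X' h l) t)
  = tm (M**V) (N**X) (M**V') (N**X') (lw M V V' h) (lw N X X' l) (ex M N V X t)"
proof -
 have "tm (M**N) (V**X) (M**N) (V'**X') (tm M N M N id id) (tm V X V' X' h l) = lw (M**N) (V**X) (V'**X') (tm V X V' X' h l)"
  by (rule tm_cong) (simp_all add: tm_id s symD(1))
 thus ?thesis using ex_nat[OF s(1-4,1,2,5,6) bmor_id' bmor_id' m t] by simp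
qed

text \<open>The defining condition describes \<open>\<boxtimes>\<^sub>A\<close> as the curried form of the exchange followed by two evaluations.\<close>

lemma box:
 assumes s: "sym V" "sym W" "sym X" "sym Y"
 shows box_bmor: "bmor (Hom V W**Hom X Y) (Hom (V**X) (W**Y)) (box V W X Y)"
  and box_evp: "t : Hom V W**Hom X Y ==> v : V**X ==> evp (V**X) (W**Y) (box V W X Y t) v
   = tm (Hom V W**V) (Hom X Y**X) W Y (evA' V W) (evA' X Y) (ex (Hom V W) (Hom X Y) V X (pr (Hom V W**Hom X Y) (V**X) t v))"
proof -
 let ?M = "Hom V W" and ?N = "Hom X Y"
 let ?G = "%t. tm (?M**V) (?N**X) W Y (evA' V W) (evA' X Y) (ex ?M ?N V X t)"
 note b = s[THEN symD(1)]
 note sM = sym_Hom[OF s(1,2)] and sN = sym_Hom[OF s(3,4)]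
 note bM = symD(1)[OF sM] and bN = symD(1)[OF sN]
 have G: "bmor ((?M**?N)**V**X) (W**Y) ?G"
  by (rule bmor_comp[OF ex_bmor[OF sM sN s(1,3)] tm_pr(2)[OF ten_bim[OF bM b(1)] ten_bim[OF bN b(3)] b(2,4) evA_bmor[OF b(1,2)] evA_bmor[OF b(3,4)]]])
 note MN = ten_bim[OF bM bN] and VX = ten_bim[OF b(1,3)] and WY = ten_bim[OF b(2,4)]
 have e: "box V W X Y = cr (?M**?N) (V**X) (W**Y) ?G"
  unfolding boxA_def Let_def cr_def by (rule trans[OF _ the_curry[OF VX WY MN G]]) (simp add: comp_def)
 show "bmor (?M**?N) (Hom (V**X) (W**Y)) (box V W X Y)" unfolding e by (rule cr_bmor[OF MN VX WY G])
 show "t : ?M**?N ==> v : V**X ==> evp (V**X) (W**Y) (box V W X Y t) v = ?G (pr (?M**?N) (V**X) t v)"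
  unfolding e by (rule cr_evp[OF MN VX WY G])
qed

text \<open>Evaluating a morphism into \<open>hom\<^sub>A\<close> that is known on elements, as an equation of morphisms.\<close>

lemma evA_rw:
 assumes b: "bim M" "bim V" "bim W" and f: "bmor M (Hom V W) f" and G: "bmor (M**V) W G"
  and eq: "!!m v. m : M ==> v : V ==> evp V W (f m) v = G (pr M V m v)" and t: "t : M**V"
 shows "evA' V W (rw M (Hom V W) V f t) = G t"
proof (rule ten_ext[OF b(1,2) bmor_comp[OF rw_bmor[OF b(2,1) Hom_bim[OF b(2,3)] f] evA_bmor[OF b(2,3)]] G t])
 fix m v assume el: "m : M" "v : V"
 show "evA' V W (rw M (Hom V W) V f (pr M V m v)) = G (pr M V m v)"
  using tm_pr(1)[OF b(1,2) Hom_bim[OF b(2,3)] b(2) f bmor_id' el] by (simp add: evA_pr[OF b(2,3) bmor_closed[OF f el(1)] el(2)] eq el)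
qed

lemma evA_box:
 assumes s: "sym V" "sym W" "sym X" "sym Y" and t: "t : (Hom V W**Hom X Y)**V**X"
 shows "evA' (V**X) (W**Y) (rw (Hom V W**Hom X Y) (Hom (V**X) (W**Y)) (V**X) (box V W X Y) t)
  = tm (Hom V W**V) (Hom X Y**X) W Y (evA' V W) (evA' X Y) (ex (Hom V W) (Hom X Y) V X t)"
proof (rule evA_rw[OF _ _ _ box_bmor[OF s] _ box_evp[OF s] t])
 note b = s[THEN symD(1)]
 note sM = sym_Hom[OF s(1,2)] and sN = sym_Hom[OF s(3,4)]
 show "bim (Hom V W**Hom X Y)" "bim (V**X)" "bim (W**Y)" using s sM sN by (simp_all add: cat symD(1))
 show "bmor ((Hom V W**Hom X Y)**V**X) (W**Y) (%t. tm (Hom V W**V) (Hom X Y**X) W Y (evA' V W) (evA' X Y) (ex (Hom V W) (Hom X Y) V X t))"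
  by (rule bmor_comp[OF ex_bmor[OF sM sN s(1,3)] tm_pr(2)[OF ten_bim[OF symD(1)[OF sM] b(1)] ten_bim[OF symD(1)[OF sN] b(3)] b(2,4) evA_bmor[OF b(1,2)] evA_bmor[OF b(3,4)]]])
qed

lemma evA_comp:
 assumes b: "bim V" "bim W" "bim X" and t: "t : (Hom W X**Hom V W)**V"
 shows "evA' V X (rw (Hom W X**Hom V W) (Hom V X) V (cm V W X) t)
  = evA' W X (lw (Hom W X) (Hom V W**V) W (evA' V W) (Ph (Hom W X) (Hom V W) V t))"
 using evA_rw[OF ten_bim[OF Hom_bim[OF b(2,3)] Hom_bim[OF b(1,2)]] b(1,3) compA_bmor[OF b] comp_ev_bmor[OF b] compA_evp[OF b] t]
 by (simp add: comp_ev_def[OF b])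

context
 fixes U V W X Y Z
 assumes s: "sym U" "sym V" "sym W" "sym X" "sym Y" "sym Z"
begin

private lemmas bm = s[THEN symD(1)]

text \<open>Evaluated, both sides are a pair of iterated evaluations after two exchanges, and the exchanges agree by
\<open>ex_comp\<close>.\<close>

lemma box_comp:
 fixes t
 defines "P \<equiv> Hom V Y" and "Q \<equiv> Hom X Z" and "K \<equiv> Hom U V" and "T \<equiv> Hom W X"
 defines "F \<equiv> %t. cm (U**W) (V**X) (Y**Z) (tm (P**Q) (K**T) (Hom (V**X) (Y**Z)) (Hom (U**W) (V**X)) (box V Y X Z) (box U V W X) t)"
  and "G \<equiv> %t. box U Y W Z (tm (P**K) (Q**T) (Hom U Y) (Hom W Z) (cm U V Y) (cm W X Z) (ex P Q K T t))"
 shows box_comp_F: "bmor ((P**Q)**K**T) (Hom (U**W) (Y**Z)) F"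
  and box_comp_G: "bmor ((P**Q)**K**T) (Hom (U**W) (Y**Z)) G"
  and box_comp_eq: "t : (P**Q)**K**T ==> F t = G t"
proof -
 have sP: "sym P" "sym Q" "sym K" "sym T" unfolding P_def Q_def K_def T_def by (simp_all add: sym_Hom s)
 let ?B = "Hom (V**X) (Y**Z)" and ?C = "Hom (U**W) (V**X)" and ?UW = "U**W" and ?VX = "V**X" and ?YZ = "Y**Z"
 let ?PQ = "P**Q" and ?KT = "K**T" and ?UY = "Hom U Y" and ?WZ = "Hom W Z"
 have sH: "sym ?B" "sym ?C" "sym ?UY" "sym ?WZ" by (simp_all add: sym_Hom sym_ten s)
 note ss' = sP sH s sym_ten
 note bs = cat ss' ss'[THEN symD(1)] ex_bmor ex_cl
 note bP = sP[THEN symD(1)] and bH = sH[THEN symD(1)]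
 note boxes = box_bmor[OF s(2,5,4,6), folded P_def Q_def] box_bmor[OF s(1,2,3,4), folded K_def T_def]
 note evb = evA_bmor[OF bm(2,5), folded P_def] evA_bmor[OF bm(4,6), folded Q_def] evA_bmor[OF bm(1,2), folded K_def] evA_bmor[OF bm(3,4), folded T_def]
 note cms = compA_bmor[OF bm(1,2,5), folded P_def K_def] compA_bmor[OF bm(3,4,6), folded Q_def T_def]
 have bb: "bim ?PQ" "bim ?KT" "bim ?UW" "bim ?VX" "bim ?YZ" "bim (P**K)" "bim (Q**T)" by (simp_all add: bs)
 note bx = tm_pr(2)[OF bb(1,2) bH(1,2) boxes]
 show F: "bmor (?PQ**?KT) (Hom ?UW ?YZ) F" unfolding F_def by (rule bmor_comp[OF bx compA_bmor[OF bb(3,4,5)]])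
 note cx = tm_pr(2)[OF bb(6,7) bH(3,4) cms]
 show G: "bmor (?PQ**?KT) (Hom ?UW ?YZ) G" unfolding G_def
  by (rule bmor_comp[OF bmor_comp[OF ex_bmor[OF sP] cx] box_bmor[OF s(1,5,3,6)]])
 let ?EV = "%v. tm (K**U) (T**W) V X (evA' U V) (evA' W X) (ex K T U W v)"
 have ev: "bmor ((K**U)**T**W) ?VX (tm (K**U) (T**W) V X (evA' U V) (evA' W X))"
  by (rule tm_pr(2)[OF _ _ bm(2,4) evb(3,4)]) (simp_all add: bs)
 have EV: "bmor (?KT**?UW) ?VX ?EV"
  by (rule bmor_comp[OF ex_bmor ev]) (simp_all add: bs)
 let ?e1 = "%v. evA' V Y (lw P (K**U) V (evA' U V) v)" and ?e2 = "%v. evA' X Z (lw Q (T**W) X (evA' W X) v)"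
 have l: "bmor (P**K**U) (P**V) (lw P (K**U) V (evA' U V))" "bmor (Q**T**W) (Q**X) (lw Q (T**W) X (evA' W X))"
  by (rule lw_bmor[OF _ _ _ evb(3)] lw_bmor[OF _ _ _ evb(4)]; simp add: bs)+
 have e12: "bmor (P**K**U) Y ?e1" "bmor (Q**T**W) Z ?e2"
  by (rule bmor_comp[OF l(1) evb(1)] bmor_comp[OF l(2) evb(2)])+
 assume t: "t : ?PQ**?KT"
 show "F t = G t"
 proof (rule Hom_ext[OF bb(3,5) ten_bim[OF bb(1,2)] F G _ t])
  fix t v assume t: "t : ?PQ**?KT" and v: "v : ?UW"
  (* Evaluating the composition evaluates the inner map first, then the outer one. Naturality of the
     associator and of the exchange moves the inner evaluations past the outer exchange. *)
  define x where "x = pr (?PQ**?KT) ?UW t v"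
  have x: "x : (?PQ**?KT)**?UW" unfolding x_def using t v by (simp add: pr_in bs)
  define w where "w = Ph ?PQ ?KT ?UW x"
  have w: "w : ?PQ**?KT**?UW" unfolding w_def using x by (simp add: bs)
  define z where "z = ex P Q (K**U) (T**W) (lex ?PQ K T U W w)"
  have lex: "lex ?PQ K T U W w : ?PQ**(K**U)**T**W" using w by (simp add: bs)
  have z: "z : (P**K**U)**Q**T**W" unfolding z_def using lex by (simp add: bs)
  have rx: "rw (?PQ**?KT) (?B**?C) ?UW (tm ?PQ ?KT ?B ?C (box V Y X Z) (box U V W X)) x : (?B**?C)**?UW"
   by (rule rw_cl[OF _ _ _ bx x]) (simp_all add: bs)
  have 1: "evp ?UW ?YZ (F t) v = evA' ?VX ?YZ (lw ?B (?C**?UW) ?VX (evA' ?UW ?VX) (Ph ?B ?C ?UW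
    (rw (?PQ**?KT) (?B**?C) ?UW (tm ?PQ ?KT ?B ?C (box V Y X Z) (box U V W X)) x)))"
   unfolding F_def compA_evp[OF bb(3,4,5) bmor_closed[OF bx t] v] comp_ev_def[OF bb(3,4,5)] x_def
   using tm_pr(1)[OF ten_bim[OF bb(1,2)] bb(3) ten_bim[OF bH(1,2)] bb(3) bx bmor_id' t v] by simp
  have 2: "Ph ?B ?C ?UW (rw (?PQ**?KT) (?B**?C) ?UW (tm ?PQ ?KT ?B ?C (box V Y X Z) (box U V W X)) x)
    = tm ?PQ (?KT**?UW) ?B (?C**?UW) (box V Y X Z) (rw ?KT ?C ?UW (box U V W X)) w"
   unfolding w_def by (rule Ph_nat[OF bb(1,2,3) bH(1,2) bb(3) boxes bmor_id' x])
  have rb: "bmor (?KT**?UW) (?C**?UW) (rw ?KT ?C ?UW (box U V W X))" by (rule rw_bmor[OF bb(3,2) bH(2) boxes(2)])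
  have 3: "lw ?B (?C**?UW) ?VX (evA' ?UW ?VX) (tm ?PQ (?KT**?UW) ?B (?C**?UW) (box V Y X Z) (rw ?KT ?C ?UW (box U V W X)) w)
    = tm ?PQ (?KT**?UW) ?B ?VX (box V Y X Z) (%v. evA' ?UW ?VX (rw ?KT ?C ?UW (box U V W X) v)) w"
   using tm_comp[OF bb(1) ten_bim[OF bb(2,3)] bH(1) ten_bim[OF bH(2) bb(3)] bH(1) bb(4) boxes(1) rb bmor_id' evA_bmor[OF bb(3,4)] w] by simp
  have 4: "tm ?PQ (?KT**?UW) ?B ?VX (box V Y X Z) (%v. evA' ?UW ?VX (rw ?KT ?C ?UW (box U V W X) v))
    = tm ?PQ (?KT**?UW) ?B ?VX (box V Y X Z) ?EV"
   by (rule tm_cong) (simp_all add: evA_box[OF s(1-4), folded K_def T_def])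
  have 5: "tm ?PQ (?KT**?UW) ?B ?VX (box V Y X Z) ?EV w = rw ?PQ ?B ?VX (box V Y X Z) (lw ?PQ (?KT**?UW) ?VX ?EV w)"
   by (rule tm_lr(2)[OF bb(1) ten_bim[OF bb(2,3)] bH(1) bb(4) boxes(1) EV w])
  have 6: "lw ?PQ (?KT**?UW) ?VX ?EV w = lw ?PQ ((K**U)**T**W) ?VX (tm (K**U) (T**W) V X (evA' U V) (evA' W X)) (lex ?PQ K T U W w)"
   by (rule lw_comp[symmetric, OF bb(1) ten_bim[OF bb(2,3)] _ bb(4) _ ev w]) (simp_all add: bs)
  have 7: "lw ?PQ (?KT**?UW) ?VX ?EV w : ?PQ**?VX" by (rule lw_cl[OF bb(1) ten_bim[OF bb(2,3)] bb(4) EV w])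
  have 8: "evA' ?VX ?YZ (rw ?PQ ?B ?VX (box V Y X Z) (lw ?PQ (?KT**?UW) ?VX ?EV w))
    = tm (P**V) (Q**X) Y Z (evA' V Y) (evA' X Z) (ex P Q V X (lw ?PQ (?KT**?UW) ?VX ?EV w))"
   unfolding P_def Q_def by (rule evA_box[OF s(2,5,4,6)]) (rule 7[unfolded P_def Q_def])
  have 9: "ex P Q V X (lw ?PQ (?KT**?UW) ?VX ?EV w) = tm (P**K**U) (Q**T**W) (P**V) (Q**X) (lw P (K**U) V (evA' U V)) (lw Q (T**W) X (evA' W X)) z"
   unfolding 6 z_def by (rule ex_nat_r[OF sP(1,2) _ _ s(2,4) evb(3,4) lex]) (simp_all add: bs)
  have 10: "tm (P**V) (Q**X) Y Z (evA' V Y) (evA' X Z) (tm (P**K**U) (Q**T**W) (P**V) (Q**X) (lw P (K**U) V (evA' U V)) (lw Q (T**W) X (evA' W X)) z)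
    = tm (P**K**U) (Q**T**W) Y Z ?e1 ?e2 z"
   by (rule tm_comp[OF _ _ _ _ bm(5,6) l evb(1,2) z]) (simp_all add: bs)
  have lhs: "evp ?UW ?YZ (F t) v = tm (P**K**U) (Q**T**W) Y Z ?e1 ?e2 z"
   unfolding 1 2 3 4 5 8 9 10 ..
  (* The exchange of function factors comes first; evaluating the two compositions gives the iterated evaluations. *)
  define x1 where "x1 = rex ?UW P Q K T x"
  have x1: "x1 : ((P**K)**Q**T)**?UW" unfolding x1_def using x by (simp add: bs)
  have pe: "pr ((P**K)**Q**T) ?UW (ex P Q K T t) v = x1"
   unfolding x1_def x_def using tm_pr(1)[OF ten_bim[OF bb(1,2)] bb(3) ten_bim[OF bb(6,7)] bb(3) ex_bmor[OF sP] bmor_id' t v] by simp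
  have et: "ex P Q K T t : (P**K)**Q**T" by (rule ex_cl[OF sP t])
  have 11: "evp ?UW ?YZ (G t) v = tm (?UY**U) (?WZ**W) Y Z (evA' U Y) (evA' W Z)
    (ex ?UY ?WZ U W (rw ((P**K)**Q**T) (?UY**?WZ) ?UW (tm (P**K) (Q**T) ?UY ?WZ (cm U V Y) (cm W X Z)) x1))"
   unfolding G_def box_evp[OF s(1,5,3,6) bmor_closed[OF cx et] v]
   using tm_pr(1)[OF ten_bim[OF bb(6,7)] bb(3) ten_bim[OF bH(3,4)] bb(3) cx bmor_id' et v] by (simp add: pe)
  let ?z = "ex (P**K) (Q**T) U W x1"
  have zc: "?z : ((P**K)**U)**(Q**T)**W" by (rule ex_cl[OF _ _ s(1,3) x1]) (simp_all add: bs)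
  have 12: "ex ?UY ?WZ U W (rw ((P**K)**Q**T) (?UY**?WZ) ?UW (tm (P**K) (Q**T) ?UY ?WZ (cm U V Y) (cm W X Z)) x1)
    = tm ((P**K)**U) ((Q**T)**W) (?UY**U) (?WZ**W) (rw (P**K) ?UY U (cm U V Y)) (rw (Q**T) ?WZ W (cm W X Z)) ?z"
   by (rule ex_nat_l[OF _ _ s(1,3) sH(3,4) cms x1]) (simp_all add: bs)
  have rc: "bmor ((P**K)**U) (?UY**U) (rw (P**K) ?UY U (cm U V Y))" "bmor ((Q**T)**W) (?WZ**W) (rw (Q**T) ?WZ W (cm W X Z))"
   by (rule rw_bmor[OF bm(1) bb(6) bH(3) cms(1)] rw_bmor[OF bm(3) bb(7) bH(4) cms(2)])+
  have 13: "tm (?UY**U) (?WZ**W) Y Z (evA' U Y) (evA' W Z)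
     (tm ((P**K)**U) ((Q**T)**W) (?UY**U) (?WZ**W) (rw (P**K) ?UY U (cm U V Y)) (rw (Q**T) ?WZ W (cm W X Z)) ?z)
    = tm ((P**K)**U) ((Q**T)**W) Y Z (%v. evA' U Y (rw (P**K) ?UY U (cm U V Y) v)) (%v. evA' W Z (rw (Q**T) ?WZ W (cm W X Z) v)) ?z"
   by (rule tm_comp[OF _ _ _ _ bm(5,6) rc evA_bmor[OF bm(1,5)] evA_bmor[OF bm(3,6)] zc]) (simp_all add: bs)
  have 14: "tm ((P**K)**U) ((Q**T)**W) Y Z (%v. evA' U Y (rw (P**K) ?UY U (cm U V Y) v)) (%v. evA' W Z (rw (Q**T) ?WZ W (cm W X Z) v))
    = tm ((P**K)**U) ((Q**T)**W) Y Z (%v. ?e1 (Ph P K U v)) (%v. ?e2 (Ph Q T W v))"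
   by (rule tm_cong) (simp_all add: evA_comp[OF bm(1,2,5), folded P_def K_def] evA_comp[OF bm(3,4,6), folded Q_def T_def])
  have 15: "tm ((P**K)**U) ((Q**T)**W) Y Z (%v. ?e1 (Ph P K U v)) (%v. ?e2 (Ph Q T W v)) ?z
    = tm (P**K**U) (Q**T**W) Y Z ?e1 ?e2 (tm ((P**K)**U) ((Q**T)**W) (P**K**U) (Q**T**W) (Ph P K U) (Ph Q T W) ?z)"
   by (rule tm_comp[symmetric, OF _ _ _ _ bm(5,6) _ _ e12 zc]) (simp_all add: bs)
  have 16: "tm ((P**K)**U) ((Q**T)**W) (P**K**U) (Q**T**W) (Ph P K U) (Ph Q T W) ?z = z"
   unfolding x1_def z_def w_def by (rule ex_comp[OF sP s(1,3) x])
  have "evp ?UW ?YZ (G t) v = tm (P**K**U) (Q**T**W) Y Z ?e1 ?e2 z"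
   unfolding 11 12 13 14 15 16 ..
  thus "evp ?UW ?YZ (F t) v = evp ?UW ?YZ (G t) v" using lhs by simp
 qed
qed

text \<open>Evaluated, both sides are three evaluations after two exchanges; the associators that conjugation contributes are
those in \<open>ex_assoc\<close>.\<close>

lemma box_assoc:
 fixes t
 defines "M \<equiv> Hom U V" and "N \<equiv> Hom W X" and "L \<equiv> Hom Y Z"
 defines "F \<equiv> %t. conjA k H A U V W X Y Z (box (U**W) (V**X) Y Z (rw (M**N) (Hom (U**W) (V**X)) L (box U V W X) t))"
  and "G \<equiv> %t. box U V (W**Y) (X**Z) (lw M (N**L) (Hom (W**Y) (X**Z)) (box W X Y Z) (Ph M N L t))"
 shows box_assoc_F: "bmor ((M**N)**L) (Hom (U**W**Y) (V**X**Z)) F"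
  and box_assoc_G: "bmor ((M**N)**L) (Hom (U**W**Y) (V**X**Z)) G"
  and box_assoc_eq: "t : (M**N)**L ==> F t = G t"
proof -
 have sM: "sym M" "sym N" "sym L" unfolding M_def N_def L_def by (simp_all add: sym_Hom s)
 let ?UW = "U**W" and ?VX = "V**X" and ?WY = "W**Y" and ?XZ = "X**Z"
 let ?B = "Hom ?UW ?VX" and ?C = "Hom ?WY ?XZ" and ?S = "?UW**Y" and ?S' = "U**?WY" and ?T = "?VX**Z" and ?T' = "V**?XZ"
 have sH: "sym ?B" "sym ?C" and sT: "sym ?UW" "sym ?VX" "sym ?WY" "sym ?XZ" by (simp_all add: sym_Hom sym_ten s)
 note ss' = sM sH s sT sym_ten
 note bs = cat ss' ss'[THEN symD(1)] ex_bmor ex_cl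
 note bM = sM[THEN symD(1)] and bH = sH[THEN symD(1)] and bT = sT[THEN symD(1)]
 note boxes = box_bmor[OF s(1-4), folded M_def N_def] box_bmor[OF s(3-6), folded N_def L_def]
 note evb = evA_bmor[OF bm(1,2), folded M_def] evA_bmor[OF bm(3,4), folded N_def] evA_bmor[OF bm(5,6), folded L_def]
 note MN = ten_bim[OF bM(1,2)] and NL = ten_bim[OF bM(2,3)]
 have bS: "bim ?S" "bim ?T" "bim ?S'" "bim ?T'" by (simp_all add: bs)
 note bx = rw_bmor[OF bM(3) MN bH(1) boxes(1)] and bx2 = lw_bmor[OF bM(1) NL bH(2) boxes(2)]
 note bb = box_bmor[OF sT(1,2) s(5,6), folded L_def] and bb2 = box_bmor[OF s(1,2) sT(3,4), folded M_def]
 note cb = hom_conj(1)[OF bS Pi_bmor[OF bm(1,3,5)] Ph_bmor[OF bm(2,4,6)], folded conjA_def]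
  and ce = hom_conj(2)[OF bS Pi_bmor[OF bm(1,3,5)] Ph_bmor[OF bm(2,4,6)], folded conjA_def]
 show F: "bmor ((M**N)**L) (Hom ?S' ?T') F" unfolding F_def by (rule bmor_comp[OF bmor_comp[OF bx bb] cb])
 show G: "bmor ((M**N)**L) (Hom ?S' ?T') G" unfolding G_def by (rule bmor_comp[OF bmor_comp[OF Ph_bmor[OF bM] bx2] bb2])
 let ?ev12 = "tm (M**U) (N**W) V X (evA' U V) (evA' W X)" and ?ev23 = "tm (N**W) (L**Y) X Z (evA' W X) (evA' Y Z)"
 have bE: "bim (M**U)" "bim (N**W)" "bim (L**Y)" "bim ((M**N)**?UW)" "bim ((N**L)**?WY)" "bim ((M**U)**N**W)" "bim ((N**W)**L**Y)" by (simp_all add: bs)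
 note ev12 = tm_pr(2)[OF bE(1,2) bm(2,4) evb(1,2)] and ev23 = tm_pr(2)[OF bE(2,3) bm(4,6) evb(2,3)]
 have ex1: "bmor ((M**N)**?UW) ((M**U)**N**W) (ex M N U W)" and ex2: "bmor ((N**L)**?WY) ((N**W)**L**Y) (ex N L W Y)"
  by (simp_all add: bs)
 assume t: "t : (M**N)**L"
 show "F t = G t"
 proof (rule Hom_ext[OF bS(3,4) ten_bim[OF MN bM(3)] F G _ t])
  fix t v assume t: "t : (M**N)**L" and v: "v : ?S'"
  have Pv: "Pi U W Y v : ?S" using v by (simp add: bs)
  (* Conjugation evaluates at the rebracketed argument and rebrackets the result; naturality of the
     associator moves the latter in front of the evaluations. *)
  define x where "x = pr ((M**N)**L) ?S t (Pi U W Y v)"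
  have x: "x : ((M**N)**L)**?S" unfolding x_def using t Pv by (simp add: pr_in bs)
  define e where "e = ex (M**N) L ?UW Y x"
  have e: "e : ((M**N)**?UW)**L**Y" unfolding e_def using x by (simp add: bs)
  have 1: "evp ?S' ?T' (F t) v = Ph V X Z (tm (?B**?UW) (L**Y) ?VX Z (evA' ?UW ?VX) (evA' Y Z)
    (ex ?B L ?UW Y (rw ((M**N)**L) (?B**L) ?S (rw (M**N) ?B L (box U V W X)) x)))"
   unfolding F_def ce[OF bmor_closed[OF bb bmor_closed[OF bx t]] v] box_evp[OF sT(1,2) s(5,6), folded L_def, OF bmor_closed[OF bx t] Pv] x_def
   using tm_pr(1)[OF ten_bim[OF MN bM(3)] bS(1) ten_bim[OF bH(1) bM(3)] bS(1) bx bmor_id' t Pv] by simp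
  have 2: "ex ?B L ?UW Y (rw ((M**N)**L) (?B**L) ?S (rw (M**N) ?B L (box U V W X)) x)
    = tm ((M**N)**?UW) (L**Y) (?B**?UW) (L**Y) (rw (M**N) ?B ?UW (box U V W X)) (rw L L Y id) e"
   unfolding e_def by (rule ex_nat_l[OF _ sM(3) sT(1) s(5) sH(1) sM(3) boxes(1) bmor_id' x]) (simp add: bs)
  have rb: "bmor ((M**N)**?UW) (?B**?UW) (rw (M**N) ?B ?UW (box U V W X))" "bmor (L**Y) (L**Y) (rw L L Y id)"
   by (rule rw_bmor[OF bT(1) MN bH(1) boxes(1)] rw_bmor[OF bm(5) bM(3) bM(3) bmor_id'])+
  have 3: "tm (?B**?UW) (L**Y) ?VX Z (evA' ?UW ?VX) (evA' Y Z)
     (tm ((M**N)**?UW) (L**Y) (?B**?UW) (L**Y) (rw (M**N) ?B ?UW (box U V W X)) (rw L L Y id) e)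
    = tm ((M**N)**?UW) (L**Y) ?VX Z (%v. evA' ?UW ?VX (rw (M**N) ?B ?UW (box U V W X) v)) (%v. evA' Y Z (rw L L Y id v)) e"
   by (rule tm_comp[OF bE(4,3) ten_bim[OF bH(1) bT(1)] bE(3) bT(2) bm(6) rb evA_bmor[OF bT(1,2)] evb(3) e])
  have 4: "tm ((M**N)**?UW) (L**Y) ?VX Z (%v. evA' ?UW ?VX (rw (M**N) ?B ?UW (box U V W X) v)) (%v. evA' Y Z (rw L L Y id v))
    = tm ((M**N)**?UW) (L**Y) ?VX Z (%v. ?ev12 (ex M N U W v)) (evA' Y Z)"
   by (rule tm_cong) (simp_all add: evA_box[OF s(1-4), folded M_def N_def] tm_id bM bm)
  have 5: "tm ((M**N)**?UW) (L**Y) ?VX Z (%v. ?ev12 (ex M N U W v)) (evA' Y Z) e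
    = tm ((M**U)**N**W) (L**Y) ?VX Z ?ev12 (evA' Y Z) (rex (L**Y) M N U W e)"
   using tm_comp[OF bE(4,3,6,3) bT(2) bm(6) ex1 bmor_id' ev12 evb(3) e] by simp
  have 6: "Ph V X Z (tm ((M**U)**N**W) (L**Y) ?VX Z ?ev12 (evA' Y Z) (rex (L**Y) M N U W e))
    = tm (M**U) ((N**W)**L**Y) V ?XZ (evA' U V) ?ev23 (Ph (M**U) (N**W) (L**Y) (rex (L**Y) M N U W e))"
   by (rule Ph_nat[OF bE(1-3) bm(2,4,6) evb rw_cl[OF bE(3,4,6) ex1 e]])
  have lhs: "evp ?S' ?T' (F t) v = tm (M**U) ((N**W)**L**Y) V ?XZ (evA' U V) ?ev23
    (Ph (M**U) (N**W) (L**Y) (rex (L**Y) M N U W e))"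
   unfolding 1 2 3 4 5 6 ..
  define x1 where "x1 = pr (M**N**L) ?S' (Ph M N L t) v"
  have Pt: "Ph M N L t : M**N**L" using t by (simp add: bs)
  have x1: "x1 : (M**N**L)**?S'" unfolding x1_def using Pt v by (simp add: pr_in bs)
  have xx: "tm ((M**N)**L) ?S (M**N**L) ?S' (Ph M N L) (Ph U W Y) x = x1"
   unfolding x_def x1_def using tm_pr(1)[OF ten_bim[OF MN bM(3)] bS(1) ten_bim[OF bM(1) NL] bS(3) Ph_bmor[OF bM] Ph_bmor[OF bm(1,3,5)] t Pv]
   by (simp add: Pi_inverse(2)[OF bm(1,3,5) v])
  let ?z = "ex M (N**L) U ?WY x1"
  have z: "?z : (M**U)**(N**L)**?WY" using x1 by (simp add: bs)
  have 11: "evp ?S' ?T' (G t) v = tm (M**U) (?C**?WY) V ?XZ (evA' U V) (evA' ?WY ?XZ)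
    (ex M ?C U ?WY (rw (M**N**L) (M**?C) ?S' (lw M (N**L) ?C (box W X Y Z)) x1))"
   unfolding G_def box_evp[OF s(1,2) sT(3,4), folded M_def, OF bmor_closed[OF bx2 Pt] v] x1_def
   using tm_pr(1)[OF ten_bim[OF bM(1) NL] bS(3) ten_bim[OF bM(1) bH(2)] bS(3) bx2 bmor_id' Pt v] by simp
  have 12: "ex M ?C U ?WY (rw (M**N**L) (M**?C) ?S' (lw M (N**L) ?C (box W X Y Z)) x1)
    = tm (M**U) ((N**L)**?WY) (M**U) (?C**?WY) (rw M M U id) (rw (N**L) ?C ?WY (box W X Y Z)) ?z"
   by (rule ex_nat_l[OF sM(1) _ s(1) sT(3) sM(1) sH(2) bmor_id' boxes(2) x1]) (simp add: bs)
  have rb: "bmor (M**U) (M**U) (rw M M U id)" "bmor ((N**L)**?WY) (?C**?WY) (rw (N**L) ?C ?WY (box W X Y Z))"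
   by (rule rw_bmor[OF bm(1) bM(1) bM(1) bmor_id'] rw_bmor[OF bT(3) NL bH(2) boxes(2)])+
  have 13: "tm (M**U) (?C**?WY) V ?XZ (evA' U V) (evA' ?WY ?XZ)
     (tm (M**U) ((N**L)**?WY) (M**U) (?C**?WY) (rw M M U id) (rw (N**L) ?C ?WY (box W X Y Z)) ?z)
    = tm (M**U) ((N**L)**?WY) V ?XZ (%v. evA' U V (rw M M U id v)) (%v. evA' ?WY ?XZ (rw (N**L) ?C ?WY (box W X Y Z) v)) ?z"
   by (rule tm_comp[OF bE(1,5,1) ten_bim[OF bH(2) bT(3)] bm(2) bT(4) rb evb(1) evA_bmor[OF bT(3,4)] z])
  have 14: "tm (M**U) ((N**L)**?WY) V ?XZ (%v. evA' U V (rw M M U id v)) (%v. evA' ?WY ?XZ (rw (N**L) ?C ?WY (box W X Y Z) v))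
    = tm (M**U) ((N**L)**?WY) V ?XZ (evA' U V) (%v. ?ev23 (ex N L W Y v))"
   by (rule tm_cong) (simp_all add: evA_box[OF s(3-6), folded N_def L_def] tm_id bM bm)
  have 15: "tm (M**U) ((N**L)**?WY) V ?XZ (evA' U V) (%v. ?ev23 (ex N L W Y v)) ?z
    = tm (M**U) ((N**W)**L**Y) V ?XZ (evA' U V) ?ev23 (lex (M**U) N L W Y ?z)"
   using tm_comp[OF bE(1,5,1,7) bm(2) bT(4) bmor_id' ex2 evb(1) ev23 z] by simp
  have 16: "lex (M**U) N L W Y ?z
    = Ph (M**U) (N**W) (L**Y) (rex (L**Y) M N U W e)"
   unfolding xx[symmetric] e_def by (rule ex_assoc[OF sM s(1,3,5) x, symmetric])
  have "evp ?S' ?T' (G t) v = tm (M**U) ((N**W)**L**Y) V ?XZ (evA' U V) ?ev23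
    (Ph (M**U) (N**W) (L**Y) (rex (L**Y) M N U W e))"
   unfolding 11 12 13 14 15 16 ..
  thus "evp ?S' ?T' (F t) v = evp ?S' ?T' (G t) v" using lhs by simp
 qed
qed

end

end

theorem proposition5p20:
  fixes k :: "'k ring" and H :: "('k, 'h) qqH" and A :: "('k, 'h, 'a) halg"
    and U :: "('k, 'h, 'a, 'u) bimod" and V :: "('k, 'h, 'a, 'v) bimod"
    and W :: "('k, 'h, 'a, 'w) bimod" and X :: "('k, 'h, 'a, 'x) bimod"
    and Y :: "('k, 'h, 'a, 'y) bimod" and Z :: "('k, 'h, 'a, 'z) bimod"
  assumes "quasitriangular_quasi_Hopf_algebra k H"
    and "is_halg k H A" and "braided_commutative k H A"
    and "is_sym_bimod k H A U" and "is_sym_bimod k H A V" and "is_sym_bimod k H A W"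
    and "is_sym_bimod k H A X" and "is_sym_bimod k H A Y" and "is_sym_bimod k H A Z"
  shows "(let P = homA k H A V Y; Q = homA k H A X Z; K = homA k H A U V; T = homA k H A W X;
         UW = tensA k H A U W; VX = tensA k H A V X; YZ = tensA k H A Y Z;
         UY = homA k H A U Y; WZ = homA k H A W Z;
         PQ = tensA k H A P Q; KT = tensA k H A K T; QT = tensA k H A Q T;
         Dom = tensA k H A PQ KT;
         Cod = homA k H A UW YZ;
         F = compA k H A UW VX YZ
             \<circ> tmapA k H A PQ KT (homA k H A VX YZ) (homA k H A UW VX)
                 (boxA k H A V Y X Z) (boxA k H A U V W X);
         G = boxA k H A U Y W Z
             \<circ> tmapA k H A (tensA k H A P K) QT UY WZ
                 (compA k H A U V Y) (compA k H A W X Z)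
             \<circ> PhiA_inv k H A P K QT
             \<circ> tmapA k H A P (tensA k H A (tensA k H A K Q) T) P (tensA k H A K QT)
                 id (PhiA k H A K Q T)
             \<circ> tmapA k H A P (tensA k H A (tensA k H A Q K) T) P (tensA k H A (tensA k H A K Q) T)
                 id (tmapA k H A (tensA k H A Q K) T (tensA k H A K Q) T (tauA k H A Q K) id)
             \<circ> tmapA k H A P (tensA k H A Q KT) P (tensA k H A (tensA k H A Q K) T)
                 id (PhiA_inv k H A Q K T)
             \<circ> PhiA k H A P Q KT
     in is_bimor k H A Dom Cod F \<and> is_bimor k H A Dom Cod G \<and> (\<forall>t\<in>carrier Dom. F t = G t)) \<and>
    (let M = homA k H A U V; N = homA k H A W X; L = homA k H A Y Z;
         UW = tensA k H A U W; VX = tensA k H A V X;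
         WY = tensA k H A W Y; XZ = tensA k H A X Z;
         MN = tensA k H A M N;
         Dom = tensA k H A MN L;
         Cod = homA k H A (tensA k H A U WY) (tensA k H A V XZ);
         F = conjA k H A U V W X Y Z
             \<circ> boxA k H A UW VX Y Z
             \<circ> tmapA k H A MN L (homA k H A UW VX) L (boxA k H A U V W X) id;
         G = boxA k H A U V WY XZ
             \<circ> tmapA k H A M (tensA k H A N L) M (homA k H A WY XZ) id (boxA k H A W X Y Z)
             \<circ> PhiA k H A M N L
     in is_bimor k H A Dom Cod F \<and> is_bimor k H A Dom Cod G \<and> (\<forall>t\<in>carrier Dom. F t = G t))"
proof -
  interpret S: algebra_setting k H A
    using assms(1,2) by (simp add: algebra_setting_def algebra_setting_axioms_def)
  note s = assms(4-9)[THEN S.is_sym_bimod_sym]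
  show ?thesis
    unfolding Let_def
    using S.box_comp_F[OF s] S.box_comp_G[OF s] S.box_comp_eq[OF s] S.box_assoc_F[OF s] S.box_assoc_G[OF s] S.box_assoc_eq[OF s]
    unfolding exchA_def comp_def by blast
qed

end
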